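(* Let $\alpha,\beta\ge-1/2$ and $1<p<\infty$, and suppose $$-\frac14\le a+(\alpha+1)\Big(\frac1p-\frac12\Big)<\frac14,\qquad -\frac14\le b+(\beta+1)\Big(\frac1p-\frac12\Big)<\frac14.$$ Then there exists $C>0$ such that $\Vert u\,S_n(u^{-1}\chi_E)\Vert_{L^{p,\infty}(d\nu)}\le C\Vert\chi_E\Vert_{L^p(d\nu)}$ for every $n\ge0$ and every measurable set $E\subseteq[-1,1]$.
   Context: $d\nu=(1-x)^\alpha(1+x)^\beta dx+\sum_{i=1}^kM_i\delta_{a_i}$ on $[-1,1]$, with $a_1,\dots,a_k\in[-1,1]$ distinct and $M_i>0$. $(P_n)$ are the orthonormal polynomials for $\nu$, $L_n(x,y)=\sum_{j=0}^nP_j(x)P_j(y)$, $S_nf(x)=\int L_n(x,y)f(y)\,d\nu(y)$. The weight is $u(x)=(1-x)^a(1+x)^b$ for $x\in(-1,1)$ ($a,b\in\mathbb R$), with $0<u(\pm1)<\infty$. $\chi_E$ is the indicator of $E$. $L^{p,\infty}(d\nu)$ is the weak $L^p$ space with quasinorm $\sup_{t>0}t^{1/p}f^*(t)$, $f^*$ the nonincreasing rearrangement with respect to $\nu$. *)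

theory Defs
  imports "HOL-Analysis.Analysis" "HOL-Computational_Algebra.Polynomial"
begin

text \<open>The measure nu = (1-x)^alpha (1+x)^beta dx on (-1,1) plus point masses M a at the
  points a of the finite set A (a subset of [-1,1]).  Space: the real line with Borel sets;
  nu is concentrated on [-1,1].\<close>
definition jacobi_weight :: "real \<Rightarrow> real \<Rightarrow> real \<Rightarrow> real" where
  "jacobi_weight \<alpha> \<beta> x = indicator {-1<..<1} x * (1 - x) powr \<alpha> * (1 + x) powr \<beta>"

definition nu_measure :: "real \<Rightarrow> real \<Rightarrow> real set \<Rightarrow> (real \<Rightarrow> real) \<Rightarrow> real measure" where
  "nu_measure \<alpha> \<beta> A M = measure_of UNIV (sets borel)
     (\<lambda>E. (\<integral>\<^sup>+ x. ennreal (indicator E x * jacobi_weight \<alpha> \<beta> x) \<partial>lborel)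
          + (\<Sum>a\<in>A \<inter> E. ennreal (M a)))"

definition orthonormal_polys :: "real measure \<Rightarrow> (nat \<Rightarrow> real poly) \<Rightarrow> bool" where
  "orthonormal_polys \<nu> P \<longleftrightarrow>
     (\<forall>n. degree (P n) = n \<and> lead_coeff (P n) > 0 \<and>
       (\<forall>m. integrable \<nu> (\<lambda>x. poly (P m) x * poly (P n) x) \<and>
            (\<integral>x. poly (P m) x * poly (P n) x \<partial>\<nu>) = (if m = n then 1 else 0)))"

definition kernel_L :: "(nat \<Rightarrow> real poly) \<Rightarrow> nat \<Rightarrow> real \<Rightarrow> real \<Rightarrow> real" where
  "kernel_L P n x y = (\<Sum>j\<le>n. poly (P j) x * poly (P j) y)"

definition partial_sum_S :: "real measure \<Rightarrow> (nat \<Rightarrow> real poly) \<Rightarrow> nat \<Rightarrow> (real \<Rightarrow> real) \<Rightarrow> real \<Rightarrow> real" where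
  "partial_sum_S \<nu> P n f x = (\<integral>y. kernel_L P n x y * f y \<partial>\<nu>)"

text \<open>Nonincreasing rearrangement f*(t) = inf { s >= 0 : nu{|f| > s} <= t } (inf of empty = \<infinity>).\<close>
definition rearrangement :: "'a measure \<Rightarrow> ('a \<Rightarrow> real) \<Rightarrow> real \<Rightarrow> ereal" where
  "rearrangement \<nu> f t = Inf {ereal s | s. s \<ge> 0 \<and>
      emeasure \<nu> {x \<in> space \<nu>. \<bar>f x\<bar> > s} \<le> ennreal t}"

definition weak_Lp_norm :: "'a measure \<Rightarrow> real \<Rightarrow> ('a \<Rightarrow> real) \<Rightarrow> ereal" where
  "weak_Lp_norm \<nu> p f = (SUP t\<in>{0<..}. ereal (t powr (1 / p)) * rearrangement \<nu> f t)"

text \<open>L^p norm (\<integral>|f|^p d nu)^{1/p} (used only for integrable |f|^p).\<close>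
definition Lp_norm :: "'a measure \<Rightarrow> real \<Rightarrow> ('a \<Rightarrow> real) \<Rightarrow> real" where
  "Lp_norm \<nu> p f = (\<integral>x. \<bar>f x\<bar> powr p \<partial>\<nu>) powr (1 / p)"

end

theory Submission
 imports Defs "HOL-Complex_Analysis.Complex_Analysis"
begin

text \<open>
 Write K for the kernel of the Jacobi polynomials and L for that of the polynomials orthonormal with
 respect to nu. The structure relation and Christoffel-Darboux give Pollard's decomposition: up to a
 factor of order n, (x - y) K(x, y) is p(x) (1 - y^2) p'(y) - p(y) (1 - x^2) p'(x) - n (x - y) p(x) p(y). An
 energy argument for the Jacobi equation bounds |p| and sqrt(1 - x^2) |p'| / n by the reciprocal of
 (1 - x)^(alpha/2 + 1/4) (1 + x)^(beta/2 + 1/4). Hence the Jacobi partial sum is controlled by two weighted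
 Hilbert transforms of bounded functions supported in E. The unweighted transform is of restricted weak
 type because even powers of the Cauchy transform have vanishing integral over horizontal lines; the
 power weights are removed by a dyadic localisation at the endpoints. What is not local is at most
 rho(x)^(-1/p) times the integral of rho^(-1/q) over E (q conjugate to p), where rho satisfies
 nu {rho < t} = O(t), and such a bound is of restricted weak type.
 The masses enter through L(x, y) = K(x, y) - (sum over the masses a of M a L(x, a) K(a, y)). At the
 masses this is a linear system for L(x, a), asymptotically diagonally dominant because the upper
 bounds on the exponents are strict, and its solution is again bounded in terms of rho.
\<close>

section \<open>The regularised Hilbert transform\<close>

text \<open>The target is weak L^r because, at the lower ends of the exponent ranges, the outer
  weight of Pollard's first term is comparable at the endpoint to \<open>rho0\<close> to the power
  -1/r, which lies in weak L^r but not in L^r. Three devices shape the proof. Principal values are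
  avoided by the kernel (x - y) / ((x - y)^2 + e^2) with bounds uniform in e; e tends to 0 only at
  the level of distribution functions. No normalising constant of a Jacobi polynomial is computed:
  the kernel at (1, 1) obeys a first-order recurrence that Pochhammer symbols solve. The polynomials
  belong to an abstract functional \<open>J\<close>, so that x -> -x, which exchanges \<alpha> and
  \<beta>, is a second interpretation of the same locale and every statement at 1 gives one at -1.
  For masses inside the interval, diagonal dominance needs a linear lower bound for the diagonal
  kernel; it comes from comparison with \<alpha> = \<beta> = -1/2, where the energy is constant.
  Each estimate for the masses is applied twice, once as a bound in x and once, with the signs of
  the exponents reversed and r replaced by its conjugate, as a bound in y.\<close>

abbreviation (input) Ioo :: "real set" where
 "Ioo \<equiv> {-1<..<1}"

text \<open>A bound by the indicator, rather than equality with it, keeps the class stable under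
  multiplication by functions of modulus at most 1; the polynomial factors of the kernel enter in
  this way.\<close>

definition dominated :: "(real => real) => real set => bool" where
 "dominated f E \<longleftrightarrow> f \<in> borel_measurable borel \<and> E \<in> sets borel \<and> E \<subseteq> {-1..1} \<and>
   (\<forall>x. \<bar>f x\<bar> <= indicator E x)"

definition cauchy_transform :: "(real => real) => complex => complex" where
 "cauchy_transform f z = (\<integral>t. complex_of_real (f t) / (z - of_real t) \<partial>lborel)"

text \<open>The real part of the Cauchy transform at height e above x, without the customary factor
  1/pi. Accordingly \<open>poisson_reg\<close>, minus the imaginary part, has a kernel of total mass
  pi.\<close>

definition hilbert_reg :: "real => (real => real) => real => real" where
 "hilbert_reg e f x = (\<integral>t. (x - t) / ((x - t)^2 + e^2) * f t \<partial>lborel)"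

definition poisson_reg :: "real => (real => real) => real => real" where
 "poisson_reg e f x = (\<integral>t. e / ((x - t)^2 + e^2) * f t \<partial>lborel)"

section \<open>Analyticity, decay and boundary values of the Cauchy transform\<close>

lemma integrable_indicator_Icc: "integrable lborel (\<lambda>t. c * indicator {-1..1::real} t :: real)"
 by simp

lemma dominatedD:
 assumes "dominated f E"
 shows "f \<in> borel_measurable borel" "E \<in> sets borel" "E \<subseteq> {-1..1}" "\<bar>f x\<bar> <= indicator E x"
  "\<bar>f x\<bar> <= indicator {-1..1} x"
proof -
 show 4: "\<bar>f x\<bar> <= indicator E x" and "f \<in> borel_measurable borel" "E \<in> sets borel"
  and 3: "E \<subseteq> {-1..1}"
  using assms by (auto simp: dominated_def)
 have "indicator E x <= (indicator {-1..1} x :: real)" using 3 by (auto simp: indicator_def)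
 with 4 show "\<bar>f x\<bar> <= indicator {-1..1} x" by linarith
qed

lemma dominated_kernel_bound:
 fixes k :: "real => 'a :: {real_normed_field, banach, second_countable_topology}"
 assumes f: "dominated f E" and k: "k \<in> borel_measurable borel"
  and B: "\<And>t. t \<in> {-1..1} ==> norm (k t) <= B"
 shows "integrable lborel (\<lambda>t. of_real (f t) * k t)"
  and "norm (\<integral>t. of_real (f t) * k t \<partial>lborel) <= 2 * B"
proof -
 have bd: "norm (of_real (f t) * k t) <= B * indicator {-1..1} t" for t
 proof (cases "t \<in> {-1..1}")
  case True
  have "norm (of_real (f t) * k t) = \<bar>f t\<bar> * norm (k t)" by (simp add: norm_mult)
  also have "... <= 1 * B"
   using dominatedD(5)[OF f, of t] True B[OF True] by (intro mult_mono) auto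
  finally show ?thesis using True by simp
 next
  case False
  then show ?thesis using dominatedD(5)[OF f, of t] by simp
 qed
 have B0: "0 <= B" using order_trans[OF norm_ge_zero B[of 0]] by auto
 show int: "integrable lborel (\<lambda>t. of_real (f t) * k t)"
 proof (rule Bochner_Integration.integrable_bound[OF integrable_indicator_Icc[of B]])
  show "(\<lambda>t. of_real (f t) * k t) \<in> borel_measurable lborel"
   using dominatedD(1)[OF f] k by measurable
  show "AE t in lborel. norm (of_real (f t) * k t) <= norm (B * indicator {-1..1} t)"
   using bd B0 by (auto simp: abs_mult)
 qed
 show "norm (\<integral>t. of_real (f t) * k t \<partial>lborel) <= 2 * B"
  using Bochner_Integration.integral_norm_bound_integral[OF int integrable_indicator_Icc[of B]] bd
  by (simp add: mult.commute)
qed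

lemma Im_le_norm_diff_of_real: "\<bar>Im z\<bar> <= norm (z - of_real t)"
 using abs_Im_le_cmod[of "z - of_real t"] by simp

text \<open>By partial fractions, the error of the difference quotient is y - z times another
  integral of the same type, whose kernel is at most 2 / d^3 as long as y stays within d / 2 of
  z.\<close>

lemma cauchy_transform_has_derivative:
 assumes f: "dominated f E" and z: "Im z > 0"
 shows "(cauchy_transform f has_field_derivative
     (\<integral>t. of_real (f t) * (- 1 / (z - of_real t)^2) \<partial>lborel)) (at z)"
proof -
 define d where "d = Im z"
 define F' where "F' = (\<integral>t. of_real (f t) * (- 1 / (z - of_real t)^2) \<partial>lborel)"
 have d: "d > 0" using z by (simp add: d_def)
 have i1: "integrable lborel (\<lambda>t. of_real (f t) * (1 / (y - complex_of_real t)))" if "Im y > 0" for y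
 proof (rule dominated_kernel_bound(1)[OF f, where B = "1 / Im y"])
  show "norm (1 / (y - complex_of_real t)) <= 1 / Im y" for t
   using Im_le_norm_diff_of_real[of y t] that by (auto simp: norm_divide intro!: divide_left_mono mult_pos_pos)
 qed measurable
 have i2: "integrable lborel (\<lambda>t. of_real (f t) * (- 1 / (z - complex_of_real t)^2))"
 proof (rule dominated_kernel_bound(1)[OF f, where B = "1 / d^2"])
  show "norm (- 1 / (z - complex_of_real t)^2) <= 1 / d^2" for t
   using Im_le_norm_diff_of_real[of z t] d
   by (auto simp: norm_divide norm_power d_def intro!: divide_left_mono mult_pos_pos power_mono zero_less_power)
 qed measurable
 have gen: "(\<integral>t. A t - B t - c * C t \<partial>lborel) = (\<integral>t. A t \<partial>lborel) - (\<integral>t. B t \<partial>lborel) - c * (\<integral>t. C t \<partial>lborel)"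
  if "integrable lborel A" "integrable lborel B" "integrable lborel C"
  for A B C :: "real => complex" and c
  using that by simp
 have ct: "cauchy_transform f y = (\<integral>t. of_real (f t) * (1 / (y - complex_of_real t)) \<partial>lborel)" for y
  by (simp add: cauchy_transform_def)
 have key: "norm ((cauchy_transform f y - cauchy_transform f z) / (y - z) - F')
   <= norm (y - z) * (2 * (2 / d^3))" if y: "y ~= z" "norm (y - z) < d / 2" for y
 proof -
  have Imy: "Im y >= d / 2"
   using abs_Im_le_cmod[of "y - z"] y by (simp add: d_def)
  then have Imy0: "Im y > 0" using d by simp
  have nz: "z - of_real t ~= 0" "y - of_real t ~= 0" for t
   using Im_le_norm_diff_of_real[of z t] Im_le_norm_diff_of_real[of y t] Imy0 z by auto
  have eq: "of_real (f t) * (1 / (y - complex_of_real t)) - of_real (f t) * (1 / (z - complex_of_real t))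
    - (y - z) * (of_real (f t) * (- 1 / (z - complex_of_real t)^2))
    = (y - z)^2 * (of_real (f t) * (1 / ((z - complex_of_real t)^2 * (y - complex_of_real t))))" for t
  proof -
   have "1 / Y - 1 / Z - (Y - Z) * (- 1 / Z^2) = (Y - Z)^2 * (1 / (Z^2 * Y))"
    if "Y ~= 0" "Z ~= 0" for Y Z :: complex
    using that by (simp add: field_simps power2_eq_square)
   from this[OF nz(2) nz(1), of t t]
   have "1 / (y - complex_of_real t) - 1 / (z - complex_of_real t)
     - (y - z) * (- 1 / (z - complex_of_real t)^2)
     = (y - z)^2 * (1 / ((z - complex_of_real t)^2 * (y - complex_of_real t)))" by simp
   from arg_cong[OF this, of "\<lambda>x. of_real (f t) * x"] show ?thesis
    by (simp add: algebra_simps)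
  qed
  have "cauchy_transform f y - cauchy_transform f z - (y - z) * F'
    = (\<integral>t. of_real (f t) * (1 / (y - complex_of_real t)) - of_real (f t) * (1 / (z - complex_of_real t))
    - (y - z) * (of_real (f t) * (- 1 / (z - complex_of_real t)^2)) \<partial>lborel)"
   using gen[OF i1[OF Imy0] i1[OF z] i2] unfolding ct F'_def by simp
  also have "... = (y - z)^2 * (\<integral>t. of_real (f t) * (1 / ((z - complex_of_real t)^2 * (y - complex_of_real t))) \<partial>lborel)"
   unfolding eq by (rule integral_mult_right_zero)
  finally have quot: "(cauchy_transform f y - cauchy_transform f z) / (y - z) - F'
    = (y - z) * (\<integral>t. of_real (f t) * (1 / ((z - complex_of_real t)^2 * (y - complex_of_real t))) \<partial>lborel)"
   using y by (simp add: field_simps power2_eq_square)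
  have bnd: "norm (\<integral>t. of_real (f t) * (1 / ((z - complex_of_real t)^2 * (y - complex_of_real t))) \<partial>lborel) <= 2 * (2 / d^3)"
  proof (rule dominated_kernel_bound(2)[OF f])
   fix t
   have "d^2 * (d / 2) <= norm (z - complex_of_real t) ^ 2 * norm (y - complex_of_real t)"
    using Im_le_norm_diff_of_real[of z t] Im_le_norm_diff_of_real[of y t] Imy d
    by (intro mult_mono power_mono) (auto simp: d_def)
   then have "norm (1 / ((z - complex_of_real t)^2 * (y - complex_of_real t))) <= 1 / (d^2 * (d / 2))"
    unfolding norm_divide norm_mult norm_power norm_one
    using d nz[of t] by (intro divide_left_mono mult_pos_pos) (auto intro!: mult_pos_pos)
   also have "1 / (d^2 * (d / 2)) = 2 / d^3"
    using d by (simp add: power3_eq_cube power2_eq_square)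
   finally show "norm (1 / ((z - complex_of_real t)^2 * (y - complex_of_real t))) <= 2 / d^3" .
  qed measurable
  show ?thesis unfolding quot norm_mult by (rule mult_left_mono[OF bnd]) simp
 qed
 have "((\<lambda>y. (cauchy_transform f y - cauchy_transform f z) / (y - z) - F') \<longlongrightarrow> 0) (at z)"
 proof (rule Lim_null_comparison)
  show "\<forall>\<^sub>F y in at z. norm ((cauchy_transform f y - cauchy_transform f z) / (y - z) - F')
    <= norm (y - z) * (2 * (2 / d^3))"
   unfolding eventually_at using d key by (intro exI[of _ "d / 2"]) (auto simp: dist_norm)
  show "((\<lambda>y. norm (y - z) * (2 * (2 / d^3))) \<longlongrightarrow> 0) (at z)"
   by (intro tendsto_mult_left_zero tendsto_norm_zero LIM_zero tendsto_ident_at)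
 qed
 then show ?thesis
  unfolding has_field_derivative_iff F'_def[symmetric] by (simp add: LIM_zero_iff)
qed

lemma cauchy_transform_holomorphic:
 assumes "dominated f E"
 shows "cauchy_transform f holomorphic_on {z. Im z > 0}"
 using cauchy_transform_has_derivative[OF assms] holomorphic_onI
 by (metis (mono_tags, lifting) field_differentiable_at_within field_differentiable_def mem_Collect_eq)

lemma cauchy_transform_bound:
 assumes f: "dominated f E" and z: "norm z >= 2"
 shows "norm (cauchy_transform f z) <= 4 / norm z"
proof -
 have "norm (\<integral>t. of_real (f t) * (1 / (z - complex_of_real t)) \<partial>lborel) <= 2 * (2 / norm z)"
 proof (rule dominated_kernel_bound(2)[OF f])
  fix t :: real assume "t \<in> {-1..1}"
  then have "norm (z - of_real t) >= norm z / 2"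
   using norm_triangle_ineq2[of z "of_real t"] z by auto
  moreover have "norm z > 0" using z by auto
  ultimately have "1 / norm (z - of_real t) <= 1 / (norm z / 2)"
   by (intro divide_left_mono mult_pos_pos) auto
  then show "norm (1 / (z - complex_of_real t)) <= 2 / norm z"
   by (simp add: norm_divide)
 qed measurable
 then show ?thesis by (simp add: cauchy_transform_def)
qed

lemma cauchy_transform_Re_Im:
 assumes f: "dominated f E" and e: "e > 0"
 shows "cauchy_transform f (Complex x e) = Complex (hilbert_reg e f x) (- poisson_reg e f x)"
proof -
 have i1: "integrable lborel (\<lambda>t. of_real (f t) * (1 / (Complex x e - complex_of_real t)))"
 proof (rule dominated_kernel_bound(1)[OF f, where B = "1 / e"])
  show "norm (1 / (Complex x e - complex_of_real t)) <= 1 / e" for t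
   using Im_le_norm_diff_of_real[of "Complex x e" t] e
   by (auto simp: norm_divide intro!: divide_left_mono mult_pos_pos)
 qed measurable
 have i: "integrable lborel (\<lambda>t. of_real (f t) / (Complex x e - complex_of_real t))"
  using i1 by simp
 have 1: "of_real (f t) / (Complex x e - complex_of_real t)
   = Complex ((x - t) / ((x - t)^2 + e^2) * f t) (- (e / ((x - t)^2 + e^2) * f t))" for t
  by (simp add: complex_eq_iff Re_divide Im_divide)
 have "Re (cauchy_transform f (Complex x e)) = hilbert_reg e f x"
  unfolding cauchy_transform_def hilbert_reg_def
  by (subst integral_Re[OF i, symmetric]) (simp only: 1 complex.sel)
 moreover have "Im (cauchy_transform f (Complex x e)) = - poisson_reg e f x"
  unfolding cauchy_transform_def poisson_reg_def
  by (subst integral_Im[OF i, symmetric]) (simp only: 1 complex.sel Bochner_Integration.integral_minus)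
 ultimately show ?thesis by (simp add: complex_eq_iff)
qed

text \<open>The contour is closed by the upper half circle of radius R, on which the decay of the
  transform makes its m-th power small. For m >= 2 the bound tends to 0 as R grows, so the power has
  vanishing integral over the horizontal line.\<close>

lemma cauchy_transform_power_integral:
 assumes f: "dominated f E" and e: "e > 0" and R: "R >= 2"
 shows "\<exists>I. ((\<lambda>x. cauchy_transform f (Complex x e) ^ m) has_integral I) {-R..R} \<and>
       norm I <= (4 / R) ^ m * R * pi"
proof -
 define G where "G z = cauchy_transform f (z + \<i> * of_real e) ^ m" for z
 define S where "S = {z. Im z > - e}"
 define g1 where "g1 = linepath (complex_of_real (-R)) (of_real R)"
 define g2 where "g2 = part_circlepath 0 R 0 pi"
 have G: "G holomorphic_on S"
 proof -
  have "(\<lambda>z. cauchy_transform f (z + \<i> * of_real e)) holomorphic_on S"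
   by (rule holomorphic_on_compose_gen[OF _ cauchy_transform_holomorphic[OF f], unfolded o_def])
     (auto simp: S_def intro!: holomorphic_intros)
  then show ?thesis unfolding G_def by (intro holomorphic_intros)
 qed
 have S: "convex S" unfolding S_def using convex_halfspace_Im_gt by auto
 have v: "valid_path g1" "valid_path g2" by (auto simp: g1_def g2_def)
 have pe: "pathfinish g1 = pathstart g2" "pathfinish g2 = pathstart g1"
  using R by (auto simp: g1_def g2_def exp_Euler)
 have p1: "path_image g1 \<subseteq> S"
 proof -
  have "path_image g1 \<subseteq> {z. Im z >= 0}"
   unfolding g1_def path_image_linepath
   by (rule closed_segment_subset) (auto simp: convex_halfspace_Im_ge)
  then show ?thesis using e by (auto simp: S_def)
 qed
 have p2': "norm z = R \<and> Im z >= 0" if "z \<in> path_image g2" for z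
 proof -
  from that obtain x where x: "z = of_real R * exp (\<i> * of_real x)" "0 <= x" "x <= pi"
   unfolding g2_def by (auto simp: path_image_part_circlepath)
  have "norm z = R" using R x(1) by (simp add: norm_mult)
  moreover have "Im z >= 0" using R x by (simp add: Im_exp sin_ge_zero)
  ultimately show ?thesis by simp
 qed
 have p2: "path_image g2 \<subseteq> S" using p2' e by (force simp: S_def)
 have c0: "(G has_contour_integral 0) (g1 +++ g2)"
  by (rule Cauchy_theorem_convex_simple[OF G S])
    (use v pe p1 p2 in \<open>auto simp: path_image_join\<close>)
 have "G contour_integrable_on (g1 +++ g2)" using c0 by (auto simp: contour_integrable_on_def)
 then have ci: "G contour_integrable_on g1" "G contour_integrable_on g2" using v by auto
 then obtain I I2 where I: "(G has_contour_integral I) g1" "(G has_contour_integral I2) g2"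
  by (auto simp: contour_integrable_on_def)
 have "(G has_contour_integral (I + I2)) (g1 +++ g2)"
  by (rule has_contour_integral_join[OF I v])
 then have "I = - I2" using c0 contour_integral_unique by (metis add_eq_0_iff2 add.commute)
 have "norm I2 <= (4 / R) ^ m * R * (pi - 0)"
 proof (rule has_contour_integral_bound_part_circlepath[OF I(2)[unfolded g2_def]])
  fix z assume "z \<in> path_image (part_circlepath 0 R 0 pi)"
  then have z: "norm z = R" "Im z >= 0" using p2' g2_def by auto
  \<comment> \<open>Raising a point of the closed upper half plane moves it away from 0, so the
    decay for radius R remains valid on the shifted arc.\<close>
  have le: "norm z <= norm (z + \<i> * of_real e)"
   unfolding cmod_def using z e by (auto intro!: real_sqrt_le_mono add_mono power_mono)
  have "norm (cauchy_transform f (z + \<i> * of_real e)) <= 4 / norm (z + \<i> * of_real e)"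
   by (rule cauchy_transform_bound[OF f]) (use le z R in auto)
  also have "... <= 4 / R" using le z R by (intro divide_left_mono mult_pos_pos) auto
  finally show "norm (G z) <= (4 / R) ^ m"
   unfolding G_def norm_power by (intro power_mono) auto
 qed (use R in auto)
 moreover have "((\<lambda>x. G (of_real x)) has_integral I) {-R..R}"
  using I(1) R unfolding g1_def
  by (subst (asm) has_contour_integral_linepath_Reals_iff) auto
 moreover have "G (of_real x) = cauchy_transform f (Complex x e) ^ m" for x
  by (simp add: G_def complex_eq_iff Complex_eq)
 ultimately show ?thesis using \<open>I = - I2\<close> by auto
qed

text \<open>If U is small against V, then (V - iU)^n is within V^n / 2 of V^n; otherwise a multiple
  of U^n controls both V^n and the real part. For even n the powers of V and U are those of their
  absolute values.\<close>

lemma power_le_Re_power_even: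
 fixes n :: nat
 assumes n: "even n" "n >= 1"
 shows "\<exists>C\<ge>0. \<forall>V U::real. V ^ n <= 2 * Re (Complex V (- U) ^ n) + C * U ^ n"
proof -
 \<comment> \<open>The threshold between the two cases: after division by 2V the perturbation is at
   most d / 2, and n d / 2 is half of (1/2)^n.\<close>
 define d where "d = 1 / (real n * 2 ^ n)"
 have d: "d > 0" using n by (simp add: d_def)
 have nd: "real n * d = 1 / 2 ^ n" using n by (simp add: d_def)
 have "d <= 1" using n mult_mono[of 1 "real n" 1 "2 ^ n"] by (simp add: d_def)
 define C where "C = 3 * (1 + 1 / d) ^ n"
 have "V ^ n <= 2 * Re (Complex V (- U) ^ n) + C * U ^ n" for V U :: real
 proof -
  define z where "z = Complex V (- U)"
  have zV: "norm (z - of_real V) = \<bar>U\<bar>"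
   by (simp add: z_def cmod_def)
  have zle: "norm z <= \<bar>V\<bar> + \<bar>U\<bar>"
   using norm_triangle_ineq[of "of_real V" "z - of_real V"] zV by simp
  have Un: "U ^ n = \<bar>U\<bar> ^ n" and Vn: "V ^ n = \<bar>V\<bar> ^ n"
   using n(1) by (auto simp: power_even_abs)
  show ?thesis
  proof (cases "\<bar>U\<bar> <= d * \<bar>V\<bar>")
   case True
   show ?thesis
   proof (cases "V = 0")
    case True
    then have "U = 0" using \<open>\<bar>U\<bar> <= d * \<bar>V\<bar>\<close> by simp
    then show ?thesis using True n by (simp add: zero_power Complex_eq)
   next
    case False
    have U: "\<bar>U\<bar> <= \<bar>V\<bar>" using True \<open>d <= 1\<close> by (meson abs_ge_zero mult_left_le_one_le order_trans d less_imp_le)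
    \<comment> \<open>Division by 2V, not by V, keeps \<open>z'\<close> in the unit disc, as
      \<open>norm_power_diff\<close> requires; this explains the factor 2^n in
      \<open>d\<close>.\<close>
    define z' where "z' = z / of_real (2 * V)"
    have "norm z' <= 1" using zle U False by (simp add: z'_def norm_divide field_simps norm_mult)
    moreover have "z' - 1 / 2 = (z - of_real V) / of_real (2 * V)"
     using False by (simp add: z'_def field_simps)
    then have "norm (z' - 1 / 2) = \<bar>U\<bar> / (2 * \<bar>V\<bar>)"
     using zV by (simp add: norm_divide norm_mult)
    ultimately have "norm (z' ^ n - (1 / 2) ^ n) <= real n * (\<bar>U\<bar> / (2 * \<bar>V\<bar>))"
     using norm_power_diff[of z' "1/2" n] by simp
    also have "... <= real n * (d / 2)"
     using True False by (intro mult_left_mono) (auto simp: field_simps)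
    also have "... = (1 / 2 ^ n) / 2" using nd by simp
    finally have 1: "norm (z' ^ n - (1 / 2) ^ n) <= (1 / 2 ^ n) / 2" .
    have "z ^ n - of_real V ^ n = of_real (2 * V) ^ n * (z' ^ n - (1 / 2) ^ n)"
     using False by (simp add: z'_def power_divide power_mult_distrib field_simps)
    then have "norm (z ^ n - of_real V ^ n) = (2 * \<bar>V\<bar>) ^ n * norm (z' ^ n - (1 / 2) ^ n)"
     by (simp add: norm_mult norm_power)
    also have "... <= (2 * \<bar>V\<bar>) ^ n * ((1 / 2 ^ n) / 2)"
     by (intro mult_left_mono 1) auto
    also have "... = V ^ n / 2" by (simp add: power_mult_distrib Vn)
    finally have "\<bar>Re (z ^ n - of_real V ^ n)\<bar> <= V ^ n / 2"
     using abs_Re_le_cmod order_trans by blast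
    moreover have "Re (z ^ n - of_real V ^ n) = Re (z ^ n) - V ^ n"
     by (simp flip: of_real_power)
    ultimately have "V ^ n <= 2 * Re (z ^ n)" by linarith
    moreover have "0 <= C * U ^ n" using d Un by (simp add: C_def)
    ultimately show ?thesis by (simp add: z_def)
   qed
  next
   case False
   then have V: "\<bar>V\<bar> <= (1 / d) * \<bar>U\<bar>" using d by (simp add: field_simps)
   then have V': "\<bar>V\<bar> <= (1 + 1 / d) * \<bar>U\<bar>" by (simp add: distrib_right)
   have z': "norm z <= (1 + 1 / d) * \<bar>U\<bar>" using zle V by (simp add: algebra_simps)
   have "V ^ n <= (1 + 1 / d) ^ n * U ^ n"
    unfolding Vn Un power_mult_distrib[symmetric] using V' by (intro power_mono) auto
   moreover have "- Re (z ^ n) <= (1 + 1 / d) ^ n * U ^ n"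
   proof -
    have "- Re (z ^ n) <= norm (z ^ n)" using abs_Re_le_cmod[of "z ^ n"] by linarith
    also have "... <= ((1 + 1 / d) * \<bar>U\<bar>) ^ n" unfolding norm_power using z' by (intro power_mono) auto
    finally show ?thesis by (simp add: power_mult_distrib Un)
   qed
   ultimately show ?thesis by (simp add: z_def C_def)
  qed
 qed
 moreover have "C >= 0" using d by (simp add: C_def)
 ultimately show ?thesis by blast
qed

section \<open>The Poisson part and even moments of the Hilbert transform\<close>

lemma poisson_kernel_has_derivative:
 assumes "e > (0::real)"
 shows "((\<lambda>x. arctan ((x - t) / e)) has_real_derivative e / ((x - t)^2 + e^2)) (at x within S)"
proof -
 have "((\<lambda>x. arctan ((x - t) / e)) has_real_derivative inverse (1 + ((x - t) / e)^2) * (1 / e)) (at x within S)"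
  using assms by (auto intro!: derivative_eq_intros)
 also have "inverse (1 + ((x - t) / e)^2) * (1 / e) = e / ((x - t)^2 + e^2)"
 proof -
  have "1 + ((x - t) / e)^2 = ((x - t)^2 + e^2) / e^2"
   using assms by (simp add: power_divide field_simps)
  then show ?thesis using assms by (simp add: power2_eq_square)
 qed
 finally show ?thesis .
qed

lemma poisson_kernel_integral:
 assumes e: "e > (0::real)" and "a <= b"
 shows "(\<integral>\<^sup>+x. ennreal (e / ((x - t)^2 + e^2)) * indicator {a..b} x \<partial>lborel) <= ennreal pi"
proof -
 have "(\<integral>\<^sup>+x. ennreal (e / ((x - t)^2 + e^2)) * indicator {a..b} x \<partial>lborel)
   = ennreal (arctan ((b - t) / e) - arctan ((a - t) / e))"
  using assms by (intro nn_integral_FTC_Icc poisson_kernel_has_derivative) auto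
 also have "... <= ennreal pi"
  using arctan_bounded[of "(b - t) / e"] arctan_bounded[of "(a - t) / e"] by (intro ennreal_leI) auto
 finally show ?thesis .
qed

lemma poisson_kernel_integrable:
 assumes f: "dominated f E" and e: "e > 0"
 shows "integrable lborel (\<lambda>t. e / ((x - t)^2 + e^2) * f t)"
proof -
 have "integrable lborel (\<lambda>t. of_real (f t) * (e / ((x - t)^2 + e^2)))"
 proof (rule dominated_kernel_bound(1)[OF f, where B = "1 / e"])
  show "norm (e / ((x - t)^2 + e^2)) <= 1 / e" for t
  proof -
   have "e / ((x - t)^2 + e^2) <= e / e^2" using e by (intro divide_left_mono) (auto intro!: mult_pos_pos add_nonneg_pos)
   then show ?thesis using e by (simp add: power2_eq_square)
  qed
 qed measurable
 then show ?thesis by (simp add: mult.commute)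
qed

lemma poisson_reg_nn_bound:
 assumes f: "dominated f E" and e: "e > 0"
 shows "ennreal \<bar>poisson_reg e f x\<bar> <= (\<integral>\<^sup>+t. ennreal (e / ((x - t)^2 + e^2)) * indicator E t \<partial>lborel)"
proof -
 have "ennreal \<bar>poisson_reg e f x\<bar> <= (\<integral>\<^sup>+t. norm (e / ((x - t)^2 + e^2) * f t) \<partial>lborel)"
  unfolding poisson_reg_def
  using integral_norm_bound_ennreal[OF poisson_kernel_integrable[OF f e, of x]] by simp
 also have "... <= (\<integral>\<^sup>+t. ennreal (e / ((x - t)^2 + e^2)) * indicator E t \<partial>lborel)"
 proof (rule nn_integral_mono)
  fix t
  show "ennreal (norm (e / ((x - t)^2 + e^2) * f t)) <= ennreal (e / ((x - t)^2 + e^2)) * indicator E t"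
  proof (cases "t \<in> E")
   case True
   have "norm (e / ((x - t)^2 + e^2) * f t) <= e / ((x - t)^2 + e^2) * 1"
    unfolding norm_mult using e dominatedD(4)[OF f, of t] True by (intro mult_mono) auto
   then show ?thesis using True by (simp add: ennreal_leI)
  next
   case False
   then show ?thesis using dominatedD(4)[OF f, of t] by simp
  qed
 qed
 finally show ?thesis .
qed

lemma poisson_reg_le_pi:
 assumes f: "dominated f E" and e: "e > 0"
 shows "\<bar>poisson_reg e f x\<bar> <= pi"
proof -
 have "ennreal \<bar>poisson_reg e f x\<bar> <= (\<integral>\<^sup>+t. ennreal (e / ((x - t)^2 + e^2)) * indicator E t \<partial>lborel)"
  by (rule poisson_reg_nn_bound[OF f e])
 also have "... <= (\<integral>\<^sup>+t. ennreal (e / ((t - x)^2 + e^2)) * indicator {-1..1} t \<partial>lborel)"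
  using dominatedD(3)[OF f] by (intro nn_integral_mono) (auto simp: indicator_def power2_commute)
 also have "... <= ennreal pi" by (rule poisson_kernel_integral[OF e]) simp
 finally show ?thesis by (subst (asm) ennreal_le_iff) auto
qed

text \<open>Fubini: integrated in x, the Poisson kernel centred at t has mass at most pi, uniformly
  in e.\<close>

lemma poisson_reg_L1:
 assumes f: "dominated f E" and e: "e > 0" and R: "R >= 0"
 shows "(\<integral>\<^sup>+x. ennreal \<bar>poisson_reg e f x\<bar> * indicator {-R..R} x \<partial>lborel) <= ennreal pi * emeasure lborel E"
proof -
 have [measurable]: "E \<in> sets borel" using f by (auto simp: dominated_def)
 have "(\<integral>\<^sup>+x. ennreal \<bar>poisson_reg e f x\<bar> * indicator {-R..R} x \<partial>lborel)
   <= (\<integral>\<^sup>+x. (\<integral>\<^sup>+t. ennreal (e / ((x - t)^2 + e^2)) * indicator E t \<partial>lborel) * indicator {-R..R} x \<partial>lborel)"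
  by (intro nn_integral_mono mult_right_mono poisson_reg_nn_bound[OF f e]) auto
 also have "... = (\<integral>\<^sup>+x. (\<integral>\<^sup>+t. ennreal (e / ((x - t)^2 + e^2)) * indicator E t * indicator {-R..R} x \<partial>lborel) \<partial>lborel)"
  by (subst nn_integral_multc) auto
 also have "... = (\<integral>\<^sup>+t. (\<integral>\<^sup>+x. ennreal (e / ((x - t)^2 + e^2)) * indicator E t * indicator {-R..R} x \<partial>lborel) \<partial>lborel)"
  by (rule lborel_pair.Fubini') measurable
 also have "... = (\<integral>\<^sup>+t. (\<integral>\<^sup>+x. ennreal (e / ((x - t)^2 + e^2)) * indicator {-R..R} x \<partial>lborel) * indicator E t \<partial>lborel)"
  by (subst nn_integral_multc[symmetric]) (auto simp: ac_simps)
 also have "... <= (\<integral>\<^sup>+t. ennreal pi * indicator E t \<partial>lborel)"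
  by (intro nn_integral_mono mult_right_mono poisson_kernel_integral[OF e]) (use R in auto)
 also have "... = ennreal pi * emeasure lborel E" by (simp add: nn_integral_cmult)
 finally show ?thesis .
qed

lemma nn_integral_Icc_continuous:
 fixes g :: "real => real"
 assumes g: "continuous_on UNIV g" "\<And>x. g x >= 0"
 shows "(\<integral>\<^sup>+x. ennreal (g x) * indicator {a..b} x \<partial>lborel) = ennreal (integral {a..b} g)"
proof -
 have si: "set_integrable lborel {a..b} g"
  by (rule borel_integrable_atLeastAtMost') (use g(1) continuous_on_subset in blast)
 have "(\<integral>\<^sup>+x. ennreal (g x) * indicator {a..b} x \<partial>lborel) = (\<integral>\<^sup>+x. ennreal (indicator {a..b} x *\<^sub>R g x) \<partial>lborel)"
  by (intro nn_integral_cong) (auto simp: indicator_def)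
 also have "... = ennreal (\<integral>x. indicator {a..b} x *\<^sub>R g x \<partial>lborel)"
  using si g(2) unfolding set_integrable_def by (intro nn_integral_eq_integral) auto
 also have "... = ennreal (integral {a..b} g)"
  using set_borel_integral_eq_integral(2)[OF si] by (simp add: set_lebesgue_integral_def)
 finally show ?thesis .
qed

lemma hilbert_poisson_continuous:
 assumes f: "dominated f E" and e: "e > 0"
 shows "continuous_on UNIV (\<lambda>x. cauchy_transform f (Complex x e))"
  and "continuous_on UNIV (hilbert_reg e f)" and "continuous_on UNIV (poisson_reg e f)"
proof -
 have "continuous_on {z. Im z > 0} (cauchy_transform f)"
  by (rule holomorphic_on_imp_continuous_on[OF cauchy_transform_holomorphic[OF f]])
 moreover have "continuous_on UNIV (\<lambda>x. Complex x e)"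
  unfolding Complex_eq by (intro continuous_intros)
 ultimately show c: "continuous_on UNIV (\<lambda>x. cauchy_transform f (Complex x e))"
  by (rule continuous_on_compose2) (use e in auto)
 have "continuous_on UNIV (\<lambda>x. Re (cauchy_transform f (Complex x e)))"
  "continuous_on UNIV (\<lambda>x. - Im (cauchy_transform f (Complex x e)))"
  using c by (intro continuous_intros; assumption)+
 then show "continuous_on UNIV (hilbert_reg e f)" "continuous_on UNIV (poisson_reg e f)"
  by (simp_all add: cauchy_transform_Re_Im[OF f e])
qed

text \<open>The inequality of \<open>power_le_Re_power_even\<close> trades V^n for the real part of
  the n-th power of the Cauchy transform, whose integral vanishes in the limit of large R, and for
  U^n. Since U is bounded by pi, U^n is at most pi^(n - 1) times |U| and integrates to a multiple of
  the measure of E. The bound is linear in that measure for every even n.\<close>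

lemma hilbert_reg_even_power_bound:
 assumes n: "even n" "n >= 2"
 shows "\<exists>C\<ge>0. \<forall>f E e. dominated f E \<and> e > 0 -->
   integral {-1..1} (\<lambda>x. hilbert_reg e f x ^ n) <= C * measure lborel E"
proof -
 obtain C where C: "C >= 0" "\<And>V U. V ^ n <= 2 * Re (Complex V (- U) ^ n) + C * U ^ n"
  using power_le_Re_power_even[of n] n by auto
 have "integral {-1..1} (\<lambda>x. hilbert_reg e f x ^ n) <= C * pi ^ n * measure lborel E"
  if f: "dominated f E" and e: "e > 0" for f E e
 proof -
  define V where "V = hilbert_reg e f"
  define U where "U = poisson_reg e f"
  define F where "F x = cauchy_transform f (Complex x e)" for x
  have cV: "continuous_on UNIV V" and cU: "continuous_on UNIV U" and cF: "continuous_on UNIV F"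
   using hilbert_poisson_continuous[OF f e] by (auto simp: V_def U_def F_def[abs_def])
  have FVU: "F x = Complex (V x) (- U x)" for x
   using cauchy_transform_Re_Im[OF f e, of x] by (simp add: F_def V_def U_def)
  have ic: "g integrable_on {a..b}" if "continuous_on UNIV g" for g :: "real => real" and a b
   by (rule integrable_continuous_interval) (use that continuous_on_subset in blast)
  have E: "emeasure lborel E < \<infinity>"
  proof -
   have "emeasure lborel E <= emeasure lborel {-1..1::real}"
    by (rule emeasure_mono) (use dominatedD(3)[OF f] in auto)
   then show ?thesis by (simp add: order_le_less_trans)
  qed
  have U1: "integral {-R..R} (\<lambda>x. \<bar>U x\<bar>) <= pi * measure lborel E" if "R >= 0" for R
  proof -
   have "ennreal (integral {-R..R} (\<lambda>x. \<bar>U x\<bar>)) = (\<integral>\<^sup>+x. ennreal \<bar>U x\<bar> * indicator {-R..R} x \<partial>lborel)"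
    by (rule nn_integral_Icc_continuous[symmetric]) (auto intro!: continuous_intros cU)
   also have "... <= ennreal pi * emeasure lborel E"
    unfolding U_def by (rule poisson_reg_L1[OF f e that])
   also have "... = ennreal (pi * measure lborel E)"
    using E by (simp add: emeasure_eq_ennreal_measure ennreal_mult)
   finally show ?thesis by (subst (asm) ennreal_le_iff) auto
  qed
  have bound: "integral {-1..1} (\<lambda>x. V x ^ n) <= 2 * ((4 / R) ^ n * R * pi) + C * pi ^ n * measure lborel E"
   if R: "R >= 2" for R
  proof -
   obtain I where I: "((\<lambda>x. F x ^ n) has_integral I) {-R..R}" "norm I <= (4 / R) ^ n * R * pi"
    using cauchy_transform_power_integral[OF f e R, of n] by (auto simp: F_def)
   have Re: "((\<lambda>x. Re (F x ^ n)) has_integral Re I) {-R..R}" by (rule has_integral_Re[OF I(1)])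
   have "integral {-1..1} (\<lambda>x. V x ^ n) <= integral {-R..R} (\<lambda>x. V x ^ n)"
    by (rule integral_subset_le) (use R n in \<open>auto intro!: ic continuous_intros cV simp: zero_le_even_power\<close>)
   also have "... <= integral {-R..R} (\<lambda>x. 2 * Re (F x ^ n) + C * pi ^ (n - 1) * \<bar>U x\<bar>)"
   proof (rule integral_le)
    show "(\<lambda>x. V x ^ n) integrable_on {-R..R}" by (auto intro!: ic continuous_intros cV)
    show "(\<lambda>x. 2 * Re (F x ^ n) + C * pi ^ (n - 1) * \<bar>U x\<bar>) integrable_on {-R..R}"
     by (auto intro!: ic continuous_intros cU cF)
    fix x
    have "U x ^ n = \<bar>U x\<bar> ^ (n - 1) * \<bar>U x\<bar>"
     using n by (metis One_nat_def Suc_pred less_le_trans pos2 power_Suc2 power_even_abs)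
    also have "... <= pi ^ (n - 1) * \<bar>U x\<bar>"
     using poisson_reg_le_pi[OF f e, of x] by (intro mult_right_mono power_mono) (auto simp: U_def)
    finally have "C * U x ^ n <= C * (pi ^ (n - 1) * \<bar>U x\<bar>)" using C(1) by (intro mult_left_mono)
    then show "V x ^ n <= 2 * Re (F x ^ n) + C * pi ^ (n - 1) * \<bar>U x\<bar>"
     using C(2)[of "V x" "U x"] by (simp add: FVU mult.assoc)
   qed
   also have "... = 2 * Re I + C * pi ^ (n - 1) * integral {-R..R} (\<lambda>x. \<bar>U x\<bar>)"
    by (intro integral_unique has_integral_add has_integral_mult_right Re integrable_integral ic)
      (auto intro!: continuous_intros cU)
   also have "... <= 2 * ((4 / R) ^ n * R * pi) + C * pi ^ (n - 1) * (pi * measure lborel E)"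
    using U1[of R] R I(2) abs_Re_le_cmod[of I] C(1) by (intro add_mono mult_left_mono) auto
   also have "C * pi ^ (n - 1) * (pi * measure lborel E) = C * pi ^ n * measure lborel E"
    using n by (cases n) auto
   finally show ?thesis .
  qed
  have lim: "((\<lambda>R. 2 * ((4 / R) ^ n * R * pi) + C * pi ^ n * measure lborel E) \<longlongrightarrow> 2 * (0 * pi) + C * pi ^ n * measure lborel E) at_top"
  proof (intro tendsto_intros)
   \<comment> \<open>Splitting off 16 / R leaves the power n - 2, which for n = 2 is constantly 1
     and otherwise tends to 0; the product tends to 0 in both cases.\<close>
   have "((\<lambda>R::real. (4 / R) ^ (n - 2) * (16 * inverse R)) \<longlongrightarrow> (if n = 2 then 1 else 0) * (16 * 0)) at_top"
   proof (intro tendsto_intros tendsto_inverse_0_at_top filterlim_ident)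
    have "((\<lambda>R::real. (4 * inverse R) ^ (n - 2)) \<longlongrightarrow> (4 * 0) ^ (n - 2)) at_top"
     by (intro tendsto_intros tendsto_inverse_0_at_top filterlim_ident)
    also have "(4 * 0) ^ (n - 2) = (if n = 2 then 1 else 0 :: real)" using n by (auto simp: zero_power)
    finally show "((\<lambda>R::real. (4 / R) ^ (n - 2)) \<longlongrightarrow> (if n = 2 then 1 else 0)) at_top"
     by (simp add: divide_inverse)
   qed
   moreover have "\<forall>\<^sub>F R in at_top. (4 / R) ^ (n - 2) * (16 * inverse R) = (4 / R) ^ n * (R::real)"
    using eventually_gt_at_top[of 0]
   proof eventually_elim
    case (elim R)
    have "(4 / R) ^ n = (4 / R) ^ (n - 2) * (4 / R)^2"
     using n by (metis le_add_diff_inverse2 power_add)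
    then show ?case using elim by (simp add: power2_eq_square field_simps)
   qed
   ultimately show "((\<lambda>R::real. (4 / R) ^ n * R) \<longlongrightarrow> 0) at_top"
    by (simp add: tendsto_cong)
  qed
  have "integral {-1..1} (\<lambda>x. V x ^ n) <= 2 * (0 * pi) + C * pi ^ n * measure lborel E"
   by (rule tendsto_lowerbound[OF lim])
     (auto intro!: eventually_mono[OF eventually_ge_at_top[of 2]] bound)
  then show ?thesis by (simp add: V_def)
 qed
 moreover have "C * pi ^ n >= 0" using C by auto
 ultimately show ?thesis by blast
qed

section \<open>Weak type estimates for the Hilbert transform\<close>

lemma hilbert_kernel_bound:
 fixes a e :: real
 assumes "e > 0"
 shows "\<bar>a / (a^2 + e^2)\<bar> <= 1 / e"
proof -
 have "0 <= (\<bar>a\<bar> - e)^2" by simp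
 then have "2 * (\<bar>a\<bar> * e) <= a^2 + e^2" by (simp add: power2_diff)
 moreover have "0 <= \<bar>a\<bar> * e" using assms by simp
 ultimately have "\<bar>a\<bar> * e <= a^2 + e^2" by linarith
 moreover have "a^2 + e^2 > 0" using assms by (simp add: add_nonneg_pos)
 ultimately show ?thesis using assms by (simp add: field_simps abs_divide)
qed

lemma dominated_finite:
 assumes f: "dominated f E"
 shows "emeasure lborel E < \<infinity>"
proof -
 have "emeasure lborel E <= emeasure lborel {-1..1::real}"
  by (rule emeasure_mono) (use dominatedD(3)[OF f] in auto)
 then show ?thesis by (simp add: order_le_less_trans)
qed

lemma hilbert_reg_markov:
 assumes f: "dominated f E" and e: "e > 0" and s: "s > 0" and n: "even n"
 shows "measure lborel {x\<in>{-1..1}. \<bar>hilbert_reg e f x\<bar> > s} * s ^ n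
   <= integral {-1..1} (\<lambda>x. hilbert_reg e f x ^ n)"
proof -
 define A where "A = {x\<in>{-1..1}. \<bar>hilbert_reg e f x\<bar> > s}"
 have [measurable]: "hilbert_reg e f \<in> borel_measurable borel"
  by (intro borel_measurable_continuous_onI hilbert_poisson_continuous[OF f e])
 have A: "A \<in> sets borel" unfolding A_def by measurable
 have fin: "emeasure lborel A < \<infinity>"
 proof -
  have "emeasure lborel A <= emeasure lborel {-1..1::real}"
   by (rule emeasure_mono) (auto simp: A_def)
  then show ?thesis by (simp add: order_le_less_trans)
 qed
 have "ennreal (measure lborel A * s ^ n) = (\<integral>\<^sup>+x. ennreal (s ^ n) * indicator A x \<partial>lborel)"
  using A fin s by (subst nn_integral_cmult_indicator) (auto simp: emeasure_eq_ennreal_measure ennreal_mult mult.commute less_top)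
 also have "... <= (\<integral>\<^sup>+x. ennreal (hilbert_reg e f x ^ n) * indicator {-1..1} x \<partial>lborel)"
 proof (rule nn_integral_mono)
  fix x
  have "s ^ n <= hilbert_reg e f x ^ n" if "x \<in> A"
  proof -
   have "s ^ n <= \<bar>hilbert_reg e f x\<bar> ^ n" using that s by (intro power_mono) (auto simp: A_def)
   then show ?thesis using n by (simp add: power_even_abs)
  qed
  then show "ennreal (s ^ n) * indicator A x <= ennreal (hilbert_reg e f x ^ n) * indicator {-1..1} x"
   by (auto simp: indicator_def A_def intro!: ennreal_leI)
 qed
 also have "... = ennreal (integral {-1..1} (\<lambda>x. hilbert_reg e f x ^ n))"
  using n by (intro nn_integral_Icc_continuous continuous_intros hilbert_poisson_continuous[OF f e])
    (auto simp: zero_le_even_power)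
 finally show ?thesis unfolding A_def[symmetric]
  by (subst (asm) ennreal_le_iff) (auto intro!: integral_nonneg integrable_continuous_interval continuous_intros
    continuous_on_subset[OF hilbert_poisson_continuous(2)[OF f e]] simp: zero_le_even_power n)
qed

text \<open>Fubini applies because the regularised kernel is bounded by 1 / e, and the sign comes
  from its oddness. Exponents below 2 are reached through this identity.\<close>

lemma hilbert_reg_adjoint:
 assumes f: "dominated f E" and F: "F \<in> sets borel" "F \<subseteq> {-1..1}" and e: "e > 0"
 shows "(\<integral>x. indicator F x * hilbert_reg e f x \<partial>lborel)
    = - (\<integral>t. f t * hilbert_reg e (indicator F) t \<partial>lborel)"
proof -
 define k where "k x t = indicator F x * ((x - t) / ((x - t)^2 + e^2) * f t)" for x t :: real
 have [measurable]: "f \<in> borel_measurable borel" "F \<in> sets borel" using f F by (auto simp: dominated_def)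
 have int: "integrable (lborel \<Otimes>\<^sub>M lborel) (case_prod k)"
 proof (rule Bochner_Integration.integrable_bound)
  show "integrable (lborel \<Otimes>\<^sub>M lborel) (\<lambda>z. 1 / e * indicator ({-1..1::real} \<times> {-1..1::real}) z :: real)"
  proof (intro integrable_mult_right integrable_real_indicator)
   show "{-1..1::real} \<times> {-1..1::real} \<in> sets (lborel \<Otimes>\<^sub>M lborel)" by (intro pair_measureI) auto
   show "emeasure (lborel \<Otimes>\<^sub>M lborel) ({-1..1::real} \<times> {-1..1::real}) < \<infinity>"
    by (subst lborel.emeasure_pair_measure_Times) (auto simp: ennreal_mult_less_top)
  qed
  show "case_prod k \<in> borel_measurable (lborel \<Otimes>\<^sub>M lborel)"
   unfolding k_def by measurable
  have "norm (k x t) <= norm (1 / e * indicator ({-1..1} \<times> {-1..1}) (x, t) :: real)" for x t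
  proof -
   have "\<bar>k x t\<bar> = indicator F x * (\<bar>(x - t) / ((x - t)^2 + e^2)\<bar> * \<bar>f t\<bar>)"
    by (simp add: k_def abs_mult)
   also have "... <= indicator {-1..1} x * (1 / e * indicator {-1..1} t)"
    using F(2) dominatedD(5)[OF f, of t] hilbert_kernel_bound[OF e, of "x - t"] e
    by (intro mult_mono) (auto simp: indicator_def)
   also have "... = norm (1 / e * indicator ({-1..1} \<times> {-1..1}) (x, t) :: real)"
    using e by (auto simp: indicator_def)
   finally show ?thesis by simp
  qed
  then show "AE z in lborel \<Otimes>\<^sub>M lborel. norm (case_prod k z) <= norm (1 / e * indicator ({-1..1} \<times> {-1..1}) z :: real)"
   by auto
 qed
 have "(\<integral>x. indicator F x * hilbert_reg e f x \<partial>lborel) = (\<integral>x. (\<integral>t. k x t \<partial>lborel) \<partial>lborel)"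
  unfolding k_def hilbert_reg_def by (simp only: integral_mult_right_zero)
 also have "... = (\<integral>t. (\<integral>x. k x t \<partial>lborel) \<partial>lborel)"
  by (rule lborel_pair.Fubini_integral[OF int, symmetric])
 also have "... = (\<integral>t. - (f t * hilbert_reg e (indicator F) t) \<partial>lborel)"
 proof (intro Bochner_Integration.integral_cong refl)
  fix t
  have kern: "(x - t) / ((x - t)^2 + e^2) = - ((t - x) / ((t - x)^2 + e^2))" for x
   by (metis minus_diff_eq minus_divide_left power2_commute)
  have "k x t = - f t * ((t - x) / ((t - x)^2 + e^2) * indicator F x)" for x
   unfolding k_def kern by (simp only: mult_minus_left mult_minus_right mult_ac)
  then have "(\<integral>x. k x t \<partial>lborel) = (\<integral>x. - f t * ((t - x) / ((t - x)^2 + e^2) * indicator F x) \<partial>lborel)"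
   by simp
  also have "... = - f t * hilbert_reg e (indicator F) t"
   unfolding hilbert_reg_def by (rule integral_mult_right_zero)
  finally show "(\<integral>x. k x t \<partial>lborel) = - (f t * hilbert_reg e (indicator F) t)" by simp
 qed
 also have "... = - (\<integral>t. f t * hilbert_reg e (indicator F) t \<partial>lborel)" by simp
 finally show ?thesis .
qed

lemma dominated_indicator: "F \<in> sets borel ==> F \<subseteq> {-1..1} ==> dominated (indicator F) F"
 by (auto simp: dominated_def)

lemma exists_even_ge: "\<exists>n::nat. even n \<and> n >= 2 \<and> real n >= q"
proof -
 have "real (2 * (nat \<lceil>\<bar>q\<bar>\<rceil> + 1)) >= q"
  by (simp add: of_nat_nat) linarith
 then show ?thesis by (intro exI[of _ "2 * (nat \<lceil>\<bar>q\<bar>\<rceil> + 1)"]) auto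
qed

text \<open>Chebyshev's inequality with one of two even exponents: n >= p for s >= 1, and 2 for s <
  1. Both moments are linear in the measure of E, so no interpolation theorem is called for.\<close>

lemma hilbert_weak_type_large:
 assumes p: "p >= 2"
 shows "\<exists>C\<ge>0. \<forall>f E e s. dominated f E \<and> e > 0 \<and> s > 0 -->
   measure lborel {x\<in>{-1..1}. \<bar>hilbert_reg e f x\<bar> > s} <= C * s powr (- p) * measure lborel E"
proof -
 obtain n where n: "even n" "n >= 2" "real n >= p" using exists_even_ge by blast
 obtain C1 where C1: "C1 >= 0" "\<And>f E e. dominated f E ==> e > 0 ==>
   integral {-1..1} (\<lambda>x. hilbert_reg e f x ^ 2) <= C1 * measure lborel E"
  using hilbert_reg_even_power_bound[of 2] by auto
 obtain C2 where C2: "C2 >= 0" "\<And>f E e. dominated f E ==> e > 0 ==>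
   integral {-1..1} (\<lambda>x. hilbert_reg e f x ^ n) <= C2 * measure lborel E"
  using hilbert_reg_even_power_bound[of n] n by auto
 have "measure lborel {x\<in>{-1..1}. \<bar>hilbert_reg e f x\<bar> > s} <= (C1 + C2) * s powr (- p) * measure lborel E"
  if f: "dominated f E" and e: "e > 0" and s: "s > 0" for f E e s
 proof -
  define A where "A = measure lborel {x\<in>{-1..1}. \<bar>hilbert_reg e f x\<bar> > s}"
  have gen: "A <= C * s powr (- p) * measure lborel E"
   if "A * s ^ m <= C * measure lborel E" "s powr (- real m) <= s powr (- p)" "C >= 0" for m :: nat and C
  proof -
   have "A = A * s ^ m * s powr (- real m)"
    using s by (simp add: powr_minus powr_realpow)
   also have "... <= (C * measure lborel E) * s powr (- p)"
    using mult_mono[OF that(1,2)] that(3) by simp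
   finally show ?thesis by (simp add: mult_ac)
  qed
  have "A <= C1 * s powr (- p) * measure lborel E \<or> A <= C2 * s powr (- p) * measure lborel E"
  proof (cases "s >= 1")
   case True
   have "A <= C2 * s powr (- p) * measure lborel E"
   proof (rule gen[of n])
    show "A * s ^ n <= C2 * measure lborel E"
     unfolding A_def using hilbert_reg_markov[OF f e s n(1)] C2(2)[OF f e] by linarith
   qed (use True n C2 in \<open>auto intro!: powr_mono\<close>)
   then show ?thesis ..
  next
   case False
   have "A <= C1 * s powr (- p) * measure lborel E"
   proof (rule gen[of 2])
    show "A * s ^ 2 <= C1 * measure lborel E"
     unfolding A_def using hilbert_reg_markov[OF f e s, of 2] C1(2)[OF f e] by simp
   qed (use False s p C1 in \<open>auto intro!: powr_mono'\<close>)
   then show ?thesis ..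
  qed
  moreover have "0 <= C1 * s powr (- p) * measure lborel E" "0 <= C2 * s powr (- p) * measure lborel E"
   using C1(1) C2(1) by auto
  ultimately show ?thesis unfolding A_def by (auto simp: distrib_right)
 qed
 then show ?thesis using C1(1) C2(1) by (intro exI[of _ "C1 + C2"]) auto
qed

text \<open>Let F be the set where the transform exceeds s. Then s |F| is at most the integral of
  the transform over F, which by antisymmetry is an integral of f against G, the transform of the
  indicator of F. Where |G| <= \<eta> this costs at most \<eta> |E|; elsewhere |G| is at most
  \<eta>^(1 - q) times a sum of even powers of G, whose integrals are multiples of |F|.\<close>

lemma hilbert_weak_type_dual:
 assumes q: "q >= 2"
 shows "\<exists>D>0. \<forall>f E e s \<eta>. dominated f E \<and> e > 0 \<and> s > 0 \<and> \<eta> > 0 -->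
   s * measure lborel {x\<in>{-1..1}. hilbert_reg e f x > s}
   <= \<eta> * measure lborel E + \<eta> powr (1 - q) * D * measure lborel {x\<in>{-1..1}. hilbert_reg e f x > s}"
proof -
 obtain n where n: "even n" "n >= 2" "real n >= q" using exists_even_ge by blast
 obtain C1 where C1: "C1 >= 0" "\<And>f E e. dominated f E ==> e > 0 ==>
   integral {-1..1} (\<lambda>x. hilbert_reg e f x ^ 2) <= C1 * measure lborel E"
  using hilbert_reg_even_power_bound[of 2] by auto
 obtain C2 where C2: "C2 >= 0" "\<And>f E e. dominated f E ==> e > 0 ==>
   integral {-1..1} (\<lambda>x. hilbert_reg e f x ^ n) <= C2 * measure lborel E"
  using hilbert_reg_even_power_bound[of n] n by auto
 define D where "D = C1 + C2 + 1"
 have "s * measure lborel {x\<in>{-1..1}. hilbert_reg e f x > s}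
   <= \<eta> * measure lborel E + \<eta> powr (1 - q) * D * measure lborel {x\<in>{-1..1}. hilbert_reg e f x > s}"
  if f: "dominated f E" and e: "e > 0" and s: "s > 0" and eta: "\<eta> > 0" for f E e s \<eta>
 proof -
  define V where "V = hilbert_reg e f"
  define F where "F = {x\<in>{-1..1}. V x > s}"
  define G where "G = hilbert_reg e (indicator F)"
  have cV: "continuous_on UNIV V" unfolding V_def by (rule hilbert_poisson_continuous[OF f e])
  have [measurable]: "V \<in> borel_measurable borel" by (intro borel_measurable_continuous_onI cV)
  have F: "F \<in> sets borel" "F \<subseteq> {-1..1}" unfolding F_def by (measurable, auto)
  have dF: "dominated (indicator F) F" by (rule dominated_indicator[OF F])
  have cG: "continuous_on UNIV G" unfolding G_def by (rule hilbert_poisson_continuous[OF dF e])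
  have [measurable]: "G \<in> borel_measurable borel" by (intro borel_measurable_continuous_onI cG)
  have [measurable]: "F \<in> sets borel" "E \<in> sets borel" "f \<in> borel_measurable borel"
   using F f by (auto simp: dominated_def)
  have i1: "integrable lborel (\<lambda>x. indicator {-1..1} x * g x)" if "continuous_on UNIV g" for g :: "real => real"
   using borel_integrable_compact[of "{-1..1}" g] that continuous_on_subset by auto
  have iS: "integrable lborel (\<lambda>x. h x * g x)"
   if "continuous_on UNIV g" "h \<in> borel_measurable borel" "\<And>x. \<bar>h x\<bar> <= indicator {-1..1} x" for g h :: "real => real"
  proof (rule Bochner_Integration.integrable_bound[OF i1[OF that(1)]])
   show "(\<lambda>x. h x * g x) \<in> borel_measurable lborel"
    using borel_measurable_times[OF that(2) borel_measurable_continuous_onI[OF that(1)]] by simp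
   have "norm (h x * g x) <= norm (indicator {-1..1} x * g x)" for x
    using that(3)[of x] by (simp add: abs_mult mult_right_mono)
   then show "AE x in lborel. norm (h x * g x) <= norm (indicator {-1..1} x * g x)" by simp
  qed
  have indE: "\<bar>indicator E x\<bar> <= (indicator {-1..1} x :: real)" for x
   using dominatedD(3)[OF f] by (auto simp: indicator_def)
  have indF: "\<bar>indicator F x\<bar> <= (indicator {-1..1} x :: real)" for x
   using F by (auto simp: indicator_def)
  have finF: "emeasure lborel F < \<infinity>" by (rule dominated_finite[OF dF])
  have finE: "emeasure lborel E < \<infinity>" by (rule dominated_finite[OF f])
  have "s * measure lborel F = (\<integral>x. s * indicator F x \<partial>lborel)" by simp
  also have "... <= (\<integral>x. indicator F x * V x \<partial>lborel)"
  proof (rule Bochner_Integration.integral_mono)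
   show "integrable lborel (\<lambda>x. s * indicator F x)" using finF by simp
   show "integrable lborel (\<lambda>x. indicator F x * V x)" by (rule iS[OF cV _ indF]) simp
  qed (auto simp: F_def indicator_def)
  also have "... = - (\<integral>t. f t * G t \<partial>lborel)"
   unfolding V_def G_def by (rule hilbert_reg_adjoint[OF f F e])
  also have "... = (\<integral>t. - (f t * G t) \<partial>lborel)" by simp
  also have "... <= (\<integral>t. \<eta> * indicator E t + \<eta> powr (1 - q) * (indicator {-1..1} t * (G t ^ 2 + G t ^ n)) \<partial>lborel)"
  proof (rule Bochner_Integration.integral_mono)
   show "integrable lborel (\<lambda>t. - (f t * G t))"
    using iS[OF cG _ dominatedD(5)[OF f]] by simp
   show "integrable lborel (\<lambda>t. \<eta> * indicator E t + \<eta> powr (1 - q) * (indicator {-1..1} t * (G t ^ 2 + G t ^ n)))"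
    using finE by (intro Bochner_Integration.integrable_add integrable_mult_right i1 continuous_intros cG) simp
   fix t
   show "- (f t * G t) <= \<eta> * indicator E t + \<eta> powr (1 - q) * (indicator {-1..1} t * (G t ^ 2 + G t ^ n))"
   proof (cases "t \<in> E")
    case False
    then have "f t = 0" using dominatedD(4)[OF f, of t] by simp
    then show ?thesis using False n by (auto simp: indicator_def zero_le_even_power)
   next
    case True
    then have t: "t \<in> {-1..1}" using dominatedD(3)[OF f] by auto
    define a where "a = \<bar>G t\<bar>"
    have ev: "G t ^ 2 = a ^ 2" "G t ^ n = a ^ n" using n(1) by (auto simp: a_def power_even_abs)
    have "- (f t * G t) <= \<bar>f t\<bar> * a" by (metis a_def abs_ge_minus_self abs_mult)
    also have "... <= 1 * a" using dominatedD(4)[OF f, of t] True by (intro mult_right_mono) (auto simp: a_def)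
    finally have 1: "- (f t * G t) <= a" by simp
    have "a <= \<eta> + \<eta> powr (1 - q) * (a ^ 2 + a ^ n)"
    proof (cases "a <= \<eta>")
     case True
     then show ?thesis using n(1) by (smt (verit) powr_ge_zero mult_nonneg_nonneg zero_le_even_power even_numeral)
    next
     case False
     then have a: "a > \<eta>" "a > 0" using eta by auto
     have "1 <= (a / \<eta>) powr (q - 1)" using a eta q by (intro ge_one_powr_ge_zero) auto
     also have "... = a powr (q - 1) * \<eta> powr (1 - q)"
      using a eta by (subst powr_divide) (auto simp: powr_minus_divide[of \<eta> "q - 1", simplified])
     finally have "a * 1 <= a * (a powr (q - 1) * \<eta> powr (1 - q))"
      using a by (intro mult_left_mono) auto
     also have "... = \<eta> powr (1 - q) * a powr q"
      using a powr_add[of a 1 "q - 1"] by (simp add: mult_ac)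
     \<comment> \<open>Since 2 <= q <= n, one of the two even powers dominates, according to whether
       a is below or above 1.\<close>
     also have "a powr q <= a ^ 2 + a ^ n"
     proof (cases "a >= 1")
      case True
      have "a powr q <= a powr (real n)" using True n by (intro powr_mono) auto
      then show ?thesis using a by (simp add: powr_realpow add_increasing)
     next
      case False
      have "a powr q <= a powr (real 2)" using False a q by (intro powr_mono') auto
      then show ?thesis using a by (simp add: powr_realpow[of a 2, simplified] add_increasing2)
     qed
     finally have "a <= \<eta> powr (1 - q) * (a ^ 2 + a ^ n)" by (simp add: mult_left_mono)
     then show ?thesis using eta by simp
    qed
    then show ?thesis using 1 True t by (simp add: ev)
   qed
  qed
  also have "... = \<eta> * measure lborel E + \<eta> powr (1 - q) * (\<integral>t. indicator {-1..1} t * (G t ^ 2 + G t ^ n) \<partial>lborel)"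
   using finE by (subst Bochner_Integration.integral_add)
    (auto intro!: integrable_mult_right i1 continuous_intros cG)
  also have "(\<integral>t. indicator {-1..1} t * (G t ^ 2 + G t ^ n) \<partial>lborel) = integral {-1..1} (\<lambda>t. G t ^ 2 + G t ^ n)"
  proof -
   have "set_integrable lborel {-1..1} (\<lambda>t. G t ^ 2 + G t ^ n)"
    by (intro borel_integrable_atLeastAtMost' continuous_intros continuous_on_subset[OF cG]) auto
   from set_borel_integral_eq_integral(2)[OF this] show ?thesis
    by (simp add: set_lebesgue_integral_def)
  qed
  also have "... = integral {-1..1} (\<lambda>t. G t ^ 2) + integral {-1..1} (\<lambda>t. G t ^ n)"
   by (intro Henstock_Kurzweil_Integration.integral_add integrable_continuous_interval continuous_intros continuous_on_subset[OF cG]) auto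
  also have "\<eta> * measure lborel E + \<eta> powr (1 - q) * ... <= \<eta> * measure lborel E + \<eta> powr (1 - q) * (D * measure lborel F)"
  proof (intro add_left_mono mult_left_mono)
   show "integral {-1..1} (\<lambda>t. G t ^ 2) + integral {-1..1} (\<lambda>t. G t ^ n) <= D * measure lborel F"
    using C1(2)[OF dF e] C2(2)[OF dF e] measure_nonneg[of lborel F]
    unfolding D_def G_def distrib_right by linarith
  qed simp
  finally show ?thesis unfolding F_def V_def by (simp add: mult.assoc)
 qed
 moreover have "D > 0" using C1 C2 by (simp add: D_def)
 ultimately show ?thesis by blast
qed

text \<open>For p < 2 the dual inequality is used with the conjugate exponent q and with \<eta>
  chosen so that \<open>\<eta> powr (1 - q) * D\<close> is s / 2; the last term is then absorbed by
  the left side. The one-sided bounds for f and -f are added.\<close>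

lemma hilbert_weak_type:
 assumes p: "p > 1"
 shows "\<exists>C\<ge>0. \<forall>f E e s. dominated f E \<and> e > 0 \<and> s > 0 -->
   measure lborel {x\<in>{-1..1}. \<bar>hilbert_reg e f x\<bar> > s} <= C * s powr (- p) * measure lborel E"
proof (cases "p >= 2")
 case True
 then show ?thesis by (rule hilbert_weak_type_large)
next
 case False
 define q where "q = p / (p - 1)"
 have q: "q >= 2" "1 / (q - 1) = p - 1" using p False by (auto simp: q_def field_simps)
 obtain D where D: "D > 0" "\<And>f E e s \<eta>. dominated f E ==> e > 0 ==> s > 0 ==> \<eta> > 0 ==>
   s * measure lborel {x\<in>{-1..1}. hilbert_reg e f x > s}
   <= \<eta> * measure lborel E + \<eta> powr (1 - q) * D * measure lborel {x\<in>{-1..1}. hilbert_reg e f x > s}"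
  using hilbert_weak_type_dual[OF q(1)] by blast
 define C where "C = 2 * (2 * D) powr (p - 1)"
 have one: "measure lborel {x\<in>{-1..1}. hilbert_reg e f x > s} <= C * s powr (- p) * measure lborel E"
  if f: "dominated f E" and e: "e > 0" and s: "s > 0" for f E e s
 proof -
  define F where "F = measure lborel {x\<in>{-1..1}. hilbert_reg e f x > s}"
  define \<eta> where "\<eta> = (2 * D / s) powr (p - 1)"
  have eta: "\<eta> > 0" using D s by (simp add: \<eta>_def)
  have "\<eta> powr (1 - q) = (2 * D / s) powr ((p - 1) * (1 - q))"
   by (simp add: \<eta>_def powr_powr)
  also have "(p - 1) * (1 - q) = - 1" using p by (simp add: q_def field_simps)
  also have "(2 * D / s) powr (- 1) = s / (2 * D)" using D s by (simp add: powr_minus_divide)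
  finally have "\<eta> powr (1 - q) * D = s / 2" using D by simp
  with D(2)[OF f e s eta] have "s * F <= \<eta> * measure lborel E + s / 2 * F" by (simp add: F_def)
  then have "F <= 2 * \<eta> / s * measure lborel E" using s by (simp add: field_simps)
  also have "2 * \<eta> / s = C * s powr (- p)"
  proof -
   have "\<eta> = (2 * D) powr (p - 1) / s powr (p - 1)" using D s by (simp add: \<eta>_def powr_divide)
   moreover have "s powr (- p) = 1 / (s powr (p - 1) * s)"
    using s powr_add[of s "p - 1" 1] by (simp add: powr_minus_divide)
   ultimately show ?thesis by (simp add: C_def)
  qed
  finally show ?thesis by (simp add: F_def)
 qed
 have "measure lborel {x\<in>{-1..1}. \<bar>hilbert_reg e f x\<bar> > s} <= (2 * C) * s powr (- p) * measure lborel E"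
  if f: "dominated f E" and e: "e > 0" and s: "s > 0" for f E e s
 proof -
  define g where "g x = - f x" for x
  have g: "dominated g E" using f by (auto simp: g_def[abs_def] dominated_def)
  have Hg: "hilbert_reg e g x = - hilbert_reg e f x" for x
   unfolding hilbert_reg_def g_def by simp
  have [measurable]: "hilbert_reg e f \<in> borel_measurable borel" "hilbert_reg e g \<in> borel_measurable borel"
   by (intro borel_measurable_continuous_onI hilbert_poisson_continuous[OF _ e]; fact f g)+
  have fin: "{x\<in>{-1..1}. hilbert_reg e h x > s} \<in> fmeasurable lborel" if "hilbert_reg e h \<in> borel_measurable borel" for h
  proof (rule fmeasurableI2[of "{-1..1::real}"])
   show "{x \<in> {- 1..1}. s < hilbert_reg e h x} \<in> sets lborel" using that by measurable
  qed (auto simp: fmeasurable_def)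
  have "{x\<in>{-1..1}. \<bar>hilbert_reg e f x\<bar> > s} = {x\<in>{-1..1}. hilbert_reg e f x > s} \<union> {x\<in>{-1..1}. hilbert_reg e g x > s}"
   by (auto simp: Hg)
  then have "measure lborel {x\<in>{-1..1}. \<bar>hilbert_reg e f x\<bar> > s} \<le>
    measure lborel {x\<in>{-1..1}. hilbert_reg e f x > s} + measure lborel {x\<in>{-1..1}. hilbert_reg e g x > s}"
   using fin by (auto intro!: measure_Un_le simp: fmeasurable_def)
  then show ?thesis using one[OF f e s] one[OF g e s] by simp
 qed
 moreover have "2 * C >= 0" by (simp add: C_def)
 ultimately show ?thesis by blast
qed

section \<open>Jacobi polynomials\<close>

lemma poly_span:
 fixes P :: "nat => real poly"
 assumes "\<And>k. k < n ==> coeff (P k) k ~= 0 \<and> degree (P k) <= k" "\<And>i. i >= n ==> coeff r i = 0"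
 shows "\<exists>c. r = (\<Sum>k<n. smult (c k) (P k))"
 using assms
proof (induction n arbitrary: r)
 case 0
 then show ?case by (auto simp: poly_eq_iff)
next
 case (Suc n)
 define a where "a = coeff r n / coeff (P n) n"
 have "coeff (r - smult a (P n)) i = 0" if "i >= n" for i
 proof (cases "i = n")
  case True
  then show ?thesis using Suc.prems(1)[of n] by (simp add: a_def)
 next
  case False
  then have "i > n" using that by simp
  then show ?thesis using Suc.prems(1)[of n] Suc.prems(2)[of i] by (simp add: coeff_eq_0)
 qed
 from Suc.IH[OF Suc.prems(1) this]
 obtain c where c: "r - smult a (P n) = (\<Sum>k<n. smult (c k) (P k))" by auto
 have "r = (\<Sum>k<Suc n. smult ((c(n := a)) k) (P k))"
  using c by (simp add: algebra_simps)
 then show ?case by blast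
qed

text \<open>\<open>pearson\<close> is integration by parts: the weight times its argument is the
  derivative of (1 - x^2) f times the weight. The differential equation, the structure relation and
  the endpoint values follow from these axioms alone, and an abstract \<open>J\<close> also admits
  the functional composed with x -> -x.\<close>

locale jacobi_functional =
 fixes \<alpha> \<beta> :: real and J :: "real poly => real"
 assumes J_add: "J (f + g) = J f + J g"
  and J_smult: "J (smult c f) = c * J f"
  and J_pos: "f ~= 0 ==> J (f * f) > 0"
  and pearson: "J ([:1, 0, -1:] * pderiv f + [:\<beta> - \<alpha>, - (\<alpha> + \<beta> + 2):] * f) = 0"
begin

lemma J_0 [simp]: "J 0 = 0"
 using J_smult[of 0 0] by simp

lemma J_diff: "J (f - g) = J f - J g"
 using J_add[of f "smult (-1) g"] J_smult[of "-1" g] by simp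

lemma J_minus: "J (- f) = - J f"
 using J_diff[of 0 f] by simp

lemma J_sum: "J (\<Sum>i\<in>A. f i) = (\<Sum>i\<in>A. J (f i))"
 by (induction A rule: infinite_finite_induct) (auto simp: J_add)

text \<open>Gram-Schmidt applied to the monomial of degree n. Lower degree is expressed by vanishing
  coefficients, so that n = 0 and the zero polynomial need no separate treatment.\<close>

lemma orthogonal_poly_exists:
 "\<exists>q. degree q = n \<and> coeff q n ~= 0 \<and> J (q * q) = 1 \<and> (\<forall>r. (\<forall>i\<ge>n. coeff r i = 0) --> J (r * q) = 0)"
proof (induction n rule: less_induct)
 case (less n)
 then obtain P where P: "\<And>k. k < n ==> degree (P k) = k \<and> coeff (P k) k ~= 0 \<and> J (P k * P k) = 1 \<and>
   (\<forall>r. (\<forall>i\<ge>k. coeff r i = 0) --> J (r * P k) = 0)"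
  by metis
 have orth: "J (P j * P k) = (if j = k then 1 else 0)" if "j < n" "k < n" for j k
 proof -
  have "J (P j * P k) = 0" if "j < k" "k < n" for j k
  proof -
   have "\<forall>i\<ge>k. coeff (P j) i = 0" using that P[of j] by (auto intro!: coeff_eq_0)
   then show ?thesis using P[OF \<open>k < n\<close>] by blast
  qed
  then show ?thesis using that P by (metis mult.commute nat_neq_iff)
 qed
 define s where "s = (\<Sum>k<n. smult (J (monom 1 n * P k)) (P k))"
 define q where "q = monom 1 n - s"
 have s: "coeff s i = 0" if "i >= n" for i
  unfolding s_def coeff_sum using that P by (intro sum.neutral) (auto intro!: coeff_eq_0)
 have qn: "coeff q n = 1" using s by (simp add: q_def)
 have dq: "degree q = n"
 proof (rule antisym)
  show "degree q <= n" by (rule degree_le) (auto simp: q_def s)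
  show "n <= degree q" using qn by (intro le_degree) auto
 qed
 have qP: "J (P k * q) = 0" if "k < n" for k
 proof -
  have "J (P k * s) = (\<Sum>j<n. J (monom 1 n * P j) * J (P k * P j))"
   unfolding s_def sum_distrib_left J_sum by (intro sum.cong) (auto simp: J_smult)
  also have "... = (\<Sum>j<n. if j = k then J (monom 1 n * P k) else 0)"
   using that by (intro sum.cong) (auto simp: orth)
  also have "... = J (monom 1 n * P k)" using that by simp
  finally show ?thesis by (simp add: q_def right_diff_distrib J_diff mult.commute)
 qed
 have rq: "J (r * q) = 0" if "\<forall>i\<ge>n. coeff r i = 0" for r
 proof -
  have "\<exists>c. r = (\<Sum>k<n. smult (c k) (P k))"
   by (rule poly_span) (use P that in auto)
  then obtain c where c: "r = (\<Sum>k<n. smult (c k) (P k))" by blast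
  show ?thesis unfolding c sum_distrib_right J_sum by (intro sum.neutral) (auto simp: J_smult qP)
 qed
 have "q ~= 0" using qn by auto
 then have pos: "J (q * q) > 0" by (rule J_pos)
 define c where "c = 1 / sqrt (J (q * q))"
 have c: "c ~= 0" "c * c * J (q * q) = 1" using pos by (auto simp: c_def)
 show ?case
 proof (intro exI[of _ "smult c q"] conjI allI impI)
  show "J (r * smult c q) = 0" if "\<forall>i\<ge>n. coeff r i = 0" for r
   using rq[OF that] by (simp add: J_smult)
 qed (use c dq qn in \<open>auto simp: J_smult\<close>)
qed

lemma orthonormal_exists:
 "\<exists>p. \<forall>n. degree (p n) = n \<and> (\<forall>m. J (p m * p n) = (if m = n then 1 else 0))"
proof -
 obtain p where p: "\<And>n. degree (p n) = n \<and> coeff (p n) n ~= 0 \<and> J (p n * p n) = 1 \<and>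
   (\<forall>r. (\<forall>i\<ge>n. coeff r i = 0) --> J (r * p n) = 0)"
  using orthogonal_poly_exists by metis
 have "J (p m * p n) = 0" if "m < n" for m n
 proof -
  have "\<forall>i\<ge>n. coeff (p m) i = 0" using that p[of m] by (auto intro!: coeff_eq_0)
  then show ?thesis using p[of n] by blast
 qed
 then have "J (p m * p n) = (if m = n then 1 else 0)" for m n
  using p by (metis mult.commute nat_neq_iff)
 then show ?thesis using p by blast
qed

end

locale jacobi_polys = jacobi_functional +
 fixes p :: "nat => real poly"
 assumes degree_p: "degree (p n) = n"
  and orth: "J (p m * p n) = (if m = n then 1 else 0)"
begin

lemma p_nonzero: "p n ~= 0"
 using orth[of n n] by auto

lemma coeff_p_nonzero: "coeff (p n) n ~= 0"
 using p_nonzero[of n] degree_p[of n] by (metis leading_coeff_0_iff)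

lemma expansion:
 assumes "\<And>i. i >= n ==> coeff r i = 0"
 shows "r = (\<Sum>j<n. smult (J (r * p j)) (p j))"
proof -
 have "\<exists>c. r = (\<Sum>k<n. smult (c k) (p k))"
  by (rule poly_span) (use assms coeff_p_nonzero degree_p in auto)
 then obtain c where c: "r = (\<Sum>k<n. smult (c k) (p k))" by blast
 have "J (r * p j) = c j" if "j < n" for j
 proof -
  have "J (r * p j) = (\<Sum>k<n. c k * J (p k * p j))"
   unfolding c sum_distrib_right J_sum by (intro sum.cong) (auto simp: J_smult)
  also have "... = (\<Sum>k<n. if k = j then c j else 0)" by (intro sum.cong) (auto simp: orth)
  finally show ?thesis using that by simp
 qed
 then show ?thesis by (subst c) (auto intro!: sum.cong)
qed

lemma orth_low:
 assumes "\<And>i. i >= n ==> coeff r i = 0"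
 shows "J (r * p n) = 0"
proof -
 have "r * p n = (\<Sum>j<n. smult (J (r * p j)) (p j * p n))"
  by (subst expansion[OF assms]) (auto simp: sum_distrib_right)
 then show ?thesis by (simp add: J_sum J_smult orth)
qed

section \<open>Differential equation, structure relation and three-term recurrence\<close>

definition jacobi_op :: "real poly => real poly" where
 "jacobi_op f = [:1, 0, -1:] * pderiv (pderiv f) + [:\<beta> - \<alpha>, - (\<alpha> + \<beta> + 2):] * pderiv f"

definition eigenval :: "nat => real" where
 "eigenval n = real n * (real n + \<alpha> + \<beta> + 1)"

lemma coeff_mult_one_minus_sq: "coeff ([:1, 0, -1:] * g) i = coeff g i - (if i >= 2 then coeff g (i - 2) else 0)"
 for g :: "real poly"
 by (cases i rule: nat.exhaust; cases "i - 1" rule: nat.exhaust) (auto simp: coeff_pCons split: nat.splits)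

lemma coeff_mult_linear: "coeff ([:b, c:] * g) i = b * coeff g i + (if i >= 1 then c * coeff g (i - 1) else 0)"
 for g :: "real poly"
 by (cases i) (auto simp: coeff_pCons)

text \<open>On coefficients the operator is triangular with diagonal \<open>- eigenval i\<close>.
  Hence it does not raise degrees, and adding \<open>eigenval n\<close> times the identity lowers
  degree n.\<close>

lemma coeff_jacobi_op:
 "coeff (jacobi_op f) i = real (i + 1) * real (i + 2) * coeff f (i + 2) + (\<beta> - \<alpha>) * real (i + 1) * coeff f (i + 1)
   - eigenval i * coeff f i"
proof -
 consider "i = 0" | "i = 1" | k where "i = Suc (Suc k)" by (metis One_nat_def nat.exhaust)
 then show ?thesis
  unfolding jacobi_op_def coeff_add coeff_mult_one_minus_sq coeff_mult_linear coeff_pderiv eigenval_def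
  by cases (auto simp: algebra_simps numeral_2_eq_2)
qed

text \<open>Pearson's identity for f' g gives -J((1 - x^2) f' g'), which is symmetric in f and
  g.\<close>

lemma jacobi_op_symmetric: "J (jacobi_op f * g) = J (f * jacobi_op g)"
proof -
 have *: "J (jacobi_op f * g) = - J ([:1, 0, -1:] * (pderiv f * pderiv g))" for f g
 proof -
  have "[:1, 0, -1:] * pderiv (pderiv f * g) + [:\<beta> - \<alpha>, - (\<alpha> + \<beta> + 2):] * (pderiv f * g)
    = jacobi_op f * g + [:1, 0, -1:] * (pderiv f * pderiv g)"
   unfolding jacobi_op_def pderiv_mult by (simp only: distrib_left distrib_right mult_ac add_ac)
  then show ?thesis using pearson[of "pderiv f * g"] by (simp only: J_add)
 qed
 show ?thesis using *[of f g] *[of g f] by (simp only: mult.commute)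
qed

text \<open>The operator plus \<open>eigenval n\<close>, applied to \<open>p n\<close>, has degree
  below n because the leading terms cancel. By symmetry of the operator the result is orthogonal to
  every lower \<open>p k\<close>, so it is zero.\<close>

lemma jacobi_ode: "jacobi_op (p n) = smult (- eigenval n) (p n)"
proof -
 define r where "r = jacobi_op (p n) + smult (eigenval n) (p n)"
 have r: "coeff r i = 0" if "i >= n" for i
 proof (cases "i = n")
  case True
  then show ?thesis by (simp add: r_def coeff_jacobi_op coeff_eq_0 degree_p)
 next
  case False
  then show ?thesis using that by (simp add: r_def coeff_jacobi_op coeff_eq_0 degree_p)
 qed
 have "J (r * p k) = 0" if "k < n" for k
 proof -
  have "J (jacobi_op (p k) * p n) = 0"
   by (rule orth_low) (use that in \<open>auto simp: coeff_jacobi_op coeff_eq_0 degree_p\<close>)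
  then have "J (jacobi_op (p n) * p k) = 0" by (metis jacobi_op_symmetric mult.commute)
  then show ?thesis using that by (simp add: r_def distrib_right J_add J_smult orth)
 qed
 then have "r = 0" using expansion[of n r, OF r] by simp
 then show ?thesis by (simp add: r_def add_eq_0_iff)
qed

text \<open>When k is the degree of f, the leading terms cancel and the degree does not
  rise.\<close>

definition struct :: "real => real poly => real poly" where
 "struct k f = [:1, 0, -1:] * pderiv f + smult k ([:0, 1:] * f)"

text \<open>The off-diagonal coefficient of the three-term recurrence. It is meant for n >= 1, as n
  - 1 is truncated at 0.\<close>

definition gam :: "nat => real" where
 "gam n = J ([:0, 1:] * p (n - 1) * p n)"

lemma coeff_struct: "coeff (struct k f) i = real (i + 1) * coeff f (i + 1) + (if i >= 1 then (k - (real i - 1)) * coeff f (i - 1) else 0)"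
proof -
 consider "i = 0" | "i = 1" | k where "i = Suc (Suc k)" by (metis One_nat_def nat.exhaust)
 then show ?thesis
  unfolding struct_def coeff_add coeff_smult coeff_mult_one_minus_sq coeff_mult_linear coeff_pderiv
  by cases (auto simp: algebra_simps numeral_2_eq_2)
qed

lemma J_by_parts:
 "J ([:1, 0, -1:] * pderiv f * g) = - J (f * ([:1, 0, -1:] * pderiv g + [:\<beta> - \<alpha>, - (\<alpha> + \<beta> + 2):] * g))"
proof -
 have "[:1, 0, -1:] * pderiv (f * g) + [:\<beta> - \<alpha>, - (\<alpha> + \<beta> + 2):] * (f * g)
   = [:1, 0, -1:] * pderiv f * g + f * ([:1, 0, -1:] * pderiv g + [:\<beta> - \<alpha>, - (\<alpha> + \<beta> + 2):] * g)"
  unfolding pderiv_mult by (simp only: distrib_left distrib_right mult_ac add_ac)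
 then show ?thesis using pearson[of "f * g"] by (simp only: J_add)
qed

text \<open>The left side has degree at most n + 1 and is orthogonal to \<open>p j\<close> for j <
  n, so only two terms survive. The coefficient of \<open>p n\<close> is found by parts; b stays
  unspecified, since it cancels in the antisymmetric expression of Christoffel-Darboux.\<close>

lemma structure_relation:
 "\<exists>b. [:1, 0, -1:] * pderiv (p (Suc n)) + smult (real (Suc n)) ([:0, 1:] * p (Suc n))
   = smult b (p (Suc n)) + smult ((2 * real (Suc n) + 1 + \<alpha> + \<beta>) * gam (Suc n)) (p n)"
proof -
 define N where "N = Suc n"
 define r where "r = struct (real N) (p N)"
 have r0: "coeff r i = 0" if "i >= Suc N" for i
 proof (cases "i = Suc N")
  case True
  then show ?thesis by (simp add: r_def coeff_struct coeff_eq_0 degree_p)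
 next
  case False
  then show ?thesis using that by (simp add: r_def coeff_struct coeff_eq_0 degree_p)
 qed
 have parts: "J (r * p j) = - J (([:1, 0, -1:] * pderiv (p j) + [:\<beta> - \<alpha>, - (\<alpha> + \<beta> + 2):] * p j) * p N)
    + real N * J (([:0, 1:] * p j) * p N)" for j
 proof -
  have "r * p j = [:1, 0, -1:] * pderiv (p N) * p j + smult (real N) (([:0, 1:] * p j) * p N)"
   unfolding r_def struct_def by (simp only: distrib_right distrib_left mult_smult_left mult_smult_right mult_ac)
  then show ?thesis using J_by_parts[of "p N" "p j"] by (simp only: J_add J_smult mult.commute)
 qed
 have low: "J (r * p j) = 0" if "j < n" for j
 proof -
  have "J (([:1, 0, -1:] * pderiv (p j) + [:\<beta> - \<alpha>, - (\<alpha> + \<beta> + 2):] * p j) * p N) = 0"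
   by (rule orth_low) (use that in \<open>auto simp del: mult_pCons_left simp: N_def coeff_mult_one_minus_sq coeff_mult_linear coeff_pderiv coeff_eq_0 degree_p\<close>)
  moreover have "J (([:0, 1:] * p j) * p N) = 0"
   by (rule orth_low) (use that in \<open>auto simp del: mult_pCons_left simp: N_def coeff_mult_linear coeff_eq_0 degree_p\<close>)
  ultimately show ?thesis using parts by simp
 qed
 have top: "J (r * p n) = (2 * real N + 1 + \<alpha> + \<beta>) * gam N"
 proof -
  have "J (struct (real n) (p n) * p N) = 0"
  proof (rule orth_low)
   fix i assume "i >= N"
   then show "coeff (struct (real n) (p n)) i = 0"
    by (cases "i = N") (auto simp: N_def coeff_struct coeff_eq_0 degree_p)
  qed
  \<comment> \<open>Modulo polynomials orthogonal to \<open>p N\<close>, only a multiple of x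
    \<open>p n\<close> is left. Its factor, with the sign reversed, is \<alpha> + \<beta> + 2 + n;
    adding N = n + 1 gives 2 N + 1 + \<alpha> + \<beta>.\<close>
  moreover have "[:1, 0, -1:] * pderiv (p n) + [:\<beta> - \<alpha>, - (\<alpha> + \<beta> + 2):] * p n
   = struct (real n) (p n) + smult (\<beta> - \<alpha>) (p n) + smult (- (\<alpha> + \<beta> + 2 + real n)) ([:0, 1:] * p n)"
  proof -
   define Q where "Q = [:0, 1:] * p n"
   have "[:\<beta> - \<alpha>, - (\<alpha> + \<beta> + 2):] * p n = smult (\<beta> - \<alpha>) (p n) + smult (- (\<alpha> + \<beta> + 2)) Q"
    by (simp add: Q_def)
   then show ?thesis unfolding struct_def Q_def[symmetric] by (intro poly_eqI) (simp add: algebra_simps)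
  qed
  ultimately have "J (([:1, 0, -1:] * pderiv (p n) + [:\<beta> - \<alpha>, - (\<alpha> + \<beta> + 2):] * p n) * p N)
   = - (\<alpha> + \<beta> + 2 + real n) * gam N"
   by (simp only: distrib_right J_add mult_smult_left J_smult orth gam_def N_def)
     (simp add: mult_ac)
  then show ?thesis using parts[of n] by (simp add: gam_def N_def algebra_simps)
 qed
 have "r = (\<Sum>j<Suc (Suc n). smult (J (r * p j)) (p j))"
  by (rule expansion) (use r0 in \<open>auto simp: N_def\<close>)
 also have "... = smult (J (r * p n)) (p n) + smult (J (r * p N)) (p N)"
  using low by (simp add: N_def)
 finally have "r = smult (J (r * p N)) (p N) + smult ((2 * real N + 1 + \<alpha> + \<beta>) * gam N) (p n)"
  using top by simp
 then show ?thesis unfolding r_def struct_def N_def by blast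
qed

lemma three_term:
 "\<exists>b. [:0, 1:] * p n = smult (gam (Suc n)) (p (Suc n)) + smult b (p n) + (if n = 0 then 0 else smult (gam n) (p (n - 1)))"
proof -
 define r where "r = [:0, 1:] * p n"
 have "r = (\<Sum>j<Suc (Suc n). smult (J (r * p j)) (p j))"
  by (rule expansion) (auto simp del: mult_pCons_left simp: r_def coeff_mult_linear coeff_eq_0 degree_p)
 also have "... = (\<Sum>j<n. smult (J (r * p j)) (p j)) + smult (J (r * p n)) (p n) + smult (gam (Suc n)) (p (Suc n))"
  by (simp add: gam_def r_def)
 also have "(\<Sum>j<n. smult (J (r * p j)) (p j)) = (if n = 0 then 0 else smult (gam n) (p (n - 1)))"
 proof (cases n)
  case (Suc m)
  have "J (r * p j) = 0" if "j < m" for j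
  proof -
   have "J (([:0, 1:] * p j) * p n) = 0"
    by (rule orth_low) (use that Suc in \<open>auto simp del: mult_pCons_left simp: coeff_mult_linear coeff_eq_0 degree_p\<close>)
   then show ?thesis by (simp only: r_def mult_ac)
  qed
  moreover have "J (r * p m) = gam n" unfolding r_def gam_def Suc by (simp only: mult_ac diff_Suc_1)
  ultimately show ?thesis using Suc by simp
 qed simp
 finally have fin: "r = (if n = 0 then 0 else smult (gam n) (p (n - 1))) + smult (J (r * p n)) (p n) + smult (gam (Suc n)) (p (Suc n))" .
 show ?thesis by (rule exI[of _ "J (r * p n)"]) (use fin in \<open>simp only: r_def add_ac\<close>)
qed

section \<open>The reproducing kernel, Pollard's decomposition and the values at the endpoint
  1\<close>

definition ker :: "nat => real => real => real" where
 "ker n x y = (\<Sum>j\<le>n. poly (p j) x * poly (p j) y)"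

lemma christoffel_darboux:
 "(x - y) * ker n x y = gam (Suc n) * (poly (p (Suc n)) x * poly (p n) y - poly (p n) x * poly (p (Suc n)) y)"
proof (induction n)
 case 0
 obtain b where b: "[:0, 1:] * p 0 = smult (gam 1) (p 1) + smult b (p 0)"
  using three_term[of 0] by auto
 have "z * poly (p 0) z = gam 1 * poly (p 1) z + b * poly (p 0) z" for z
  using arg_cong[OF b, of "\<lambda>q. poly q z"] by simp
 from this[of x] this[of y] show ?case
  unfolding ker_def by simp algebra
next
 case (Suc n)
 obtain b where b: "[:0, 1:] * p (Suc n) = smult (gam (Suc (Suc n))) (p (Suc (Suc n))) + smult b (p (Suc n)) + smult (gam (Suc n)) (p n)"
  using three_term[of "Suc n"] by auto
 have "z * poly (p (Suc n)) z = gam (Suc (Suc n)) * poly (p (Suc (Suc n))) z + b * poly (p (Suc n)) z + gam (Suc n) * poly (p n) z" for z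
  using arg_cong[OF b, of "\<lambda>q. poly q z"] by simp
 from this[of x] this[of y] Suc.IH show ?case
  unfolding ker_def by (simp add: distrib_left) algebra
qed

text \<open>The structure relation, solved for the multiple of \<open>p n\<close>, is inserted into
  Christoffel-Darboux. The terms with b cancel, and the terms with x and y combine into the last
  summand, which has no singularity after division by x - y.\<close>

lemma pollard:
 "(2 * real (Suc n) + 1 + \<alpha> + \<beta>) * ((x - y) * ker n x y) =
   poly (p (Suc n)) x * ((1 - y^2) * poly (pderiv (p (Suc n))) y)
   - poly (p (Suc n)) y * ((1 - x^2) * poly (pderiv (p (Suc n))) x)
   - real (Suc n) * (x - y) * (poly (p (Suc n)) x * poly (p (Suc n)) y)"
proof -
 obtain b where b: "[:1, 0, -1:] * pderiv (p (Suc n)) + smult (real (Suc n)) ([:0, 1:] * p (Suc n))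
   = smult b (p (Suc n)) + smult ((2 * real (Suc n) + 1 + \<alpha> + \<beta>) * gam (Suc n)) (p n)"
  using structure_relation by blast
 have "(1 - z^2) * poly (pderiv (p (Suc n))) z + real (Suc n) * (z * poly (p (Suc n)) z)
   = b * poly (p (Suc n)) z + (2 * real (Suc n) + 1 + \<alpha> + \<beta>) * gam (Suc n) * poly (p n) z" for z
  using arg_cong[OF b, of "\<lambda>q. poly q z"] by (simp add: algebra_simps power2_eq_square)
 from this[of x] this[of y] christoffel_darboux[of x y n] show ?thesis
  by algebra
qed

lemma ker_sym: "ker n x y = ker n y x"
 unfolding ker_def by (simp add: mult.commute)

text \<open>At y = 1 the term with 1 - y^2 disappears and x - 1 divides the rest. The division is
  carried out for polynomials, so that x = 1 is included.\<close>

lemma ker_endpoint: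
 "(2 * real (Suc n) + 1 + \<alpha> + \<beta>) * ker n x 1 =
   poly (p (Suc n)) 1 * ((1 + x) * poly (pderiv (p (Suc n))) x - real (Suc n) * poly (p (Suc n)) x)"
proof -
 define A where "A = smult (2 * real (Suc n) + 1 + \<alpha> + \<beta>) (\<Sum>j\<le>n. smult (poly (p j) 1) (p j))"
 define B where "B = smult (poly (p (Suc n)) 1) ([:1, 1:] * pderiv (p (Suc n)) - smult (real (Suc n)) (p (Suc n)))"
 have A: "poly A x = (2 * real (Suc n) + 1 + \<alpha> + \<beta>) * ker n x 1" for x
  unfolding A_def ker_def by (simp add: poly_sum mult.commute)
 have B: "poly B x = poly (p (Suc n)) 1 * ((1 + x) * poly (pderiv (p (Suc n))) x - real (Suc n) * poly (p (Suc n)) x)" for x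
  unfolding B_def by (simp add: algebra_simps)
 have "poly ([:-1, 1:] * A) x = poly ([:-1, 1:] * B) x" for x
 proof -
  have "(x - 1) * poly A x = (x - 1) * poly B x"
   using pollard[of n x 1] unfolding A B by (simp add: power2_eq_square) algebra
  then show ?thesis by (simp add: algebra_simps)
 qed
 then have "[:-1, 1:] * A = [:-1, 1:] * B" by (simp only: poly_eq_poly_eq_iff[symmetric] fun_eq_iff) simp
 then have "A = B" by (subst (asm) mult_left_cancel) auto
 then show ?thesis using A[of x] B[of x] by simp
qed

lemma deriv_at_1: "(2 * \<alpha> + 2) * poly (pderiv (p n)) 1 = eigenval n * poly (p n) 1"
proof -
 have "poly (jacobi_op (p n)) 1 = - eigenval n * poly (p n) 1"
  unfolding jacobi_ode by simp
 then show ?thesis unfolding jacobi_op_def by (simp add: algebra_simps)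
qed

text \<open>The endpoint formula at x = 1, with the derivative eliminated through the differential
  equation, which has order one there.\<close>

lemma ker_11_square:
 assumes "\<alpha> > -1"
 shows "(\<alpha> + 1) * (2 * real (Suc n) + 1 + \<alpha> + \<beta>) * ker n 1 1 = real (Suc n) * (real (Suc n) + \<beta>) * (poly (p (Suc n)) 1)^2"
proof -
 have 1: "(2 * real (Suc n) + 1 + \<alpha> + \<beta>) * ker n 1 1 =
   poly (p (Suc n)) 1 * (2 * poly (pderiv (p (Suc n))) 1 - real (Suc n) * poly (p (Suc n)) 1)"
  using ker_endpoint[of n 1] by simp
 have 2: "2 * (\<alpha> + 1) * poly (pderiv (p (Suc n))) 1 = real (Suc n) * (real (Suc n) + \<alpha> + \<beta> + 1) * poly (p (Suc n)) 1"
  using deriv_at_1[of "Suc n"] by (simp add: eigenval_def algebra_simps)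
 show ?thesis using 1 2 by algebra
qed

text \<open>The increment of the kernel is the square of \<open>p (Suc n)\<close> at 1, itself a
  multiple of \<open>ker n 1 1\<close> by \<open>ker_11_square\<close>. The resulting first-order
  recurrence replaces the explicit normalisation of the Jacobi polynomials.\<close>

lemma ker_11_recurrence:
 assumes "\<alpha> > -1"
 shows "real (Suc n) * (real (Suc n) + \<beta>) * ker (Suc n) 1 1
   = (real (Suc n) + \<alpha> + 1) * (real (Suc n) + \<alpha> + \<beta> + 1) * ker n 1 1"
proof -
 have "ker (Suc n) 1 1 = ker n 1 1 + (poly (p (Suc n)) 1)^2"
  by (simp add: ker_def power2_eq_square)
 with ker_11_square[OF assms, of n] show ?thesis by algebra
qed

end

section \<open>Energy estimates for the Jacobi equation\<close>

lemma jacobi_energy_near_1: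
 fixes \<alpha> \<beta> :: real
 assumes ab: "\<alpha> >= -1/2" "\<beta> >= -1/2"
  and lam: "lam >= 1"
  and ode: "\<And>x. (1 - x^2) * poly (pderiv (pderiv y)) x + (\<beta> - \<alpha> - (\<alpha> + \<beta> + 2) * x) * poly (pderiv y) x = - lam * poly y x"
  and x: "x \<in> {0..1}"
 shows "lam * (poly y x)^2 + (1 - x^2) * (poly (pderiv y) x)^2 <= exp (2 * \<beta> + 1) * (lam * (poly y 1)^2)"
proof -
 define y0 y1 y2 where "y0 = poly y" and "y1 = poly (pderiv y)" and "y2 = poly (pderiv (pderiv y))"
 define En where "En x = lam * (y0 x)^2 + (1 - x^2) * (y1 x)^2" for x
 define F where "F x = En x * exp ((2 * \<beta> + 1) * x)" for x
 have d0: "(y0 has_real_derivative y1 x) (at x)" "(y1 has_real_derivative y2 x) (at x)" for x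
  unfolding y0_def y1_def y2_def by (rule poly_DERIV)+
 have ode': "(1 - x^2) * y2 x = ((\<alpha> - \<beta> + (\<alpha> + \<beta> + 1) * x) + x) * y1 x - lam * y0 x" for x
  using ode[of x] unfolding y0_def y1_def y2_def by algebra
 have En': "(En has_real_derivative 2 * (\<alpha> - \<beta> + (\<alpha> + \<beta> + 1) * x) * (y1 x)^2) (at x)" for x
 proof -
  have "(En has_real_derivative lam * (2 * y0 x * y1 x) + (- 2 * x * (y1 x)^2 + (1 - x^2) * (2 * y1 x * y2 x))) (at x)"
   unfolding En_def by (auto intro!: derivative_eq_intros d0)
  moreover have "lam * (2 * y0 x * y1 x) + (- 2 * x * (y1 x)^2 + (1 - x^2) * (2 * y1 x * y2 x))
   = 2 * (\<alpha> - \<beta> + (\<alpha> + \<beta> + 1) * x) * (y1 x)^2"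
   using ode'[of x] by algebra
  ultimately show ?thesis by simp
 qed
 have F': "(F has_real_derivative (2 * (\<alpha> - \<beta> + (\<alpha> + \<beta> + 1) * x) * (y1 x)^2 + (2 * \<beta> + 1) * En x) * exp ((2 * \<beta> + 1) * x)) (at x)" for x
  unfolding F_def by (auto intro!: derivative_eq_intros En' simp: algebra_simps)
 \<comment> \<open>The derivative of the energy is (2 \<alpha> + 1)(1 + t) - (2 \<beta> + 1)(1 - t)
   times y'^2. The first part is nonnegative, and for t >= 0 the second is at most 2 \<beta> + 1
   times the energy, which the exponential factor of F compensates.\<close>
 have nonneg: "0 <= 2 * (\<alpha> - \<beta> + (\<alpha> + \<beta> + 1) * t) * (y1 t)^2 + (2 * \<beta> + 1) * En t" if t: "0 <= t" "t <= 1" for t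
 proof -
  have "2 * (\<alpha> - \<beta> + (\<alpha> + \<beta> + 1) * t) = (2 * \<alpha> + 1) * (1 + t) - (2 * \<beta> + 1) * (1 - t)" by (simp add: algebra_simps)
  moreover have "(2 * \<alpha> + 1) * (1 + t) * (y1 t)^2 >= 0" using ab t by (intro mult_nonneg_nonneg) auto
  moreover have "(2 * \<beta> + 1) * ((1 - t) * (y1 t)^2) <= (2 * \<beta> + 1) * En t"
  proof (intro mult_left_mono)
   have "(1 - t) * (y1 t)^2 <= (1 - t^2) * (y1 t)^2"
    using t by (intro mult_right_mono) (auto simp: power2_eq_square mult_left_le_one_le)
   then show "(1 - t) * (y1 t)^2 <= En t" using lam by (simp add: En_def add_increasing)
  qed (use ab in auto)
  ultimately show ?thesis by (simp add: algebra_simps)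
 qed
 have "F x <= F 1"
 proof (rule DERIV_nonneg_imp_nondecreasing[where f = F and a = x and b = 1])
  fix t assume "x <= t" "t <= 1"
  then have "0 <= (2 * (\<alpha> - \<beta> + (\<alpha> + \<beta> + 1) * t) * (y1 t)^2 + (2 * \<beta> + 1) * En t) * exp ((2 * \<beta> + 1) * t)"
   using nonneg[of t] x by (intro mult_nonneg_nonneg) auto
  with F'[of t] show "\<exists>D. (F has_real_derivative D) (at t) \<and> 0 <= D" by blast
 qed (use x in auto)
 moreover have "F 1 = exp (2 * \<beta> + 1) * (lam * (poly y 1)^2)" by (simp add: F_def En_def y0_def)
 moreover have "En x * 1 <= F x"
  unfolding F_def using x ab lam
  by (intro mult_left_mono) (auto simp: En_def power_le_one intro!: add_nonneg_nonneg mult_nonneg_nonneg)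
 ultimately show ?thesis by (simp add: En_def y0_def y1_def)
qed

text \<open>With the energy T = lam y^2 + (1 - x^2) y'^2, the weight g = (1 - x)^(alpha + 1/2) (1 + x)^(beta + 1/2) and
 D = alpha - beta + (alpha + beta + 1) x, the corrected energy Z = T - D y y' satisfies
 (g Z)' = - g y y' (D' + x D / (1 - x^2)), so g Z changes by a bounded factor only up to distance 1 / lam of 1.\<close>

lemma jacobi_energy_monotone:
 fixes \<alpha> \<beta> :: real
 assumes d: "d = \<bar>\<alpha> - \<beta>\<bar> + \<bar>\<alpha> + \<beta> + 1\<bar> + 1"
  and lam: "lam >= 1"
  and ode: "\<And>x. (1 - x^2) * poly (pderiv (pderiv y)) x + (\<beta> - \<alpha> - (\<alpha> + \<beta> + 2) * x) * poly (pderiv y) x = - lam * poly y x"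
  and x: "0 <= x" "x <= x1" and x1: "x1 = 1 - d^2 / lam"
 shows "(1 - x) powr (\<alpha> + 1/2) * (1 + x) powr (\<beta> + 1/2) * (lam * (poly y x)^2 + (1 - x^2) * (poly (pderiv y) x)^2)
   <= 4 * exp 4 * ((1 - x1) powr (\<alpha> + 1/2) * (1 + x1) powr (\<beta> + 1/2) *
     (lam * (poly y x1)^2 + (1 - x1^2) * (poly (pderiv y) x1)^2))"
proof -
 let ?h = "\<alpha> + 1/2"
 define y0 y1 y2 where "y0 = poly y" and "y1 = poly (pderiv y)" and "y2 = poly (pderiv (pderiv y))"
 define En where "En x = lam * (y0 x)^2 + (1 - x^2) * (y1 x)^2" for x
 define D where "D x = \<alpha> - \<beta> + (\<alpha> + \<beta> + 1) * x" for x
 define Z where "Z x = En x - D x * (y0 x * y1 x)" for x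
 define g where "g x = (1 - x) powr ?h * (1 + x) powr (\<beta> + 1/2)" for x
 define l where "l = sqrt lam"
 \<comment> \<open>The derivative of \<Theta>, which is 2 d / (l (1 - t)^(3/2)), dominates the
   relative rate of change of g Z, so g Z exp(\<Theta>) increases. At \<open>x1\<close> the value of
   \<Theta> is at most 4, whence the factor exp 4.\<close>
 define \<Theta> where "\<Theta> x = 4 * d / (l * sqrt (1 - x))" for x
 define W where "W x = g x * Z x * exp (\<Theta> x)" for x
 have d1: "d >= 1" using d by simp
 have l: "l >= 1" "l^2 = lam" using lam by (auto simp: l_def)
 have x1_lt: "x1 < 1" using x1 d1 lam by simp
 have d0: "(y0 has_real_derivative y1 x) (at x)" "(y1 has_real_derivative y2 x) (at x)" for x
  unfolding y0_def y1_def y2_def by (rule poly_DERIV)+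
 have ode': "(1 - x^2) * y2 x = (D x + x) * y1 x - lam * y0 x" for x
  using ode[of x] unfolding y0_def y1_def y2_def D_def by algebra
 have Dd: "\<bar>D t\<bar> <= d" if "0 <= t" "t <= 1" for t
 proof -
  have "\<bar>(\<alpha> + \<beta> + 1) * t\<bar> <= \<bar>\<alpha> + \<beta> + 1\<bar>" using that by (simp add: abs_mult mult_left_le)
  then show ?thesis unfolding D_def d by linarith
 qed
 have Enn: "En t >= 0" if "0 <= t" "t <= 1" for t
  using that lam by (auto simp: En_def power_le_one intro!: add_nonneg_nonneg mult_nonneg_nonneg)
 have yy: "2 * (l * sqrt (1 - t)) * \<bar>y0 t * y1 t\<bar> <= En t" if t: "0 <= t" "t <= 1" for t
 proof -
  define r where "r = sqrt (1 - t)"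
  have r: "r^2 = 1 - t" using t by (simp add: r_def)
  have "0 <= (l * \<bar>y0 t\<bar> - r * \<bar>y1 t\<bar>)^2" by simp
  then have "2 * (l * r) * (\<bar>y0 t\<bar> * \<bar>y1 t\<bar>) <= l^2 * (y0 t)^2 + r^2 * (y1 t)^2"
   by (simp add: power2_diff power_mult_distrib algebra_simps)
  also have "r^2 * (y1 t)^2 <= (1 - t^2) * (y1 t)^2"
   using t unfolding r by (intro mult_right_mono) (auto simp: power2_eq_square mult_left_le_one_le)
  finally show ?thesis by (simp add: En_def l abs_mult r_def)
 qed
 have rd: "l * sqrt (1 - t) >= d" if "0 <= t" "t <= x1" for t
 proof -
  have "d^2 / lam <= 1 - t" using that x1 by simp
  then have "d^2 <= lam * (1 - t)" using lam by (simp add: field_simps)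
  then have "sqrt (d^2) <= sqrt (lam * (1 - t))" by (rule real_sqrt_le_mono)
  then show ?thesis using d1 by (simp add: l_def real_sqrt_mult)
 qed
 \<comment> \<open>The reason for the value of \<open>x1\<close>: up to there l sqrt(1 - t) is at
   least d, so the correction D y y' is at most half of the energy, and the energy and Z agree up to
   a factor 2.\<close>
 have DZ: "\<bar>D t * (y0 t * y1 t)\<bar> <= En t / 2" if t: "0 <= t" "t <= x1" for t
 proof -
  have t1: "t <= 1" using t x1_lt by simp
  have "\<bar>D t * (y0 t * y1 t)\<bar> <= (l * sqrt (1 - t)) * \<bar>y0 t * y1 t\<bar>"
   unfolding abs_mult[of "D t"] using Dd[OF t(1) t1] rd[OF t] by (intro mult_right_mono) auto
  then show ?thesis using yy[OF t(1) t1] by simp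
 qed
 have EZ: "En t <= 2 * Z t" "Z t <= 2 * En t" if t: "0 <= t" "t <= x1" for t
  using DZ[OF t] Enn[of t] t x1_lt by (auto simp: Z_def)
 have g': "(g has_real_derivative - (g t * D t / (1 - t^2))) (at t)" if t: "0 <= t" "t < 1" for t
 proof -
  have "(g has_real_derivative ?h * (1 - t) powr (\<alpha> + 1/2 - 1) * (-1) * (1 + t) powr (\<beta> + 1/2)
    + (1 - t) powr ?h * ((\<beta> + 1/2) * (1 + t) powr (\<beta> + 1/2 - 1))) (at t)"
   unfolding g_def using t by (auto intro!: derivative_eq_intros)
  moreover have "(1 - t) powr (\<alpha> + 1/2 - 1) = (1 - t) powr ?h / (1 - t)"
   "(1 + t) powr (\<beta> + 1/2 - 1) = (1 + t) powr (\<beta> + 1/2) / (1 + t)"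
   using t powr_diff[of "1 - t" "\<alpha> + 1/2" 1] powr_diff[of "1 + t" "\<beta> + 1/2" 1] by simp_all
  moreover have "?h * (A / (1 - t)) * (-1) * B + A * ((\<beta> + 1/2) * (B / (1 + t))) = - (A * B * D t / (1 - t^2))" for A B
  proof -
   define i where "i = 1 / (1 - t)"
   define j where "j = 1 / (1 + t)"
   have ij: "i * (1 - t) = 1" "j * (1 + t) = 1" using t by (auto simp: i_def j_def)
   have "1 - t^2 = (1 - t) * (1 + t)" by (simp add: power2_eq_square algebra_simps)
   then have div: "a / (1 - t) = a * i" "a / (1 + t) = a * j" "a / (1 - t^2) = a * (i * j)" for a
    by (simp_all add: i_def j_def)
   have "?h * (A * i) * (-1) * B + A * ((\<beta> + 1/2) * (B * j)) = - (A * B * (\<alpha> - \<beta> + (\<alpha> + \<beta> + 1) * t) * (i * j))"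
    using ij by algebra
   then show ?thesis unfolding div D_def .
  qed
  ultimately show ?thesis by (simp add: g_def)
 qed
 have Z': "(Z has_real_derivative 2 * D t * (y1 t)^2 - ((\<alpha> + \<beta> + 1) * (y0 t * y1 t) + D t * (y1 t * y1 t + y0 t * y2 t))) (at t)" for t
 proof -
  have "(Z has_real_derivative (lam * (2 * y0 t * y1 t) + (- 2 * t * (y1 t)^2 + (1 - t^2) * (2 * y1 t * y2 t)))
   - ((\<alpha> + \<beta> + 1) * (y0 t * y1 t) + D t * (y1 t * y1 t + y0 t * y2 t))) (at t)"
   unfolding Z_def En_def D_def by (auto intro!: derivative_eq_intros d0)
  moreover have "lam * (2 * y0 t * y1 t) + (- 2 * t * (y1 t)^2 + (1 - t^2) * (2 * y1 t * y2 t))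
   = 2 * D t * (y1 t)^2"
   using ode'[of t] by algebra
  ultimately show ?thesis by simp
 qed
 have gZ': "((\<lambda>t. g t * Z t) has_real_derivative - (g t * (y0 t * y1 t) * ((\<alpha> + \<beta> + 1) + t * D t / (1 - t^2)))) (at t)"
  if t: "0 <= t" "t < 1" for t
 proof -
  have "((\<lambda>t. g t * Z t) has_real_derivative - (g t * D t / (1 - t^2)) * Z t +
    g t * (2 * D t * (y1 t)^2 - ((\<alpha> + \<beta> + 1) * (y0 t * y1 t) + D t * (y1 t * y1 t + y0 t * y2 t)))) (at t)"
   using DERIV_mult[OF g'[OF t] Z'[of t]] by (simp add: mult.commute add.commute)
  moreover have "- (g t * D t / (1 - t^2)) * Z t +
    g t * (2 * D t * (y1 t)^2 - ((\<alpha> + \<beta> + 1) * (y0 t * y1 t) + D t * (y1 t * y1 t + y0 t * y2 t)))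
    = - (g t * (y0 t * y1 t) * ((\<alpha> + \<beta> + 1) + t * D t / (1 - t^2)))"
  proof -
   have "t * t < 1" using t by (metis less_eq_real_def mult_left_le_one_le mult_less_cancel_right2 mult_zero_left order_le_less_trans)
   then have s: "1 - t^2 ~= 0" by (simp add: power2_eq_square)
   define i where "i = 1 / (1 - t^2)"
   have i: "i * (1 - t^2) = 1" using s by (simp add: i_def)
   have div: "a / (1 - t^2) = a * i" for a by (simp add: i_def)
   show ?thesis using ode'[of t] i unfolding div Z_def En_def by algebra
  qed
  ultimately show ?thesis by simp
 qed
 have Th': "(\<Theta> has_real_derivative 2 * d / (l * (1 - t) * sqrt (1 - t))) (at t)" if t: "t < 1" for t
 proof -
  have s: "sqrt (1 - t) > 0" "sqrt (1 - t) * sqrt (1 - t) = 1 - t" using t by auto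
  have "((\<lambda>x. sqrt (1 - x)) has_real_derivative - (1 / (2 * sqrt (1 - t)))) (at t)"
   using t by (auto intro!: derivative_eq_intros simp: field_simps)
  then have "((\<lambda>x. l * sqrt (1 - x)) has_real_derivative l * - (1 / (2 * sqrt (1 - t)))) (at t)"
   by (rule DERIV_cmult)
  then have "(\<Theta> has_real_derivative (0 * (l * sqrt (1 - t)) - 4 * d * (l * - (1 / (2 * sqrt (1 - t))))) / ((l * sqrt (1 - t)) * (l * sqrt (1 - t)))) (at t)"
   unfolding \<Theta>_def using s l by (intro DERIV_divide DERIV_const) auto
  moreover have "(0 * (l * sqrt (1 - t)) - 4 * d * (l * - (1 / (2 * sqrt (1 - t))))) / ((l * sqrt (1 - t)) * (l * sqrt (1 - t)))
   = 2 * d / (l * (sqrt (1 - t) * sqrt (1 - t)) * sqrt (1 - t))"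
   using s(1) l by (simp add: field_simps)
  ultimately show ?thesis by (simp only: s(2))
 qed
 have W': "\<exists>D'. (W has_real_derivative D') (at t) \<and> 0 <= D'" if t: "0 <= t" "t <= x1" for t
 proof -
  have t1: "t < 1" using t x1_lt by simp
  define T' where "T' = 2 * d / (l * (1 - t) * sqrt (1 - t))"
  define R where "R = (\<alpha> + \<beta> + 1) + t * D t / (1 - t^2)"
  have "(W has_real_derivative - (g t * (y0 t * y1 t) * R) * exp (\<Theta> t) + exp (\<Theta> t) * T' * (g t * Z t)) (at t)"
   unfolding W_def R_def T'_def
   by (rule DERIV_mult[OF gZ'[OF t(1) t1] DERIV_fun_exp[OF Th'[OF t1]]])
  moreover have "- (g t * (y0 t * y1 t) * R) * exp (\<Theta> t) + exp (\<Theta> t) * T' * (g t * Z t)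
    = exp (\<Theta> t) * g t * (T' * Z t - (y0 t * y1 t) * R)" by (simp add: algebra_simps)
  moreover have "0 <= exp (\<Theta> t) * g t * (T' * Z t - (y0 t * y1 t) * R)"
  proof (intro mult_nonneg_nonneg)
   have Rb: "\<bar>R\<bar> <= 2 * d / (1 - t)"
   proof -
    have "\<bar>t * D t / (1 - t^2)\<bar> = t * \<bar>D t\<bar> / (1 - t^2)"
     using t t1 by (simp add: abs_mult abs_square_le_1 power_le_one)
    also have "... <= 1 * d / (1 - t)"
    proof (rule frac_le)
     show "t * \<bar>D t\<bar> <= 1 * d" using Dd[of t] t t1 by (intro mult_mono) auto
     show "1 - t <= 1 - t^2" using t t1 by (simp add: power2_eq_square mult_left_le_one_le)
    qed (use t1 d1 in auto)
    finally have "\<bar>t * D t / (1 - t^2)\<bar> <= d / (1 - t)" by simp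
    moreover have "\<bar>\<alpha> + \<beta> + 1\<bar> <= d / (1 - t)"
    proof -
     have "\<bar>\<alpha> + \<beta> + 1\<bar> <= d" using d by simp
     also have "d <= d / (1 - t)" using d1 t t1 by (simp add: field_simps)
     finally show ?thesis .
    qed
    moreover have "2 * d / (1 - t) = d / (1 - t) + d / (1 - t)" by simp
    moreover have "\<bar>R\<bar> <= \<bar>\<alpha> + \<beta> + 1\<bar> + \<bar>t * D t / (1 - t^2)\<bar>"
     unfolding R_def by (rule abs_triangle_ineq)
    ultimately show ?thesis by linarith
   qed
   have s: "sqrt (1 - t) > 0" using t1 by simp
   have "(y0 t * y1 t) * R <= \<bar>y0 t * y1 t\<bar> * \<bar>R\<bar>" by (metis abs_ge_self abs_mult)
   also have "... <= \<bar>y0 t * y1 t\<bar> * (2 * d / (1 - t))" by (intro mult_left_mono Rb) auto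
   also have "... = (2 * (l * sqrt (1 - t)) * \<bar>y0 t * y1 t\<bar>) * (d / (l * (1 - t) * sqrt (1 - t)))"
    using s l t1 by (simp add: field_simps)
   also have "... <= (2 * Z t) * (d / (l * (1 - t) * sqrt (1 - t)))"
    using yy[of t] EZ(1)[OF t] t t1 d1 l by (intro mult_right_mono) auto
   also have "... = T' * Z t" by (simp add: T'_def)
   finally show "0 <= T' * Z t - (y0 t * y1 t) * R" by simp
  qed (auto simp: g_def)
  ultimately show ?thesis by metis
 qed
 have "W x <= W x1"
  by (rule DERIV_nonneg_imp_nondecreasing) (use x W' in auto)
 moreover have "g x * Z x <= W x"
 proof -
  have "g x * Z x * 1 <= g x * Z x * exp (\<Theta> x)"
  proof (rule mult_left_mono)
   show "0 <= g x * Z x" using EZ[OF x] Enn[of x] x x1_lt by (auto simp: g_def intro!: mult_nonneg_nonneg)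
   show "1 <= exp (\<Theta> x)" using d1 l x x1_lt by (simp add: \<Theta>_def)
  qed
  then show ?thesis by (simp add: W_def)
 qed
 moreover have "g x * En x <= 2 * (g x * Z x)"
  using mult_left_mono[OF EZ(1)[OF x], of "g x"] by (simp add: g_def mult_ac)
 moreover have "W x1 <= g x1 * (2 * En x1) * exp 4"
 proof -
  have "\<Theta> x1 <= 4" using rd[of x1] x d1 l x1_lt by (auto simp: \<Theta>_def divide_simps)
  then show ?thesis unfolding W_def
   using EZ[of x1] x Enn[of x1] x1_lt by (intro mult_mono mult_left_mono) (auto simp: g_def intro!: mult_nonneg_nonneg)
 qed
 ultimately have "g x * En x <= 4 * exp 4 * (g x1 * En x1)" by (simp add: mult_ac)
 then show ?thesis by (simp add: g_def En_def y0_def y1_def)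
qed

text \<open>Within distance d^2 / lam of 1 the unweighted estimate suffices, because (1 -
  x)^(\<alpha> + 1/2) is at most a multiple of lam^(- (\<alpha> + 1/2)) there. Farther away the
  weighted energy is compared with its value at exactly that distance.\<close>

lemma jacobi_energy_bound:
 fixes \<alpha> \<beta> :: real
 assumes ab: "\<alpha> >= -1/2" "\<beta> >= -1/2"
 shows "\<exists>C>0. \<forall>y lam. lam >= 1 \<and>
   (\<forall>x. (1 - x^2) * poly (pderiv (pderiv y)) x + (\<beta> - \<alpha> - (\<alpha> + \<beta> + 2) * x) * poly (pderiv y) x = - lam * poly y x) -->
   (\<forall>x\<in>{0..1}. (1 - x) powr (\<alpha> + 1/2) * (lam * (poly y x)^2 + (1 - x^2) * (poly (pderiv y) x)^2)
     <= C * (lam powr (- (\<alpha> + 1/2)) * (lam * (poly y 1)^2)))"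
proof -
 let ?h = "\<alpha> + 1/2"
 define d where "d = \<bar>\<alpha> - \<beta>\<bar> + \<bar>\<alpha> + \<beta> + 1\<bar> + 1"
 define c where "c = (d^2) powr ?h * exp (2 * \<beta> + 1)"
 define C where "C = c + 4 * exp 4 * 2 powr (\<beta> + 1/2) * c"
 have d1: "d >= 1" by (simp add: d_def)
 have c: "c > 0" using d1 by (simp add: c_def)
 have "(1 - x) powr ?h * (lam * (poly y x)^2 + (1 - x^2) * (poly (pderiv y) x)^2)
     <= C * (lam powr (- ?h) * (lam * (poly y 1)^2))"
  if lam: "lam >= 1" and ode: "\<And>x. (1 - x^2) * poly (pderiv (pderiv y)) x + (\<beta> - \<alpha> - (\<alpha> + \<beta> + 2) * x) * poly (pderiv y) x = - lam * poly y x"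
   and x: "x \<in> {0..1}" for y lam x
 proof -
  define En where "En x = lam * (poly y x)^2 + (1 - x^2) * (poly (pderiv y) x)^2" for x
  define R where "R = lam powr (- ?h) * (lam * (poly y 1)^2)"
  have R: "R >= 0" using lam by (simp add: R_def)
  have En1: "En t <= exp (2 * \<beta> + 1) * (lam * (poly y 1)^2)" if "t \<in> {0..1}" for t
   unfolding En_def by (rule jacobi_energy_near_1[OF ab lam ode that])
  have Enn: "En t >= 0" if "t \<in> {0..1}" for t
   using that lam by (auto simp: En_def power_le_one intro!: add_nonneg_nonneg mult_nonneg_nonneg)
  have close: "(1 - t) powr ?h * En t <= c * R" if t: "t \<in> {0..1}" "1 - t <= d^2 / lam" for t
  proof -
   have "(1 - t) powr ?h <= (d^2 / lam) powr ?h"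
    using t ab by (intro powr_mono2) auto
   also have "... = (d^2) powr ?h * lam powr (- ?h)"
    using lam powr_minus_divide[of lam "\<alpha> + 1/2"] by (simp add: powr_divide)
   finally have "(1 - t) powr ?h * En t
     <= ((d^2) powr ?h * lam powr (- ?h)) * (exp (2 * \<beta> + 1) * (lam * (poly y 1)^2))"
    using En1[OF t(1)] Enn[OF t(1)] by (intro mult_mono) auto
   then show ?thesis by (simp add: c_def R_def mult_ac)
  qed
  have "(1 - x) powr ?h * En x <= C * R"
  proof (cases "1 - x <= d^2 / lam")
   case True
   have "c * R <= C * R" using R c by (intro mult_right_mono) (auto simp: C_def)
   then show ?thesis using close[OF x True] by linarith
  next
   case False
   define x1 where "x1 = 1 - d^2 / lam"
   have xx1: "x <= x1" using False by (simp add: x1_def)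
   have "x1 <= 1" using lam by (simp add: x1_def)
   then have x1: "x1 \<in> {0..1}" using xx1 x by simp
   have "(1 - x) powr ?h * 1 * En x <= (1 - x) powr ?h * (1 + x) powr (\<beta> + 1/2) * En x"
    using x ab Enn[OF x] by (intro mult_right_mono mult_left_mono ge_one_powr_ge_zero) auto
   also have "... <= 4 * exp 4 * ((1 - x1) powr ?h * (1 + x1) powr (\<beta> + 1/2) * En x1)"
    unfolding En_def by (rule jacobi_energy_monotone[OF d_def lam ode _ xx1 x1_def]) (use x in auto)
   also have "... <= 4 * exp 4 * (2 powr (\<beta> + 1/2) * (c * R))"
   proof -
    have "(1 - x1) powr ?h * (1 + x1) powr (\<beta> + 1/2) * En x1 = (1 + x1) powr (\<beta> + 1/2) * ((1 - x1) powr ?h * En x1)"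
     by (simp add: mult_ac)
    also have "... <= 2 powr (\<beta> + 1/2) * (c * R)"
    proof (rule mult_mono)
     show "(1 + x1) powr (\<beta> + 1/2) <= 2 powr (\<beta> + 1/2)" using x1 ab by (intro powr_mono2) auto
     show "(1 - x1) powr ?h * En x1 <= c * R" by (rule close[OF x1]) (simp add: x1_def)
     show "0 <= (1 - x1) powr ?h * En x1" using Enn[OF x1] by simp
    qed simp
    finally show ?thesis by simp
   qed
   also have "... <= C * R" using c R by (simp add: C_def algebra_simps)
   finally show ?thesis by simp
  qed
  then show ?thesis by (simp add: En_def R_def)
 qed
 moreover have "C > 0" using c by (simp add: C_def add_pos_pos)
 ultimately show ?thesis by blast
qed

section \<open>The measures\<close>

definition jacobi_measure :: "real => real => real measure" where
 "jacobi_measure \<alpha> \<beta> = density lborel (\<lambda>x. ennreal (jacobi_weight \<alpha> \<beta> x))"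

lemma jacobi_weight_nonneg: "jacobi_weight \<alpha> \<beta> x >= 0"
 by (simp add: jacobi_weight_def)

lemma jacobi_weight_measurable [measurable]: "jacobi_weight \<alpha> \<beta> \<in> borel_measurable borel"
 unfolding jacobi_weight_def[abs_def] by measurable

lemma sets_jacobi_measure [simp, measurable_cong]: "sets (jacobi_measure \<alpha> \<beta>) = sets borel"
 by (simp add: jacobi_measure_def)

lemma space_jacobi_measure [simp]: "space (jacobi_measure \<alpha> \<beta>) = UNIV"
 by (simp add: jacobi_measure_def)

lemma emeasure_jacobi_measure:
 "E \<in> sets borel ==> emeasure (jacobi_measure \<alpha> \<beta>) E = (\<integral>\<^sup>+ x. ennreal (indicator E x * jacobi_weight \<alpha> \<beta> x) \<partial>lborel)"
 unfolding jacobi_measure_def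
 by (subst emeasure_density) (auto intro!: nn_integral_cong simp: indicator_def)

lemma nn_integral_jacobi_measure:
 assumes [measurable]: "f \<in> borel_measurable borel"
 shows "(\<integral>\<^sup>+x. f x \<partial>jacobi_measure \<alpha> \<beta>) = (\<integral>\<^sup>+x. ennreal (jacobi_weight \<alpha> \<beta> x) * f x \<partial>lborel)"
 unfolding jacobi_measure_def by (subst nn_integral_density) auto

lemma sum_Int_eq_indicator:
 "finite A ==> (\<Sum>a\<in>A \<inter> E. f a) = (\<Sum>a\<in>A. f a * indicator E a)" for f :: "'a => ennreal"
 by (simp add: sum.inter_restrict indicator_def if_distrib cong: if_cong)

context
 fixes \<alpha> \<beta> :: real and A :: "real set" and M :: "real => real"
 assumes A: "finite A"
begin

lemma sets_nu [simp, measurable_cong]: "sets (nu_measure \<alpha> \<beta> A M) = sets borel"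
 unfolding nu_measure_def using sets.sigma_sets_eq[of borel] by (simp add: sets_measure_of)

lemma space_nu [simp]: "space (nu_measure \<alpha> \<beta> A M) = UNIV"
 unfolding nu_measure_def by (simp add: space_measure_of)

text \<open>Countable additivity must be proved here: \<open>measure_of\<close> assigns 0 to every
  set when the given function is not a measure.\<close>

lemma emeasure_nu:
 assumes E: "E \<in> sets borel"
 shows "emeasure (nu_measure \<alpha> \<beta> A M) E = emeasure (jacobi_measure \<alpha> \<beta>) E + (\<Sum>a\<in>A. ennreal (M a) * indicator E a)"
proof -
 define m where "m E = (\<integral>\<^sup>+ x. ennreal (indicator E x * jacobi_weight \<alpha> \<beta> x) \<partial>lborel) + (\<Sum>a\<in>A \<inter> E. ennreal (M a))" for E
 have m: "m E = emeasure (jacobi_measure \<alpha> \<beta>) E + (\<Sum>a\<in>A. ennreal (M a) * indicator E a)" if "E \<in> sets borel" for E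
  unfolding m_def by (simp only: emeasure_jacobi_measure[OF that] sum_Int_eq_indicator[OF A])
 have "emeasure (nu_measure \<alpha> \<beta> A M) E = m E"
 proof (rule emeasure_measure_of[where \<Omega> = UNIV and A = "sets borel"])
  show "nu_measure \<alpha> \<beta> A M = measure_of UNIV (sets borel) m"
   unfolding nu_measure_def m_def ..
  show "positive (sets (nu_measure \<alpha> \<beta> A M)) m"
   by (simp add: positive_def m)
  show "countably_additive (sets (nu_measure \<alpha> \<beta> A M)) m"
  proof (rule countably_additiveI)
   fix B :: "nat => real set"
   assume B: "range B \<subseteq> sets (nu_measure \<alpha> \<beta> A M)" "disjoint_family B" "(\<Union>i. B i) \<in> sets (nu_measure \<alpha> \<beta> A M)"
   then have Bs: "B i \<in> sets borel" for i by auto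
   have "(\<Sum>i. m (B i)) = (\<Sum>i. emeasure (jacobi_measure \<alpha> \<beta>) (B i)) + (\<Sum>i. \<Sum>a\<in>A. ennreal (M a) * indicator (B i) a)"
    using Bs by (simp add: m suminf_add)
   also have "(\<Sum>i. emeasure (jacobi_measure \<alpha> \<beta>) (B i)) = emeasure (jacobi_measure \<alpha> \<beta>) (\<Union>i. B i)"
    by (rule suminf_emeasure) (use B Bs in auto)
   also have "(\<Sum>i. \<Sum>a\<in>A. ennreal (M a) * indicator (B i) a) = (\<Sum>a\<in>A. \<Sum>i. ennreal (M a) * indicator (B i) a)"
    by (rule suminf_sum) auto
   also have "... = (\<Sum>a\<in>A. ennreal (M a) * indicator (\<Union>i. B i) a)"
    using suminf_indicator[OF B(2)] by (simp add: ennreal_suminf_cmult)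
   also have "emeasure (jacobi_measure \<alpha> \<beta>) (\<Union>i. B i) + ... = m (\<Union>i. B i)"
    using B by (intro m[symmetric]) auto
   finally show "(\<Sum>i. m (B i)) = m (\<Union>i. B i)" .
  qed
  show "E \<in> sets (nu_measure \<alpha> \<beta> A M)" using E by simp
 qed (auto intro: sets.space_closed)
 then show ?thesis using m[OF E] by simp
qed

lemma nn_integral_nu:
 assumes "f \<in> borel_measurable borel"
 shows "(\<integral>\<^sup>+x. f x \<partial>nu_measure \<alpha> \<beta> A M) = (\<integral>\<^sup>+x. f x \<partial>jacobi_measure \<alpha> \<beta>) + (\<Sum>a\<in>A. ennreal (M a) * f a)"
 using assms
proof (induction rule: borel_measurable_induct)
 case (cong f g)
 then have "f = g" by auto
 with cong show ?case by simp
next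
 case (set B)
 then show ?case by (simp add: emeasure_nu)
next
 case (mult u v)
 then show ?case by (simp add: nn_integral_cmult distrib_left sum_distrib_left mult.left_commute)
next
 case (add u v)
 then show ?case by (simp add: nn_integral_add distrib_left sum.distrib add_ac)
next
 case (seq U)
 have [measurable]: "U i \<in> borel_measurable borel" for i by fact
 have inc: "incseq U" by fact
 have fx: "(SUP i. U i) x = (SUP i. U i x)" for x by (simp add: image_comp)
 have incx: "incseq (\<lambda>i. U i x)" for x using inc by (auto simp: incseq_def le_fun_def)
 have "(\<integral>\<^sup>+x. (SUP i. U i) x \<partial>nu_measure \<alpha> \<beta> A M) = (SUP i. \<integral>\<^sup>+x. U i x \<partial>nu_measure \<alpha> \<beta> A M)"
  unfolding fx by (rule nn_integral_monotone_convergence_SUP[OF inc]) auto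
 also have "... = (SUP i. (\<integral>\<^sup>+x. U i x \<partial>jacobi_measure \<alpha> \<beta>) + (\<Sum>a\<in>A. ennreal (M a) * U i a))"
  using seq by simp
 also have "... = (SUP i. \<integral>\<^sup>+x. U i x \<partial>jacobi_measure \<alpha> \<beta>) + (SUP i. \<Sum>a\<in>A. ennreal (M a) * U i a)"
 proof (rule ennreal_SUP_add)
  show "incseq (\<lambda>i. \<integral>\<^sup>+x. U i x \<partial>jacobi_measure \<alpha> \<beta>)"
   using incx by (auto simp: incseq_def intro!: nn_integral_mono)
  show "incseq (\<lambda>i. \<Sum>a\<in>A. ennreal (M a) * U i a)"
   using incx by (auto simp: incseq_def intro!: sum_mono mult_left_mono)
 qed
 also have "(SUP i. \<integral>\<^sup>+x. U i x \<partial>jacobi_measure \<alpha> \<beta>) = (\<integral>\<^sup>+x. (SUP i. U i) x \<partial>jacobi_measure \<alpha> \<beta>)"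
  unfolding fx by (rule nn_integral_monotone_convergence_SUP[OF inc, symmetric]) auto
 also have "(SUP i. \<Sum>a\<in>A. ennreal (M a) * U i a) = (\<Sum>a\<in>A. SUP i. ennreal (M a) * U i a)"
  using incx by (intro ennreal_SUP_sum) (auto simp: incseq_def intro!: mult_left_mono)
 also have "... = (\<Sum>a\<in>A. ennreal (M a) * (SUP i. U i) a)"
  unfolding fx by (simp add: SUP_mult_left_ennreal)
 finally show ?case .
qed

end

section \<open>Size of the Jacobi measure near the endpoints\<close>

lemma powr_nn_integral_near_0:
 assumes "a > -1" "r >= 0"
 shows "(\<integral>\<^sup>+x. ennreal (x powr a) * indicator {0..r} x \<partial>lborel) = ennreal (r powr (a + 1) / (a + 1))"
 using assms by (intro nn_integral_has_integral_lebesgue' has_integral_powr_from_0) auto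

lemma jacobi_measure_near_1:
 assumes a: "\<alpha> > -1" and r: "r >= 0"
 shows "emeasure (jacobi_measure \<alpha> \<beta>) {x\<in>{0..<1}. 1 - x <= r} <= ennreal (2 powr \<bar>\<beta>\<bar> / (\<alpha> + 1) * r powr (\<alpha> + 1))"
proof -
 have [measurable]: "{x\<in>{0..<1::real}. 1 - x <= r} \<in> sets borel" by measurable
 have "emeasure (jacobi_measure \<alpha> \<beta>) {x\<in>{0..<1}. 1 - x <= r}
   = (\<integral>\<^sup>+ x. ennreal (indicator {x\<in>{0..<1}. 1 - x <= r} x * jacobi_weight \<alpha> \<beta> x) \<partial>lborel)"
  by (rule emeasure_jacobi_measure) measurable
 also have "... <= (\<integral>\<^sup>+ x. ennreal (2 powr \<bar>\<beta>\<bar>) * (ennreal ((1 + (-1) * x) powr \<alpha>) * indicator {0..r} (1 + (-1) * x)) \<partial>lborel)"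
 proof (rule nn_integral_mono)
  fix x :: real
  have "(1 + x) powr \<beta> <= 2 powr \<bar>\<beta>\<bar>" if "0 <= x" "x < 1"
  proof -
   have "(1 + x) powr \<beta> <= (1 + x) powr \<bar>\<beta>\<bar>" using that by (intro powr_mono) auto
   also have "... <= 2 powr \<bar>\<beta>\<bar>" using that by (intro powr_mono2) auto
   finally show ?thesis .
  qed
  then show "ennreal (indicator {x\<in>{0..<1}. 1 - x <= r} x * jacobi_weight \<alpha> \<beta> x)
   <= ennreal (2 powr \<bar>\<beta>\<bar>) * (ennreal ((1 + (-1) * x) powr \<alpha>) * indicator {0..r} (1 + (-1) * x))"
   by (auto simp: indicator_def jacobi_weight_def mult.commute[of "(1 - x) powr \<alpha>"] simp flip: ennreal_mult intro!: ennreal_leI mult_right_mono)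
 qed
 also have "... = ennreal (2 powr \<bar>\<beta>\<bar>) * (\<integral>\<^sup>+ x. (ennreal ((1 + (-1) * x) powr \<alpha>) * indicator {0..r} (1 + (-1) * x)) \<partial>lborel)"
  by (rule nn_integral_cmult) measurable
 also have "(\<integral>\<^sup>+ x. (ennreal ((1 + (-1) * x) powr \<alpha>) * indicator {0..r} (1 + (-1) * x)) \<partial>lborel)
   = (\<integral>\<^sup>+ x. ennreal (x powr \<alpha>) * indicator {0..r} x \<partial>lborel)"
  by (subst (2) nn_integral_real_affine[where c = "-1" and t = 1]) auto
 also have "... = ennreal (r powr (\<alpha> + 1) / (\<alpha> + 1))" by (rule powr_nn_integral_near_0[OF a r])
 finally show ?thesis using a by (simp add: ennreal_mult[symmetric] mult_ac)
qed

lemma jacobi_measure_reflect: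
 assumes E: "E \<in> sets borel"
 shows "emeasure (jacobi_measure \<alpha> \<beta>) E = emeasure (jacobi_measure \<beta> \<alpha>) (uminus -` E)"
proof -
 have [measurable]: "E \<in> sets borel" by fact
 have E': "uminus -` E \<in> sets borel" using measurable_sets[of uminus borel borel E] by auto
 have "emeasure (jacobi_measure \<alpha> \<beta>) E = (\<integral>\<^sup>+ x. ennreal (indicator E x * jacobi_weight \<alpha> \<beta> x) \<partial>lborel)"
  by (rule emeasure_jacobi_measure[OF E])
 also have "... = (\<integral>\<^sup>+ x. ennreal (indicator E (0 + (-1) * x) * jacobi_weight \<alpha> \<beta> (0 + (-1) * x)) \<partial>lborel)"
  by (subst nn_integral_real_affine[where c = "-1" and t = 0]) auto
 also have "... = (\<integral>\<^sup>+ x. ennreal (indicator (uminus -` E) x * jacobi_weight \<beta> \<alpha> x) \<partial>lborel)"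
  by (intro nn_integral_cong arg_cong[where f = ennreal]) (auto simp: indicator_def jacobi_weight_def)
 also have "... = emeasure (jacobi_measure \<beta> \<alpha>) (uminus -` E)"
  by (rule emeasure_jacobi_measure[OF E', symmetric])
 finally show ?thesis .
qed

lemma jacobi_measure_near_m1:
 assumes b: "\<beta> > -1" and r: "r >= 0"
 shows "emeasure (jacobi_measure \<alpha> \<beta>) {x\<in>{-1<..0}. 1 + x <= r} <= ennreal (2 powr \<bar>\<alpha>\<bar> / (\<beta> + 1) * r powr (\<beta> + 1))"
proof -
 have "emeasure (jacobi_measure \<alpha> \<beta>) {x\<in>{-1<..0}. 1 + x <= r} = emeasure (jacobi_measure \<beta> \<alpha>) (uminus -` {x\<in>{-1<..0}. 1 + x <= r})"
  by (rule jacobi_measure_reflect) measurable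
 also have "uminus -` {x\<in>{-1<..0}. 1 + x <= r} = {x\<in>{0..<1}. 1 - x <= r}" by auto
 finally show ?thesis using jacobi_measure_near_1[OF b r, of \<alpha>] by simp
qed

lemma jacobi_measure_outside: "E \<in> sets borel ==> E \<inter> Ioo = {} ==> emeasure (jacobi_measure \<alpha> \<beta>) E = 0"
proof -
 assume E: "E \<in> sets borel" "E \<inter> Ioo = {}"
 have z: "indicator E x * jacobi_weight \<alpha> \<beta> x = 0" for x
  using E(2) by (auto simp: jacobi_weight_def indicator_def)
 show ?thesis unfolding emeasure_jacobi_measure[OF E(1)] z by simp
qed

lemma jacobi_measure_finite:
 assumes "\<alpha> > -1" "\<beta> > -1"
 shows "finite_measure (jacobi_measure \<alpha> \<beta>)"
proof
 define B where "B = {x::real\<in>{0..<1}. 1 - x <= 1} \<union> {x\<in>{-1<..0}. 1 + x <= 1}"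
 have B: "B \<in> sets borel" unfolding B_def by measurable
 have "emeasure (jacobi_measure \<alpha> \<beta>) UNIV <= emeasure (jacobi_measure \<alpha> \<beta>) B + emeasure (jacobi_measure \<alpha> \<beta>) (- B)"
  using B emeasure_subadditive[of B "jacobi_measure \<alpha> \<beta>" "- B"] by auto
 also have "emeasure (jacobi_measure \<alpha> \<beta>) (- B) = 0"
  using B by (intro jacobi_measure_outside) (auto simp: B_def)
 also have "emeasure (jacobi_measure \<alpha> \<beta>) B <= emeasure (jacobi_measure \<alpha> \<beta>) {x::real\<in>{0..<1}. 1 - x <= 1}
   + emeasure (jacobi_measure \<alpha> \<beta>) {x\<in>{-1<..0}. 1 + x <= 1}"
  unfolding B_def by (rule emeasure_subadditive) measurable
 also have "... <= ennreal (2 powr \<bar>\<beta>\<bar> / (\<alpha> + 1) * 1 powr (\<alpha> + 1)) + ennreal (2 powr \<bar>\<alpha>\<bar> / (\<beta> + 1) * 1 powr (\<beta> + 1))"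
  using assms by (intro add_mono jacobi_measure_near_1 jacobi_measure_near_m1) auto
 also have "... < \<infinity>" by simp
 finally show "emeasure (jacobi_measure \<alpha> \<beta>) (space (jacobi_measure \<alpha> \<beta>)) ~= \<infinity>" by auto
qed

text \<open>Up to constants, the Jacobi measure of the interval between x and the nearer endpoint.
  Its sublevel sets are therefore of measure O(t).\<close>

definition rho0 :: "real => real => real => real" where
 "rho0 \<alpha> \<beta> x = (1 - x) powr (\<alpha> + 1) * (1 + x) powr (\<beta> + 1)"

lemma rho0_measurable [measurable]: "rho0 \<alpha> \<beta> \<in> borel_measurable borel"
 unfolding rho0_def[abs_def] by measurable

lemma rho0_sublevel:
 assumes ab: "\<alpha> > -1" "\<beta> > -1"
 shows "\<exists>C\<ge>0. \<forall>t>0. emeasure (jacobi_measure \<alpha> \<beta>) {x\<in>Ioo. rho0 \<alpha> \<beta> x < t} <= ennreal (C * t)"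
proof -
 define C1 where "C1 = 2 powr \<bar>\<beta>\<bar> / (\<alpha> + 1)"
 define C2 where "C2 = 2 powr \<bar>\<alpha>\<bar> / (\<beta> + 1)"
 have C: "C1 >= 0" "C2 >= 0" using ab by (auto simp: C1_def C2_def)
 have "emeasure (jacobi_measure \<alpha> \<beta>) {x\<in>Ioo. rho0 \<alpha> \<beta> x < t} <= ennreal ((C1 + C2) * t)" if t: "t > 0" for t
 proof -
  have sub: "{x\<in>Ioo. rho0 \<alpha> \<beta> x < t} \<subseteq> {x\<in>{0..<1}. 1 - x <= t powr (1 / (\<alpha> + 1))} \<union> {x\<in>{-1<..0}. 1 + x <= t powr (1 / (\<beta> + 1))}"
  proof
   fix x assume x: "x \<in> {x\<in>Ioo. rho0 \<alpha> \<beta> x < t}"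
   have root: "y <= t powr (1 / c)" if "y powr c <= t" "y > 0" "c > 0" for y c
   proof -
    have "y = (y powr c) powr (1 / c)" using that by (simp add: powr_powr)
    also have "... <= t powr (1 / c)" using that by (intro powr_mono2) auto
    finally show ?thesis .
   qed
   show "x \<in> {x\<in>{0..<1}. 1 - x <= t powr (1 / (\<alpha> + 1))} \<union> {x\<in>{-1<..0}. 1 + x <= t powr (1 / (\<beta> + 1))}"
   proof (cases "x >= 0")
    case True
    have "(1 - x) powr (\<alpha> + 1) * 1 <= rho0 \<alpha> \<beta> x"
     unfolding rho0_def using True ab by (intro mult_left_mono ge_one_powr_ge_zero) auto
    then show ?thesis using x True ab by (auto intro!: root)
   next
    case False
    have "1 * (1 + x) powr (\<beta> + 1) <= rho0 \<alpha> \<beta> x"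
     unfolding rho0_def using False ab by (intro mult_right_mono ge_one_powr_ge_zero) auto
    then show ?thesis using x False ab by (auto intro!: root)
   qed
  qed
  have "emeasure (jacobi_measure \<alpha> \<beta>) {x\<in>Ioo. rho0 \<alpha> \<beta> x < t}
    <= emeasure (jacobi_measure \<alpha> \<beta>) ({x\<in>{0..<1}. 1 - x <= t powr (1 / (\<alpha> + 1))} \<union> {x\<in>{-1<..0}. 1 + x <= t powr (1 / (\<beta> + 1))})"
   by (rule emeasure_mono[OF sub]) measurable
  also have "... <= emeasure (jacobi_measure \<alpha> \<beta>) {x\<in>{0..<1}. 1 - x <= t powr (1 / (\<alpha> + 1))}
    + emeasure (jacobi_measure \<alpha> \<beta>) {x\<in>{-1<..0}. 1 + x <= t powr (1 / (\<beta> + 1))}"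
   by (rule emeasure_subadditive) measurable
  also have "... <= ennreal (C1 * (t powr (1 / (\<alpha> + 1))) powr (\<alpha> + 1)) + ennreal (C2 * (t powr (1 / (\<beta> + 1))) powr (\<beta> + 1))"
   unfolding C1_def C2_def using ab by (intro add_mono jacobi_measure_near_1 jacobi_measure_near_m1) auto
  also have "... = ennreal ((C1 + C2) * t)"
   using C ab t by (simp add: powr_powr distrib_right flip: ennreal_plus)
  finally show ?thesis .
 qed
 then show ?thesis using C by (intro exI[of _ "C1 + C2"]) auto
qed

lemma sum_ennreal_mult_enn2real:
 assumes "finite A" "\<forall>a\<in>A. M a >= 0"
 shows "(\<Sum>a\<in>A. ennreal (M a) * ennreal (f a)) = ennreal (\<Sum>a\<in>A. M a * max 0 (f a))"
proof -
 have "ennreal (M a) * ennreal (f a) = ennreal (M a * max 0 (f a))" if "a \<in> A" for a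
  using assms(2) that by (cases "f a >= 0") (auto simp: ennreal_mult ennreal_neg max_def)
 then have "(\<Sum>a\<in>A. ennreal (M a) * ennreal (f a)) = (\<Sum>a\<in>A. ennreal (M a * max 0 (f a)))" by simp
 also have "... = ennreal (\<Sum>a\<in>A. M a * max 0 (f a))"
  using assms by (intro sum_ennreal) auto
 finally show ?thesis .
qed

lemma integrable_nu_iff:
 assumes A: "finite A" and f [measurable]: "f \<in> borel_measurable borel" "\<forall>a\<in>A. M a >= 0"
 shows "integrable (nu_measure \<alpha> \<beta> A M) (f :: real => real) \<longleftrightarrow> integrable (jacobi_measure \<alpha> \<beta>) f"
proof -
 have "(\<integral>\<^sup>+x. ennreal (norm (f x)) \<partial>nu_measure \<alpha> \<beta> A M)
   = (\<integral>\<^sup>+x. ennreal (norm (f x)) \<partial>jacobi_measure \<alpha> \<beta>) + ennreal (\<Sum>a\<in>A. M a * max 0 (norm (f a)))"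
  using A f by (subst nn_integral_nu[OF A]) (auto simp: sum_ennreal_mult_enn2real)
 moreover have "f \<in> borel_measurable (nu_measure \<alpha> \<beta> A M)" "f \<in> borel_measurable (jacobi_measure \<alpha> \<beta>)"
  using f(1) by (auto simp: measurable_def sets_nu[OF A] space_nu[OF A])
 ultimately show ?thesis by (auto simp: integrable_iff_bounded)
qed

lemma integral_nu:
 assumes A: "finite A" and f [measurable]: "f \<in> borel_measurable borel" and M: "\<forall>a\<in>A. M a >= 0"
  and int: "integrable (jacobi_measure \<alpha> \<beta>) f"
 shows "(\<integral>x. f x \<partial>nu_measure \<alpha> \<beta> A M) = (\<integral>x. f x \<partial>jacobi_measure \<alpha> \<beta>) + (\<Sum>a\<in>A. M a * f a :: real)"
proof -
 have int': "integrable (nu_measure \<alpha> \<beta> A M) f" using integrable_nu_iff[OF A f M] int by blast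
 have pm: "max 0 (f a) - max 0 (- f a) = f a" for a by auto
 have fin: "(\<integral>\<^sup>+x. ennreal (f x) \<partial>jacobi_measure \<alpha> \<beta>) < \<infinity>" "(\<integral>\<^sup>+x. ennreal (- f x) \<partial>jacobi_measure \<alpha> \<beta>) < \<infinity>"
  using integrableD(2,3)[OF int] by (auto simp: less_top infinity_ennreal_def)
 have nonneg: "0 <= (\<Sum>a\<in>A. M a * max 0 (g a))" for g :: "real => real"
  using M by (intro sum_nonneg mult_nonneg_nonneg) auto
 have "(\<integral>x. f x \<partial>nu_measure \<alpha> \<beta> A M) = enn2real (\<integral>\<^sup>+x. ennreal (f x) \<partial>nu_measure \<alpha> \<beta> A M) - enn2real (\<integral>\<^sup>+x. ennreal (- f x) \<partial>nu_measure \<alpha> \<beta> A M)"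
  by (rule real_lebesgue_integral_def[OF int'])
 also have "(\<integral>\<^sup>+x. ennreal (f x) \<partial>nu_measure \<alpha> \<beta> A M) = (\<integral>\<^sup>+x. ennreal (f x) \<partial>jacobi_measure \<alpha> \<beta>) + ennreal (\<Sum>a\<in>A. M a * max 0 (f a))"
  by (subst nn_integral_nu[OF A]) (auto simp: sum_ennreal_mult_enn2real[OF A M])
 also have "(\<integral>\<^sup>+x. ennreal (- f x) \<partial>nu_measure \<alpha> \<beta> A M) = (\<integral>\<^sup>+x. ennreal (- f x) \<partial>jacobi_measure \<alpha> \<beta>) + ennreal (\<Sum>a\<in>A. M a * max 0 (- f a))"
  by (subst nn_integral_nu[OF A]) (auto simp: sum_ennreal_mult_enn2real[OF A M])
 finally have "(\<integral>x. f x \<partial>nu_measure \<alpha> \<beta> A M) =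
   (enn2real (\<integral>\<^sup>+x. ennreal (f x) \<partial>jacobi_measure \<alpha> \<beta>) + (\<Sum>a\<in>A. M a * max 0 (f a)))
   - (enn2real (\<integral>\<^sup>+x. ennreal (- f x) \<partial>jacobi_measure \<alpha> \<beta>) + (\<Sum>a\<in>A. M a * max 0 (- f a)))"
  using fin nonneg[of f] nonneg[of "\<lambda>x. - f x"] by (simp add: enn2real_plus)
 also have "... = (\<integral>x. f x \<partial>jacobi_measure \<alpha> \<beta>) + (\<Sum>a\<in>A. M a * (max 0 (f a) - max 0 (- f a)))"
  unfolding real_lebesgue_integral_def[OF int] by (simp add: right_diff_distrib sum_subtractf)
 finally show ?thesis unfolding pm .
qed

section \<open>Polynomials integrated against the Jacobi measure\<close>

lemma integral_jacobi_measure: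
 fixes f :: "real => real"
 assumes "f \<in> borel_measurable borel"
 shows "(\<integral>x. f x \<partial>jacobi_measure \<alpha> \<beta>) = (\<integral>x. jacobi_weight \<alpha> \<beta> x * f x \<partial>lborel)"
  and "integrable (jacobi_measure \<alpha> \<beta>) f \<longleftrightarrow> integrable lborel (\<lambda>x. jacobi_weight \<alpha> \<beta> x * f x)"
 unfolding jacobi_measure_def using assms
 by (auto simp: integral_density integrable_density jacobi_weight_nonneg)

lemma AE_jacobi_measure_Ioo: "AE x in jacobi_measure \<alpha> \<beta>. x \<in> Ioo"
 unfolding jacobi_measure_def by (subst AE_density) (auto simp: jacobi_weight_def indicator_def)

lemma poly_bounded_Icc: "\<exists>B\<ge>0. \<forall>x\<in>{-1..1::real}. \<bar>poly q x\<bar> <= B"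
proof -
 have "compact (poly q ` {-1..1})"
  by (intro compact_continuous_image continuous_intros) auto
 then have "bounded (poly q ` {-1..1})" by (rule compact_imp_bounded)
 then obtain b where "b > 0" "\<forall>x\<in>poly q ` {-1..1}. norm x <= b" unfolding bounded_pos by blast
 then show ?thesis by (intro exI[of _ b]) auto
qed

lemma integrable_jacobi_bounded:
 assumes ab: "\<alpha> > -1" "\<beta> > -1" and f: "f \<in> borel_measurable borel" and B: "\<And>x. x \<in> Ioo ==> \<bar>f x\<bar> <= B"
 shows "integrable (jacobi_measure \<alpha> \<beta>) (f :: real => real)"
proof -
 interpret finite_measure "jacobi_measure \<alpha> \<beta>" by (rule jacobi_measure_finite[OF ab])
 have "AE x in jacobi_measure \<alpha> \<beta>. norm (f x) <= B"
  using AE_jacobi_measure_Ioo by eventually_elim (use B in auto)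
 then show ?thesis using f by (intro integrable_const_bound[of f B]) (auto simp: measurable_def)
qed

lemma poly_measurable [measurable]: "poly q \<in> borel_measurable borel" for q :: "real poly"
 by (intro borel_measurable_continuous_onI continuous_intros)

lemma integrable_jacobi_poly:
 assumes ab: "\<alpha> > -1" "\<beta> > -1"
 shows "integrable (jacobi_measure \<alpha> \<beta>) (poly q)"
proof -
 obtain B where "\<forall>x\<in>{-1..1::real}. \<bar>poly q x\<bar> <= B" using poly_bounded_Icc by blast
 then show ?thesis by (intro integrable_jacobi_bounded[OF ab, of _ B]) auto
qed

text \<open>The integrand times the weight is the derivative of (1 - x)^(\<alpha> + 1) (1 +
  x)^(\<beta> + 1) f, which is continuous on [-1, 1] and vanishes at both ends because the exponents
  are positive.\<close>

lemma jacobi_pearson: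
 assumes ab: "\<alpha> > -1" "\<beta> > -1"
 shows "(\<integral>x. poly ([:1, 0, -1:] * pderiv f + [:\<beta> - \<alpha>, - (\<alpha> + \<beta> + 2):] * f) x \<partial>jacobi_measure \<alpha> \<beta>) = 0"
proof -
 define q where "q = [:1, 0, -1:] * pderiv f + [:\<beta> - \<alpha>, - (\<alpha> + \<beta> + 2):] * f"
 define G where "G x = (1 - x) powr (\<alpha> + 1) * (1 + x) powr (\<beta> + 1) * poly f x" for x
 have G': "(G has_vector_derivative jacobi_weight \<alpha> \<beta> x * poly q x) (at x)" if x: "x \<in> Ioo" for x
 proof -
  have "(G has_real_derivative
    ((\<alpha> + 1) * (1 - x) powr (\<alpha> + 1 - 1) * (-1) * (1 + x) powr (\<beta> + 1)
     + (1 - x) powr (\<alpha> + 1) * ((\<beta> + 1) * (1 + x) powr (\<beta> + 1 - 1))) * poly f x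
    + (1 - x) powr (\<alpha> + 1) * (1 + x) powr (\<beta> + 1) * poly (pderiv f) x) (at x)"
   unfolding G_def using x by (auto intro!: derivative_eq_intros poly_DERIV)
  moreover have "(1 - x) powr (\<alpha> + 1) = (1 - x) powr \<alpha> * (1 - x)" "(1 + x) powr (\<beta> + 1) = (1 + x) powr \<beta> * (1 + x)"
   using x by (simp_all add: powr_add)
  moreover have "jacobi_weight \<alpha> \<beta> x = (1 - x) powr \<alpha> * (1 + x) powr \<beta>"
   using x by (simp add: jacobi_weight_def)
  moreover have "poly q x = (1 - x^2) * poly (pderiv f) x + (\<beta> - \<alpha> - (\<alpha> + \<beta> + 2) * x) * poly f x"
   by (simp add: q_def algebra_simps power2_eq_square)
  moreover have "((\<alpha> + 1) * P * (-1) * (Q * (1 + x)) + (P * (1 - x)) * ((\<beta> + 1) * Q)) * F + (P * (1 - x)) * (Q * (1 + x)) * F'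
    = (P * Q) * ((1 - x^2) * F' + (\<beta> - \<alpha> - (\<alpha> + \<beta> + 2) * x) * F)" for P Q F F' :: real
   by algebra
  ultimately have "(G has_real_derivative jacobi_weight \<alpha> \<beta> x * poly q x) (at x)"
   by (simp only: add_diff_cancel_right')
  then show ?thesis by (simp add: has_real_derivative_iff_has_vector_derivative)
 qed
 have "continuous_on {-1..1} G"
  unfolding G_def using ab by (intro continuous_intros continuous_on_powr') auto
 from fundamental_theorem_of_calculus_interior[OF _ this G']
 have "((\<lambda>x. jacobi_weight \<alpha> \<beta> x * poly q x) has_integral (G 1 - G (-1))) {-1..1}" by auto
 moreover have "G 1 - G (-1) = 0" using ab by (simp add: G_def)
 ultimately have "((\<lambda>x. if x \<in> {-1..1} then jacobi_weight \<alpha> \<beta> x * poly q x else 0) has_integral 0) UNIV"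
  by (simp add: has_integral_restrict_UNIV del: atLeastAtMost_iff)
 moreover have "(\<lambda>x. if x \<in> {-1..1} then jacobi_weight \<alpha> \<beta> x * poly q x else 0) = (\<lambda>x. jacobi_weight \<alpha> \<beta> x * poly q x)"
  by (intro ext) (auto simp: jacobi_weight_def indicator_def)
 ultimately have 1: "((\<lambda>x. jacobi_weight \<alpha> \<beta> x * poly q x) has_integral 0) UNIV" by simp
 have "integrable lborel (\<lambda>x. jacobi_weight \<alpha> \<beta> x * poly q x)"
  using integrable_jacobi_poly[OF ab, of q] by (simp add: integral_jacobi_measure(2))
 from has_integral_integral_lborel[OF this] 1
 have "(\<integral>x. jacobi_weight \<alpha> \<beta> x * poly q x \<partial>lborel) = 0" by (rule has_integral_unique)
 then show ?thesis unfolding q_def[symmetric] by (simp add: integral_jacobi_measure(1))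
qed

text \<open>Otherwise f would vanish almost everywhere on (-1, 1), against the finiteness of its
  zero set.\<close>

lemma jacobi_square_integral_pos:
 assumes ab: "\<alpha> > -1" "\<beta> > -1" and f: "f ~= 0"
 shows "(\<integral>x. poly (f * f) x \<partial>jacobi_measure \<alpha> \<beta>) > 0"
proof (rule ccontr)
 assume "\<not> ?thesis"
 moreover have "(\<integral>x. poly (f * f) x \<partial>jacobi_measure \<alpha> \<beta>) >= 0"
  by (intro Bochner_Integration.integral_nonneg) auto
 ultimately have "(\<integral>x. poly (f * f) x \<partial>jacobi_measure \<alpha> \<beta>) = 0" by linarith
 then have "AE x in jacobi_measure \<alpha> \<beta>. poly (f * f) x = 0"
  by (subst (asm) integral_nonneg_eq_0_iff_AE[OF integrable_jacobi_poly[OF ab]]) auto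
 then have "AE x in lborel. 0 < ennreal (jacobi_weight \<alpha> \<beta> x) --> poly (f * f) x = 0"
  unfolding jacobi_measure_def by (subst (asm) AE_density) auto
 moreover have "AE x in lborel. x \<notin> {x. poly f x = 0}"
  by (intro AE_not_in finite_imp_null_set_lborel poly_roots_finite[OF f])
 ultimately have ae: "AE x in lborel. x \<notin> {-1<..<1::real}"
  by eventually_elim (auto simp: jacobi_weight_def)
 have "emeasure lborel {-1<..<1::real} = 0"
 proof -
  have "{x\<in>space lborel. \<not> (x \<notin> {-1<..<1::real})} = Ioo" by auto
  from AE_iff_measurable[OF _ this] ae show ?thesis by auto
 qed
 then show False by simp
qed

lemma jacobi_functional_measure:
 assumes ab: "\<alpha> > -1" "\<beta> > -1"
 shows "jacobi_functional \<alpha> \<beta> (\<lambda>q. \<integral>x. poly q x \<partial>jacobi_measure \<alpha> \<beta>)"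
proof
 show "(\<integral>x. poly (f + g) x \<partial>jacobi_measure \<alpha> \<beta>) = (\<integral>x. poly f x \<partial>jacobi_measure \<alpha> \<beta>) + (\<integral>x. poly g x \<partial>jacobi_measure \<alpha> \<beta>)" for f g
  using integrable_jacobi_poly[OF ab] by simp
qed (use jacobi_pearson[OF ab] jacobi_square_integral_pos[OF ab] in auto)

text \<open>The set lies in the sublevel set of \<rho> at height (K / s)^p. Combined with
  \<open>sublevel_integral_bound\<close> this shows that an operator dominated by \<rho>(x)^(-1/p)
  times the integral of \<rho>^(-1/q) over E is of restricted weak type.\<close>

lemma sublevel_weak_bound:
 assumes rho: "\<rho> \<in> borel_measurable N" "\<And>x. \<rho> x >= 0"
  and C: "\<And>t. t > 0 ==> emeasure N {x\<in>space N. \<rho> x < t} <= ennreal (C * t)"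
  and p: "p > 0" and K: "K >= 0" and s: "s > 0"
 shows "emeasure N {x\<in>space N. K * \<rho> x powr (- 1 / p) > s} <= ennreal (C * (K powr p * s powr (- p)))"
proof (cases "K = 0")
 case True
 then have "{x\<in>space N. K * \<rho> x powr (- 1 / p) > s} = {}" using s by auto
 then show ?thesis by (metis emeasure_empty zero_le)
next
 case False
 then have K: "K > 0" using K by simp
 define t where "t = (K / s) powr p"
 have t: "t > 0" using K s by (simp add: t_def)
 have "\<rho> x < t" if "K * \<rho> x powr (- 1 / p) > s" for x
 proof -
  \<comment> \<open>At a zero of \<rho> the left side of the hypothesis is 0, since
    \<open>0 powr y = 0\<close>; such points are not in the set.\<close>
  have r: "\<rho> x > 0" using that s rho(2)[of x] by (cases "\<rho> x = 0") auto
  have "K * \<rho> x powr (- 1 / p) = K / \<rho> x powr (1 / p)"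
   using powr_minus_divide[of "\<rho> x" "1 / p"] by simp
  with that have "s < K / \<rho> x powr (1 / p)" by simp
  moreover have "\<rho> x powr (1 / p) > 0" using r by simp
  moreover have "y < K / s" if "s < K / y" "y > 0" for y using that s by (simp add: field_simps)
  ultimately have "\<rho> x powr (1 / p) < K / s" by blast
  then have "(\<rho> x powr (1 / p)) powr p < (K / s) powr p" using p by (intro powr_less_mono2) auto
  then show ?thesis using r p by (simp add: powr_powr t_def)
 qed
 then have "emeasure N {x\<in>space N. K * \<rho> x powr (- 1 / p) > s} <= emeasure N {x\<in>space N. \<rho> x < t}"
  using rho by (intro emeasure_mono) auto
 also have "... <= ennreal (C * t)" by (rule C[OF t])
 also have "t = K powr p * s powr (- p)" using K s by (simp add: t_def powr_divide powr_minus_divide)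
 finally show ?thesis .
qed

lemma dyadic_between:
 fixes x :: real
 assumes "0 < x" "x < 1"
 shows "\<exists>j. (1 / 2) ^ Suc j <= x \<and> x < (1 / 2) ^ j"
proof -
 have ex: "\<exists>n. (1 / 2) ^ n < x" using real_arch_pow_inv[of x "1/2"] assms by auto
 define n where "n = (LEAST n. (1 / 2) ^ n <= x)"
 have n: "(1 / 2) ^ n <= x" unfolding n_def using ex by (metis (mono_tags, lifting) LeastI less_imp_le)
 have "n ~= 0" using n assms by (cases n) auto
 then obtain j where j: "n = Suc j" by (cases n) auto
 have "\<not> (1 / 2) ^ j <= x" using j unfolding n_def by (metis lessI not_less_Least)
 then show ?thesis using n j by (intro exI[of _ j]) auto
qed

lemma ennreal_le_suminf: "f j <= (\<Sum>i. f i)" for f :: "nat => ennreal"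
 using sum_le_suminf[of f "{j}"] by simp

text \<open>The integral is split at the height d, the measure of E. Above it the integrand is at
  most d^(-\<theta>); below it the dyadic layers contribute a geometric series with ratio
  2^(\<theta> - 1) < 1.\<close>

lemma sublevel_integral_bound:
 assumes rho: "\<rho> \<in> borel_measurable N" "\<And>x. \<rho> x >= 0"
  and C: "\<And>t. t > 0 ==> emeasure N {x\<in>space N. \<rho> x < t} <= ennreal (C * t)" "C >= 0"
  and th: "0 < \<theta>" "\<theta> < 1" and E: "E \<in> sets N" "emeasure N E < \<infinity>"
 shows "(\<integral>\<^sup>+x. ennreal (\<rho> x powr (- \<theta>)) * indicator E x \<partial>N)
   <= ennreal ((1 + C * 2 powr \<theta> / (1 - 2 powr (\<theta> - 1))) * measure N E powr (1 - \<theta>))"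
proof (cases "measure N E = 0")
 case True
 then have "E \<in> null_sets N" using E by (auto simp: null_sets_def emeasure_eq_ennreal_measure)
 then have "AE x in N. ennreal (\<rho> x powr (- \<theta>)) * indicator E x = 0"
  by (rule AE_mp[OF AE_not_in]) auto
 then have "(\<integral>\<^sup>+x. ennreal (\<rho> x powr (- \<theta>)) * indicator E x \<partial>N) = 0"
  using rho(1) E(1) by (subst nn_integral_0_iff_AE) auto
 then show ?thesis by simp
next
 case False
 define d where "d = measure N E"
 have d: "d > 0" using False by (simp add: d_def zero_less_measure_iff)
 have Ed: "emeasure N E = ennreal d" using E by (simp add: d_def emeasure_eq_ennreal_measure)
 define b where "b j = ((1 / 2) ^ Suc j * d) powr (- \<theta>)" for j :: nat
 define S where "S j = {x\<in>space N. \<rho> x < (1 / 2) ^ j * d}" for j :: nat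
 have S [measurable]: "S j \<in> sets N" for j unfolding S_def using rho by measurable
 have [measurable]: "E \<in> sets N" by fact
 have pt: "ennreal (\<rho> x powr (- \<theta>)) * indicator E x <= ennreal (d powr (- \<theta>)) * indicator E x + (\<Sum>j. ennreal (b j) * indicator (S j) x)"
  if x: "x \<in> space N" for x
 proof (cases "\<rho> x = 0 \<or> x \<notin> E")
  case True
  then show ?thesis by auto
 next
  case False
  then have r: "\<rho> x > 0" "x \<in> E" using rho(2)[of x] by auto
  show ?thesis
  proof (cases "\<rho> x >= d")
   case True
   have "\<rho> x powr (- \<theta>) <= d powr (- \<theta>)" using True d th by (intro powr_mono2') auto
   then show ?thesis using r by (simp add: ennreal_leI add_increasing2)
  next
   case False
   then obtain j where j: "(1 / 2) ^ Suc j <= \<rho> x / d" "\<rho> x / d < (1 / 2) ^ j"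
    using dyadic_between[of "\<rho> x / d"] r d by auto
   have "\<rho> x powr (- \<theta>) <= b j"
    unfolding b_def using j d th by (intro powr_mono2') (auto simp: field_simps)
   moreover have "x \<in> S j" using j x d by (simp add: S_def field_simps)
   ultimately have "ennreal (\<rho> x powr (- \<theta>)) * indicator E x <= ennreal (b j) * indicator (S j) x"
    using r by (simp add: ennreal_leI)
   also have "... <= (\<Sum>j. ennreal (b j) * indicator (S j) x)"
    by (rule ennreal_le_suminf[of "\<lambda>j. ennreal (b j) * indicator (S j) x"])
   finally show ?thesis by (simp add: add_increasing)
  qed
 qed
 define r where "r = 2 powr (\<theta> - 1)"
 have r: "0 < r" "r < 1" unfolding r_def using th powr_less_mono[of "\<theta> - 1" 0 2] by auto
 have bj: "b j * (C * ((1 / 2) ^ j * d)) = C * 2 powr \<theta> * d powr (1 - \<theta>) * r ^ j" for j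
 proof -
  have h: "(1 / 2) ^ k = 2 powr (- real k)" for k :: nat
   by (simp add: powr_minus_divide powr_realpow power_one_over)
  have "b j = 2 powr (\<theta> * (real j + 1)) * d powr (- \<theta>)"
   unfolding b_def h using d by (simp add: powr_mult powr_powr mult.commute) (simp add: algebra_simps)
  moreover have "r ^ j = 2 powr ((\<theta> - 1) * real j)" by (simp add: r_def powr_powr flip: powr_realpow)
  moreover have "d powr (1 - \<theta>) = d powr (- \<theta>) * d" using d powr_add[of d "- \<theta>" 1] by (simp add: add.commute)
  moreover have "2 powr (\<theta> * (real j + 1)) * 2 powr (- real j) = 2 powr \<theta> * 2 powr ((\<theta> - 1) * real j)"
   unfolding powr_add[symmetric] by (simp add: algebra_simps)
  ultimately show ?thesis unfolding h by (simp add: mult_ac)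
 qed
 have "(\<integral>\<^sup>+x. ennreal (\<rho> x powr (- \<theta>)) * indicator E x \<partial>N)
  <= (\<integral>\<^sup>+x. ennreal (d powr (- \<theta>)) * indicator E x + (\<Sum>j. ennreal (b j) * indicator (S j) x) \<partial>N)"
  by (intro nn_integral_mono pt)
 also have "... = ennreal (d powr (- \<theta>)) * emeasure N E + (\<Sum>j. ennreal (b j) * emeasure N (S j))"
  by (subst nn_integral_add) (auto simp: nn_integral_suminf nn_integral_cmult_indicator)
 also have "... <= ennreal (d powr (- \<theta>) * d) + (\<Sum>j. ennreal (C * 2 powr \<theta> * d powr (1 - \<theta>) * r ^ j))"
 proof (intro add_mono suminf_le)
  show "ennreal (d powr (- \<theta>)) * emeasure N E <= ennreal (d powr (- \<theta>) * d)"
   using d by (simp add: Ed ennreal_mult)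
  fix j
  have "ennreal (b j) * emeasure N (S j) <= ennreal (b j) * ennreal (C * ((1 / 2) ^ j * d))"
   unfolding S_def using d by (intro mult_left_mono C) auto
  also have "... = ennreal (b j * (C * ((1 / 2) ^ j * d)))" using d C(2) by (subst ennreal_mult) (auto simp: b_def)
  finally show "ennreal (b j) * emeasure N (S j) <= ennreal (C * 2 powr \<theta> * d powr (1 - \<theta>) * r ^ j)" unfolding bj .
 qed auto
 also have "(\<Sum>j. ennreal (C * 2 powr \<theta> * d powr (1 - \<theta>) * r ^ j)) = ennreal (C * 2 powr \<theta> * d powr (1 - \<theta>) * (1 / (1 - r)))"
  using sums_mult[OF geometric_sums[of r], of "C * 2 powr \<theta> * d powr (1 - \<theta>)"] r C(2)
  by (intro suminf_ennreal_eq) auto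
 also have "ennreal (d powr (- \<theta>) * d) + ... = ennreal ((1 + C * 2 powr \<theta> / (1 - r)) * d powr (1 - \<theta>))"
 proof -
  have "d powr (1 - \<theta>) = d powr (- \<theta>) * d" using d powr_add[of d "- \<theta>" 1] by (simp add: add.commute)
  then show ?thesis using r C(2) d by (subst ennreal_plus[symmetric]) (auto simp: algebra_simps)
 qed
 finally show ?thesis by (simp add: d_def r_def)
qed

lemma positive_convergent_bounds:
 fixes X :: "nat => real"
 assumes X: "X \<longlonglongrightarrow> L" "L > 0" "\<And>n. X n > 0"
 shows "\<exists>c>0. \<exists>C>0. \<forall>n. c <= X n \<and> X n <= C"
proof -
 have "Bseq X" using X(1) by (rule convergentI[THEN convergent_imp_Bseq])
 then obtain C where C: "C > 0" "\<And>n. norm (X n) <= C" by (auto simp: Bseq_def)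
 have "(\<lambda>n. inverse (X n)) \<longlonglongrightarrow> inverse L" using X by (intro tendsto_inverse) auto
 then have "Bseq (\<lambda>n. inverse (X n))" by (rule convergentI[THEN convergent_imp_Bseq])
 then obtain D where D: "D > 0" "\<And>n. norm (inverse (X n)) <= D" by (auto simp: Bseq_def)
 have "1 / D <= X n" for n
  using D(2)[of n] D(1) X(3)[of n] by (simp add: field_simps)
 moreover have "X n <= C" for n using C(2)[of n] by simp
 ultimately show ?thesis using C(1) D(1) by (intro exI[of _ "1 / D"] conjI exI[of _ C]) auto
qed

section \<open>Bounds for the polynomials and the kernel\<close>

text \<open>The quotient converges to 1 / Gamma(z) by the limit formula for Gamma and is positive
  for every n, so it lies between positive constants. The base n + 1 instead of n includes n =
  0.\<close>

lemma pochhammer_bounds: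
 fixes z :: real
 assumes z: "z > 0"
 shows "\<exists>c>0. \<exists>C>0. \<forall>n. c * (fact n * real (Suc n) powr (z - 1)) <= pochhammer z n \<and>
   pochhammer z n <= C * (fact n * real (Suc n) powr (z - 1))"
proof -
 define X where "X n = pochhammer z n / (fact n * real (Suc n) powr (z - 1))" for n
 have pos: "pochhammer z n > 0" for n using z by (intro pochhammer_pos)
 have Xpos: "X n > 0" for n using pos[of n] by (simp add: X_def)
 have G: "Gamma z > 0" using z by (rule Gamma_real_pos)
 have eq: "(real n / real (Suc n)) powr z * (real (Suc n) / (real n + z)) / Gamma_series z n = X n" if n: "n > 0" for n
 proof -
  have "Gamma_series z n = fact n * real n powr z / (pochhammer z n * (z + real n))"
   using n by (simp add: Gamma_series_def powr_def pochhammer_Suc)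
  moreover have "real (Suc n) powr z = real (Suc n) powr (z - 1) * real (Suc n)"
   using powr_add[of "real (Suc n)" "z - 1" 1] by simp
  moreover have "(real n / real (Suc n)) powr z = real n powr z / real (Suc n) powr z"
   by (simp add: powr_divide)
  moreover have "A / (B * S) * (S / r) / (F * A / (P * r)) = P / (F * B)"
   if "A > 0" "B > 0" "S > 0" "r > 0" "F > 0" "P > 0" for A B S r F P :: real
   using that by (simp add: field_simps)
  from this[of "real n powr z" "real (Suc n) powr (z - 1)" "real (Suc n)" "z + real n" "fact n" "pochhammer z n"]
  have "real n powr z / (real (Suc n) powr (z - 1) * real (Suc n)) * (real (Suc n) / (z + real n)) /
    (fact n * real n powr z / (pochhammer z n * (z + real n))) = X n"
   using n z pos[of n] by (simp add: X_def)
  ultimately show ?thesis by (simp only: add.commute)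
 qed
 have l1: "(\<lambda>n. real (Suc n) / (real n + z)) \<longlonglongrightarrow> 1"
 proof -
  have "filterlim (\<lambda>n. z + real n) at_top sequentially"
   by (rule filterlim_tendsto_add_at_top[OF tendsto_const filterlim_real_sequentially])
  then have "(\<lambda>n. 1 + (1 - z) * inverse (z + real n)) \<longlonglongrightarrow> 1 + (1 - z) * 0"
   by (intro tendsto_intros tendsto_inverse_0_at_top)
  moreover have "1 + (1 - z) * inverse (z + real n) = real (Suc n) / (real n + z)" for n
   using z by (simp add: field_simps)
  ultimately show ?thesis by simp
 qed
 have l2: "(\<lambda>n. (real n / real (Suc n)) powr z) \<longlonglongrightarrow> 1 powr z"
  by (intro tendsto_intros LIMSEQ_n_over_Suc_n) auto
 have "(\<lambda>n. (real n / real (Suc n)) powr z * (real (Suc n) / (real n + z)) / Gamma_series z n) \<longlonglongrightarrow> 1 powr z * 1 / Gamma z"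
  by (intro tendsto_divide tendsto_mult l1 l2 Gamma_series_LIMSEQ) (use G in auto)
 then have "(\<lambda>n. (real n / real (Suc n)) powr z * (real (Suc n) / (real n + z)) / Gamma_series z n) \<longlonglongrightarrow> 1 / Gamma z"
  by simp
 then have "X \<longlonglongrightarrow> 1 / Gamma z"
  by (rule Lim_transform_eventually) (use eq in \<open>auto intro!: eventually_mono[OF eventually_gt_at_top[of 0]]\<close>)
 from positive_convergent_bounds[OF this _ Xpos] G
 obtain c C where cC: "c > 0" "C > 0" "\<And>n. c <= X n \<and> X n <= C" by auto
 have "c * (fact n * real (Suc n) powr (z - 1)) <= pochhammer z n \<and>
   pochhammer z n <= C * (fact n * real (Suc n) powr (z - 1))" for n
 proof -
  have q: "fact n * real (Suc n) powr (z - 1) > 0" by simp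
  show ?thesis using cC(3)[of n] q unfolding X_def by (auto simp: field_simps)
 qed
 then show ?thesis using cC(1,2) by blast
qed

section \<open>Reflection and growth at the endpoint 1\<close>

lemma pderiv_reflect: "pderiv (pcompose f [:0, -1:]) = - pcompose (pderiv f) [:0, -1:]" for f :: "real poly"
 by (simp add: pderiv_pcompose pderiv_pCons)

context jacobi_polys
begin

text \<open>Under x -> -x the derivative changes sign and 1 - x^2 does not, which turns Pearson's
  identity for (\<alpha>, \<beta>) into that for (\<beta>, \<alpha>).\<close>

lemma reflect: "jacobi_polys \<beta> \<alpha> (\<lambda>q. J (pcompose q [:0, -1:])) (\<lambda>n. pcompose (p n) [:0, -1:])"
proof
 fix f g :: "real poly" and c :: real
 show "J (pcompose (f + g) [:0, -1:]) = J (pcompose f [:0, -1:]) + J (pcompose g [:0, -1:])"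
  by (simp add: pcompose_add J_add)
 show "J (pcompose (smult c f) [:0, -1:]) = c * J (pcompose f [:0, -1:])"
  by (simp add: pcompose_smult J_smult)
 show "0 < J (pcompose (f * f) [:0, -1:])" if "f ~= 0"
 proof -
  have "pcompose f [:0, -1:] ~= 0" using that by (simp add: pcompose_eq_0_iff)
  then show ?thesis by (simp add: pcompose_mult J_pos)
 qed
 define r where "r = pcompose f [:0, -1:]"
 have "pcompose ([:1, 0, -1:] * pderiv f + [:\<alpha> - \<beta>, - (\<beta> + \<alpha> + 2):] * f) [:0, -1:]
   = [:1, 0, -1:] * (pcompose (pderiv f) [:0, -1:]) + [:\<alpha> - \<beta>, \<beta> + \<alpha> + 2:] * r"
  unfolding r_def pcompose_add pcompose_mult by (simp add: pcompose_pCons algebra_simps)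
 also have "pcompose (pderiv f) [:0, -1:] = - pderiv r" unfolding r_def pderiv_reflect by simp
 also have "[:\<alpha> - \<beta>, \<beta> + \<alpha> + 2:] = - [:\<beta> - \<alpha>, - (\<alpha> + \<beta> + 2):]" by simp
 also have "[:1, 0, -1:] * (- pderiv r) + - [:\<beta> - \<alpha>, - (\<alpha> + \<beta> + 2):] * r
   = - ([:1, 0, -1:] * pderiv r + [:\<beta> - \<alpha>, - (\<alpha> + \<beta> + 2):] * r)"
  by (simp only: mult_minus_right mult_minus_left minus_add_distrib)
 finally show "J (pcompose ([:1, 0, -1:] * pderiv f + [:\<alpha> - \<beta>, - (\<beta> + \<alpha> + 2):] * f) [:0, -1:]) = 0"
  using pearson[of r] by (simp only: J_minus) 
next
 show "degree (pcompose (p n) [:0, -1:]) = n" for n by (simp add: degree_pcompose degree_p)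
 show "J (pcompose (pcompose (p m) [:0, -1:] * pcompose (p n) [:0, -1:]) [:0, -1:]) = (if m = n then 1 else 0)" for m n
 proof -
  have "pcompose (pcompose q [:0, -1:]) [:0, -1:] = q" for q :: "real poly"
   by (simp flip: pcompose_assoc add: pcompose_pCons)
  then show ?thesis by (simp add: pcompose_mult orth)
 qed
qed

lemma ker_0: "ker 0 x y = (coeff (p 0) 0)^2"
proof -
 have "degree (p 0) = 0" by (rule degree_p)
 then obtain c where "p 0 = [:c:]" by (rule degree_eq_zeroE)
 then show ?thesis by (simp add: ker_def power2_eq_square)
qed

lemma ker_0_pos: "ker 0 x y > 0"
 unfolding ker_0 using coeff_p_nonzero[of 0] by simp

lemma ker_diag_mono: "m <= n ==> ker m x x <= ker n x x"
 unfolding ker_def by (rule sum_mono2) auto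

lemma ker_11_pochhammer:
 assumes "\<alpha> > -1"
 shows "fact n * pochhammer (\<beta> + 1) n * ker n 1 1 = ker 0 1 1 * pochhammer (\<alpha> + 2) n * pochhammer (\<alpha> + \<beta> + 2) n"
proof (induction n)
 case (Suc n)
 have "fact (Suc n) * pochhammer (\<beta> + 1) (Suc n) * ker (Suc n) 1 1
   = fact n * pochhammer (\<beta> + 1) n * (real (Suc n) * (real (Suc n) + \<beta>) * ker (Suc n) 1 1)"
  by (simp add: pochhammer_Suc algebra_simps)
 also have "... = fact n * pochhammer (\<beta> + 1) n * ker n 1 1 * ((real (Suc n) + \<alpha> + 1) * (real (Suc n) + \<alpha> + \<beta> + 1))"
  unfolding ker_11_recurrence[OF assms] by simp
 also have "... = ker 0 1 1 * pochhammer (\<alpha> + 2) (Suc n) * pochhammer (\<alpha> + \<beta> + 2) (Suc n)"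
  unfolding Suc.IH by (simp add: pochhammer_Suc algebra_simps)
 finally show ?case .
qed simp

text \<open>In the closed form of the kernel the factorials cancel, and the powers of n + 1 combine
  as (\<alpha> + 1) + (\<alpha> + \<beta> + 1) - \<beta> = 2 \<alpha> + 2.\<close>

lemma ker_11_bounds:
 assumes ab: "\<alpha> >= -1/2" "\<beta> >= -1/2"
 shows "\<exists>c>0. \<exists>C>0. \<forall>n. c * real (Suc n) powr (2 * \<alpha> + 2) <= ker n 1 1 \<and> ker n 1 1 <= C * real (Suc n) powr (2 * \<alpha> + 2)"
proof -
 obtain c1 C1 where 1: "c1 > 0" "C1 > 0" "\<And>n. c1 * (fact n * real (Suc n) powr (\<alpha> + 1)) <= pochhammer (\<alpha> + 2) n"
   "\<And>n. pochhammer (\<alpha> + 2) n <= C1 * (fact n * real (Suc n) powr (\<alpha> + 1))"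
  using pochhammer_bounds[of "\<alpha> + 2"] ab by (auto simp: algebra_simps)
 obtain c2 C2 where 2: "c2 > 0" "C2 > 0" "\<And>n. c2 * (fact n * real (Suc n) powr (\<alpha> + \<beta> + 1)) <= pochhammer (\<alpha> + \<beta> + 2) n"
   "\<And>n. pochhammer (\<alpha> + \<beta> + 2) n <= C2 * (fact n * real (Suc n) powr (\<alpha> + \<beta> + 1))"
  using pochhammer_bounds[of "\<alpha> + \<beta> + 2"] ab by (auto simp: algebra_simps)
 obtain c3 C3 where 3: "c3 > 0" "C3 > 0" "\<And>n. c3 * (fact n * real (Suc n) powr \<beta>) <= pochhammer (\<beta> + 1) n"
   "\<And>n. pochhammer (\<beta> + 1) n <= C3 * (fact n * real (Suc n) powr \<beta>)"
  using pochhammer_bounds[of "\<beta> + 1"] ab by (auto simp: algebra_simps)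
 define k0 where "k0 = ker 0 1 1"
 have k0: "k0 > 0" using ker_0_pos by (simp add: k0_def)
 have "k0 * c1 * c2 / C3 * real (Suc n) powr (2 * \<alpha> + 2) <= ker n 1 1 \<and> ker n 1 1 <= k0 * C1 * C2 / c3 * real (Suc n) powr (2 * \<alpha> + 2)" for n
 proof -
  define N where "N = real (Suc n)"
  define f where "f = (fact n :: real)"
  have N: "N > 0" and f: "f > 0" by (auto simp: N_def f_def)
  have pw: "N powr (\<alpha> + 1) * N powr (\<alpha> + \<beta> + 1) = N powr (2 * \<alpha> + 2) * N powr \<beta>"
   unfolding powr_add[symmetric] by (simp add: algebra_simps)
  define P1 P2 P3 where "P1 = pochhammer (\<alpha> + 2) n" and "P2 = pochhammer (\<alpha> + \<beta> + 2) n" and "P3 = pochhammer (\<beta> + 1) n"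
  have P: "P1 > 0" "P2 > 0" "P3 > 0" unfolding P1_def P2_def P3_def using ab by (auto intro!: pochhammer_pos)
  have eq: "f * P3 * ker n 1 1 = k0 * P1 * P2"
   unfolding f_def P1_def P2_def P3_def k0_def using ab by (intro ker_11_pochhammer) auto
  have knn: "ker n 1 1 > 0" using ker_diag_mono[of 0 n 1] ker_0_pos[of 1 1] by simp
  have "k0 * (c1 * (f * N powr (\<alpha> + 1))) * (c2 * (f * N powr (\<alpha> + \<beta> + 1))) <= k0 * P1 * P2"
   using 1 2 k0 P f N by (intro mult_mono) (auto simp: P1_def P2_def f_def N_def)
  also have "... = f * P3 * ker n 1 1" using eq by simp
  also have "... <= f * (C3 * (f * N powr \<beta>)) * ker n 1 1"
   using 3 f knn by (intro mult_right_mono mult_left_mono) (auto simp: P3_def f_def N_def)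
  finally have "(k0 * c1 * c2 * N powr (2 * \<alpha> + 2)) * (f * f * N powr \<beta>) <= (C3 * ker n 1 1) * (f * f * N powr \<beta>)"
   using pw by (simp add: mult_ac)
  then have A: "k0 * c1 * c2 * N powr (2 * \<alpha> + 2) <= C3 * ker n 1 1"
   using f N by (subst (asm) mult_le_cancel_right) auto
  have "f * (c3 * (f * N powr \<beta>)) * ker n 1 1 <= f * P3 * ker n 1 1"
   using 3 f knn by (intro mult_right_mono mult_left_mono) (auto simp: P3_def f_def N_def)
  also have "... = k0 * P1 * P2" using eq by simp
  also have "... <= k0 * (C1 * (f * N powr (\<alpha> + 1))) * (C2 * (f * N powr (\<alpha> + \<beta> + 1)))"
   using 1 2 k0 P f N by (intro mult_mono) (auto simp: P1_def P2_def f_def N_def)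
  finally have "(c3 * ker n 1 1) * (f * f * N powr \<beta>) <= (k0 * C1 * C2 * N powr (2 * \<alpha> + 2)) * (f * f * N powr \<beta>)"
   using pw by (simp add: mult_ac)
  then have B: "c3 * ker n 1 1 <= k0 * C1 * C2 * N powr (2 * \<alpha> + 2)"
   using f N by (subst (asm) mult_le_cancel_right) auto
  show ?thesis unfolding N_def[symmetric] using A B 3(1,2) by (simp add: field_simps)
 qed
 then show ?thesis using k0 1 2 3
  by (intro exI[of _ "k0 * c1 * c2 / C3"] conjI exI[of _ "k0 * C1 * C2 / c3"]) auto
qed

text \<open>\<open>ker_11_square\<close> expresses the square by the kernel. Since \<beta> >= -1/2,
  n (n + \<beta>) is at least n^2 / 2, which leaves the exponent 2 \<alpha> + 2 + 1 - 2.\<close>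

lemma p_at_1_bound:
 assumes ab: "\<alpha> >= -1/2" "\<beta> >= -1/2"
 shows "\<exists>C>0. \<forall>n. (poly (p n) 1)\<^sup>2 <= C * real (Suc n) powr (2 * \<alpha> + 1)"
proof -
 obtain C where C: "C > 0" "\<And>n. ker n 1 1 <= C * real (Suc n) powr (2 * \<alpha> + 2)"
  using ker_11_bounds[OF ab] by blast
 define D where "D = 2 * (\<alpha> + 1) * (3 + \<alpha> + \<beta>) * C + (poly (p 0) 1)^2"
 have D1: "2 * (\<alpha> + 1) * (3 + \<alpha> + \<beta>) * C > 0" using ab C by (intro mult_pos_pos) auto
 have "(poly (p n) 1)^2 <= D * real (Suc n) powr (2 * \<alpha> + 1)" for n
 proof (cases n)
  case 0
  then show ?thesis using D1 by (simp add: D_def)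
 next
  case (Suc m)
  define N where "N = real (Suc m)"
  have N: "N >= 1" by (simp add: N_def)
  have "N * (N / 2) * (poly (p n) 1)^2 <= N * (N + \<beta>) * (poly (p n) 1)^2"
   using N ab by (intro mult_right_mono mult_left_mono) auto
  also have "... = (\<alpha> + 1) * (2 * N + 1 + \<alpha> + \<beta>) * ker m 1 1"
   using ker_11_square[of m] ab unfolding N_def Suc by simp
  also have "... <= (\<alpha> + 1) * (N * (3 + \<alpha> + \<beta>)) * (C * N powr (2 * \<alpha> + 2))"
  proof (intro mult_mono mult_left_mono)
   have "1 + \<alpha> + \<beta> <= N * (1 + \<alpha> + \<beta>)" using N ab by (simp add: mult_le_cancel_right1)
   then show "2 * N + 1 + \<alpha> + \<beta> <= N * (3 + \<alpha> + \<beta>)" by (simp add: algebra_simps)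
   show "ker m 1 1 <= C * N powr (2 * \<alpha> + 2)" using C(2)[of m] by (simp add: N_def)
   show "0 <= ker m 1 1" using ker_diag_mono[of 0 m 1] ker_0_pos[of 1 1] by simp
  qed (use ab N in auto)
  also have "N powr (2 * \<alpha> + 2) = N powr (2 * \<alpha> + 1) * N" using N powr_add[of N "2 * \<alpha> + 1" 1] by (simp add: algebra_simps)
  finally have "(N * N) * (poly (p n) 1)^2 <= (N * N) * (2 * (\<alpha> + 1) * (3 + \<alpha> + \<beta>) * C * N powr (2 * \<alpha> + 1))"
   by (simp add: field_simps)
  then have "(poly (p n) 1)^2 <= 2 * (\<alpha> + 1) * (3 + \<alpha> + \<beta>) * C * N powr (2 * \<alpha> + 1)"
   using N by (subst (asm) mult_le_cancel_left_pos) auto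
  also have "... <= D * real (Suc n) powr (2 * \<alpha> + 1)"
   using D1 N ab by (intro mult_mono powr_mono2) (auto simp: D_def N_def Suc)
  finally show ?thesis .
 qed
 moreover have "D > 0" using D1 by (simp add: D_def add_pos_nonneg)
 ultimately show ?thesis by blast
qed

lemma ode_pointwise:
 "(1 - x^2) * poly (pderiv (pderiv (p n))) x + (\<beta> - \<alpha> - (\<alpha> + \<beta> + 2) * x) * poly (pderiv (p n)) x
   = - eigenval n * poly (p n) x"
 using arg_cong[OF jacobi_ode[of n], of "\<lambda>q. poly q x"] unfolding jacobi_op_def
 by (simp add: algebra_simps power2_eq_square)

lemma eigenval_bounds:
 assumes ab: "\<alpha> >= -1/2" "\<beta> >= -1/2" and n: "n >= 1"
 shows "eigenval n >= 1" "(real (Suc n) / 2)^2 <= eigenval n" "eigenval n <= (2 + \<alpha> + \<beta>) * (real (Suc n))^2"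
proof -
 have n2: "(real n)^2 <= eigenval n"
  unfolding eigenval_def power2_eq_square using ab by (intro mult_left_mono) auto
 moreover have "1 <= (real n)^2" using n by (simp add: one_le_power)
 ultimately show "eigenval n >= 1" by linarith
 have "(real (Suc n) / 2)^2 <= (real n)^2" using n by (intro power_mono) auto
 then show "(real (Suc n) / 2)^2 <= eigenval n" using n2 by linarith
 have "real n + \<alpha> + \<beta> + 1 <= (2 + \<alpha> + \<beta>) * real (Suc n)"
 proof -
  have "0 <= (1 + \<alpha> + \<beta>) * real n" using ab by simp
  then show ?thesis by (simp add: algebra_simps)
 qed
 then have "eigenval n <= real (Suc n) * ((2 + \<alpha> + \<beta>) * real (Suc n))"
  unfolding eigenval_def using ab by (intro mult_mono) auto
 then show "eigenval n <= (2 + \<alpha> + \<beta>) * (real (Suc n))^2" by (simp add: power2_eq_square mult_ac)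
qed

text \<open>The eigenvalue is of order n^2 and the square of the value at 1 is O(n^(2 \<alpha> +
  1)), so the energy bound has right side O(\<open>eigenval n\<close>); the two summands of the
  energy give the first two estimates. The third, which carries no weight, comes from
  \<open>jacobi_energy_near_1\<close>.\<close>

lemma half_bounds:
 assumes ab: "\<alpha> >= -1/2" "\<beta> >= -1/2"
 shows "\<exists>C>0. \<forall>n. \<forall>x\<in>{0..1}. (1 - x) powr (\<alpha> + 1/2) * (poly (p n) x)^2 <= C \<and>
   (1 - x) powr (\<alpha> + 1/2) * ((1 - x^2) * (poly (pderiv (p n)) x)^2) <= C * (real (Suc n))^2 \<and>
   (poly (p n) x)\<^sup>2 <= C * real (Suc n) powr (2 * \<alpha> + 1)"
proof -
 let ?h = "\<alpha> + 1/2"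
 obtain C1 where C1: "C1 > 0" "\<And>n. (poly (p n) 1)\<^sup>2 <= C1 * real (Suc n) powr (2 * \<alpha> + 1)"
  using p_at_1_bound[OF ab] by blast
 obtain C2 where C2: "C2 > 0" "\<And>y lam x. lam >= 1 ==>
   (\<forall>x. (1 - x^2) * poly (pderiv (pderiv y)) x + (\<beta> - \<alpha> - (\<alpha> + \<beta> + 2) * x) * poly (pderiv y) x = - lam * poly y x) ==>
   x\<in>{0..1} ==> (1 - x) powr ?h * (lam * (poly y x)^2 + (1 - x^2) * (poly (pderiv y) x)^2)
     <= C2 * (lam powr (- ?h) * (lam * (poly y 1)^2))"
  using jacobi_energy_bound[OF ab] by blast
 define C3 where "C3 = C2 * (C1 * 4 powr ?h)"
 have C3: "C3 > 0" using C1 C2 by (simp add: C3_def)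
 define c0 where "c0 = (coeff (p 0) 0)^2"
 define D where "D = C3 + C3 * (2 + \<alpha> + \<beta>) + c0 + exp (2 * \<beta> + 1) * C1"
 have c0: "c0 >= 0" by (simp add: c0_def)
 have t: "0 <= C3 * (2 + \<alpha> + \<beta>)" "0 <= exp (2 * \<beta> + 1) * C1" using C3 ab C1 by auto
 have "(1 - x) powr ?h * (poly (p n) x)^2 <= D \<and>
   (1 - x) powr ?h * ((1 - x^2) * (poly (pderiv (p n)) x)^2) <= D * (real (Suc n))^2 \<and>
   (poly (p n) x)\<^sup>2 <= D * real (Suc n) powr (2 * \<alpha> + 1)" if x: "x \<in> {0..1}" for n x
 proof (cases "n = 0")
  case True
  have "degree (p 0) = 0" by (rule degree_p)
  then obtain c where c: "p 0 = [:c:]" by (rule degree_eq_zeroE)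
  have "(1 - x) powr ?h <= 1 powr ?h" using x ab by (intro powr_mono2) auto
  then have "(1 - x) powr ?h * c^2 <= 1 * c^2" by (intro mult_right_mono) auto
  moreover have "c^2 = c0" by (simp add: c0_def c)
  ultimately show ?thesis using True C3 t c0 by (simp add: c D_def)
 next
  case False
  then have n: "n >= 1" by simp
  define lam where "lam = eigenval n"
  define N where "N = real (Suc n)"
  have N: "N > 0" by (simp add: N_def)
  have lam: "lam >= 1" "(N / 2)^2 <= lam" "lam <= (2 + \<alpha> + \<beta>) * N^2"
   using eigenval_bounds[OF ab n] by (auto simp: lam_def N_def)
  define En where "En = lam * (poly (p n) x)^2 + (1 - x^2) * (poly (pderiv (p n)) x)^2"
  have x2: "1 - x^2 >= 0" using x by (simp add: power_le_one)
  have "(1 - x) powr ?h * En <= C2 * (lam powr (- ?h) * (lam * (poly (p n) 1)^2))"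
   unfolding En_def by (rule C2(2)[OF lam(1) _ x]) (use ode_pointwise lam_def in auto)
  \<comment> \<open>Only the negative power of \<open>lam\<close> is estimated, through
    \<open>lam\<close> >= (N / 2)^2; the factor \<open>lam\<close> itself is kept and cancels
    against the one in the energy.\<close>
  also have "... <= C2 * (((N / 2)^2) powr (- ?h) * (lam * (C1 * N powr (2 * \<alpha> + 1))))"
  proof (intro mult_left_mono mult_mono)
   show "lam powr (- ?h) <= ((N / 2)^2) powr (- ?h)"
    using lam ab N by (intro powr_mono2') auto
  qed (use C1 C2 lam in \<open>auto simp: N_def\<close>)
  also have "((N / 2)^2) powr (- ?h) = 4 powr ?h * N powr (- (2 * \<alpha> + 1))"
  proof -
   have "((N / 2)^2) powr (- ?h) = (N^2) powr (- ?h) / 4 powr (- ?h)"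
    by (simp add: power_divide powr_divide)
   also have "(N^2) powr (- ?h) = N powr (2 * (- ?h))"
    using N by (subst powr_powr[symmetric]) (simp add: powr_numeral)
   also have "2 * (- ?h) = - (2 * \<alpha> + 1)" by simp
   also have "4 powr (- ?h) = 1 / 4 powr ?h" by (rule powr_minus_divide)
   finally show ?thesis by simp
  qed
  also have "C2 * (4 powr ?h * N powr (- (2 * \<alpha> + 1)) * (lam * (C1 * N powr (2 * \<alpha> + 1)))) = C3 * lam * (N powr (- (2 * \<alpha> + 1)) * N powr (2 * \<alpha> + 1))"
   by (simp add: C3_def mult_ac)
  also have "N powr (- (2 * \<alpha> + 1)) * N powr (2 * \<alpha> + 1) = 1"
   using N by (simp flip: powr_add)
  finally have main: "(1 - x) powr ?h * En <= C3 * lam" by simp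
  have "(1 - x) powr ?h * (lam * (poly (p n) x)^2) <= (1 - x) powr ?h * En"
   using x2 by (intro mult_left_mono) (auto simp: En_def)
  then have "lam * ((1 - x) powr ?h * (poly (p n) x)^2) <= lam * C3" using main by (simp add: mult_ac)
  then have a: "(1 - x) powr ?h * (poly (p n) x)^2 <= C3" using lam by (subst (asm) mult_le_cancel_left_pos) auto
  have "(1 - x) powr ?h * ((1 - x^2) * (poly (pderiv (p n)) x)^2) <= (1 - x) powr ?h * En"
   using lam by (intro mult_left_mono) (auto simp: En_def)
  also have "... <= C3 * lam" by (rule main)
  also have "... <= C3 * ((2 + \<alpha> + \<beta>) * N^2)" using lam C3 by (intro mult_left_mono) auto
  finally have b: "(1 - x) powr ?h * ((1 - x^2) * (poly (pderiv (p n)) x)^2) <= C3 * (2 + \<alpha> + \<beta>) * N^2" by (simp add: mult_ac)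
  have "lam * (poly (p n) x)^2 <= En" using x2 by (auto simp: En_def)
  also have "En <= exp (2 * \<beta> + 1) * (lam * (poly (p n) 1)^2)"
   unfolding En_def by (rule jacobi_energy_near_1[OF ab lam(1) _ x]) (use ode_pointwise lam_def in auto)
  finally have "lam * (poly (p n) x)^2 <= lam * (exp (2 * \<beta> + 1) * (poly (p n) 1)^2)" by (simp add: mult_ac)
  then have "(poly (p n) x)^2 <= exp (2 * \<beta> + 1) * (poly (p n) 1)^2" using lam by (subst (asm) mult_le_cancel_left_pos) auto
  also have "... <= exp (2 * \<beta> + 1) * (C1 * N powr (2 * \<alpha> + 1))"
   using C1(2)[of n] by (intro mult_left_mono) (auto simp: N_def)
  finally have c: "(poly (p n) x)^2 <= exp (2 * \<beta> + 1) * C1 * N powr (2 * \<alpha> + 1)" by simp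
  have d1: "C3 <= D" "C3 * (2 + \<alpha> + \<beta>) <= D" "exp (2 * \<beta> + 1) * C1 <= D" using C3 t c0 by (auto simp: D_def)
  show ?thesis
   using a b c mult_right_mono[OF d1(2), of "N^2"] mult_right_mono[OF d1(3), of "N powr (2 * \<alpha> + 1)"] d1(1)
   unfolding N_def[symmetric] by simp
 qed
 moreover have "D > 0" using C3 t c0 by (simp add: D_def add_pos_nonneg)
 ultimately show ?thesis by blast
qed

end

section \<open>Pointwise bounds for the polynomials and for the kernel\<close>

context jacobi_polys
begin

text \<open>The square root of the Jacobi weight times sqrt(1 - x^2), extended by its power formula;
  up to a constant, 1 / \<open>hw\<close> bounds every |p n|.\<close>

definition hw :: "real => real" where
 "hw x = (1 - x) powr (\<alpha> / 2 + 1/4) * (1 + x) powr (\<beta> / 2 + 1/4)"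

lemma hw_pos: "x \<in> Ioo ==> hw x > 0"
 by (simp add: hw_def)

lemma hw_square: "x \<in> {-1..1} ==> (hw x)\<^sup>2 = (1 - x) powr (\<alpha> + 1/2) * (1 + x) powr (\<beta> + 1/2)"
 unfolding hw_def power_mult_distrib power2_eq_square powr_add[symmetric] mult.assoc[symmetric]
 by (simp add: powr_add[symmetric] mult_ac)

lemma le_of_square_le: "a^2 <= b^2 ==> 0 <= b ==> \<bar>a\<bar> <= b" for a b :: real
 by (metis abs_le_square_iff abs_of_nonneg)

lemma ker_reflect: "(\<Sum>j\<le>n. poly (pcompose (p j) [:0, -1:]) x * poly (pcompose (p j) [:0, -1:]) y) = ker n (- x) (- y)"
 by (simp add: ker_def poly_pcompose)

text \<open>Each half of the interval is handled by \<open>half_bounds\<close>, for the polynomials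
  or for their reflections. The factor of \<open>hw\<close> belonging to the other endpoint is
  bounded by K.\<close>

lemma square_bounds:
 assumes ab: "\<alpha> >= -1/2" "\<beta> >= -1/2"
 shows "\<exists>C>0. \<forall>n. \<forall>x\<in>{-1..1}. (hw x * poly (p n) x)\<^sup>2 <= C \<and>
   (hw x)\<^sup>2 * ((1 - x^2) * (poly (pderiv (p n)) x)^2) <= C * (real (Suc n))^2 \<and>
   (x >= 0 --> (poly (p n) x)\<^sup>2 <= C * real (Suc n) powr (2 * \<alpha> + 1)) \<and>
   (x <= 0 --> (poly (p n) x)\<^sup>2 <= C * real (Suc n) powr (2 * \<beta> + 1))"
proof -
 let ?h = "\<alpha> + 1/2"
 interpret R: jacobi_polys \<beta> \<alpha> "\<lambda>q. J (pcompose q [:0, -1:])" "\<lambda>n. pcompose (p n) [:0, -1:]"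
  by (rule reflect)
 obtain C1 where C1: "C1 > 0" "\<And>n x. x \<in> {0..1} ==> (1 - x) powr ?h * (poly (p n) x)^2 <= C1 \<and>
   (1 - x) powr ?h * ((1 - x^2) * (poly (pderiv (p n)) x)^2) <= C1 * (real (Suc n))^2 \<and>
   (poly (p n) x)\<^sup>2 <= C1 * real (Suc n) powr (2 * \<alpha> + 1)"
  using half_bounds[OF ab] by blast
 obtain C2 where C2: "C2 > 0" "\<And>n x. x \<in> {0..1} ==> (1 - x) powr (\<beta> + 1/2) * (poly (pcompose (p n) [:0, -1:]) x)^2 <= C2 \<and>
   (1 - x) powr (\<beta> + 1/2) * ((1 - x^2) * (poly (pderiv (pcompose (p n) [:0, -1:])) x)^2) <= C2 * (real (Suc n))^2 \<and>
   (poly (pcompose (p n) [:0, -1:]) x)\<^sup>2 <= C2 * real (Suc n) powr (2 * \<beta> + 1)"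
  using R.half_bounds[OF ab(2,1)] by blast
 have C2': "(1 + x) powr (\<beta> + 1/2) * (poly (p n) x)^2 <= C2 \<and>
   (1 + x) powr (\<beta> + 1/2) * ((1 - x^2) * (poly (pderiv (p n)) x)^2) <= C2 * (real (Suc n))^2 \<and>
   (poly (p n) x)\<^sup>2 <= C2 * real (Suc n) powr (2 * \<beta> + 1)" if "x \<in> {-1..0}" for n x
  using C2(2)[of "- x" n] that unfolding pderiv_reflect by (simp add: poly_pcompose)
 define K where "K = 2 powr ?h + 2 powr (\<beta> + 1/2) + 1"
 have K: "K >= 1" "2 powr ?h <= K" "2 powr (\<beta> + 1/2) <= K" by (auto simp: K_def)
 define D where "D = K * (C1 + C2)"
 have D: "D > 0" "C1 <= D" "C2 <= D"
 proof -
  show "D > 0" using K C1 C2 by (simp add: D_def)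
  have "1 * (C1 + C2) <= D" unfolding D_def using K C1 C2 by (intro mult_right_mono) auto
  then show "C1 <= D" "C2 <= D" using C1 C2 by auto
 qed
 have comb: "A * B * X <= D * Y" if "A * X <= C * Y" "0 <= A" "0 <= X" "0 <= B" "B <= K" "0 < C" "C <= C1 + C2" "0 <= Y" for A B X Y C
 proof -
  have "A * B * X = B * (A * X)" by simp
  also have "... <= K * (C * Y)" using mult_mono[OF that(5) that(1)] that(2,3) K by simp
  also have "... <= K * ((C1 + C2) * Y)" using that K by (intro mult_left_mono mult_right_mono) auto
  finally show ?thesis by (simp add: D_def mult_ac)
 qed
 have "(hw x * poly (p n) x)^2 <= D \<and>
   (hw x)\<^sup>2 * ((1 - x^2) * (poly (pderiv (p n)) x)^2) <= D * (real (Suc n))^2 \<and>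
   (x >= 0 --> (poly (p n) x)\<^sup>2 <= D * real (Suc n) powr (2 * \<alpha> + 1)) \<and>
   (x <= 0 --> (poly (p n) x)\<^sup>2 <= D * real (Suc n) powr (2 * \<beta> + 1))" if x: "x \<in> {-1..1}" for n x
 proof (intro conjI impI)
  have x2: "1 - x^2 >= 0" using x by (simp add: abs_square_le_1 abs_le_iff)
  have ple: "(1 + x) powr (\<beta> + 1/2) <= K" "(1 - x) powr ?h <= K"
  proof -
   have "(1 + x) powr (\<beta> + 1/2) <= 2 powr (\<beta> + 1/2)" "(1 - x) powr ?h <= 2 powr ?h"
    using x ab by (auto intro!: powr_mono2)
   then show "(1 + x) powr (\<beta> + 1/2) <= K" "(1 - x) powr ?h <= K" using K by auto
  qed
  show "(hw x * poly (p n) x)^2 <= D"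
  proof (cases "x >= 0")
   case True
   have "(1 - x) powr ?h * (1 + x) powr (\<beta> + 1/2) * (poly (p n) x)^2 <= D * 1"
    by (rule comb[of _ _ C1]) (use C1 C2 C1(2)[of x n] True x ple in auto)
   then show ?thesis by (simp only: power_mult_distrib hw_square[OF x] mult_1_right)
  next
   case False
   have "(1 + x) powr (\<beta> + 1/2) * (1 - x) powr ?h * (poly (p n) x)^2 <= D * 1"
    by (rule comb[of _ _ C2]) (use C1 C2 C2'[of x n] False x ple in auto)
   then show ?thesis by (simp only: power_mult_distrib hw_square[OF x] mult_1_right mult_ac)
  qed
  show "(hw x)^2 * ((1 - x^2) * (poly (pderiv (p n)) x)^2) <= D * (real (Suc n))^2"
  proof (cases "x >= 0")
   case True
   show ?thesis unfolding hw_square[OF x]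
    by (rule comb[of _ _ C1]) (use C1 C2 C1(2)[of x n] True x ple x2 in auto)
  next
   case False
   show ?thesis unfolding hw_square[OF x] mult.commute[of "(1 - x) powr ?h"]
    by (rule comb[of _ _ C2]) (use C1 C2 C2'[of x n] False x ple x2 in auto)
  qed
  show "(poly (p n) x)^2 <= D * real (Suc n) powr (2 * \<alpha> + 1)" if "0 <= x"
  proof -
   have "(poly (p n) x)^2 <= C1 * real (Suc n) powr (2 * \<alpha> + 1)" using C1(2)[of x n] that x by auto
   also have "... <= D * real (Suc n) powr (2 * \<alpha> + 1)" using D by (intro mult_right_mono) auto
   finally show ?thesis .
  qed
  show "(poly (p n) x)^2 <= D * real (Suc n) powr (2 * \<beta> + 1)" if "x <= 0"
  proof -
   have "(poly (p n) x)^2 <= C2 * real (Suc n) powr (2 * \<beta> + 1)" using C2'[of x n] that x by auto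
   also have "... <= D * real (Suc n) powr (2 * \<beta> + 1)" using D by (intro mult_right_mono) auto
   finally show ?thesis .
  qed
 qed
 then show ?thesis using D by blast
qed

lemma pointwise_bounds:
 assumes ab: "\<alpha> >= -1/2" "\<beta> >= -1/2"
 shows "\<exists>C>0. \<forall>n. \<forall>x\<in>{-1..1}. \<bar>poly (p n) x\<bar> * hw x <= C \<and>
   \<bar>poly (pderiv (p n)) x\<bar> * (sqrt (1 - x^2) * hw x) <= C * real (Suc n) \<and>
   (x >= 0 --> \<bar>poly (p n) x\<bar> <= C * real (Suc n) powr (\<alpha> + 1/2)) \<and>
   (x <= 0 --> \<bar>poly (p n) x\<bar> <= C * real (Suc n) powr (\<beta> + 1/2))"
proof -
 obtain C where C: "C > 0" "\<And>n x. x \<in> {-1..1} ==> (hw x * poly (p n) x)\<^sup>2 <= C \<and>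
   (hw x)\<^sup>2 * ((1 - x^2) * (poly (pderiv (p n)) x)^2) <= C * (real (Suc n))^2 \<and>
   (x >= 0 --> (poly (p n) x)\<^sup>2 <= C * real (Suc n) powr (2 * \<alpha> + 1)) \<and>
   (x <= 0 --> (poly (p n) x)\<^sup>2 <= C * real (Suc n) powr (2 * \<beta> + 1))"
  using square_bounds[OF ab] by blast
 have s: "sqrt C > 0" "(sqrt C)^2 = C" using C by auto
 have h0: "hw x >= 0" for x by (simp add: hw_def)
 have pw: "(real (Suc n) powr (c + 1/2))^2 = real (Suc n) powr (2 * c + 1)" for n c
  unfolding power2_eq_square powr_add[symmetric] by (simp add: algebra_simps)
 have "\<bar>poly (p n) x\<bar> * hw x <= sqrt C \<and>
   \<bar>poly (pderiv (p n)) x\<bar> * (sqrt (1 - x^2) * hw x) <= sqrt C * real (Suc n) \<and>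
   (x >= 0 --> \<bar>poly (p n) x\<bar> <= sqrt C * real (Suc n) powr (\<alpha> + 1/2)) \<and>
   (x <= 0 --> \<bar>poly (p n) x\<bar> <= sqrt C * real (Suc n) powr (\<beta> + 1/2))" if x: "x \<in> {-1..1}" for n x
 proof (intro conjI impI)
  have x2: "1 - x^2 >= 0" using x by (simp add: abs_square_le_1 abs_le_iff)
  have "\<bar>hw x * poly (p n) x\<bar> <= sqrt C"
   by (rule le_of_square_le) (use C(2)[OF x, of n] s in auto)
  then show "\<bar>poly (p n) x\<bar> * hw x <= sqrt C" using h0[of x] by (simp add: abs_mult mult.commute)
  have "\<bar>poly (pderiv (p n)) x * (sqrt (1 - x^2) * hw x)\<bar> <= sqrt C * real (Suc n)"
   by (rule le_of_square_le) (use C(2)[OF x, of n] s x2 in \<open>auto simp: power_mult_distrib mult_ac\<close>)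
  then show "\<bar>poly (pderiv (p n)) x\<bar> * (sqrt (1 - x^2) * hw x) <= sqrt C * real (Suc n)"
   using h0[of x] x2 by (simp add: abs_mult)
  show "\<bar>poly (p n) x\<bar> <= sqrt C * real (Suc n) powr (\<alpha> + 1/2)" if "0 <= x"
   by (rule le_of_square_le) (use C(2)[OF x, of n] s that in \<open>auto simp: power_mult_distrib pw simp del: of_nat_Suc\<close>)
  show "\<bar>poly (p n) x\<bar> <= sqrt C * real (Suc n) powr (\<beta> + 1/2)" if "x <= 0"
   by (rule le_of_square_le) (use C(2)[OF x, of n] s that in \<open>auto simp: power_mult_distrib pw simp del: of_nat_Suc\<close>)
 qed
 then show ?thesis using s by blast
qed

text \<open>The first bound sums n + 1 terms of bounded size. The second is Pollard's decomposition
  with one variable fixed inside the interval: all three terms are O(n), as is the factor on the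
  left. The derivative bound at x is applicable because 1 - x^2 <= sqrt(1 - x^2).\<close>

lemma ker_interior_bounds:
 assumes ab: "\<alpha> >= -1/2" "\<beta> >= -1/2" and a: "a \<in> Ioo"
 shows "\<exists>C>0. \<forall>n. \<forall>x\<in>Ioo. \<bar>ker n x a\<bar> * hw x <= C * real (Suc n) \<and> \<bar>x - a\<bar> * \<bar>ker n x a\<bar> * hw x <= C"
proof -
 obtain C where C: "C > 0" "\<And>n x. x \<in> {-1..1} ==> \<bar>poly (p n) x\<bar> * hw x <= C \<and>
   \<bar>poly (pderiv (p n)) x\<bar> * (sqrt (1 - x^2) * hw x) <= C * real (Suc n)"
  using pointwise_bounds[OF ab] by blast
 have ha: "hw a > 0" by (rule hw_pos[OF a])
 have a2: "1 - a^2 > 0" using a by (auto simp: abs_square_less_1)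
 define A where "A = C / hw a"
 have A: "A > 0" using C ha by (simp add: A_def)
 have pa: "\<bar>poly (p n) a\<bar> <= A" for n using C(2)[of a n] ha a by (simp add: A_def field_simps)
 define A' where "A' = C * (1 - a^2) / (sqrt (1 - a^2) * hw a)"
 have A': "A' > 0" using C ha a2 by (simp add: A'_def)
 have p'a: "(1 - a^2) * \<bar>poly (pderiv (p n)) a\<bar> <= A' * real (Suc n)" for n
 proof -
  have "\<bar>poly (pderiv (p n)) a\<bar> <= C * real (Suc n) / (sqrt (1 - a^2) * hw a)"
   using C(2)[of a n] ha a a2 by (simp add: pos_le_divide_eq)
  then have "(1 - a^2) * \<bar>poly (pderiv (p n)) a\<bar> <= (1 - a^2) * (C * real (Suc n) / (sqrt (1 - a^2) * hw a))"
   using a2 by (intro mult_left_mono) auto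
  then show ?thesis by (simp add: A'_def mult_ac)
 qed
 define D where "D = C * A + C * A' + A * C + 2 * (C * A)"
 have D: "D > 0" unfolding D_def using C A A' by (intro add_pos_pos mult_pos_pos) auto
 have "\<bar>ker n x a\<bar> * hw x <= D * real (Suc n) \<and> \<bar>x - a\<bar> * \<bar>ker n x a\<bar> * hw x <= D" if x: "x \<in> Ioo" for n x
 proof
  have x': "x \<in> {-1..1}" using x by auto
  have hx: "hw x > 0" by (rule hw_pos[OF x])
  have "\<bar>ker n x a\<bar> * hw x <= (\<Sum>j\<le>n. \<bar>poly (p j) x * poly (p j) a\<bar>) * hw x"
   unfolding ker_def using hx by (intro mult_right_mono sum_abs) auto
  also have "... = (\<Sum>j\<le>n. (\<bar>poly (p j) x\<bar> * hw x) * \<bar>poly (p j) a\<bar>)"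
   unfolding sum_distrib_right by (intro sum.cong) (auto simp: abs_mult mult_ac)
  also have "... <= (\<Sum>j\<le>n. C * A)"
   using C(1) C(2)[OF x'] pa A hx by (intro sum_mono mult_mono) auto
  also have "... = C * A * real (Suc n)" by simp
  also have "... <= D * real (Suc n)"
   using C A A' by (intro mult_right_mono) (auto simp: D_def)
  finally show "\<bar>ker n x a\<bar> * hw x <= D * real (Suc n)" .
  define N where "N = real (Suc n)"
  define P where "P = poly (p (Suc n))"
  define P' where "P' = poly (pderiv (p (Suc n)))"
  have N1: "N >= 1" by (simp add: N_def)
  have x2: "1 - x^2 > 0" using x by (auto simp: abs_square_less_1)
  have xs: "1 - x^2 <= sqrt (1 - x^2)" using x2 real_le_rsqrt[of "1 - x^2" "1 - x^2"]
   by (simp add: power2_eq_square mult_left_le)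
  have Pb: "\<bar>P x\<bar> * hw x <= C" using C(2)[OF x', of "Suc n"] by (simp add: P_def)
  have P'b: "\<bar>P' x\<bar> * (1 - x^2) * hw x <= C * (N + 1)"
  proof -
   have "\<bar>P' x\<bar> * (1 - x^2) * hw x <= \<bar>P' x\<bar> * sqrt (1 - x^2) * hw x"
    using xs hx by (intro mult_right_mono mult_left_mono) auto
   then show ?thesis using C(2)[OF x', of "Suc n"] by (simp add: P'_def N_def mult_ac)
  qed
  have pol: "(2 * N + 1 + \<alpha> + \<beta>) * ((x - a) * ker n x a) = P x * ((1 - a^2) * P' a) - P a * ((1 - x^2) * P' x) - N * (x - a) * (P x * P a)"
   using pollard[of n x a] by (simp add: P_def P'_def N_def)
  have "(2 * N) * (\<bar>x - a\<bar> * \<bar>ker n x a\<bar> * hw x) <= (2 * N + 1 + \<alpha> + \<beta>) * (\<bar>x - a\<bar> * \<bar>ker n x a\<bar> * hw x)"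
   using hx ab by (intro mult_right_mono) auto
  also have "... = \<bar>(2 * N + 1 + \<alpha> + \<beta>) * ((x - a) * ker n x a)\<bar> * hw x"
   using N1 ab by (simp add: abs_mult mult_ac)
  also have "... <= (\<bar>P x\<bar> * ((1 - a^2) * \<bar>P' a\<bar>) + \<bar>P a\<bar> * ((1 - x^2) * \<bar>P' x\<bar>) + N * \<bar>x - a\<bar> * (\<bar>P x\<bar> * \<bar>P a\<bar>)) * hw x"
  proof (rule mult_right_mono)
   have t: "\<bar>u - v - w\<bar> <= \<bar>u\<bar> + \<bar>v\<bar> + \<bar>w\<bar>" for u v w :: real by linarith
   show "\<bar>(2 * N + 1 + \<alpha> + \<beta>) * ((x - a) * ker n x a)\<bar> <= \<bar>P x\<bar> * ((1 - a^2) * \<bar>P' a\<bar>) + \<bar>P a\<bar> * ((1 - x^2) * \<bar>P' x\<bar>) + N * \<bar>x - a\<bar> * (\<bar>P x\<bar> * \<bar>P a\<bar>)"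
    unfolding pol using t[of "P x * ((1 - a^2) * P' a)" "P a * ((1 - x^2) * P' x)" "N * (x - a) * (P x * P a)"] a2 x2 N1
    by (simp add: abs_mult)
  qed (use hx in auto)
  also have "... = (\<bar>P x\<bar> * hw x) * ((1 - a^2) * \<bar>P' a\<bar>) + \<bar>P a\<bar> * (\<bar>P' x\<bar> * (1 - x^2) * hw x) + N * (\<bar>x - a\<bar> * ((\<bar>P x\<bar> * hw x) * \<bar>P a\<bar>))"
   by (simp add: algebra_simps)
  also have "... <= C * (A' * (N + 1)) + A * (C * (N + 1)) + N * (2 * (C * A))"
  proof -
   have N2: "real (Suc (Suc n)) = N + 1" by (simp add: N_def)
   have "(\<bar>P x\<bar> * hw x) * ((1 - a^2) * \<bar>P' a\<bar>) <= C * (A' * (N + 1))"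
    by (rule mult_mono[OF Pb]) (use p'a[of "Suc n"] C a2 N2 in \<open>auto simp: P'_def simp del: of_nat_Suc\<close>)
   moreover have "\<bar>P a\<bar> * (\<bar>P' x\<bar> * (1 - x^2) * hw x) <= A * (C * (N + 1))"
    by (rule mult_mono[OF _ P'b]) (use pa[of "Suc n"] A x2 hx in \<open>auto simp: P_def\<close>)
   moreover have "(\<bar>P x\<bar> * hw x) * \<bar>P a\<bar> <= C * A"
    by (rule mult_mono[OF Pb]) (use pa[of "Suc n"] C in \<open>auto simp: P_def\<close>)
   then have "\<bar>x - a\<bar> * ((\<bar>P x\<bar> * hw x) * \<bar>P a\<bar>) <= 2 * (C * A)"
    by (rule mult_mono[rotated]) (use x a hx in auto)
   then have "N * (\<bar>x - a\<bar> * ((\<bar>P x\<bar> * hw x) * \<bar>P a\<bar>)) <= N * (2 * (C * A))"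
    using N1 by (intro mult_left_mono) auto
   ultimately show ?thesis by linarith
  qed
  also have "... <= 2 * N * D"
  proof -
   have "C * (A' * (N + 1)) <= C * (A' * (2 * N))" "A * (C * (N + 1)) <= A * (C * (2 * N))"
    using C A A' N1 by (auto intro!: mult_left_mono)
   moreover have "N * (2 * (C * A)) <= N * (4 * (C * A))" "0 <= N * (C * A)" using C A N1 by (auto intro!: mult_left_mono)
   ultimately show ?thesis unfolding D_def by (simp add: algebra_simps)
  qed
  finally show "\<bar>x - a\<bar> * \<bar>ker n x a\<bar> * hw x <= D" using N1 by (subst (asm) mult_le_cancel_left_pos) auto
 qed
 then show ?thesis using D by blast
qed

text \<open>The first and third bounds come from the endpoint formula, whose left factor of order n
  compensates the derivative or the factor n on the right. The second bound sums n + 1 products of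
  size n^(2 \<alpha> + 1).\<close>

lemma ker_at_1_bounds:
 assumes ab: "\<alpha> >= -1/2" "\<beta> >= -1/2"
 shows "\<exists>C>0. \<forall>n. (\<forall>x\<in>Ioo. \<bar>ker n x 1\<bar> * (sqrt (1 - x) * hw x) <= C * real (Suc n) powr (\<alpha> + 1/2)) \<and>
   (\<forall>x\<in>{0..1}. \<bar>ker n x 1\<bar> <= C * real (Suc n) powr (2 * \<alpha> + 2)) \<and>
   \<bar>ker n (-1) 1\<bar> <= C * real (Suc n) powr (\<alpha> + \<beta> + 1)"
proof -
 let ?h = "\<alpha> + 1/2"
 obtain C where C: "C > 0" "\<And>n x. x \<in> {-1..1} ==> \<bar>poly (p n) x\<bar> * hw x <= C \<and>
   \<bar>poly (pderiv (p n)) x\<bar> * (sqrt (1 - x^2) * hw x) <= C * real (Suc n) \<and>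
   (x >= 0 --> \<bar>poly (p n) x\<bar> <= C * real (Suc n) powr ?h) \<and>
   (x <= 0 --> \<bar>poly (p n) x\<bar> <= C * real (Suc n) powr (\<beta> + 1/2))"
  using pointwise_bounds[OF ab] by metis
 define D where "D = C * 2 powr ?h * (4 * C) + C * C + C * 2 powr ?h * (C * 2 powr (\<beta> + 1/2))"
 have Dpos: "C * 2 powr ?h * (4 * C) > 0" "C * C > 0" "C * 2 powr ?h * (C * 2 powr (\<beta> + 1/2)) > 0" using C by auto
 have D: "D > 0" "C * 2 powr ?h * (4 * C) <= D" "C * C <= D" "C * 2 powr ?h * (C * 2 powr (\<beta> + 1/2)) <= D"
  unfolding D_def using Dpos by linarith+
 \<comment> \<open>The endpoint formula involves \<open>p (Suc n)\<close>; passing from n + 2 to n +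
   1 in its bounds costs only a constant factor.\<close>
 have two: "real (Suc (Suc n)) powr c <= 2 powr c * real (Suc n) powr c" if "c >= 0" for n c
 proof -
  have "real (Suc (Suc n)) powr c <= (2 * real (Suc n)) powr c" using that by (intro powr_mono2) auto
  also have "... = 2 powr c * real (Suc n) powr c" by (rule powr_mult)
  finally show ?thesis .
 qed
 have P1: "\<bar>poly (p (Suc n)) 1\<bar> <= C * (2 powr ?h * real (Suc n) powr ?h)" for n
 proof -
  have "\<bar>poly (p (Suc n)) 1\<bar> <= C * real (Suc (Suc n)) powr ?h" using C(2)[of 1 "Suc n"] by auto
  also have "... <= C * (2 powr ?h * real (Suc n) powr ?h)"
   using C ab by (intro mult_left_mono two) auto
  finally show ?thesis .
 qed
 have Pm1: "\<bar>poly (p (Suc n)) (-1)\<bar> <= C * (2 powr (\<beta> + 1/2) * real (Suc n) powr (\<beta> + 1/2))" for n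
 proof -
  have "\<bar>poly (p (Suc n)) (-1)\<bar> <= C * real (Suc (Suc n)) powr (\<beta> + 1/2)" using C(2)[of "-1" "Suc n"] by auto
  also have "... <= C * (2 powr (\<beta> + 1/2) * real (Suc n) powr (\<beta> + 1/2))"
   using C ab by (intro mult_left_mono two) auto
  finally show ?thesis .
 qed
 have "(\<forall>x\<in>Ioo. \<bar>ker n x 1\<bar> * (sqrt (1 - x) * hw x) <= D * real (Suc n) powr ?h) \<and>
   (\<forall>x\<in>{0..1}. \<bar>ker n x 1\<bar> <= D * real (Suc n) powr (2 * \<alpha> + 2)) \<and>
   \<bar>ker n (-1) 1\<bar> <= D * real (Suc n) powr (\<alpha> + \<beta> + 1)" for n
 proof (intro conjI ballI)
  define N where "N = real (Suc n)"
  define P where "P = poly (p (Suc n))"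
  define P' where "P' = poly (pderiv (p (Suc n)))"
  have N1: "N >= 1" by (simp add: N_def)
  have ep: "(2 * N + 1 + \<alpha> + \<beta>) * ker n x 1 = P 1 * ((1 + x) * P' x - N * P x)" for x
   using ker_endpoint[of n x] by (simp add: P_def P'_def N_def)
  have ep2: "(2 * N) * \<bar>ker n x 1\<bar> <= \<bar>P 1\<bar> * \<bar>(1 + x) * P' x - N * P x\<bar>" for x
  proof -
   have "(2 * N) * \<bar>ker n x 1\<bar> <= (2 * N + 1 + \<alpha> + \<beta>) * \<bar>ker n x 1\<bar>" using ab by (intro mult_right_mono) auto
   also have "... = \<bar>(2 * N + 1 + \<alpha> + \<beta>) * ker n x 1\<bar>" using ab N1 by (simp add: abs_mult)
   finally show ?thesis unfolding ep by (simp add: abs_mult)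
  qed
  {
   fix x assume x: "x \<in> {-1<..<1::real}"
   then have x': "x \<in> {-1..1}" by auto
   have hx: "hw x > 0" by (rule hw_pos[OF x])
   have sq: "sqrt (1 - x^2) = sqrt (1 - x) * sqrt (1 + x)"
    by (simp add: power2_eq_square algebra_simps flip: real_sqrt_mult)
   have s2: "sqrt (1 + x) <= 2" "sqrt (1 - x) <= 2" using x by (auto intro!: real_le_lsqrt)
   have "(2 * N) * (\<bar>ker n x 1\<bar> * (sqrt (1 - x) * hw x)) = ((2 * N) * \<bar>ker n x 1\<bar>) * (sqrt (1 - x) * hw x)" by simp
   also have "... <= (\<bar>P 1\<bar> * \<bar>(1 + x) * P' x - N * P x\<bar>) * (sqrt (1 - x) * hw x)"
    using ep2 hx x by (intro mult_right_mono) auto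
   also have "... <= (\<bar>P 1\<bar> * ((1 + x) * \<bar>P' x\<bar> + N * \<bar>P x\<bar>)) * (sqrt (1 - x) * hw x)"
   proof (intro mult_right_mono mult_left_mono)
    show "\<bar>(1 + x) * P' x - N * P x\<bar> <= (1 + x) * \<bar>P' x\<bar> + N * \<bar>P x\<bar>"
     using abs_triangle_ineq4[of "(1 + x) * P' x" "N * P x"] x N1 by (simp add: abs_mult)
   qed (use hx x in auto)
   also have "... = \<bar>P 1\<bar> * (sqrt (1 + x) * (\<bar>P' x\<bar> * (sqrt (1 - x^2) * hw x)) + N * (sqrt (1 - x) * (\<bar>P x\<bar> * hw x)))"
   proof -
    have e: "1 + x = sqrt (1 + x) * sqrt (1 + x)" using x by simp
    have "(U * ((r * r) * V + N * W)) * (q * h) = U * (r * (V * ((q * r) * h)) + N * (q * (W * h)))"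
     for U V W r q h :: real by (simp add: algebra_simps)
    then show ?thesis unfolding sq by (subst e)
   qed
   also have "... <= (C * (2 powr ?h * N powr ?h)) * (2 * (C * (N + 1)) + N * (2 * C))"
   proof (rule mult_mono)
    have N2: "real (Suc (Suc n)) = N + 1" by (simp add: N_def)
    have "sqrt (1 + x) * (\<bar>P' x\<bar> * (sqrt (1 - x^2) * hw x)) <= 2 * (C * (N + 1))"
     by (rule mult_mono[OF s2(1)])
       (use C(2)[OF x', of "Suc n"] N2 hx x' in \<open>auto simp: P'_def abs_square_le_1 abs_le_iff simp del: of_nat_Suc\<close>)
    moreover have "sqrt (1 - x) * (\<bar>P x\<bar> * hw x) <= 2 * C"
     by (rule mult_mono[OF s2(2)]) (use C(2)[OF x', of "Suc n"] hx in \<open>auto simp: P_def\<close>)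
    then have "N * (sqrt (1 - x) * (\<bar>P x\<bar> * hw x)) <= N * (2 * C)" using N1 by (intro mult_left_mono) auto
    ultimately show "sqrt (1 + x) * (\<bar>P' x\<bar> * (sqrt (1 - x^2) * hw x)) + N * (sqrt (1 - x) * (\<bar>P x\<bar> * hw x)) <= 2 * (C * (N + 1)) + N * (2 * C)"
     by linarith
    show "\<bar>P 1\<bar> <= C * (2 powr ?h * N powr ?h)" using P1[of n] by (simp add: P_def N_def)
    show "0 <= sqrt (1 + x) * (\<bar>P' x\<bar> * (sqrt (1 - x^2) * hw x)) + N * (sqrt (1 - x) * (\<bar>P x\<bar> * hw x))"
     using x' hx N1 by (intro add_nonneg_nonneg mult_nonneg_nonneg) (auto simp: abs_square_le_1 abs_le_iff)
   qed (use C in auto)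
   also have "... <= (C * (2 powr ?h * N powr ?h)) * (2 * N * (4 * C))"
   proof (intro mult_left_mono)
    have "C <= C * N" "0 <= C * N" using C N1 by simp_all
    then show "2 * (C * (N + 1)) + N * (2 * C) <= 2 * N * (4 * C)" by (simp add: algebra_simps)
   qed (use C in auto)
   also have "... = (2 * N) * ((C * 2 powr ?h * (4 * C)) * N powr ?h)" by (simp add: mult_ac)
   also have "... <= (2 * N) * (D * N powr ?h)"
    using D N1 by (intro mult_left_mono mult_right_mono) auto
   finally show "\<bar>ker n x 1\<bar> * (sqrt (1 - x) * hw x) <= D * real (Suc n) powr ?h"
    using N1 unfolding N_def[symmetric] by (subst (asm) mult_le_cancel_left_pos) auto
  }
  {
   fix x assume x: "x \<in> {0..1::real}"
   then have x': "x \<in> {-1..1}" by auto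
   have pj: "\<bar>poly (p j) y\<bar> <= C * N powr ?h" if "j <= n" "y \<in> {0..1}" for j y
   proof -
    have "\<bar>poly (p j) y\<bar> <= C * real (Suc j) powr ?h" using C(2)[of y j] that by auto
    also have "... <= C * N powr ?h"
     using C ab that by (intro mult_left_mono powr_mono2) (auto simp: N_def)
    finally show ?thesis .
   qed
   have "\<bar>ker n x 1\<bar> <= (\<Sum>j\<le>n. \<bar>poly (p j) x\<bar> * \<bar>poly (p j) 1\<bar>)"
    unfolding ker_def by (rule order_trans[OF sum_abs]) (simp add: abs_mult)
   also have "... <= (\<Sum>j\<le>n. (C * N powr ?h) * (C * N powr ?h))"
    using pj x C by (intro sum_mono mult_mono) auto
   also have "... = C * C * (N powr 1 * N powr ?h * N powr ?h)" using N1 by (simp add: N_def mult_ac)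
   also have "N powr 1 * N powr ?h * N powr ?h = N powr (2 * \<alpha> + 2)"
    unfolding powr_add[symmetric] by (simp add: algebra_simps)
   also have "C * C * N powr (2 * \<alpha> + 2) <= D * N powr (2 * \<alpha> + 2)" using D by (intro mult_right_mono) auto
   finally show "\<bar>ker n x 1\<bar> <= D * real (Suc n) powr (2 * \<alpha> + 2)" by (simp add: N_def)
  }
  have "(2 * N) * \<bar>ker n (-1) 1\<bar> <= \<bar>P 1\<bar> * (N * \<bar>P (-1)\<bar>)"
   using ep2[of "-1"] N1 by (simp add: abs_mult)
  also have "... <= (C * (2 powr ?h * N powr ?h)) * (N * (C * (2 powr (\<beta> + 1/2) * N powr (\<beta> + 1/2))))"
  proof (rule mult_mono)
   show "\<bar>P 1\<bar> <= C * (2 powr ?h * N powr ?h)" using P1[of n] by (simp add: P_def N_def)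
   show "N * \<bar>P (-1)\<bar> <= N * (C * (2 powr (\<beta> + 1/2) * N powr (\<beta> + 1/2)))"
    using Pm1[of n] N1 by (intro mult_left_mono) (auto simp: P_def N_def)
  qed (use C N1 in auto)
  also have "... = N * (C * 2 powr ?h * (C * 2 powr (\<beta> + 1/2)) * (N powr ?h * N powr (\<beta> + 1/2)))" by (simp add: mult_ac)
  also have "N powr ?h * N powr (\<beta> + 1/2) = N powr (\<alpha> + \<beta> + 1)"
   unfolding powr_add[symmetric] by (simp add: algebra_simps)
  also have "N * (C * 2 powr ?h * (C * 2 powr (\<beta> + 1/2)) * N powr (\<alpha> + \<beta> + 1)) <= N * (D * N powr (\<alpha> + \<beta> + 1))"
   using D N1 by (intro mult_left_mono mult_right_mono) auto
  finally have "N * (2 * \<bar>ker n (-1) 1\<bar>) <= N * (D * N powr (\<alpha> + \<beta> + 1))" by (simp add: mult_ac)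
  then have "2 * \<bar>ker n (-1) 1\<bar> <= D * N powr (\<alpha> + \<beta> + 1)"
   using N1 by (subst (asm) mult_le_cancel_left_pos) auto
  then show "\<bar>ker n (-1) 1\<bar> <= D * real (Suc n) powr (\<alpha> + \<beta> + 1)" unfolding N_def[symmetric] by linarith
 qed
 then show ?thesis using D by blast
qed

text \<open>The confluent case of \<open>pollard\<close>: for fixed y = a both sides are polynomials
  in x, and their derivatives at x = a are compared.\<close>

lemma ker_diag_formula:
 "(2 * real (Suc n) + 1 + \<alpha> + \<beta>) * ker n a a =
   (1 - a^2) * (poly (pderiv (p (Suc n))) a)^2
   - poly (p (Suc n)) a * ((1 - a^2) * poly (pderiv (pderiv (p (Suc n)))) a - 2 * a * poly (pderiv (p (Suc n))) a)
   - real (Suc n) * (poly (p (Suc n)) a)^2"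
proof -
 define P where "P = p (Suc n)"
 define c where "c = 2 * real (Suc n) + 1 + \<alpha> + \<beta>"
 define K where "K = (\<Sum>j\<le>n. smult (poly (p j) a) (p j))"
 have K: "poly K x = ker n x a" for x by (simp add: K_def ker_def poly_sum mult.commute)
 define L where "L = [:- a, 1:] * smult c K"
 define R where "R = smult ((1 - a^2) * poly (pderiv P) a) P - smult (poly P a) ([:1, 0, -1:] * pderiv P) - smult (real (Suc n) * poly P a) ([:- a, 1:] * P)"
 have "poly L x = poly R x" for x
 proof -
  have "poly L x = c * ((x - a) * ker n x a)" by (simp add: L_def K algebra_simps)
  also have "... = poly R x"
   unfolding c_def pollard[of n x a] R_def P_def by (simp add: algebra_simps power2_eq_square)
  finally show ?thesis .
 qed
 then have "L = R" by (simp only: poly_eq_poly_eq_iff[symmetric] fun_eq_iff) simp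
 then have "poly (pderiv L) a = poly (pderiv R) a" by simp
 moreover have "poly (pderiv L) a = c * ker n a a"
  unfolding L_def pderiv_mult by (simp add: pderiv_pCons K)
 moreover have "poly (pderiv R) a = (1 - a^2) * poly (pderiv P) a * poly (pderiv P) a
  - poly P a * ((1 - a^2) * poly (pderiv (pderiv P)) a - 2 * a * poly (pderiv P) a) - real (Suc n) * poly P a * poly P a"
  unfolding R_def pderiv_diff pderiv_smult pderiv_mult
  by (simp add: pderiv_pCons algebra_simps power2_eq_square)
 ultimately show ?thesis by (simp add: P_def c_def power2_eq_square mult_ac)
qed

text \<open>The extremal property of the reciprocal Christoffel function. It makes the diagonal
  kernels of two comparable measures comparable.\<close>

lemma cauchy_schwarz_ker:
 assumes Q: "\<And>i. i > n ==> coeff Q i = 0"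
 shows "(poly Q a)^2 <= ker n a a * J (Q * Q)"
proof -
 define c where "c j = J (Q * p j)" for j
 have Qe: "Q = (\<Sum>j<Suc n. smult (c j) (p j))"
  unfolding c_def by (rule expansion) (use Q in auto)
 have "J (Q * Q) = (\<Sum>j<Suc n. c j * J (Q * p j))"
 proof -
  have "Q * Q = Q * (\<Sum>j<Suc n. smult (c j) (p j))" using Qe by metis
  also have "... = (\<Sum>j<Suc n. smult (c j) (Q * p j))" unfolding sum_distrib_left by simp
  finally show ?thesis by (simp only: J_sum J_smult)
 qed
 then have JQ: "J (Q * Q) = (\<Sum>j\<le>n. (c j)\<^sup>2)" by (simp add: c_def power2_eq_square lessThan_Suc_atMost)
 have "poly Q a = (\<Sum>j\<le>n. c j * poly (p j) a)"
 proof -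
  have "poly Q a = poly (\<Sum>j<Suc n. smult (c j) (p j)) a" using Qe by metis
  then show ?thesis by (simp add: poly_sum lessThan_Suc_atMost)
 qed
 moreover have "(\<Sum>j\<le>n. c j * poly (p j) a)^2 <= (\<Sum>j\<le>n. (c j)\<^sup>2) * (\<Sum>j\<le>n. (poly (p j) a)\<^sup>2)"
  by (rule Cauchy_Schwarz_ineq_sum)
 ultimately show ?thesis by (simp add: JQ ker_def power2_eq_square mult.commute)
qed

end

section \<open>Lower bounds for the kernel on the diagonal\<close>

context jacobi_polys
begin

lemma chebyshev_ker_11:
 assumes ab: "\<alpha> = -1/2" "\<beta> = -1/2"
 shows "ker n 1 1 = (2 * real n + 1) * ker 0 1 1"
proof (induction n)
 case (Suc n)
 have "real (Suc n) * (real (Suc n) - 1/2) * ker (Suc n) 1 1 = (real (Suc n) + 1/2) * real (Suc n) * ker n 1 1"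
  using ker_11_recurrence[of n] ab by simp
 also have "... = (real (Suc n) + 1/2) * real (Suc n) * ((2 * real n + 1) * ker 0 1 1)" by (simp only: Suc.IH)
 also have "... = real (Suc n) * (real (Suc n) - 1/2) * ((2 * real (Suc n) + 1) * ker 0 1 1)"
  by (simp add: algebra_simps)
 finally show ?case by (subst (asm) mult_left_cancel) auto
qed simp

lemma chebyshev_at_1:
 assumes ab: "\<alpha> = -1/2" "\<beta> = -1/2"
 shows "(poly (p (Suc n)) 1)^2 = 2 * ker 0 1 1"
proof -
 have "real (Suc n) * ((2 * real n + 1) * ker 0 1 1) = real (Suc n) * ((real n + 1/2) * (poly (p (Suc n)) 1)^2)"
  using ker_11_square[of n] ab chebyshev_ker_11[OF ab, of n] by (simp add: algebra_simps)
 then have "(2 * real n + 1) * ker 0 1 1 = (real n + 1/2) * (poly (p (Suc n)) 1)^2"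
  by (subst (asm) mult_left_cancel) auto
 then have "(real n + 1/2) * (2 * ker 0 1 1) = (real n + 1/2) * (poly (p (Suc n)) 1)^2" by (simp add: algebra_simps)
 then show ?thesis by (subst (asm) mult_left_cancel) auto
qed

text \<open>For these exponents the coefficient of y'^2 in the derivative of the energy is zero, so
  an identity takes the place of the inequalities of the general case.\<close>

lemma chebyshev_energy:
 assumes ab: "\<alpha> = -1/2" "\<beta> = -1/2"
 shows "(real n)^2 * (poly (p n) x)^2 + (1 - x^2) * (poly (pderiv (p n)) x)^2 = (real n)^2 * (poly (p n) 1)^2"
proof -
 define En where "En x = (real n)^2 * (poly (p n) x)^2 + (1 - x^2) * (poly (pderiv (p n)) x)^2" for x
 have "(En has_real_derivative 0) (at x)" for x
 proof -
  have "(En has_real_derivative (real n)\<^sup>2 * (2 * poly (p n) x * poly (pderiv (p n)) x)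
    + (- 2 * x * (poly (pderiv (p n)) x)^2 + (1 - x^2) * (2 * poly (pderiv (p n)) x * poly (pderiv (pderiv (p n))) x))) (at x)"
   unfolding En_def by (auto intro!: derivative_eq_intros poly_DERIV)
  moreover have "(1 - x^2) * poly (pderiv (pderiv (p n))) x - x * poly (pderiv (p n)) x = - (real n)\<^sup>2 * poly (p n) x"
   using ode_pointwise[of x n] unfolding eigenval_def using ab by (simp add: power2_eq_square)
  then have "(real n)^2 * (2 * poly (p n) x * poly (pderiv (p n)) x)
    + (- 2 * x * (poly (pderiv (p n)) x)^2 + (1 - x^2) * (2 * poly (pderiv (p n)) x * poly (pderiv (pderiv (p n))) x)) = 0"
   by algebra
  ultimately show ?thesis by simp
 qed
 then have "En x = En 1" by (rule DERIV_isconst_all[rule_format, of En]) 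
 then show ?thesis by (simp add: En_def)
qed

text \<open>With the constant energy, the confluent formula becomes 2 N K = 2 k0 N^2 plus terms of
  order N, where N = n + 1 and \<open>k0\<close> is the kernel for n = 0. So K grows linearly once N
  is large; for smaller N the bound K >= \<open>k0\<close> suffices.\<close>

lemma chebyshev_ker_lower:
 assumes ab: "\<alpha> = -1/2" "\<beta> = -1/2" and a: "a \<in> Ioo"
 shows "\<exists>c>0. \<forall>n. c * real (Suc n) <= ker n a a"
proof -
 define k0 where "k0 = ker 0 1 1"
 define t where "t = sqrt (1 - a^2)"
 have a2: "1 - a^2 > 0" using a by (simp add: abs_square_less_1 abs_less_iff)
 have t: "t > 0" "t^2 = 1 - a^2" using a2 by (auto simp: t_def)
 have k0: "k0 > 0" using ker_0_pos by (simp add: k0_def)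
 \<comment> \<open>The terms of order N replace one factor N of the main term by N - (1 + 1/t), and
   this is at least N / 2 from N = B on.\<close>
 define B where "B = 2 * (1 + 1 / t)"
 have B: "B > 0" using t by (simp add: B_def add_pos_pos)
 define c where "c = min (k0 / 2) (k0 / B)"
 have "c * real (Suc n) <= ker n a a" for n
 proof (cases "real (Suc n) >= B")
  case False
  have "c * real (Suc n) <= (k0 / B) * B" using False k0 B by (intro mult_mono) (auto simp: c_def)
  also have "... = ker 0 a a" using B by (simp add: k0_def ker_0)
  also have "... <= ker n a a" by (rule ker_diag_mono) simp
  finally show ?thesis .
 next
  case True
  define N where "N = real (Suc n)"
  define P0 P1 P2 where "P0 = poly (p (Suc n)) a" and "P1 = poly (pderiv (p (Suc n))) a" and "P2 = poly (pderiv (pderiv (p (Suc n)))) a"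
  have N: "N >= 1" by (simp add: N_def)
  have En: "N^2 * P0^2 + t^2 * P1^2 = N^2 * (2 * k0)"
   using chebyshev_energy[OF ab, of "Suc n" a] chebyshev_at_1[OF ab, of n] unfolding P0_def P1_def t N_def k0_def by simp
  have ode: "t^2 * P2 - a * P1 = - N\<^sup>2 * P0"
   using ode_pointwise[of a "Suc n"] unfolding eigenval_def t P0_def P1_def P2_def N_def using ab by (simp add: power2_eq_square)
  have "2 * N * ker n a a = t^2 * P1^2 - P0 * (t^2 * P2 - 2 * a * P1) - N * P0^2"
   using ker_diag_formula[of n a] ab unfolding t P0_def P1_def P2_def N_def by (simp add: algebra_simps)
  also have "... = N^2 * (2 * k0) + a * (P0 * P1) - N * P0^2"
   using En ode by algebra
  finally have eq: "2 * N * ker n a a = N^2 * (2 * k0) + a * (P0 * P1) - N * P0^2" .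
  have P0: "P0^2 <= 2 * k0"
  proof -
   have "N^2 * P0^2 <= N^2 * (2 * k0)" using En by (smt (verit) zero_le_power2 mult_nonneg_nonneg)
   then show ?thesis using N by (subst (asm) mult_le_cancel_left_pos) auto
  qed
  have PP: "t * \<bar>P0 * P1\<bar> <= N * (2 * k0)"
  proof -
   have "0 <= (N * \<bar>P0\<bar> - t * \<bar>P1\<bar>)^2" by simp
   then have "2 * (N * (t * \<bar>P0 * P1\<bar>)) <= N^2 * P0^2 + t^2 * P1^2"
    by (simp add: power2_diff power_mult_distrib abs_mult mult_ac)
   then have "N * (2 * (t * \<bar>P0 * P1\<bar>)) <= N * (N * (2 * k0))" using En by (simp add: power2_eq_square mult_ac)
   then have "2 * (t * \<bar>P0 * P1\<bar>) <= N * (2 * k0)" using N by (subst (asm) mult_le_cancel_left_pos) auto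
   moreover have "0 <= t * \<bar>P0 * P1\<bar>" using t by simp
   ultimately show ?thesis by linarith
  qed
  have "\<bar>a * (P0 * P1)\<bar> <= 1 * \<bar>P0 * P1\<bar>" unfolding abs_mult[of a] using a by (intro mult_right_mono) auto
  also have "... <= N * (2 * k0) / t" using PP t by (simp add: field_simps)
  finally have "- (a * (P0 * P1)) <= N * (2 * k0) / t" by linarith
  moreover have "N * P0^2 <= N * (2 * k0)" using P0 N by (intro mult_left_mono) auto
  ultimately have "2 * N * ker n a a >= N^2 * (2 * k0) - N * (2 * k0) / t - N * (2 * k0)" using eq by linarith
  then have "N * (2 * ker n a a) >= N * (2 * k0 * (N - (1 + 1 / t)))" by (simp add: algebra_simps power2_eq_square)
  then have ker2: "2 * ker n a a >= 2 * k0 * (N - (1 + 1 / t))" using N by (subst (asm) mult_le_cancel_left_pos) auto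
  have "N >= 2 * (1 + 1 / t)" using True unfolding B_def N_def .
  moreover have "N - v >= N / 2" if "N >= 2 * v" for v using that by linarith
  ultimately have "N - (1 + 1 / t) >= N / 2" by blast
  then have "k0 * (N - (1 + 1 / t)) >= k0 * (N / 2)" using k0 by (intro mult_left_mono) auto
  moreover have "k0 * (N - (1 + 1 / t)) <= ker n a a" using ker2 by simp
  ultimately have "k0 * (N / 2) <= ker n a a" by (rule order_trans)
  then have "ker n a a >= k0 / 2 * N" by simp
  moreover have "c <= k0 / 2" unfolding c_def by (rule min.cobounded1)
  then have "c * N <= k0 / 2 * N" using N by (intro mult_right_mono) auto
  ultimately have "c * N <= ker n a a" by linarith
  then show ?thesis by (simp add: N_def)
 qed
 moreover have "c > 0" using k0 B by (simp add: c_def)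
 ultimately show ?thesis by blast
qed

end

abbreviation jacobi_int :: "real => real => real poly => real" where
 "jacobi_int \<alpha> \<beta> \<equiv> (\<lambda>q. \<integral>x. poly q x \<partial>jacobi_measure \<alpha> \<beta>)"

text \<open>Since \<alpha>, \<beta> >= -1/2, the weight is at most a constant times the Chebyshev
  weight. The extremal property, with the Chebyshev kernel as test polynomial, transfers the linear
  lower bound.\<close>

lemma ker_interior_lower:
 assumes ab: "\<alpha> >= -1/2" "\<beta> >= -1/2" and a: "a \<in> Ioo"
  and p: "jacobi_polys \<alpha> \<beta> (jacobi_int \<alpha> \<beta>) p"
 shows "\<exists>c>0. \<forall>n. c * real (Suc n) <= (\<Sum>j\<le>n. (poly (p j) a)\<^sup>2)"
proof -
 interpret jacobi_polys \<alpha> \<beta> "jacobi_int \<alpha> \<beta>" p by fact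
 interpret F: jacobi_functional "-1/2" "-1/2" "jacobi_int (-1/2) (-1/2)"
  by (rule jacobi_functional_measure) auto
 obtain t where t: "\<And>n. degree (t n) = n \<and> (\<forall>m. jacobi_int (-1/2) (-1/2) (t m * t n) = (if m = n then 1 else 0))"
  using F.orthonormal_exists by blast
 interpret T: jacobi_polys "-1/2" "-1/2" "jacobi_int (-1/2) (-1/2)" t
  by unfold_locales (use t in auto)
 obtain c where c: "c > 0" "\<And>n. c * real (Suc n) <= T.ker n a a"
  using T.chebyshev_ker_lower[OF _ _ a] by auto
 define B where "B = 2 powr (\<alpha> + 1/2) * 2 powr (\<beta> + 1/2)"
 have B: "B > 0" by (simp add: B_def)
 have wle: "jacobi_weight \<alpha> \<beta> x <= B * jacobi_weight (-1/2) (-1/2) x" for x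
 proof (cases "x \<in> Ioo")
  case True
  have "(1 - x) powr \<alpha> = (1 - x) powr (\<alpha> + 1/2) * (1 - x) powr (-1/2)" "(1 + x) powr \<beta> = (1 + x) powr (\<beta> + 1/2) * (1 + x) powr (-1/2)"
   unfolding powr_add[symmetric] by simp_all
  then have "jacobi_weight \<alpha> \<beta> x = ((1 - x) powr (\<alpha> + 1/2) * (1 + x) powr (\<beta> + 1/2)) * jacobi_weight (-1/2) (-1/2) x"
   using True by (simp add: jacobi_weight_def mult_ac)
  also have "... <= B * jacobi_weight (-1/2) (-1/2) x"
  proof (rule mult_right_mono)
   show "(1 - x) powr (\<alpha> + 1/2) * (1 + x) powr (\<beta> + 1/2) <= B"
    unfolding B_def by (rule mult_mono) (use True ab in \<open>auto intro!: powr_mono2\<close>)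
  qed (rule jacobi_weight_nonneg)
  finally show ?thesis .
 next
  case False
  then show ?thesis by (simp add: jacobi_weight_def)
 qed
 have Jle: "jacobi_int \<alpha> \<beta> (Q * Q) <= B * jacobi_int (-1/2) (-1/2) (Q * Q)" for Q
 proof -
  have i1: "integrable lborel (\<lambda>x. jacobi_weight \<alpha> \<beta> x * poly (Q * Q) x)"
   if "\<alpha> >= -1/2" "\<beta> >= -1/2" for \<alpha> \<beta>
   using integrable_jacobi_poly[of \<alpha> \<beta> "Q * Q"] that integral_jacobi_measure(2)[OF poly_measurable] by auto
  have "jacobi_int \<alpha> \<beta> (Q * Q) = (\<integral>x. jacobi_weight \<alpha> \<beta> x * poly (Q * Q) x \<partial>lborel)"
   by (rule integral_jacobi_measure(1)[OF poly_measurable])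
  also have "... <= (\<integral>x. B * (jacobi_weight (-1/2) (-1/2) x * poly (Q * Q) x) \<partial>lborel)"
  proof (rule Bochner_Integration.integral_mono)
   show "integrable lborel (\<lambda>x. jacobi_weight \<alpha> \<beta> x * poly (Q * Q) x)" by (rule i1[OF ab])
   show "integrable lborel (\<lambda>x. B * (jacobi_weight (-1/2) (-1/2) x * poly (Q * Q) x))"
    by (intro integrable_mult_right i1) auto
   show "jacobi_weight \<alpha> \<beta> x * poly (Q * Q) x <= B * (jacobi_weight (-1/2) (-1/2) x * poly (Q * Q) x)" for x
    using mult_right_mono[OF wle[of x], of "poly (Q * Q) x"] by (simp add: mult_ac)
  qed
  also have "... = B * (\<integral>x. jacobi_weight (-1/2) (-1/2) x * poly (Q * Q) x \<partial>lborel)" by (rule integral_mult_right_zero)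
  also have "(\<integral>x. jacobi_weight (-1/2) (-1/2) x * poly (Q * Q) x \<partial>lborel) = jacobi_int (-1/2) (-1/2) (Q * Q)"
   by (rule integral_jacobi_measure(1)[OF poly_measurable, symmetric])
  finally show ?thesis .
 qed
 have "c / B * real (Suc n) <= (\<Sum>j\<le>n. (poly (p j) a)\<^sup>2)" for n
 proof -
  \<comment> \<open>The Chebyshev kernel at a: its value at a and its Chebyshev square integral both
    equal \<open>k\<close>, so one factor \<open>k\<close> cancels.\<close>
  define Q where "Q = (\<Sum>j\<le>n. smult (poly (t j) a) (t j))"
  define k where "k = T.ker n a a"
  have k: "c * real (Suc n) <= k" using c by (simp add: k_def)
  then have k0: "k > 0" using c by (smt (verit) mult_pos_pos of_nat_0_less_iff zero_less_Suc)
  have Qa: "poly Q a = k" by (simp add: Q_def k_def T.ker_def poly_sum)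
  have Qc: "coeff Q i = 0" if "i > n" for i
   unfolding Q_def coeff_sum using that T.degree_p by (intro sum.neutral) (auto intro!: coeff_eq_0)
  have "jacobi_int (-1/2) (-1/2) (Q * Q) = k"
  proof -
   have "jacobi_int (-1/2) (-1/2) (Q * t j) = poly (t j) a" if "j <= n" for j
   proof -
    have "jacobi_int (-1/2) (-1/2) (Q * t j) = (\<Sum>i\<le>n. poly (t i) a * jacobi_int (-1/2) (-1/2) (t i * t j))"
     unfolding Q_def sum_distrib_right F.J_sum mult_smult_left F.J_smult ..
    also have "... = (\<Sum>i\<le>n. if i = j then poly (t j) a else 0)" by (intro sum.cong) (auto simp only: T.orth refl split: if_splits)
    finally show ?thesis using that by simp
   qed
   moreover have "Q * Q = (\<Sum>j\<le>n. smult (poly (t j) a) (Q * t j))"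
    by (subst (2) Q_def) (simp add: sum_distrib_left)
   ultimately have "jacobi_int (-1/2) (-1/2) (Q * Q) = (\<Sum>j\<le>n. poly (t j) a * poly (t j) a)"
    by (simp only: F.J_sum F.J_smult) simp
   then show ?thesis by (simp add: k_def T.ker_def)
  qed
  then have "(poly Q a)^2 <= ker n a a * (B * k)"
  proof -
   assume Jk: "jacobi_int (-1/2) (-1/2) (Q * Q) = k"
   have "(poly Q a)^2 <= ker n a a * jacobi_int \<alpha> \<beta> (Q * Q)"
    by (rule cauchy_schwarz_ker) (use Qc in auto)
   also have "... <= ker n a a * (B * jacobi_int (-1/2) (-1/2) (Q * Q))"
    using ker_diag_mono[of 0 n a] ker_0_pos[of a a] by (intro mult_left_mono Jle) auto
   finally show ?thesis by (simp only: Jk)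
  qed
  then have "k * k <= k * (B * ker n a a)" by (simp add: Qa power2_eq_square mult_ac)
  then have "k <= B * ker n a a" using k0 by (subst (asm) mult_le_cancel_left_pos) auto
  then have "c * real (Suc n) <= B * ker n a a" using k by linarith
  then show ?thesis using B by (simp add: field_simps ker_def power2_eq_square)
 qed
 then show ?thesis using c B by (intro exI[of _ "c / B"]) auto
qed

text \<open>The gain of order n^(-delta) off the diagonal makes the system diagonally dominant for large n; the
 remaining finitely many n are covered by the last hypothesis.\<close>

lemma mass_system_bound:
 fixes K L :: "nat => 'a => 'a => real" and G :: "'a => real" and M ex ey :: "'a => real"
 assumes A: "finite A" and M: "\<And>z. z \<in> A ==> M z > 0" and c: "c > 0" and C: "C >= 0" and d: "\<delta> > 0"
  and G: "\<And>x. x \<in> S ==> G x >= 0"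
  and diag: "\<And>n z. z \<in> A ==> c * real (Suc n) powr (ex z + ey z) <= K n z z"
  and off: "\<And>n z z'. z \<in> A ==> z' \<in> A ==> z ~= z' ==> \<bar>K n z z'\<bar> <= C * real (Suc n) powr (ex z' + ey z - \<delta>)"
  and sys: "\<And>n x z. x \<in> S ==> z \<in> A ==> K n x z = L n x z + (\<Sum>i\<in>A. M i * L n x i * K n i z)"
  and bd: "\<And>n x z. x \<in> S ==> z \<in> A ==> \<bar>K n x z\<bar> <= C * real (Suc n) powr ex z * G x"
  and small: "\<And>n. \<exists>B\<ge>0. \<forall>x\<in>S. \<forall>z\<in>A. \<bar>L n x z\<bar> <= B * G x"
 shows "\<exists>D\<ge>0. \<forall>n. \<forall>x\<in>S. \<forall>z\<in>A. \<bar>L n x z\<bar> * real (Suc n) powr ey z <= D * G x"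
proof -
 define m where "m = real (card A)"
 \<comment> \<open>The unknown normalised by the decay in n that is to be proved for it.\<close>
 define T where "T n x z = \<bar>L n x z\<bar> * real (Suc n) powr ey z" for n x z
 define s where "s n x = (\<Sum>z\<in>A. M z * T n x z)" for n x
 have T0: "T n x z >= 0" for n x z by (simp add: T_def)
 have s0: "s n x >= 0" for n x unfolding s_def using M T0 by (intro sum_nonneg mult_nonneg_nonneg) (auto intro: less_imp_le)
 have step: "c * (M z * T n x z) <= C * G x + C * real (Suc n) powr (- \<delta>) * s n x" if x: "x \<in> S" and z: "z \<in> A" for n x z
 proof -
  define N where "N = real (Suc n)"
  have N: "N > 0" by (simp add: N_def)
  \<comment> \<open>Equation z is solved for its own unknown; on the left the diagonal entry
    dominates, and the other unknowns appear with off-diagonal entries.\<close>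
  have e: "L n x z * (1 + M z * K n z z) = K n x z - (\<Sum>i\<in>A - {z}. M i * L n x i * K n i z)"
   using sys[OF x z, of n] A z by (simp add: sum.remove[of A z] algebra_simps)
  have kzz: "K n z z >= 0" using diag[OF z, of n] c by (meson mult_nonneg_nonneg order_trans less_imp_le powr_ge_zero)
  have "\<bar>L n x z\<bar> * (M z * (c * N powr (ex z + ey z))) <= \<bar>L n x z\<bar> * (1 + M z * K n z z)"
  proof (intro mult_left_mono)
   have "M z * (c * N powr (ex z + ey z)) <= M z * K n z z"
    using diag[OF z, of n] M[OF z] by (intro mult_left_mono) (auto simp: N_def)
   then show "M z * (c * N powr (ex z + ey z)) <= 1 + M z * K n z z" by simp
  qed simp
  also have "... = \<bar>K n x z - (\<Sum>i\<in>A - {z}. M i * L n x i * K n i z)\<bar>"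
   unfolding e[symmetric] abs_mult using kzz M[OF z] by simp
  also have "... <= \<bar>K n x z\<bar> + (\<Sum>i\<in>A - {z}. \<bar>M i * L n x i * K n i z\<bar>)"
   using abs_triangle_ineq4[of "K n x z" "\<Sum>i\<in>A - {z}. M i * L n x i * K n i z"]
    sum_abs[of "\<lambda>i. M i * L n x i * K n i z" "A - {z}"] by linarith
  also have "... <= C * N powr ex z * G x + (\<Sum>i\<in>A - {z}. C * N powr ex z * N powr (- \<delta>) * (M i * T n x i))"
  proof (intro add_mono sum_mono)
   show "\<bar>K n x z\<bar> <= C * N powr ex z * G x" using bd[OF x z, of n] by (simp add: N_def)
   fix i assume i: "i \<in> A - {z}"
   have "\<bar>M i * L n x i * K n i z\<bar> = M i * \<bar>L n x i\<bar> * \<bar>K n i z\<bar>" using M[of i] i by (simp add: abs_mult)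
   also have "... <= M i * \<bar>L n x i\<bar> * (C * N powr (ex z + ey i - \<delta>))"
    using off[of i z n] i z M[of i] by (intro mult_left_mono) (auto simp: N_def)
   also have "N powr (ex z + ey i - \<delta>) = N powr ex z * N powr ey i * N powr (- \<delta>)"
    unfolding powr_add[symmetric] by simp
   finally show "\<bar>M i * L n x i * K n i z\<bar> <= C * N powr ex z * N powr (- \<delta>) * (M i * T n x i)"
    by (simp add: T_def N_def mult_ac)
  qed
  also have "... = N powr ex z * (C * G x + C * N powr (- \<delta>) * (\<Sum>i\<in>A - {z}. M i * T n x i))"
   by (simp add: sum_distrib_left distrib_left mult_ac)
  also have "\<bar>L n x z\<bar> * (M z * (c * N powr (ex z + ey z))) = N powr ex z * (c * (M z * T n x z))"
   by (simp add: T_def N_def powr_add mult_ac)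
  finally have "c * (M z * T n x z) <= C * G x + C * N powr (- \<delta>) * (\<Sum>i\<in>A - {z}. M i * T n x i)"
   using N by (subst (asm) mult_le_cancel_left_pos) auto
  also have "... <= C * G x + C * N powr (- \<delta>) * s n x"
  proof (intro add_left_mono mult_left_mono)
   show "(\<Sum>i\<in>A - {z}. M i * T n x i) <= s n x"
    unfolding s_def using A M T0 by (intro sum_mono2) (auto intro!: mult_nonneg_nonneg intro: less_imp_le)
  qed (use C in auto)
  finally show ?thesis by (simp add: N_def)
 qed
 \<comment> \<open>Summed over z, the right side contains the same sum s with a factor that tends to
   0 like n^(-\<delta>); for large n it is absorbed by the left side.\<close>
 have sum_step: "c * s n x <= m * (C * G x + C * real (Suc n) powr (- \<delta>) * s n x)" if "x \<in> S" for n x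
 proof -
  have "c * s n x = (\<Sum>z\<in>A. c * (M z * T n x z))" by (simp add: s_def sum_distrib_left)
  also have "... <= (\<Sum>z\<in>A. C * G x + C * real (Suc n) powr (- \<delta>) * s n x)" by (intro sum_mono step that)
  finally show ?thesis by (simp add: m_def)
 qed
 have "(\<lambda>n. real (Suc n) powr (- \<delta>)) \<longlonglongrightarrow> 0"
  by (intro tendsto_neg_powr filterlim_compose[OF filterlim_real_sequentially filterlim_Suc]) (use d in auto)
 then have "(\<lambda>n. m * C * real (Suc n) powr (- \<delta>)) \<longlonglongrightarrow> 0" by (rule tendsto_mult_right_zero)
 then have "\<forall>\<^sub>F n in sequentially. m * C * real (Suc n) powr (- \<delta>) < c / 2"
  by (rule order_tendstoD) (use c in auto)
 then obtain n0 where n0: "\<And>n. n >= n0 ==> m * C * real (Suc n) powr (- \<delta>) < c / 2"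
  by (auto simp: eventually_sequentially)
 obtain B where B: "\<And>n. B n >= 0" "\<And>n x z. x \<in> S ==> z \<in> A ==> \<bar>L n x z\<bar> <= B n * G x"
  using small by metis
 define R where "R n = (\<Sum>z\<in>A. B n * real (Suc n) powr ey z)" for n
 have R0: "R n >= 0" for n unfolding R_def using B by (intro sum_nonneg) auto
 define Q where "Q = (\<Sum>z\<in>A. 2 * m * C / (c * M z))"
 have Q0: "Q >= 0" unfolding Q_def using c C M by (intro sum_nonneg divide_nonneg_nonneg mult_nonneg_nonneg) (auto simp: m_def intro: less_imp_le)
 define D where "D = (\<Sum>n<n0. R n) + Q"
 have "\<bar>L n x z\<bar> * real (Suc n) powr ey z <= D * G x" if x: "x \<in> S" and z: "z \<in> A" for n x z
 proof (cases "n < n0")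
  case True
  have "\<bar>L n x z\<bar> * real (Suc n) powr ey z <= (B n * G x) * real (Suc n) powr ey z"
   using B(2)[OF x z] by (intro mult_right_mono) auto
  also have "... = (B n * real (Suc n) powr ey z) * G x" by simp
  also have "... <= R n * G x"
   unfolding R_def using A z B(1) G[OF x] by (intro mult_right_mono member_le_sum) auto
  also have "... <= D * G x"
  proof (intro mult_right_mono)
   have "R n <= (\<Sum>n<n0. R n)" using True R0 by (intro member_le_sum) auto
   then show "R n <= D" using Q0 by (simp add: D_def)
  qed (use G[OF x] in auto)
  finally show ?thesis .
 next
  case False
  then have "m * C * real (Suc n) powr (- \<delta>) * s n x <= c / 2 * s n x" using n0[of n] s0[of n x] by (intro mult_right_mono) auto
  then have "c / 2 * s n x <= m * C * G x" using sum_step[OF x, of n] by (simp add: algebra_simps)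
  moreover have "M z * T n x z <= s n x"
   unfolding s_def using A z M T0 by (intro member_le_sum) (auto intro!: mult_nonneg_nonneg intro: less_imp_le)
  then have "c / 2 * (M z * T n x z) <= c / 2 * s n x" using c by (intro mult_left_mono) auto
  ultimately have "c / 2 * (M z * T n x z) <= m * C * G x" by linarith
  then have "T n x z <= 2 * m * C / (c * M z) * G x" using c M[OF z] by (simp add: field_simps)
  also have "... <= D * G x"
  proof (intro mult_right_mono)
   have "2 * m * C / (c * M z) <= Q"
    unfolding Q_def using A z c C M
    by (intro member_le_sum[of z A "\<lambda>z. 2 * m * C / (c * M z)"] divide_nonneg_nonneg mult_nonneg_nonneg)
      (auto simp: m_def intro: less_imp_le)
   then show "2 * m * C / (c * M z) <= D" using R0 by (simp add: D_def sum_nonneg add_increasing)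
  qed (use G[OF x] in auto)
  finally show ?thesis by (simp add: T_def)
 qed
 moreover have "D >= 0" using Q0 R0 by (simp add: D_def sum_nonneg)
 ultimately show ?thesis by blast
qed

lemma powr_comparable:
 fixes a b c :: real
 assumes "a > 0" "b > 0" "a <= 4 * b" "b <= 4 * a"
 shows "a powr c <= 4 powr \<bar>c\<bar> * b powr c"
proof (cases "c >= 0")
 case True
 have "a powr c <= (4 * b) powr c" using assms True by (intro powr_mono2) auto
 then show ?thesis using True by (simp add: powr_mult)
next
 case False
 have "a powr c <= (b / 4) powr c" using assms False by (intro powr_mono2') auto
 also have "... = b powr c / 4 powr c" by (simp add: powr_divide)
 also have "... = 4 powr \<bar>c\<bar> * b powr c" using False by (simp add: powr_minus_divide[of 4 c])
 finally show ?thesis .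
qed

section \<open>Power weights\<close>

text \<open>One integer scale serves both endpoints: it tends to minus infinity at 1 and to plus
  infinity at -1. On points of equal or adjacent index any power of 1 - x or 1 + x is constant up to
  a factor.\<close>

definition whitney_index :: "real => int" where
 "whitney_index x = \<lfloor>log 2 ((1 - x) / (1 + x))\<rfloor>"

definition whitney_piece :: "int => real set" where
 "whitney_piece k = {x\<in>Ioo. whitney_index x = k}"

lemma whitney_piece_measurable [measurable]: "whitney_piece k \<in> sets borel"
 unfolding whitney_piece_def whitney_index_def by measurable

lemma whitney_index_bounds:
 assumes "x \<in> Ioo"
 shows "2 powr (whitney_index x) * (1 + x) <= 1 - x" "1 - x < 2 powr (whitney_index x + 1) * (1 + x)"
proof -
 define t where "t = (1 - x) / (1 + x)"
 have t: "t > 0" using assms by (simp add: t_def)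
 have k: "whitney_index x = \<lfloor>log 2 t\<rfloor>" by (simp add: whitney_index_def t_def)
 have t2: "t = 2 powr (log 2 t)" using t by simp
 have "2 powr (whitney_index x) <= 2 powr (log 2 t)" "2 powr (log 2 t) < 2 powr (whitney_index x + 1)"
  unfolding k by (intro powr_mono powr_less_mono; linarith)+
 then have "2 powr (whitney_index x) <= t" "t < 2 powr (whitney_index x + 1)" unfolding t2[symmetric] .
 then show "2 powr (whitney_index x) * (1 + x) <= 1 - x" "1 - x < 2 powr (whitney_index x + 1) * (1 + x)"
  using assms by (simp_all add: t_def field_simps)
qed

text \<open>A gap of two scales gives 2 (1 - x)(1 + y) <= (1 - y)(1 + x), while (1 - y)(1 + x) - (1
  - x)(1 + y) = 2 (x - y).\<close>

lemma whitney_far: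
 assumes x: "x \<in> Ioo" and y: "y \<in> Ioo" and k: "whitney_index y >= whitney_index x + 2"
 shows "y < x" "(1 - y) * (1 + x) <= 4 * (x - y)"
proof -
 have "2 powr (whitney_index x + 2) <= 2 powr (whitney_index y)" using k by (intro powr_mono) auto
 then have "2 powr (whitney_index x + 2) * (1 + y) <= 2 powr (whitney_index y) * (1 + y)"
  using y by (intro mult_right_mono) auto
 also have "... <= 1 - y" by (rule whitney_index_bounds(1)[OF y])
 finally have "2 powr (whitney_index x + 2) * (1 + y) <= 1 - y" .
 moreover have "2 powr (real_of_int (whitney_index x + 2)) = 2 * 2 powr (whitney_index x + 1)"
  using powr_add[of 2 1 "real_of_int (whitney_index x + 1)"] by (simp add: add.commute)
 ultimately have 1: "2 * 2 powr (whitney_index x + 1) * (1 + y) <= 1 - y" by simp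
 have 2: "1 - x <= 2 powr (whitney_index x + 1) * (1 + x)" using whitney_index_bounds(2)[OF x] by simp
 define W where "W = 2 powr (whitney_index x + 1)"
 have "2 * ((1 - x) * (1 + y)) <= 2 * ((W * (1 + x)) * (1 + y))"
  using 2 y unfolding W_def by (intro mult_left_mono mult_right_mono) auto
 also have "... = (2 * W * (1 + y)) * (1 + x)" by simp
 also have "... <= (1 - y) * (1 + x)" using 1 x unfolding W_def by (intro mult_right_mono) auto
 finally have 3: "2 * ((1 - x) * (1 + y)) <= (1 - y) * (1 + x)" .
 then show "(1 - y) * (1 + x) <= 4 * (x - y)" by (simp add: algebra_simps)
 moreover have "0 < (1 - y) * (1 + x)" using x y by simp
 ultimately have "0 < 4 * (x - y)" by (rule order_less_le_trans[rotated])
 then show "y < x" by simp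
qed

lemma whitney_near:
 assumes x: "x \<in> Ioo" and y: "y \<in> Ioo" and k: "whitney_index x <= whitney_index y + 1"
 shows "1 - x <= 4 * (1 - y)" "1 + y <= 4 * (1 + x)"
proof -
 have "1 - x <= 2 powr (whitney_index x + 1) * (1 + x)" using whitney_index_bounds(2)[OF x] by simp
 also have "... <= 2 powr (whitney_index y + 2) * (1 + x)" using k x by (intro mult_right_mono powr_mono) auto
 also have "2 powr (real_of_int (whitney_index y + 2)) = 4 * 2 powr (whitney_index y)"
  using powr_add[of 2 2 "real_of_int (whitney_index y)"] by (simp add: add.commute)
 finally have 1: "1 - x <= 4 * 2 powr (whitney_index y) * (1 + x)" by simp
 have "(1 - x) * (1 + y) <= (4 * 2 powr (whitney_index y) * (1 + x)) * (1 + y)"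
  using 1 y by (intro mult_right_mono) auto
 also have "... = 4 * (1 + x) * (2 powr (whitney_index y) * (1 + y))" by simp
 also have "... <= 4 * (1 + x) * (1 - y)" using whitney_index_bounds(1)[OF y] x by (intro mult_left_mono) auto
 finally have 2: "(1 - x) * (1 + y) <= 4 * (1 + x) * (1 - y)" .
 show "1 - x <= 4 * (1 - y)"
 proof (cases "y < x")
  case False
  have "(1 - x) * (1 + y) <= (4 * (1 - y)) * (1 + x)" using 2 by (simp only: mult_ac)
  also have "... <= (4 * (1 - y)) * (1 + y)" using False y by (intro mult_left_mono) auto
  finally have "(1 - x) * (1 + y) <= (4 * (1 - y)) * (1 + y)" .
  then show ?thesis using y by (subst (asm) mult_le_cancel_right_pos) auto
 qed (use y in auto)
 show "1 + y <= 4 * (1 + x)"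
 proof (cases "y < x")
  case False
  have "(1 - y) * (1 + y) <= (1 - x) * (1 + y)" using False y by (intro mult_right_mono) auto
  also have "... <= (1 - y) * (4 * (1 + x))" using 2 by (simp only: mult_ac)
  finally have "(1 - y) * (1 + y) <= (1 - y) * (4 * (1 + x))" .
  then show ?thesis using y by (subst (asm) mult_le_cancel_left_pos) auto
 qed (use x in auto)
qed

lemma jacobi_comparable:
 assumes x: "x \<in> Ioo" and y: "y \<in> Ioo" and k: "\<bar>whitney_index x - whitney_index y\<bar> <= 1"
 shows "(1 - x) powr c * (1 + x) powr d <= 4 powr (\<bar>c\<bar> + \<bar>d\<bar>) * ((1 - y) powr c * (1 + y) powr d)"
proof -
 have n: "1 - x <= 4 * (1 - y)" "1 + y <= 4 * (1 + x)" "1 - y <= 4 * (1 - x)" "1 + x <= 4 * (1 + y)"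
  using whitney_near[OF x y] whitney_near[OF y x] k by auto
 have "(1 - x) powr c * (1 + x) powr d <= (4 powr \<bar>c\<bar> * (1 - y) powr c) * (4 powr \<bar>d\<bar> * (1 + y) powr d)"
  by (rule mult_mono) (use n x y in \<open>auto intro!: powr_comparable\<close>)
 then show ?thesis by (simp add: powr_add mult_ac)
qed

lemma whitney_center: "\<exists>z\<in>Ioo. whitney_index z = k"
proof -
 define t where "t = 2 powr (real_of_int k)"
 define z where "z = (1 - t) / (1 + t)"
 have t: "t > 0" by (simp add: t_def)
 have z1: "1 - z = 2 * t / (1 + t)" "1 + z = 2 / (1 + t)" using t by (simp_all add: z_def field_simps)
 have "(1 - z) / (1 + z) = t" unfolding z1 using t by (simp add: field_simps)
 then have "whitney_index z = k" by (simp add: whitney_index_def t_def)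
 moreover have "z \<in> Ioo"
 proof -
  have "1 - z > 0" "1 + z > 0" unfolding z1 using t by simp_all
  then show ?thesis by simp
 qed
 ultimately show ?thesis by blast
qed

lemma hilbert_kernel_le:
 assumes "x ~= (y::real)"
 shows "\<bar>(x - y) / ((x - y)^2 + e^2)\<bar> <= 1 / \<bar>x - y\<bar>"
proof -
 have "\<bar>(x - y) / ((x - y)^2 + e^2)\<bar> = \<bar>x - y\<bar> / ((x - y)^2 + e^2)" by simp
 also have "... <= \<bar>x - y\<bar> / (x - y)^2" using assms by (intro divide_left_mono mult_pos_pos) (auto intro!: add_pos_nonneg)
 also have "... = 1 / \<bar>x - y\<bar>"
 proof -
  have "\<bar>d\<bar> / d^2 = 1 / \<bar>d\<bar>" if "d ~= 0" for d :: real
   using that by (cases "d > 0") (auto simp: power2_eq_square)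
  then show ?thesis using assms by simp
 qed
 finally show ?thesis .
qed

locale weighted_hilbert =
 fixes \<alpha> \<beta> \<sigma>1 \<sigma>2 r :: real
 assumes ab: "\<alpha> > -1" "\<beta> > -1" and r: "r > 1"
  and t1: "0 <= \<sigma>1 + (\<alpha> + 1) / r" "\<sigma>1 + (\<alpha> + 1) / r <= 1"
  and t2: "0 <= \<sigma>2 + (\<beta> + 1) / r" "\<sigma>2 + (\<beta> + 1) / r <= 1"
begin

definition mw :: "real => real" where
 "mw x = (1 - x) powr \<sigma>1 * (1 + x) powr \<sigma>2"

lemma mw_pos: "x \<in> Ioo ==> mw x > 0"
 by (simp add: mw_def)

lemma mw_measurable [measurable]: "mw \<in> borel_measurable borel"
 unfolding mw_def[abs_def] by measurable

lemma inverse_mw: "x \<in> Ioo ==> 1 / mw x = (1 - x) powr (- \<sigma>1) * (1 + x) powr (- \<sigma>2)"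
 by (simp add: mw_def powr_minus_divide)

text \<open>For indices at least two apart, |x - y| is at least a quarter of (1 - y)(1 + x) or of
  the mirrored product. After extraction of the separated factor only powers of quotients at most 1
  remain, with exponents \<open>\<tau>1\<close> and 1 - \<open>\<tau>2\<close>, or mirrored. So the
  kernel has a rank-one bound, to which the sublevel estimates apply.\<close>

lemma far_bound:
 assumes x: "x \<in> Ioo" and y: "y \<in> Ioo" and k: "\<bar>whitney_index x - whitney_index y\<bar> >= 2"
 shows "mw x * (\<bar>(x - y) / ((x - y)^2 + e^2)\<bar> * (1 / mw y))
   <= 4 * rho0 \<alpha> \<beta> x powr (- 1 / r) * (rho0 \<alpha> \<beta> y powr (- (1 - 1 / r)) * jacobi_weight \<alpha> \<beta> y)"
proof -
 define \<tau>1 where "\<tau>1 = \<sigma>1 + (\<alpha> + 1) / r"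
 define \<tau>2 where "\<tau>2 = \<sigma>2 + (\<beta> + 1) / r"
 have pos: "1 - x > 0" "1 + x > 0" "1 - y > 0" "1 + y > 0" using x y by auto
 define U where "U = rho0 \<alpha> \<beta> x powr (- 1 / r) * (rho0 \<alpha> \<beta> y powr (- (1 - 1 / r)) * jacobi_weight \<alpha> \<beta> y)"
 have Ux: "rho0 \<alpha> \<beta> x powr (- 1 / r) = (1 - x) powr (- ((\<alpha> + 1) / r)) * (1 + x) powr (- ((\<beta> + 1) / r))"
  using pos by (simp add: rho0_def powr_mult powr_powr)
 have e1: "(\<alpha> + 1) * (1 / r - 1) + \<alpha> = (\<alpha> + 1) / r - 1" "(\<beta> + 1) * (1 / r - 1) + \<beta> = (\<beta> + 1) / r - 1"
  using r by (simp_all add: field_simps)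
 have Uy: "rho0 \<alpha> \<beta> y powr (- (1 - 1 / r)) * jacobi_weight \<alpha> \<beta> y = (1 - y) powr ((\<alpha> + 1) / r - 1) * (1 + y) powr ((\<beta> + 1) / r - 1)"
 proof -
  have "rho0 \<alpha> \<beta> y powr (- (1 - 1 / r)) = (1 - y) powr ((\<alpha> + 1) * (1 / r - 1)) * (1 + y) powr ((\<beta> + 1) * (1 / r - 1))"
   using pos by (simp add: rho0_def powr_mult powr_powr)
  moreover have "jacobi_weight \<alpha> \<beta> y = (1 - y) powr \<alpha> * (1 + y) powr \<beta>" using y by (simp add: jacobi_weight_def)
  ultimately show ?thesis unfolding e1[symmetric] powr_add by (simp add: mult_ac)
 qed
 have tau: "0 <= \<tau>1" "\<tau>1 <= 1" "0 <= \<tau>2" "\<tau>2 <= 1" using t1 t2 by (auto simp: \<tau>1_def \<tau>2_def)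
 have s1: "\<sigma>1 = \<tau>1 - (\<alpha> + 1) / r" "\<sigma>2 = \<tau>2 - (\<beta> + 1) / r" by (auto simp: \<tau>1_def \<tau>2_def)
 have mx: "mw x = (1 - x) powr \<tau>1 * (1 + x) powr \<tau>2 * rho0 \<alpha> \<beta> x powr (- 1 / r)"
 proof -
  have "(1 - x) powr \<sigma>1 = (1 - x) powr \<tau>1 * (1 - x) powr (- ((\<alpha> + 1) / r))"
   "(1 + x) powr \<sigma>2 = (1 + x) powr \<tau>2 * (1 + x) powr (- ((\<beta> + 1) / r))"
   unfolding s1 powr_add[symmetric] by simp_all
  then show ?thesis unfolding mw_def Ux by simp
 qed
 have ratio: "(a / b) powr c <= 1" if "0 < a" "a <= b" "0 <= c" for a b c :: real
  using powr_mono2[of c "a / b" 1] that by simp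
 have core: "mw x * (1 / mw y) * (1 / ((1 - y) * (1 + x))) <= U" if "y < x"
 proof -
  have "mw x * (1 / mw y) * (1 / ((1 - y) * (1 + x))) = ((1 - x) / (1 - y)) powr \<tau>1 * ((1 + y) / (1 + x)) powr (1 - \<tau>2) * U"
  proof -
   have f1: "1 / mw y = (1 - y) powr ((\<alpha> + 1) / r - 1) * (1 + y) powr ((\<beta> + 1) / r - 1) * ((1 - y) * (1 - y) powr (- \<tau>1)) * (1 + y) powr (1 - \<tau>2)"
   proof -
    have "(1 - y) powr (- \<sigma>1) = (1 - y) powr ((\<alpha> + 1) / r - 1) * ((1 - y) powr 1 * (1 - y) powr (- \<tau>1))"
     unfolding s1 powr_add[symmetric] by simp
    moreover have "(1 + y) powr (- \<sigma>2) = (1 + y) powr ((\<beta> + 1) / r - 1) * (1 + y) powr (1 - \<tau>2)"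
     unfolding s1 powr_add[symmetric] by simp
    ultimately show ?thesis using inverse_mw[OF y] pos by simp
   qed
   have f2: "(1 + x) powr \<tau>2 = (1 + x) / (1 + x) powr (1 - \<tau>2)"
    using pos powr_diff[of "1 + x" 1 "1 - \<tau>2"] by simp
   have f3: "((1 - x) / (1 - y)) powr \<tau>1 = (1 - x) powr \<tau>1 * (1 - y) powr (- \<tau>1)"
    using pos by (simp add: powr_divide powr_minus_divide)
   have f4: "((1 + y) / (1 + x)) powr (1 - \<tau>2) = (1 + y) powr (1 - \<tau>2) / (1 + x) powr (1 - \<tau>2)"
    using pos by (simp add: powr_divide)
   have gen: "(X * (v / S) * R) * (W * (w * Z) * T) * (1 / (w * v)) = (X * Z) * (T / S) * (R * W)"
    if "v > 0" "w > 0" for X v S R W w Z T :: real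
    using that by simp
   show ?thesis unfolding mx U_def Uy f1 f2 f3 f4 by (rule gen[OF pos(2,3)])
  qed
  also have "... <= 1 * 1 * U"
  proof (intro mult_mono)
   show "((1 - x) / (1 - y)) powr \<tau>1 <= 1" using pos that tau by (intro ratio) auto
   show "((1 + y) / (1 + x)) powr (1 - \<tau>2) <= 1" using pos that tau by (intro ratio) auto
  qed (auto simp: U_def jacobi_weight_nonneg)
  finally show ?thesis by simp
 qed
 have core': "mw x * (1 / mw y) * (1 / ((1 - x) * (1 + y))) <= U" if "x < y"
 proof -
  have "mw x * (1 / mw y) * (1 / ((1 - x) * (1 + y))) = ((1 + x) / (1 + y)) powr \<tau>2 * ((1 - y) / (1 - x)) powr (1 - \<tau>1) * U"
  proof -
   have f1: "1 / mw y = (1 - y) powr ((\<alpha> + 1) / r - 1) * (1 + y) powr ((\<beta> + 1) / r - 1) * ((1 + y) * (1 + y) powr (- \<tau>2)) * (1 - y) powr (1 - \<tau>1)"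
   proof -
    have "(1 + y) powr (- \<sigma>2) = (1 + y) powr ((\<beta> + 1) / r - 1) * ((1 + y) powr 1 * (1 + y) powr (- \<tau>2))"
     unfolding s1 powr_add[symmetric] by simp
    moreover have "(1 - y) powr (- \<sigma>1) = (1 - y) powr ((\<alpha> + 1) / r - 1) * (1 - y) powr (1 - \<tau>1)"
     unfolding s1 powr_add[symmetric] by simp
    ultimately show ?thesis using inverse_mw[OF y] pos by simp
   qed
   have f2: "(1 - x) powr \<tau>1 = (1 - x) / (1 - x) powr (1 - \<tau>1)"
    using pos powr_diff[of "1 - x" 1 "1 - \<tau>1"] by simp
   have f3: "((1 + x) / (1 + y)) powr \<tau>2 = (1 + x) powr \<tau>2 * (1 + y) powr (- \<tau>2)"
    using pos by (simp add: powr_divide powr_minus_divide)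
   have f4: "((1 - y) / (1 - x)) powr (1 - \<tau>1) = (1 - y) powr (1 - \<tau>1) / (1 - x) powr (1 - \<tau>1)"
    using pos by (simp add: powr_divide)
   have gen: "((v / S) * X * R) * (W * (w * Z) * T) * (1 / (v * w)) = (X * Z) * (T / S) * (R * W)"
    if "v > 0" "w > 0" for X v S R W w Z T :: real
    using that by simp
   show ?thesis unfolding mx U_def Uy f1 f2 f3 f4 by (rule gen[OF pos(1,4)])
  qed
  also have "... <= 1 * 1 * U"
  proof (intro mult_mono)
   show "((1 + x) / (1 + y)) powr \<tau>2 <= 1" using pos that tau by (intro ratio) auto
   show "((1 - y) / (1 - x)) powr (1 - \<tau>1) <= 1" using pos that tau by (intro ratio) auto
  qed (auto simp: U_def jacobi_weight_nonneg)
  finally show ?thesis by simp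
 qed
 have fin: "mw x * (\<bar>(x - y) / ((x - y)^2 + e^2)\<bar> * (1 / mw y)) <= 4 * U"
  if "x ~= y" "0 < d" "d <= 4 * \<bar>x - y\<bar>" "mw x * (1 / mw y) * (1 / d) <= U" for d
 proof -
  have "\<bar>(x - y) / ((x - y)^2 + e^2)\<bar> <= 1 / \<bar>x - y\<bar>" by (rule hilbert_kernel_le[OF that(1)])
  also have "... <= 4 * (1 / d)" using that by (simp add: field_simps)
  finally have "\<bar>(x - y) / ((x - y)^2 + e^2)\<bar> * (mw x * (1 / mw y)) <= 4 * (1 / d) * (mw x * (1 / mw y))"
   using mw_pos[OF x] mw_pos[OF y] by (intro mult_right_mono) auto
  then show ?thesis using that(4) by (simp add: mult_ac)
 qed
 show ?thesis
 proof (cases "whitney_index y >= whitney_index x + 2")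
  case True
  note f = whitney_far[OF x y True]
  have "mw x * (\<bar>(x - y) / ((x - y)^2 + e^2)\<bar> * (1 / mw y)) <= 4 * U"
   by (rule fin[of "(1 - y) * (1 + x)"]) (use f pos core in auto)
  then show ?thesis by (simp add: U_def)
 next
  case False
  then have "whitney_index x >= whitney_index y + 2" using k by auto
  note f = whitney_far[OF y x this]
  have "mw x * (\<bar>(x - y) / ((x - y)^2 + e^2)\<bar> * (1 / mw y)) <= 4 * U"
   by (rule fin[of "(1 - x) * (1 + y)"]) (use f pos core' in auto)
  then show ?thesis by (simp add: U_def)
 qed
qed

text \<open>The exponents -\<sigma>1 and -\<sigma>2 exceed -1 by the upper bounds in
  \<open>t1\<close> and \<open>t2\<close> together with (\<alpha> + 1) / r > 0 and (\<beta> + 1) / r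
  > 0.\<close>

lemma inverse_mw_integrable: "integrable lborel (\<lambda>x. jacobi_weight (- \<sigma>1) (- \<sigma>2) x)"
proof -
 have "(\<alpha> + 1) / r > 0" "(\<beta> + 1) / r > 0" using ab r by auto
 then have "- \<sigma>1 > -1" "- \<sigma>2 > -1" using t1 t2 by linarith+
 then have "integrable (jacobi_measure (- \<sigma>1) (- \<sigma>2)) (\<lambda>x. 1 :: real)"
  by (intro integrable_jacobi_bounded[of _ _ _ 1]) auto
 then show ?thesis by (subst (asm) integral_jacobi_measure(2)) auto
qed

lemma hilbert_kernel_integrable:
 fixes g :: "real => real"
 assumes g: "integrable lborel g" and e: "e > 0"
 shows "integrable lborel (\<lambda>t. (x - t) / ((x - t)^2 + e^2) * g t)"
proof (rule Bochner_Integration.integrable_bound)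
 show "integrable lborel (\<lambda>t. 1 / e * g t)" by (intro integrable_mult_right g)
 have [measurable]: "g \<in> borel_measurable borel" using borel_measurable_integrable[OF g] by simp
 show "(\<lambda>t. (x - t) / ((x - t)^2 + e^2) * g t) \<in> borel_measurable lborel" by measurable
 have "norm ((x - t) / ((x - t)^2 + e^2) * g t) <= norm (1 / e * g t)" for t
  unfolding norm_mult using hilbert_kernel_bound[OF e, of "x - t"] e by (intro mult_right_mono) auto
 then show "AE t in lborel. norm ((x - t) / ((x - t)^2 + e^2) * g t) <= norm (1 / e * g t)" by simp
qed

definition whitney_nbhd :: "int => real set" where
 "whitney_nbhd k = {y\<in>Ioo. \<bar>whitney_index y - k\<bar> <= 1}"

lemma whitney_nbhd_eq: "whitney_nbhd k = whitney_piece (k - 1) \<union> whitney_piece k \<union> whitney_piece (k + 1)"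
 by (auto simp: whitney_nbhd_def whitney_piece_def)

lemma whitney_nbhd_measurable [measurable]: "whitney_nbhd k \<in> sets borel"
 unfolding whitney_nbhd_eq by measurable

lemma measure_comparable:
 assumes z: "z \<in> Ioo" "whitney_index z = k" and S: "S \<in> sets borel" "S \<subseteq> whitney_nbhd k"
 shows "emeasure (jacobi_measure \<alpha> \<beta>) S <= ennreal (4 powr (\<bar>\<alpha>\<bar> + \<bar>\<beta>\<bar>) * jacobi_weight \<alpha> \<beta> z) * emeasure lborel S"
  and "ennreal (jacobi_weight \<alpha> \<beta> z) * emeasure lborel S <= ennreal (4 powr (\<bar>\<alpha>\<bar> + \<bar>\<beta>\<bar>)) * emeasure (jacobi_measure \<alpha> \<beta>) S"
proof -
 define c where "c = 4 powr (\<bar>\<alpha>\<bar> + \<bar>\<beta>\<bar>)"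
 have [measurable]: "S \<in> sets borel" by fact
 have w: "jacobi_weight \<alpha> \<beta> x = (1 - x) powr \<alpha> * (1 + x) powr \<beta>" if "x \<in> Ioo" for x
  using that by (simp add: jacobi_weight_def)
 have le: "jacobi_weight \<alpha> \<beta> x <= c * jacobi_weight \<alpha> \<beta> z" "jacobi_weight \<alpha> \<beta> z <= c * jacobi_weight \<alpha> \<beta> x" if "x \<in> S" for x
 proof -
  have x: "x \<in> Ioo" "\<bar>whitney_index x - whitney_index z\<bar> <= 1" "\<bar>whitney_index z - whitney_index x\<bar> <= 1"
   using that S(2) z(2) by (auto simp: whitney_nbhd_def)
  show "jacobi_weight \<alpha> \<beta> x <= c * jacobi_weight \<alpha> \<beta> z" "jacobi_weight \<alpha> \<beta> z <= c * jacobi_weight \<alpha> \<beta> x"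
   unfolding w[OF x(1)] w[OF z(1)] c_def using jacobi_comparable[OF x(1) z(1) x(2)] jacobi_comparable[OF z(1) x(1) x(3)] by auto
 qed
 have "emeasure (jacobi_measure \<alpha> \<beta>) S = (\<integral>\<^sup>+ x. ennreal (indicator S x * jacobi_weight \<alpha> \<beta> x) \<partial>lborel)"
  by (rule emeasure_jacobi_measure[OF S(1)])
 also have "... <= (\<integral>\<^sup>+ x. ennreal (c * jacobi_weight \<alpha> \<beta> z) * indicator S x \<partial>lborel)"
  by (intro nn_integral_mono) (auto simp: indicator_def intro!: ennreal_leI le)
 also have "... = ennreal (c * jacobi_weight \<alpha> \<beta> z) * emeasure lborel S"
  by (rule nn_integral_cmult_indicator) simp
 finally show "emeasure (jacobi_measure \<alpha> \<beta>) S <= ennreal (4 powr (\<bar>\<alpha>\<bar> + \<bar>\<beta>\<bar>) * jacobi_weight \<alpha> \<beta> z) * emeasure lborel S"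
  unfolding c_def .
 have "ennreal (jacobi_weight \<alpha> \<beta> z) * emeasure lborel S = (\<integral>\<^sup>+ x. ennreal (jacobi_weight \<alpha> \<beta> z) * indicator S x \<partial>lborel)"
  by (rule nn_integral_cmult_indicator[symmetric]) simp
 also have "... <= (\<integral>\<^sup>+ x. ennreal c * ennreal (indicator S x * jacobi_weight \<alpha> \<beta> x) \<partial>lborel)"
 proof (rule nn_integral_mono)
  fix x
  have "ennreal (jacobi_weight \<alpha> \<beta> z) <= ennreal c * ennreal (jacobi_weight \<alpha> \<beta> x)" if "x \<in> S"
  proof -
   have "ennreal (jacobi_weight \<alpha> \<beta> z) <= ennreal (c * jacobi_weight \<alpha> \<beta> x)" by (intro ennreal_leI le(2) that)
   also have "... = ennreal c * ennreal (jacobi_weight \<alpha> \<beta> x)"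
    by (intro ennreal_mult) (auto simp: c_def jacobi_weight_nonneg)
   finally show ?thesis .
  qed
  then show "ennreal (jacobi_weight \<alpha> \<beta> z) * indicator S x <= ennreal c * ennreal (indicator S x * jacobi_weight \<alpha> \<beta> x)"
   by (cases "x \<in> S") auto
 qed
 also have "... = ennreal c * (\<integral>\<^sup>+ x. ennreal (indicator S x * jacobi_weight \<alpha> \<beta> x) \<partial>lborel)"
  by (rule nn_integral_cmult) measurable
 also have "(\<integral>\<^sup>+ x. ennreal (indicator S x * jacobi_weight \<alpha> \<beta> x) \<partial>lborel) = emeasure (jacobi_measure \<alpha> \<beta>) S"
  by (rule emeasure_jacobi_measure[OF S(1), symmetric])
 finally show "ennreal (jacobi_weight \<alpha> \<beta> z) * emeasure lborel S <= ennreal (4 powr (\<bar>\<alpha>\<bar> + \<bar>\<beta>\<bar>)) * emeasure (jacobi_measure \<alpha> \<beta>) S"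
  unfolding c_def .
qed

lemma local_weak_bound:
 "\<exists>D\<ge>0. \<forall>B E e s k. B \<in> borel_measurable borel \<and> (\<forall>x. \<bar>B x\<bar> <= 1) \<and> E \<in> sets borel \<and> E \<subseteq> Ioo \<and> e > 0 \<and> s > 0 -->
   (\<exists>S\<in>sets borel. S \<subseteq> whitney_piece k \<and>
    {x\<in>whitney_piece k. mw x * \<bar>hilbert_reg e (\<lambda>t. B t * (1 / mw t) * indicator (E \<inter> whitney_nbhd k) t) x\<bar> > s} \<subseteq> S \<and>
    emeasure (jacobi_measure \<alpha> \<beta>) S <= ennreal (D * s powr (- r)) * emeasure (jacobi_measure \<alpha> \<beta>) (E \<inter> whitney_nbhd k))"
proof -
 obtain CH where CH: "CH >= 0" "\<And>f E e s. dominated f E ==> e > 0 ==> s > 0 ==>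
   measure lborel {x\<in>{-1..1}. \<bar>hilbert_reg e f x\<bar> > s} <= CH * s powr (- r) * measure lborel E"
  using hilbert_weak_type[OF r] by blast
 define c0 where "c0 = 4 powr (\<bar>\<sigma>1\<bar> + \<bar>\<sigma>2\<bar>)"
 define c1 where "c1 = 4 powr (\<bar>\<alpha>\<bar> + \<bar>\<beta>\<bar>)"
 have c0: "c0 > 0" and c1: "c1 > 0" by (auto simp: c0_def c1_def)
 define D where "D = c1 * CH * (c0 * c0) powr r * c1"
 have D: "D >= 0" using c1 CH by (simp add: D_def)
 have "\<exists>S\<in>sets borel. S \<subseteq> whitney_piece k \<and>
    {x\<in>whitney_piece k. mw x * \<bar>hilbert_reg e (\<lambda>t. B t * (1 / mw t) * indicator (E \<inter> whitney_nbhd k) t) x\<bar> > s} \<subseteq> S \<and>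
    emeasure (jacobi_measure \<alpha> \<beta>) S <= ennreal (D * s powr (- r)) * emeasure (jacobi_measure \<alpha> \<beta>) (E \<inter> whitney_nbhd k)"
  if B [measurable]: "B \<in> borel_measurable borel" "\<And>x. \<bar>B x\<bar> <= 1" and E [measurable]: "E \<in> sets borel" "E \<subseteq> Ioo"
   and e: "e > 0" and s: "s > 0" for B E e s k
 proof -
  obtain z where z: "z \<in> Ioo" "whitney_index z = k" using whitney_center by blast
  define F where "F = E \<inter> whitney_nbhd k"
  have F [measurable]: "F \<in> sets borel" unfolding F_def by measurable
  have Fn: "F \<subseteq> whitney_nbhd k" and F1: "F \<subseteq> {-1..1}"
   using E by (auto simp: F_def whitney_nbhd_def)
  define g where "g t = B t * (1 / mw t) * indicator F t" for t
  define f where "f t = mw z / c0 * g t" for t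
  have mz: "mw z > 0" by (rule mw_pos[OF z(1)])
  have f: "dominated f F"
   unfolding dominated_def
  proof (intro conjI allI)
   show "f \<in> borel_measurable borel" unfolding f_def[abs_def] g_def by measurable
   fix t
   show "\<bar>f t\<bar> <= indicator F t"
   proof (cases "t \<in> F")
    case True
    then have t: "t \<in> Ioo" "\<bar>whitney_index z - whitney_index t\<bar> <= 1"
     using Fn z by (auto simp: whitney_nbhd_def)
    have mt: "mw t > 0" by (rule mw_pos[OF t(1)])
    have "mw z <= c0 * mw t"
     using jacobi_comparable[OF z(1) t, of \<sigma>1 \<sigma>2] by (simp add: mw_def c0_def)
    then have q: "mw z / (c0 * mw t) <= 1" using c0 mt by simp
    have "\<bar>f t\<bar> = (mw z / (c0 * mw t)) * \<bar>B t\<bar>"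
     using True mz mt c0 by (simp add: f_def g_def abs_mult)
    also have "... <= 1 * 1" using q B(2)[of t] by (intro mult_mono) auto
    finally show ?thesis using True by simp
   qed (simp add: f_def g_def)
  qed (use F F1 in auto)
  have Hg: "hilbert_reg e g x = c0 / mw z * hilbert_reg e f x" for x
  proof -
   have "g t = c0 / mw z * f t" for t using mz c0 by (simp add: f_def)
   then have "hilbert_reg e g x = (\<integral>t. c0 / mw z * ((x - t) / ((x - t)^2 + e^2) * f t) \<partial>lborel)"
    unfolding hilbert_reg_def by (simp only: mult_ac)
   then show ?thesis unfolding hilbert_reg_def by (simp only: integral_mult_right_zero)
  qed
  have [measurable]: "hilbert_reg e f \<in> borel_measurable borel"
   by (intro borel_measurable_continuous_onI hilbert_poisson_continuous[OF f e])
  \<comment> \<open>One factor \<open>c0\<close> comes from replacing \<open>mw x\<close> by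
    \<open>mw z\<close>, the other from scaling f so that it is dominated by the indicator.\<close>
  define s' where "s' = s / (c0 * c0)"
  have s': "s' > 0" using s c0 by (simp add: s'_def)
  define S where "S = {x\<in>whitney_piece k. \<bar>hilbert_reg e f x\<bar> > s'}"
  have Sm [measurable]: "S \<in> sets borel" unfolding S_def by measurable
  have Sp: "S \<subseteq> whitney_piece k" by (auto simp: S_def)
  have Sn: "S \<subseteq> whitney_nbhd k" using Sp by (auto simp: whitney_piece_def whitney_nbhd_def)
  have sub: "{x\<in>whitney_piece k. mw x * \<bar>hilbert_reg e g x\<bar> > s} \<subseteq> S"
  proof
   fix x assume "x \<in> {x\<in>whitney_piece k. mw x * \<bar>hilbert_reg e g x\<bar> > s}"
   then have x: "x \<in> whitney_piece k" "mw x * \<bar>hilbert_reg e g x\<bar> > s" by auto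
   have x1: "x \<in> Ioo" "\<bar>whitney_index x - whitney_index z\<bar> <= 1" using x(1) z by (auto simp: whitney_piece_def)
   have "mw x <= c0 * mw z"
    using jacobi_comparable[OF x1(1) z(1) x1(2), of \<sigma>1 \<sigma>2] by (simp add: mw_def c0_def)
   then have "mw x * \<bar>hilbert_reg e g x\<bar> <= (c0 * mw z) * \<bar>hilbert_reg e g x\<bar>" by (intro mult_right_mono) auto
   also have "... = c0 * c0 * \<bar>hilbert_reg e f x\<bar>" unfolding Hg using mz c0 by (simp add: abs_mult)
   finally have "s < c0 * c0 * \<bar>hilbert_reg e f x\<bar>" using x(2) by linarith
   then have "s' < \<bar>hilbert_reg e f x\<bar>" using c0 by (simp add: s'_def pos_divide_less_eq mult.commute)
   then show "x \<in> S" using x(1) by (simp add: S_def)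
  qed
  have fin: "emeasure lborel F = ennreal (measure lborel F)"
   using dominated_finite[OF f] by (simp add: emeasure_eq_ennreal_measure)
  have "emeasure lborel S <= emeasure lborel {x\<in>{-1..1}. \<bar>hilbert_reg e f x\<bar> > s'}"
   by (intro emeasure_mono) (auto simp: S_def whitney_piece_def)
  also have "... = ennreal (measure lborel {x\<in>{-1..1}. \<bar>hilbert_reg e f x\<bar> > s'})"
  proof (rule emeasure_eq_ennreal_measure)
   have "emeasure lborel {x\<in>{-1..1}. \<bar>hilbert_reg e f x\<bar> > s'} <= emeasure lborel {-1..1::real}"
    by (rule emeasure_mono) auto
   then show "emeasure lborel {x\<in>{-1..1}. \<bar>hilbert_reg e f x\<bar> > s'} ~= top" by (auto simp: top_unique)
  qed
  also have "... <= ennreal (CH * s' powr (- r) * measure lborel F)"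
   by (intro ennreal_leI CH(2)[OF f e s'])
  also have "... = ennreal (CH * s' powr (- r)) * emeasure lborel F"
   unfolding fin using CH(1) by (intro ennreal_mult) auto
  finally have S1: "emeasure lborel S <= ennreal (CH * s' powr (- r)) * emeasure lborel F" .
  have "emeasure (jacobi_measure \<alpha> \<beta>) S <= ennreal (c1 * jacobi_weight \<alpha> \<beta> z) * emeasure lborel S"
   unfolding c1_def by (rule measure_comparable(1)[OF z Sm Sn])
  also have "... <= ennreal (c1 * jacobi_weight \<alpha> \<beta> z) * (ennreal (CH * s' powr (- r)) * emeasure lborel F)"
   by (intro mult_left_mono S1) auto
  also have "... = ennreal (c1 * (CH * s' powr (- r))) * (ennreal (jacobi_weight \<alpha> \<beta> z) * emeasure lborel F)"
   using c1 CH(1) by (simp add: ennreal_mult jacobi_weight_nonneg mult_ac)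
  also have "... <= ennreal (c1 * (CH * s' powr (- r))) * (ennreal c1 * emeasure (jacobi_measure \<alpha> \<beta>) F)"
   unfolding c1_def by (intro mult_left_mono measure_comparable(2)[OF z F Fn]) auto
  also have "... = ennreal (c1 * (CH * s' powr (- r)) * c1) * emeasure (jacobi_measure \<alpha> \<beta>) F"
   using c1 CH(1) by (simp add: ennreal_mult mult_ac)
  also have "c1 * (CH * s' powr (- r)) * c1 = D * s powr (- r)"
  proof -
   have "s' powr (- r) = s powr (- r) / (c0 * c0) powr (- r)" using s c0 by (simp add: s'_def powr_divide)
   also have "... = s powr (- r) * (c0 * c0) powr r" by (simp add: powr_minus_divide)
   finally show ?thesis by (simp add: D_def)
  qed
  finally have "emeasure (jacobi_measure \<alpha> \<beta>) S <= ennreal (D * s powr (- r)) * emeasure (jacobi_measure \<alpha> \<beta>) F" .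
  then show ?thesis using Sm Sp sub unfolding F_def g_def by (intro bexI[of _ S]) auto
 qed
 then show ?thesis using D by blast
qed

end

lemma emeasure_jacobi_Ioo:
 assumes [measurable]: "S \<in> sets borel"
 shows "emeasure (jacobi_measure \<alpha> \<beta>) S = emeasure (jacobi_measure \<alpha> \<beta>) (S \<inter> Ioo)"
proof (rule emeasure_eq_AE)
 show "AE x in jacobi_measure \<alpha> \<beta>. x \<in> S \<longleftrightarrow> x \<in> S \<inter> Ioo"
  using AE_jacobi_measure_Ioo by eventually_elim auto
qed auto

lemma rho0_nonneg: "rho0 \<alpha> \<beta> x >= 0"
 by (simp add: rho0_def)

context weighted_hilbert
begin

text \<open>A point lies in exactly those neighbourhoods whose index is its own or an adjacent one,
  hence in three.\<close>

lemma sum_nbhd: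
 assumes [measurable]: "E \<in> sets borel"
 shows "(\<integral>\<^sup>+k. emeasure (jacobi_measure \<alpha> \<beta>) (E \<inter> whitney_nbhd k) \<partial>count_space UNIV) <= 3 * emeasure (jacobi_measure \<alpha> \<beta>) E"
proof -
 define \<mu> where "\<mu> = jacobi_measure \<alpha> \<beta>"
 have [measurable_cong]: "sets \<mu> = sets borel" by (simp add: \<mu>_def)
 have shift: "(\<integral>\<^sup>+k. emeasure \<mu> (E \<inter> whitney_piece (k + i)) \<partial>count_space UNIV) <= emeasure \<mu> E" for i
 proof -
  have "(\<integral>\<^sup>+k. emeasure \<mu> (E \<inter> whitney_piece (k + i)) \<partial>count_space UNIV) = emeasure \<mu> (\<Union>k\<in>UNIV. E \<inter> whitney_piece (k + i))"
  proof (rule emeasure_UN_countable[symmetric])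
   show "disjoint_family_on (\<lambda>k. E \<inter> whitney_piece (k + i)) UNIV"
    by (auto simp: disjoint_family_on_def whitney_piece_def)
  qed auto
  also have "... <= emeasure \<mu> E" by (rule emeasure_mono) (auto simp: \<mu>_def)
  finally show ?thesis .
 qed
 have "emeasure \<mu> (E \<inter> whitney_nbhd k) <= emeasure \<mu> (E \<inter> whitney_piece (k + (-1))) + emeasure \<mu> (E \<inter> whitney_piece (k + 0)) + emeasure \<mu> (E \<inter> whitney_piece (k + 1))" for k
 proof -
  have "emeasure \<mu> (E \<inter> whitney_nbhd k) = emeasure \<mu> ((E \<inter> whitney_piece (k + (-1)) \<union> E \<inter> whitney_piece (k + 0)) \<union> E \<inter> whitney_piece (k + 1))"
   by (rule arg_cong[where f = "emeasure \<mu>"]) (auto simp: whitney_nbhd_eq)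
  also have "... <= emeasure \<mu> (E \<inter> whitney_piece (k + (-1)) \<union> E \<inter> whitney_piece (k + 0)) + emeasure \<mu> (E \<inter> whitney_piece (k + 1))"
   by (rule emeasure_subadditive) measurable
  also have "... <= emeasure \<mu> (E \<inter> whitney_piece (k + (-1))) + emeasure \<mu> (E \<inter> whitney_piece (k + 0)) + emeasure \<mu> (E \<inter> whitney_piece (k + 1))"
   by (intro add_right_mono emeasure_subadditive) measurable
  finally show ?thesis .
 qed
 then have "(\<integral>\<^sup>+k. emeasure \<mu> (E \<inter> whitney_nbhd k) \<partial>count_space UNIV) \<le>
   (\<integral>\<^sup>+k. emeasure \<mu> (E \<inter> whitney_piece (k + (-1))) + emeasure \<mu> (E \<inter> whitney_piece (k + 0)) + emeasure \<mu> (E \<inter> whitney_piece (k + 1)) \<partial>count_space UNIV)"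
  by (intro nn_integral_mono)
 also have "... = (\<integral>\<^sup>+k. emeasure \<mu> (E \<inter> whitney_piece (k + (-1))) \<partial>count_space UNIV)
   + (\<integral>\<^sup>+k. emeasure \<mu> (E \<inter> whitney_piece (k + 0)) \<partial>count_space UNIV)
   + (\<integral>\<^sup>+k. emeasure \<mu> (E \<inter> whitney_piece (k + 1)) \<partial>count_space UNIV)"
  by (simp add: nn_integral_add)
 also have "... <= emeasure \<mu> E + emeasure \<mu> E + emeasure \<mu> E" by (intro add_mono shift)
 also have "... = 3 * emeasure \<mu> E"
 proof -
  have "(3::ennreal) = 1 + 1 + 1" by simp
  then show ?thesis by (simp only: distrib_right mult_1)
 qed
 finally show ?thesis by (simp add: \<mu>_def)
qed

text \<open>The rank-one bound integrated over E. The result no longer depends on the piece k that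
  contains x.\<close>

lemma far_part_bound:
 "\<exists>C\<ge>0. \<forall>B E e k x. B \<in> borel_measurable borel \<and> (\<forall>x. \<bar>B x\<bar> <= 1) \<and> E \<in> sets borel \<and> E \<subseteq> Ioo \<and> e > 0 \<and> x \<in> whitney_piece k -->
   mw x * \<bar>hilbert_reg e (\<lambda>t. B t * (1 / mw t) * indicator (E - whitney_nbhd k) t) x\<bar>
    <= C * measure (jacobi_measure \<alpha> \<beta>) E powr (1 / r) * rho0 \<alpha> \<beta> x powr (- 1 / r)"
proof -
 define \<mu> where "\<mu> = jacobi_measure \<alpha> \<beta>"
 interpret fin: finite_measure \<mu> unfolding \<mu>_def by (rule jacobi_measure_finite[OF ab])
 obtain C where C: "C >= 0" "\<And>t. t > 0 ==> emeasure \<mu> {x\<in>Ioo. rho0 \<alpha> \<beta> x < t} <= ennreal (C * t)"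
  using rho0_sublevel[OF ab] unfolding \<mu>_def by blast
 have C': "emeasure \<mu> {x\<in>space \<mu>. rho0 \<alpha> \<beta> x < t} <= ennreal (C * t)" if "t > 0" for t
 proof -
  have "emeasure \<mu> {x\<in>space \<mu>. rho0 \<alpha> \<beta> x < t} = emeasure \<mu> ({x\<in>space \<mu>. rho0 \<alpha> \<beta> x < t} \<inter> Ioo)"
   unfolding \<mu>_def by (rule emeasure_jacobi_Ioo) simp
  also have "{x\<in>space \<mu>. rho0 \<alpha> \<beta> x < t} \<inter> Ioo = {x\<in>Ioo. rho0 \<alpha> \<beta> x < t}" by (auto simp: \<mu>_def)
  finally show ?thesis using C(2)[OF that] by simp
 qed
 define \<theta> where "\<theta> = 1 - 1 / r"
 have th: "0 < \<theta>" "\<theta> < 1" "1 - \<theta> = 1 / r" using r by (auto simp: \<theta>_def)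
 define C2 where "C2 = 1 + C * 2 powr \<theta> / (1 - 2 powr (\<theta> - 1))"
 have "2 powr (\<theta> - 1) < 2 powr 0" using th by (intro powr_less_mono) auto
 then have C2: "C2 >= 0" using C(1) by (simp add: C2_def)
 have intb: "(\<integral>\<^sup>+x. ennreal (rho0 \<alpha> \<beta> x powr (- \<theta>)) * indicator E x \<partial>\<mu>) <= ennreal (C2 * measure \<mu> E powr (1 / r))"
  if "E \<in> sets borel" for E
  using sublevel_integral_bound[of "rho0 \<alpha> \<beta>" \<mu> C \<theta> E] C' C(1) th that rho0_nonneg
  by (simp add: C2_def less_top[symmetric]) (simp add: \<mu>_def)
 have "mw x * \<bar>hilbert_reg e (\<lambda>t. B t * (1 / mw t) * indicator (E - whitney_nbhd k) t) x\<bar>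
    <= (4 * C2) * measure \<mu> E powr (1 / r) * rho0 \<alpha> \<beta> x powr (- 1 / r)"
  if B [measurable]: "B \<in> borel_measurable borel" "\<And>x. \<bar>B x\<bar> <= 1" and E [measurable]: "E \<in> sets borel" "E \<subseteq> Ioo"
   and e: "e > 0" and x: "x \<in> whitney_piece k" for B E e k x
 proof -
  have x1: "x \<in> Ioo" "whitney_index x = k" using x by (auto simp: whitney_piece_def)
  define g where "g t = B t * (1 / mw t) * indicator (E - whitney_nbhd k) t" for t
  have gm [measurable]: "g \<in> borel_measurable borel" unfolding g_def[abs_def] by measurable
  have gi: "integrable lborel g"
  proof (rule Bochner_Integration.integrable_bound[OF inverse_mw_integrable])
   have "norm (g t) <= norm (jacobi_weight (- \<sigma>1) (- \<sigma>2) t)" for t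
   proof (cases "t \<in> E")
    case True
    then have t: "t \<in> Ioo" using E by auto
    have "\<bar>g t\<bar> = \<bar>B t\<bar> * (1 / mw t) * indicator (E - whitney_nbhd k) t" using mw_pos[OF t] by (simp add: g_def abs_mult)
    also have "... <= 1 * (1 / mw t) * 1" using B(2)[of t] mw_pos[OF t] by (intro mult_mono) (auto simp: indicator_def)
    also have "... = jacobi_weight (- \<sigma>1) (- \<sigma>2) t" using t inverse_mw[OF t] by (simp add: jacobi_weight_def)
    finally show ?thesis by simp
   qed (simp add: g_def)
   then show "AE t in lborel. norm (g t) <= norm (jacobi_weight (- \<sigma>1) (- \<sigma>2) t)" by simp
  qed simp
  define R where "R = rho0 \<alpha> \<beta> x powr (- 1 / r)"
  have R: "R >= 0" by (simp add: R_def)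
  have "ennreal (mw x * \<bar>hilbert_reg e g x\<bar>) = ennreal (mw x) * ennreal (norm (\<integral>t. (x - t) / ((x - t)^2 + e^2) * g t \<partial>lborel))"
   unfolding hilbert_reg_def using mw_pos[OF x1(1)] by (simp add: ennreal_mult)
  also have "... <= ennreal (mw x) * (\<integral>\<^sup>+t. norm ((x - t) / ((x - t)^2 + e^2) * g t) \<partial>lborel)"
   by (intro mult_left_mono integral_norm_bound_ennreal hilbert_kernel_integrable[OF gi e]) auto
  also have "... = (\<integral>\<^sup>+t. ennreal (mw x) * norm ((x - t) / ((x - t)^2 + e^2) * g t) \<partial>lborel)"
   by (rule nn_integral_cmult[symmetric]) measurable
  also have "... <= (\<integral>\<^sup>+t. ennreal (4 * R) * (ennreal (jacobi_weight \<alpha> \<beta> t) * (ennreal (rho0 \<alpha> \<beta> t powr (- \<theta>)) * indicator E t)) \<partial>lborel)"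
  proof (rule nn_integral_mono)
   fix t
   show "ennreal (mw x) * ennreal (norm ((x - t) / ((x - t)^2 + e^2) * g t)) <= ennreal (4 * R) * (ennreal (jacobi_weight \<alpha> \<beta> t) * (ennreal (rho0 \<alpha> \<beta> t powr (- \<theta>)) * indicator E t))"
   proof (cases "t \<in> E - whitney_nbhd k")
    case False
    then show ?thesis by (auto simp: g_def)
   next
    case True
    then have t: "t \<in> Ioo" "\<bar>whitney_index x - whitney_index t\<bar> >= 2" "t \<in> E"
     using E x1 by (auto simp: whitney_nbhd_def)
    have "mw x * norm ((x - t) / ((x - t)^2 + e^2) * g t) = \<bar>B t\<bar> * (mw x * (\<bar>(x - t) / ((x - t)^2 + e^2)\<bar> * (1 / mw t)))"
     using True mw_pos[OF t(1)] by (simp add: g_def abs_mult)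
    also have "... <= 1 * (mw x * (\<bar>(x - t) / ((x - t)^2 + e^2)\<bar> * (1 / mw t)))"
     using B(2)[of t] mw_pos[OF t(1)] mw_pos[OF x1(1)] by (intro mult_right_mono) auto
    also have "... <= 4 * R * (rho0 \<alpha> \<beta> t powr (- \<theta>) * jacobi_weight \<alpha> \<beta> t)"
     using far_bound[OF x1(1) t(1,2), of e] by (simp add: R_def \<theta>_def)
    finally have "ennreal (mw x * norm ((x - t) / ((x - t)^2 + e^2) * g t)) <= ennreal (4 * R * (rho0 \<alpha> \<beta> t powr (- \<theta>) * jacobi_weight \<alpha> \<beta> t))"
     by (rule ennreal_leI)
    moreover have "ennreal (mw x * norm ((x - t) / ((x - t)^2 + e^2) * g t)) = ennreal (mw x) * ennreal (norm ((x - t) / ((x - t)^2 + e^2) * g t))"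
     by (rule ennreal_mult) (use mw_pos[OF x1(1)] in auto)
    moreover have "ennreal (4 * R * (rho0 \<alpha> \<beta> t powr (- \<theta>) * jacobi_weight \<alpha> \<beta> t)) = ennreal (4 * R) * (ennreal (jacobi_weight \<alpha> \<beta> t) * (ennreal (rho0 \<alpha> \<beta> t powr (- \<theta>)) * indicator E t))"
     using t(3) R by (simp add: ennreal_mult jacobi_weight_nonneg mult_ac)
    ultimately show ?thesis by (simp only:)
   qed
  qed
  also have "... = ennreal (4 * R) * (\<integral>\<^sup>+t. ennreal (jacobi_weight \<alpha> \<beta> t) * (ennreal (rho0 \<alpha> \<beta> t powr (- \<theta>)) * indicator E t) \<partial>lborel)"
   by (rule nn_integral_cmult) measurable
  also have "(\<integral>\<^sup>+t. ennreal (jacobi_weight \<alpha> \<beta> t) * (ennreal (rho0 \<alpha> \<beta> t powr (- \<theta>)) * indicator E t) \<partial>lborel)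
    = (\<integral>\<^sup>+t. ennreal (rho0 \<alpha> \<beta> t powr (- \<theta>)) * indicator E t \<partial>\<mu>)"
   unfolding \<mu>_def by (rule nn_integral_jacobi_measure[symmetric]) measurable
  also have "ennreal (4 * R) * ... <= ennreal (4 * R) * ennreal (C2 * measure \<mu> E powr (1 / r))"
   by (intro mult_left_mono intb E) auto
  also have "... = ennreal (4 * R * (C2 * measure \<mu> E powr (1 / r)))" using R C2 by (simp add: ennreal_mult)
  finally have "mw x * \<bar>hilbert_reg e g x\<bar> <= 4 * R * (C2 * measure \<mu> E powr (1 / r))"
   using R C2 by (subst (asm) ennreal_le_iff) auto
  then show ?thesis unfolding g_def R_def by (simp add: mult_ac)
 qed
 then show ?thesis using C2 unfolding \<mu>_def by (intro exI[of _ "4 * C2"]) auto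
qed

text \<open>At a point of piece k the function is split into its part on the neighbourhood of k and
  the rest, with s / 2 for each. The local level sets are disjoint and their bounds add up by the
  bounded overlap; the far parts all lie below one multiple of \<open>rho0\<close> to the power
  -1/r.\<close>

theorem weighted_weak:
 "\<exists>C\<ge>0. \<forall>B E e s. B \<in> borel_measurable borel \<and> (\<forall>x. \<bar>B x\<bar> <= 1) \<and> E \<in> sets borel \<and> E \<subseteq> Ioo \<and> e > 0 \<and> s > 0 -->
   emeasure (jacobi_measure \<alpha> \<beta>) {x\<in>Ioo. mw x * \<bar>hilbert_reg e (\<lambda>t. B t * (1 / mw t) * indicator E t) x\<bar> > s}
   <= ennreal (C * s powr (- r) * measure (jacobi_measure \<alpha> \<beta>) E)"
proof -
 define \<mu> where "\<mu> = jacobi_measure \<alpha> \<beta>"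
 have [measurable_cong]: "sets \<mu> = sets borel" by (simp add: \<mu>_def)
 interpret fin: finite_measure \<mu> unfolding \<mu>_def by (rule jacobi_measure_finite[OF ab])
 obtain C where C: "C >= 0" "\<And>t. t > 0 ==> emeasure \<mu> {x\<in>Ioo. rho0 \<alpha> \<beta> x < t} <= ennreal (C * t)"
  using rho0_sublevel[OF ab] unfolding \<mu>_def by blast
 have C': "emeasure \<mu> {x\<in>space \<mu>. rho0 \<alpha> \<beta> x < t} <= ennreal (C * t)" if "t > 0" for t
 proof -
  have "emeasure \<mu> {x\<in>space \<mu>. rho0 \<alpha> \<beta> x < t} = emeasure \<mu> ({x\<in>space \<mu>. rho0 \<alpha> \<beta> x < t} \<inter> Ioo)"
   unfolding \<mu>_def by (rule emeasure_jacobi_Ioo) simp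
  also have "{x\<in>space \<mu>. rho0 \<alpha> \<beta> x < t} \<inter> Ioo = {x\<in>Ioo. rho0 \<alpha> \<beta> x < t}" by (auto simp: \<mu>_def)
  finally show ?thesis using C(2)[OF that] by simp
 qed
 obtain Cf where Cf: "Cf >= 0" "\<And>B E e k x. B \<in> borel_measurable borel ==> (\<And>x. \<bar>B x\<bar> <= 1) ==> E \<in> sets borel ==> E \<subseteq> Ioo ==> e > 0 ==> x \<in> whitney_piece k ==>
   mw x * \<bar>hilbert_reg e (\<lambda>t. B t * (1 / mw t) * indicator (E - whitney_nbhd k) t) x\<bar>
    <= Cf * measure \<mu> E powr (1 / r) * rho0 \<alpha> \<beta> x powr (- 1 / r)"
  using far_part_bound unfolding \<mu>_def by blast
 obtain D where D: "D >= 0" and D2: "\<forall>B E e s k. B \<in> borel_measurable borel \<and> (\<forall>x. \<bar>B x\<bar> <= 1) \<and> E \<in> sets borel \<and> E \<subseteq> Ioo \<and> e > 0 \<and> s > 0 -->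
   (\<exists>S\<in>sets borel. S \<subseteq> whitney_piece k \<and>
    {x\<in>whitney_piece k. mw x * \<bar>hilbert_reg e (\<lambda>t. B t * (1 / mw t) * indicator (E \<inter> whitney_nbhd k) t) x\<bar> > s} \<subseteq> S \<and>
    emeasure \<mu> S <= ennreal (D * s powr (- r)) * emeasure \<mu> (E \<inter> whitney_nbhd k))"
  using local_weak_bound[folded \<mu>_def] by (elim exE conjE)
 define Q where "Q = 3 * D * 2 powr r + C * Cf powr r * 2 powr r"
 have Q: "Q >= 0" using D C by (simp add: Q_def)
 have "emeasure \<mu> {x\<in>Ioo. mw x * \<bar>hilbert_reg e (\<lambda>t. B t * (1 / mw t) * indicator E t) x\<bar> > s}
   <= ennreal (Q * s powr (- r) * measure \<mu> E)"
  if B [measurable]: "B \<in> borel_measurable borel" "\<And>x. \<bar>B x\<bar> <= 1" and E [measurable]: "E \<in> sets borel" "E \<subseteq> Ioo"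
   and e: "e > 0" and s: "s > 0" for B E e s
 proof -
  have s2: "s / 2 > 0" using s by simp
  have ex: "\<forall>k. \<exists>S. S \<in> sets borel \<and> S \<subseteq> whitney_piece k \<and>
    {x\<in>whitney_piece k. mw x * \<bar>hilbert_reg e (\<lambda>t. B t * (1 / mw t) * indicator (E \<inter> whitney_nbhd k) t) x\<bar> > s / 2} \<subseteq> S \<and>
    emeasure \<mu> S <= ennreal (D * (s / 2) powr (- r)) * emeasure \<mu> (E \<inter> whitney_nbhd k)"
   using D2[rule_format, of B E e "s / 2"] B E e s2 by (simp add: Bex_def)
  obtain S where S0: "\<forall>k. S k \<in> sets borel \<and> S k \<subseteq> whitney_piece k \<and>
    {x\<in>whitney_piece k. mw x * \<bar>hilbert_reg e (\<lambda>t. B t * (1 / mw t) * indicator (E \<inter> whitney_nbhd k) t) x\<bar> > s / 2} \<subseteq> S k \<and>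
    emeasure \<mu> (S k) <= ennreal (D * (s / 2) powr (- r)) * emeasure \<mu> (E \<inter> whitney_nbhd k)"
   using choice[OF ex] by (elim exE)
  have S: "\<And>k. S k \<in> sets borel" "\<And>k. S k \<subseteq> whitney_piece k"
    "\<And>k. {x\<in>whitney_piece k. mw x * \<bar>hilbert_reg e (\<lambda>t. B t * (1 / mw t) * indicator (E \<inter> whitney_nbhd k) t) x\<bar> > s / 2} \<subseteq> S k"
    "\<And>k. emeasure \<mu> (S k) <= ennreal (D * (s / 2) powr (- r)) * emeasure \<mu> (E \<inter> whitney_nbhd k)"
   using S0 by simp_all
  define Kf where "Kf = Cf * measure \<mu> E powr (1 / r)"
  have Kf: "Kf >= 0" using Cf by (simp add: Kf_def)
  define Z where "Z = {x\<in>space \<mu>. Kf * rho0 \<alpha> \<beta> x powr (- 1 / r) > s / 2}"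
  have Zm [measurable]: "Z \<in> sets borel" unfolding Z_def \<mu>_def space_jacobi_measure by measurable
  have Um: "(\<Union>k. S k) \<in> sets borel" using S(1) by auto
  have gi: "integrable lborel (\<lambda>t. B t * (1 / mw t) * indicator F t)" if F [measurable]: "F \<in> sets borel" "F \<subseteq> Ioo" for F
  proof (rule Bochner_Integration.integrable_bound[OF inverse_mw_integrable])
   have "norm (B t * (1 / mw t) * indicator F t) <= norm (jacobi_weight (- \<sigma>1) (- \<sigma>2) t)" for t
   proof (cases "t \<in> F")
    case True
    then have t: "t \<in> Ioo" using F by auto
    have "\<bar>B t * (1 / mw t)\<bar> = \<bar>B t\<bar> * (1 / mw t)" using mw_pos[OF t] by (simp add: abs_mult)
    also have "... <= 1 * (1 / mw t)" using B(2)[of t] mw_pos[OF t] by (intro mult_right_mono) auto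
    also have "... = jacobi_weight (- \<sigma>1) (- \<sigma>2) t" using t inverse_mw[OF t] by (simp add: jacobi_weight_def)
    finally show ?thesis using True by simp
   qed simp
   then show "AE t in lborel. norm (B t * (1 / mw t) * indicator F t) <= norm (jacobi_weight (- \<sigma>1) (- \<sigma>2) t)" by simp
  qed simp
  have split: "hilbert_reg e (\<lambda>t. B t * (1 / mw t) * indicator E t) x =
    hilbert_reg e (\<lambda>t. B t * (1 / mw t) * indicator (E \<inter> whitney_nbhd k) t) x + hilbert_reg e (\<lambda>t. B t * (1 / mw t) * indicator (E - whitney_nbhd k) t) x" for x k
  proof -
   have i1: "integrable lborel (\<lambda>t. (x - t) / ((x - t)^2 + e^2) * (B t * (1 / mw t) * indicator (E \<inter> whitney_nbhd k) t))"
    using E by (intro hilbert_kernel_integrable[OF gi e]) auto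
   have i2: "integrable lborel (\<lambda>t. (x - t) / ((x - t)^2 + e^2) * (B t * (1 / mw t) * indicator (E - whitney_nbhd k) t))"
    using E by (intro hilbert_kernel_integrable[OF gi e]) auto
   have eq: "(x - t) / ((x - t)^2 + e^2) * (B t * (1 / mw t) * indicator E t) =
     (x - t) / ((x - t)^2 + e^2) * (B t * (1 / mw t) * indicator (E \<inter> whitney_nbhd k) t)
     + (x - t) / ((x - t)^2 + e^2) * (B t * (1 / mw t) * indicator (E - whitney_nbhd k) t)" for t
    by (auto simp: indicator_def)
   show ?thesis unfolding hilbert_reg_def eq by (rule Bochner_Integration.integral_add[OF i1 i2])
  qed
  have sub: "{x\<in>Ioo. mw x * \<bar>hilbert_reg e (\<lambda>t. B t * (1 / mw t) * indicator E t) x\<bar> > s} \<subseteq> (\<Union>k. S k) \<union> Z"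
  proof
   fix x assume "x \<in> {x\<in>Ioo. mw x * \<bar>hilbert_reg e (\<lambda>t. B t * (1 / mw t) * indicator E t) x\<bar> > s}"
   then have x: "x \<in> Ioo" "mw x * \<bar>hilbert_reg e (\<lambda>t. B t * (1 / mw t) * indicator E t) x\<bar> > s" by auto
   define k where "k = whitney_index x"
   have xk: "x \<in> whitney_piece k" using x by (simp add: whitney_piece_def k_def)
   define a where "a = hilbert_reg e (\<lambda>t. B t * (1 / mw t) * indicator (E \<inter> whitney_nbhd k) t) x"
   define b where "b = hilbert_reg e (\<lambda>t. B t * (1 / mw t) * indicator (E - whitney_nbhd k) t) x"
   have "s < mw x * \<bar>a + b\<bar>" using x(2) split[of x k] by (simp add: a_def b_def)
   also have "... <= mw x * (\<bar>a\<bar> + \<bar>b\<bar>)" using mw_pos[OF x(1)] by (intro mult_left_mono) auto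
   finally have "s < mw x * \<bar>a\<bar> + mw x * \<bar>b\<bar>" by (simp add: distrib_left)
   moreover have "mw x * \<bar>b\<bar> <= Kf * rho0 \<alpha> \<beta> x powr (- 1 / r)"
    unfolding b_def Kf_def by (rule Cf(2)[OF B E e xk])
   ultimately have "mw x * \<bar>a\<bar> > s / 2 \<or> Kf * rho0 \<alpha> \<beta> x powr (- 1 / r) > s / 2" by linarith
   then show "x \<in> (\<Union>k. S k) \<union> Z"
   proof
    assume "mw x * \<bar>a\<bar> > s / 2"
    then have "x \<in> S k" using S(3)[of k] xk unfolding a_def by blast
    then show ?thesis by blast
   qed (simp add: Z_def \<mu>_def)
  qed
  have dis: "disjoint_family_on S UNIV"
   unfolding disjoint_family_on_def
  proof (intro ballI impI)
   fix m n :: int assume "m ~= n"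
   then have "whitney_piece m \<inter> whitney_piece n = {}" by (auto simp: whitney_piece_def)
   then show "S m \<inter> S n = {}" using S(2)[of m] S(2)[of n] by blast
  qed
  have U: "emeasure \<mu> (\<Union>k. S k) <= ennreal (D * (s / 2) powr (- r)) * (3 * emeasure \<mu> E)"
  proof -
   have "emeasure \<mu> (\<Union>k. S k) = (\<integral>\<^sup>+k. emeasure \<mu> (S k) \<partial>count_space UNIV)"
    by (rule emeasure_UN_countable) (use S(1) dis in \<open>auto simp: \<mu>_def\<close>)
   also have "... <= (\<integral>\<^sup>+k. ennreal (D * (s / 2) powr (- r)) * emeasure \<mu> (E \<inter> whitney_nbhd k) \<partial>count_space UNIV)"
    by (intro nn_integral_mono S(4))
   also have "... = ennreal (D * (s / 2) powr (- r)) * (\<integral>\<^sup>+k. emeasure \<mu> (E \<inter> whitney_nbhd k) \<partial>count_space UNIV)"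
    by (rule nn_integral_cmult) simp
   also have "... <= ennreal (D * (s / 2) powr (- r)) * (3 * emeasure \<mu> E)"
    unfolding \<mu>_def by (intro mult_left_mono sum_nbhd E) auto
   finally show ?thesis .
  qed
  have ZZ: "emeasure \<mu> Z <= ennreal (C * (Kf powr r * (s / 2) powr (- r)))"
   unfolding Z_def
   by (rule sublevel_weak_bound) (use C' r Kf s rho0_nonneg in \<open>auto simp: \<mu>_def\<close>)
  have KfE: "Kf powr r = Cf powr r * measure \<mu> E"
   using r Cf by (simp add: Kf_def powr_mult powr_powr)
  have sr: "(s / 2) powr (- r) = 2 powr r * s powr (- r)"
   using s by (simp add: powr_divide powr_minus_divide)
  have "emeasure \<mu> {x\<in>Ioo. mw x * \<bar>hilbert_reg e (\<lambda>t. B t * (1 / mw t) * indicator E t) x\<bar> > s} <= emeasure \<mu> ((\<Union>k. S k) \<union> Z)"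
   by (rule emeasure_mono[OF sub]) (use Um in \<open>auto simp: \<mu>_def\<close>)
  also have "... <= emeasure \<mu> (\<Union>k. S k) + emeasure \<mu> Z"
   by (rule emeasure_subadditive) (use Um in \<open>auto simp: \<mu>_def\<close>)
  also have "... <= ennreal (D * (s / 2) powr (- r)) * (3 * emeasure \<mu> E) + ennreal (C * (Kf powr r * (s / 2) powr (- r)))"
   by (intro add_mono U ZZ)
  also have "ennreal (D * (s / 2) powr (- r)) * (3 * emeasure \<mu> E) = ennreal (3 * D * 2 powr r * s powr (- r) * measure \<mu> E)"
  proof -
   have "3 * emeasure \<mu> E = ennreal (3 * measure \<mu> E)" by (simp add: fin.emeasure_eq_measure ennreal_mult)
   then show ?thesis using D by (simp add: sr ennreal_mult[symmetric] mult_ac)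
  qed
  also have "... + ennreal (C * (Kf powr r * (s / 2) powr (- r))) = ennreal (Q * s powr (- r) * measure \<mu> E)"
   unfolding KfE sr using D C by (subst ennreal_plus[symmetric]) (auto simp: Q_def algebra_simps)
  finally show ?thesis .
 qed
 then show ?thesis using Q unfolding \<mu>_def by blast
qed

end

section \<open>The Jacobi partial sums\<close>

lemma powr_rho0:
 assumes "x \<in> Ioo"
 shows "rho0 \<alpha> \<beta> x powr (- c) = (1 - x) powr (- ((\<alpha> + 1) * c)) * (1 + x) powr (- ((\<beta> + 1) * c))"
 using assms by (simp add: rho0_def powr_mult powr_powr)

lemma sublevel_weak_and_integral:
 assumes fin: "finite_measure N" and rho: "\<rho> \<in> borel_measurable N" "\<And>x. \<rho> x >= 0"
  and C: "C >= 0" "\<And>t. t > 0 ==> emeasure N {x\<in>space N. \<rho> x < t} <= ennreal (C * t)" and r: "r > 1"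
 shows "\<exists>C\<ge>0. (\<forall>K s. K >= 0 \<and> s > 0 --> emeasure N {x\<in>space N. K * \<rho> x powr (- 1 / r) > s} <= ennreal (C * (K powr r * s powr (- r)))) \<and>
   (\<forall>E\<in>sets N. (\<integral>\<^sup>+x. ennreal (\<rho> x powr (- (1 - 1 / r))) * indicator E x \<partial>N) <= ennreal (C * measure N E powr (1 / r)))"
proof -
 interpret finite_measure N by fact
 define \<theta> where "\<theta> = 1 - 1 / r"
 have th: "0 < \<theta>" "\<theta> < 1" "1 - \<theta> = 1 / r" using r by (auto simp: \<theta>_def)
 define C2 where "C2 = 1 + C * 2 powr \<theta> / (1 - 2 powr (\<theta> - 1))"
 have "2 powr (\<theta> - 1) < 2 powr 0" using th by (intro powr_less_mono) auto
 then have C2: "C2 >= 0" using C(1) by (simp add: C2_def)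
 have 1: "emeasure N {x\<in>space N. K * \<rho> x powr (- 1 / r) > s} <= ennreal ((C + C2) * (K powr r * s powr (- r)))" if "K >= 0" "s > 0" for K s
 proof -
  have "emeasure N {x\<in>space N. K * \<rho> x powr (- 1 / r) > s} <= ennreal (C * (K powr r * s powr (- r)))"
   using r that by (intro sublevel_weak_bound[OF rho C(2)]) auto
  also have "... <= ennreal ((C + C2) * (K powr r * s powr (- r)))" using C2 by (intro ennreal_leI mult_right_mono) auto
  finally show ?thesis .
 qed
 have 2: "(\<integral>\<^sup>+x. ennreal (\<rho> x powr (- (1 - 1 / r))) * indicator E x \<partial>N) <= ennreal ((C + C2) * measure N E powr (1 / r))"
  if "E \<in> sets N" for E
 proof -
  have "(\<integral>\<^sup>+x. ennreal (\<rho> x powr (- \<theta>)) * indicator E x \<partial>N) <= ennreal (C2 * measure N E powr (1 - \<theta>))"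
   unfolding C2_def by (rule sublevel_integral_bound[OF rho C(2,1) th(1,2) that]) (simp_all add: less_top[symmetric])
  also have "... <= ennreal ((C + C2) * measure N E powr (1 - \<theta>))" using C(1) by (intro ennreal_leI mult_right_mono) auto
  finally show ?thesis by (simp add: \<theta>_def)
 qed
 show ?thesis using 1 2 C(1) C2 by (intro exI[of _ "C + C2"]) auto
qed

lemma rho0_sublevel_space:
 assumes ab: "\<alpha> > -1" "\<beta> > -1"
 shows "\<exists>C\<ge>0. \<forall>t>0. emeasure (jacobi_measure \<alpha> \<beta>) {x\<in>space (jacobi_measure \<alpha> \<beta>). rho0 \<alpha> \<beta> x < t} <= ennreal (C * t)"
proof -
 have "emeasure (jacobi_measure \<alpha> \<beta>) {x\<in>space (jacobi_measure \<alpha> \<beta>). rho0 \<alpha> \<beta> x < t} = emeasure (jacobi_measure \<alpha> \<beta>) {x\<in>Ioo. rho0 \<alpha> \<beta> x < t}" for t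
  by (subst emeasure_jacobi_Ioo) (auto intro!: arg_cong[where f = "emeasure _"])
 then show ?thesis using rho0_sublevel[OF ab] by simp
qed

lemma rho0_weak_and_integral:
 assumes ab: "\<alpha> > -1" "\<beta> > -1" and r: "r > 1"
 shows "\<exists>C\<ge>0. (\<forall>K s. K >= 0 \<and> s > 0 --> emeasure (jacobi_measure \<alpha> \<beta>) {x. K * rho0 \<alpha> \<beta> x powr (- 1 / r) > s} <= ennreal (C * (K powr r * s powr (- r)))) \<and>
   (\<forall>E\<in>sets borel. (\<integral>\<^sup>+x. ennreal (rho0 \<alpha> \<beta> x powr (- (1 - 1 / r))) * indicator E x \<partial>jacobi_measure \<alpha> \<beta>) <= ennreal (C * measure (jacobi_measure \<alpha> \<beta>) E powr (1 / r)))"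
proof -
 obtain C where C: "C >= 0" "\<And>t. t > 0 ==> emeasure (jacobi_measure \<alpha> \<beta>) {x\<in>space (jacobi_measure \<alpha> \<beta>). rho0 \<alpha> \<beta> x < t} <= ennreal (C * t)"
  using rho0_sublevel_space[OF ab] by blast
 have m: "rho0 \<alpha> \<beta> \<in> borel_measurable (jacobi_measure \<alpha> \<beta>)" by simp
 from sublevel_weak_and_integral[OF jacobi_measure_finite[OF ab] m rho0_nonneg C r] show ?thesis by simp
qed

text \<open>The name p is taken by the polynomial sequence, so the Lebesgue exponent of the theorem
  is called r.\<close>

locale jacobi_weighted = jacobi_polys \<alpha> \<beta> "jacobi_int \<alpha> \<beta>" p for \<alpha> \<beta> p +
 fixes a b r :: real
 assumes ab: "\<alpha> >= -1/2" "\<beta> >= -1/2" and r: "r > 1"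
  and ka: "-1/4 <= a + (\<alpha> + 1) * (1 / r - 1/2)" "a + (\<alpha> + 1) * (1 / r - 1/2) < 1/4"
  and kb: "-1/4 <= b + (\<beta> + 1) * (1 / r - 1/2)" "b + (\<beta> + 1) * (1 / r - 1/2) < 1/4"
begin

definition uw :: "real => real" where
 "uw x = (1 - x) powr a * (1 + x) powr b"

lemma uw_pos: "x \<in> Ioo ==> uw x > 0"
 by (simp add: uw_def)

lemma uw_measurable [measurable]: "uw \<in> borel_measurable borel"
 unfolding uw_def[abs_def] by measurable

lemma hw_measurable [measurable]: "hw \<in> borel_measurable borel"
 unfolding hw_def[abs_def] by measurable

lemma ker_measurable [measurable]: "(\<lambda>y. ker n x y) \<in> borel_measurable borel"
 unfolding ker_def by measurable

lemma kappa_eq: "(\<alpha> + 1) * (1 / r - 1/2) = (\<alpha> + 1) / r - (\<alpha> + 1) / 2" "(\<beta> + 1) * (1 / r - 1/2) = (\<beta> + 1) / r - (\<beta> + 1) / 2"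
 by (simp_all add: right_diff_distrib)

lemma tau_bounds:
 fixes c d X :: real
 assumes "-1/4 <= c + (X - (d + 1) / 2)" "c + (X - (d + 1) / 2) < 1/4"
 shows "0 <= c - d / 2 - 1/4 + X" "c - d / 2 - 1/4 + X <= 1" "0 <= c - d / 2 + 1/4 + X" "c - d / 2 + 1/4 + X <= 1"
 using assms by (simp_all add: field_simps)

text \<open>\<open>W1\<close> and \<open>W2\<close> are the weights outside the two singular terms
  of Pollard's decomposition. With k = a + (\<alpha> + 1)(1 / r - 1/2), the numbers required to lie
  in [0, 1] are k + 1/4 for \<open>W1\<close> and k + 3/4 for \<open>W2\<close>, and likewise at
  -1.\<close>

sublocale W1: weighted_hilbert \<alpha> \<beta> "a - \<alpha> / 2 - 1/4" "b - \<beta> / 2 - 1/4" r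
 using tau_bounds[OF ka[unfolded kappa_eq]] tau_bounds[OF kb[unfolded kappa_eq]] ab r
 by unfold_locales auto

sublocale W2: weighted_hilbert \<alpha> \<beta> "a - \<alpha> / 2 + 1/4" "b - \<beta> / 2 + 1/4" r
 using tau_bounds[OF ka[unfolded kappa_eq]] tau_bounds[OF kb[unfolded kappa_eq]] ab r
 by unfold_locales auto

lemma one_minus_sq: "1 - x^2 = (1 - x) * (1 + x)" for x :: real
 by (simp add: power2_eq_square algebra_simps)

lemma sqrt_weight:
 assumes "x \<in> Ioo"
 shows "sqrt (1 - x^2) = (1 - x) powr (1/2) * (1 + x) powr (1/2)"
 using assms by (simp add: one_minus_sq real_sqrt_mult powr_half_sqrt)

lemma W1_mw: "x \<in> Ioo ==> W1.mw x * hw x = uw x"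
proof -
 assume x: "x \<in> Ioo"
 have 1: "(1 - x) powr (a - \<alpha> / 2 - 1/4) * (1 - x) powr (\<alpha> / 2 + 1/4) = (1 - x) powr a"
  "(1 + x) powr (b - \<beta> / 2 - 1/4) * (1 + x) powr (\<beta> / 2 + 1/4) = (1 + x) powr b"
  unfolding powr_add[symmetric] by simp_all
 have "A * B * (C * D) = (A * C) * (B * D)" for A B C D :: real by simp
 then show ?thesis unfolding W1.mw_def hw_def uw_def 1[symmetric] .
qed

lemma W2_mw: "x \<in> Ioo ==> W2.mw x = W1.mw x * sqrt (1 - x^2)"
proof -
 assume x: "x \<in> Ioo"
 have "(1 - x) powr (a - \<alpha> / 2 + 1/4) = (1 - x) powr (a - \<alpha> / 2 - 1/4) * (1 - x) powr (1/2)"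
  "(1 + x) powr (b - \<beta> / 2 + 1/4) = (1 + x) powr (b - \<beta> / 2 - 1/4) * (1 + x) powr (1/2)"
  unfolding powr_add[symmetric] by (simp_all add: add.commute)
 then show ?thesis unfolding W2.mw_def W1.mw_def sqrt_weight[OF x] by simp
qed

lemma weight_hw: "x \<in> Ioo ==> jacobi_weight \<alpha> \<beta> x * sqrt (1 - x^2) = (hw x)^2"
proof -
 assume x: "x \<in> Ioo"
 have "(1 - x) powr (\<alpha> + 1/2) = (1 - x) powr \<alpha> * (1 - x) powr (1/2)" "(1 + x) powr (\<beta> + 1/2) = (1 + x) powr \<beta> * (1 + x) powr (1/2)"
  unfolding powr_add[symmetric] by simp_all
 moreover have "x \<in> {-1..1}" using x by auto
 ultimately show ?thesis using x by (simp add: sqrt_weight hw_square jacobi_weight_def)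
qed

abbreviation (input) "iu E y \<equiv> indicator E y / uw y"

text \<open>The factor (x - y)^2 / ((x - y)^2 + e^2) turns the 1 / (x - y) of Pollard's
  decomposition into the regularised Hilbert kernel, and it tends to 1 as e -> 0 whenever y differs
  from x.\<close>

definition reg_op :: "nat => real set => real => real => real" where
 "reg_op n E e x = uw x * (\<integral>y. (x - y)\<^sup>2 / ((x - y)^2 + e^2) * (ker n x y * iu E y) \<partial>jacobi_measure \<alpha> \<beta>)"

text \<open>The quotient of \<open>W1.mw\<close> and the power of \<open>rho0\<close> has exponent k
  + 1/4 at each endpoint, nonnegative by the lower bounds on a and b.\<close>

lemma W1_le_rho0: "\<exists>C\<ge>0. \<forall>x\<in>Ioo. W1.mw x <= C * rho0 \<alpha> \<beta> x powr (- 1 / r)"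
proof -
 define c where "c = a + (\<alpha> + 1) * (1 / r - 1/2) + 1/4"
 define d where "d = b + (\<beta> + 1) * (1 / r - 1/2) + 1/4"
 have cd: "c >= 0" "d >= 0" using ka kb by (auto simp: c_def d_def)
 have "W1.mw x <= (2 powr c * 2 powr d) * rho0 \<alpha> \<beta> x powr (- 1 / r)" if x: "x \<in> Ioo" for x
 proof -
  have e: "a - \<alpha> / 2 - 1/4 = c + - ((\<alpha> + 1) * (1 / r))" "b - \<beta> / 2 - 1/4 = d + - ((\<beta> + 1) * (1 / r))"
   using r by (simp_all add: c_def d_def field_simps)
  have "(1 - x) powr (a - \<alpha> / 2 - 1/4) = (1 - x) powr c * (1 - x) powr (- ((\<alpha> + 1) * (1 / r)))"
   "(1 + x) powr (b - \<beta> / 2 - 1/4) = (1 + x) powr d * (1 + x) powr (- ((\<beta> + 1) * (1 / r)))"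
   unfolding e powr_add by simp_all
  then have "W1.mw x = ((1 - x) powr c * (1 + x) powr d) * rho0 \<alpha> \<beta> x powr (- (1 / r))"
   unfolding W1.mw_def powr_rho0[OF x] by simp
  also have "... <= (2 powr c * 2 powr d) * rho0 \<alpha> \<beta> x powr (- (1 / r))"
   using x cd by (intro mult_right_mono mult_mono powr_mono2) auto
  finally show ?thesis by simp
 qed
 then show ?thesis by (intro exI[of _ "2 powr c * 2 powr d"]) auto
qed

text \<open>The complementary comparison: here the quotient has exponents 1/4 - k, nonnegative by
  the upper bounds on a and b.\<close>

lemma inverse_hw_uw_le_rho0: "\<exists>C\<ge>0. \<forall>x\<in>Ioo. 1 / (hw x * uw x) <= C * rho0 \<alpha> \<beta> x powr (- (1 - 1 / r))"
proof -
 define c where "c = 1/4 - (a + (\<alpha> + 1) * (1 / r - 1/2))"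
 define d where "d = 1/4 - (b + (\<beta> + 1) * (1 / r - 1/2))"
 have cd: "c >= 0" "d >= 0" using ka kb by (auto simp: c_def d_def)
 have "1 / (hw x * uw x) <= (2 powr c * 2 powr d) * rho0 \<alpha> \<beta> x powr (- (1 - 1 / r))" if x: "x \<in> Ioo" for x
 proof -
  have e: "- (\<alpha> / 2 + 1/4) + - a = c + - ((\<alpha> + 1) * (1 - 1 / r))" "- (\<beta> / 2 + 1/4) + - b = d + - ((\<beta> + 1) * (1 - 1 / r))"
   using r by (simp_all add: c_def d_def field_simps)
  have "1 / (hw x * uw x) = (1 - x) powr (- (\<alpha> / 2 + 1/4) + - a) * (1 + x) powr (- (\<beta> / 2 + 1/4) + - b)"
   unfolding hw_def uw_def powr_add[of _ "- (\<alpha> / 2 + 1/4)"] powr_add[of _ "- (\<beta> / 2 + 1/4)"] powr_minus_divide by simp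
  also have "... = ((1 - x) powr c * (1 + x) powr d) * rho0 \<alpha> \<beta> x powr (- (1 - 1 / r))"
   unfolding powr_rho0[OF x] e powr_add by simp
  also have "... <= (2 powr c * 2 powr d) * rho0 \<alpha> \<beta> x powr (- (1 - 1 / r))"
   using x cd by (intro mult_right_mono mult_mono powr_mono2) auto
  finally show ?thesis .
 qed
 then show ?thesis by (intro exI[of _ "2 powr c * 2 powr d"]) auto
qed

text \<open>The exponents of the Jacobi weight divided by \<open>uw\<close> exceed those of 1 /
  \<open>W2.mw\<close>, which is integrable, by \<alpha> / 2 + 1/4 and \<beta> / 2 + 1/4.\<close>

lemma inverse_uw_integrable: "integrable (jacobi_measure \<alpha> \<beta>) (\<lambda>y. indicator Ioo y / uw y)"
proof -
 have e: "- (a - \<alpha> / 2 + 1/4) > -1" "- (b - \<beta> / 2 + 1/4) > -1"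
 proof -
  have "(\<alpha> + 1) / r > 0" "(\<beta> + 1) / r > 0" using ab r by auto
  then show "- (a - \<alpha> / 2 + 1/4) > -1" "- (b - \<beta> / 2 + 1/4) > -1" using W2.t1 W2.t2 by linarith+
 qed
 have i: "integrable lborel (\<lambda>x. jacobi_weight (- (a - \<alpha> / 2 + 1/4)) (- (b - \<beta> / 2 + 1/4)) x)"
  by (rule W2.inverse_mw_integrable)
 have "integrable lborel (\<lambda>x. jacobi_weight \<alpha> \<beta> x * (indicator Ioo x / uw x))"
 proof (rule Bochner_Integration.integrable_bound)
  show "integrable lborel (\<lambda>x. 2 powr (\<alpha> / 2 + 1/4) * 2 powr (\<beta> / 2 + 1/4) * jacobi_weight (- (a - \<alpha> / 2 + 1/4)) (- (b - \<beta> / 2 + 1/4)) x)"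
   by (intro integrable_mult_right i)
  have "norm (jacobi_weight \<alpha> \<beta> x * (indicator Ioo x / uw x)) <= norm (2 powr (\<alpha> / 2 + 1/4) * 2 powr (\<beta> / 2 + 1/4) * jacobi_weight (- (a - \<alpha> / 2 + 1/4)) (- (b - \<beta> / 2 + 1/4)) x)" for x
  proof (cases "x \<in> Ioo")
   case True
   have q: "(1 - x) powr \<alpha> * (1 - x) powr (- a) = (1 - x) powr (\<alpha> / 2 + 1/4) * (1 - x) powr (- (a - \<alpha> / 2 + 1/4))"
    "(1 + x) powr \<beta> * (1 + x) powr (- b) = (1 + x) powr (\<beta> / 2 + 1/4) * (1 + x) powr (- (b - \<beta> / 2 + 1/4))"
    unfolding powr_add[symmetric] by simp_all
   have "jacobi_weight \<alpha> \<beta> x * (indicator Ioo x / uw x) = ((1 - x) powr \<alpha> * (1 - x) powr (- a)) * ((1 + x) powr \<beta> * (1 + x) powr (- b))"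
    using True by (simp add: jacobi_weight_def uw_def powr_minus_divide)
   also have "... = ((1 - x) powr (\<alpha> / 2 + 1/4) * (1 + x) powr (\<beta> / 2 + 1/4)) * jacobi_weight (- (a - \<alpha> / 2 + 1/4)) (- (b - \<beta> / 2 + 1/4)) x"
    unfolding q using True by (simp add: jacobi_weight_def)
   also have "... <= (2 powr (\<alpha> / 2 + 1/4) * 2 powr (\<beta> / 2 + 1/4)) * jacobi_weight (- (a - \<alpha> / 2 + 1/4)) (- (b - \<beta> / 2 + 1/4)) x"
    using True ab by (intro mult_right_mono mult_mono powr_mono2 jacobi_weight_nonneg) auto
   finally have "jacobi_weight \<alpha> \<beta> x * (indicator Ioo x / uw x) <= (2 powr (\<alpha> / 2 + 1/4) * 2 powr (\<beta> / 2 + 1/4)) * jacobi_weight (- (a - \<alpha> / 2 + 1/4)) (- (b - \<beta> / 2 + 1/4)) x" .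
   moreover have "0 <= jacobi_weight \<alpha> \<beta> x * (indicator Ioo x / uw x)"
    using jacobi_weight_nonneg uw_pos[OF True] by simp
   ultimately show ?thesis by (simp only: real_norm_def abs_of_nonneg)
  qed simp
  then show "AE x in lborel. norm (jacobi_weight \<alpha> \<beta> x * (indicator Ioo x / uw x)) <= norm (2 powr (\<alpha> / 2 + 1/4) * 2 powr (\<beta> / 2 + 1/4) * jacobi_weight (- (a - \<alpha> / 2 + 1/4)) (- (b - \<beta> / 2 + 1/4)) x)"
   by simp
 qed measurable
 then show ?thesis by (subst integral_jacobi_measure(2)) auto
qed

lemma bounded_mult_integrable:
 assumes f [measurable]: "f \<in> borel_measurable borel" and E [measurable]: "E \<in> sets borel" "E \<subseteq> Ioo"
  and B: "\<And>y. y \<in> Ioo ==> \<bar>f y\<bar> <= B"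
 shows "integrable (jacobi_measure \<alpha> \<beta>) (\<lambda>y. f y * iu E y)"
proof (rule Bochner_Integration.integrable_bound)
 show "integrable (jacobi_measure \<alpha> \<beta>) (\<lambda>y. B * (indicator Ioo y / uw y))"
  by (intro integrable_mult_right inverse_uw_integrable)
 have "norm (f y * iu E y) <= norm (B * (indicator Ioo y / uw y))" for y
 proof (cases "y \<in> E")
  case True
  then have y: "y \<in> Ioo" using E by auto
  have "\<bar>f y\<bar> * (1 / uw y) <= B * (1 / uw y)" using B[OF y] uw_pos[OF y] by (intro mult_right_mono) auto
  then show ?thesis using True y uw_pos[OF y] order_trans[OF abs_ge_zero B[OF y]] by (simp add: abs_mult)
 qed simp
 then show "AE y in jacobi_measure \<alpha> \<beta>. norm (f y * iu E y) <= norm (B * (indicator Ioo y / uw y))" by simp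
qed simp

end

section \<open>The regularised partial sums\<close>

context jacobi_weighted
begin

text \<open>The factors depending on y in Pollard's decomposition, divided by the weights of the two Hilbert
 transforms and normalised to be at most 1 for a suitable C.\<close>

definition bd1 :: "real => nat => real => real" where
 "bd1 C n t = indicator Ioo t * (sqrt (1 - t^2) * hw t * poly (pderiv (p (Suc n))) t) / (2 * C * real (Suc n))"

definition bd2 :: "real => nat => real => real" where
 "bd2 C n t = indicator Ioo t * (hw t * poly (p (Suc n)) t) / C"

lemma bd_measurable [measurable]: "bd1 C n \<in> borel_measurable borel" "bd2 C n \<in> borel_measurable borel"
 unfolding bd1_def[abs_def] bd2_def[abs_def] by measurable

lemma hilbert_reg_measurable [measurable]:
 assumes [measurable]: "g \<in> borel_measurable borel"
 shows "hilbert_reg e g \<in> borel_measurable borel"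
 unfolding hilbert_reg_def[abs_def] by measurable

lemma square_ratio_le_1:
 fixes z e :: real
 assumes "e > 0"
 shows "z^2 / (z^2 + e^2) <= 1"
proof -
 have "z^2 + e^2 > 0" using assms by (intro add_nonneg_pos) auto
 then show ?thesis by simp
qed

text \<open>By the relations between \<open>uw\<close>, \<open>hw\<close> and \<open>W1.mw\<close>,
  the Jacobi weight times (1 - y^2) / \<open>uw\<close> equals sqrt(1 - y^2) \<open>hw\<close> /
  \<open>W1.mw\<close>. What multiplies 1 / \<open>W1.mw\<close> is then bounded by the derivative
  estimate.\<close>

lemma weighted_int_bd1:
 assumes E [measurable]: "E \<in> sets borel" "E \<subseteq> Ioo" and C: "C > 0"
 shows "(\<integral>y. (x - y) / ((x - y)^2 + e^2) * ((1 - y^2) * poly (pderiv (p (Suc n))) y) * iu E y \<partial>jacobi_measure \<alpha> \<beta>)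
   = 2 * C * real (Suc n) * hilbert_reg e (\<lambda>t. bd1 C n t * (1 / W1.mw t) * indicator E t) x"
proof -
 define c where "c = 2 * C * real (Suc n)"
 have c: "c > 0" using C by (simp add: c_def)
 have pt: "jacobi_weight \<alpha> \<beta> y * ((x - y) / ((x - y)^2 + e^2) * ((1 - y^2) * poly (pderiv (p (Suc n))) y) * iu E y)
  = c * ((x - y) / ((x - y)^2 + e^2) * (bd1 C n y * (1 / W1.mw y) * indicator E y))" for y
 proof (cases "y \<in> E")
  case True
  then have y: "y \<in> Ioo" using E by auto
  define q where "q = sqrt (1 - y^2)"
  have q: "q * q = 1 - y^2" using y by (simp add: q_def abs_square_le_1 abs_le_iff)
  have w: "jacobi_weight \<alpha> \<beta> y * q = hw y * hw y" using weight_hw[OF y] by (simp add: q_def power2_eq_square)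
  have u: "uw y = W1.mw y * hw y" using W1_mw[OF y] by simp
  have pos: "hw y > 0" "W1.mw y > 0" using hw_pos[OF y] W1.mw_pos[OF y] by auto
  have b: "c * bd1 C n y = q * hw y * poly (pderiv (p (Suc n))) y"
   using y C by (simp add: bd1_def c_def q_def)
  have "jacobi_weight \<alpha> \<beta> y * (1 - y^2) / uw y = q * hw y / W1.mw y"
  proof -
   have "jacobi_weight \<alpha> \<beta> y * (1 - y^2) / uw y = (jacobi_weight \<alpha> \<beta> y * q) * q / (W1.mw y * hw y)" by (simp add: q[symmetric] u)
   also have "... = q * hw y / W1.mw y" unfolding w using pos by (simp add: field_simps)
   finally show ?thesis .
  qed
  moreover have gen: "W * (k * (q1 * P) * (1 / u)) = k * (P * (W * q1 / u))" for W k q1 P u :: real by simp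
  ultimately have "jacobi_weight \<alpha> \<beta> y * ((x - y) / ((x - y)^2 + e^2) * ((1 - y^2) * poly (pderiv (p (Suc n))) y) * (1 / uw y))
    = (x - y) / ((x - y)^2 + e^2) * (poly (pderiv (p (Suc n))) y * (q * hw y / W1.mw y))"
   unfolding gen by simp
  also have "... = (x - y) / ((x - y)^2 + e^2) * ((c * bd1 C n y) * (1 / W1.mw y))" unfolding b by simp
  finally show ?thesis using True by simp
 qed simp
 have "(\<integral>y. (x - y) / ((x - y)^2 + e^2) * ((1 - y^2) * poly (pderiv (p (Suc n))) y) * iu E y \<partial>jacobi_measure \<alpha> \<beta>)
  = (\<integral>y. jacobi_weight \<alpha> \<beta> y * ((x - y) / ((x - y)^2 + e^2) * ((1 - y^2) * poly (pderiv (p (Suc n))) y) * iu E y) \<partial>lborel)"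
  by (rule integral_jacobi_measure(1)) measurable
 also have "... = c * hilbert_reg e (\<lambda>t. bd1 C n t * (1 / W1.mw t) * indicator E t) x"
  unfolding pt hilbert_reg_def by (rule integral_mult_right_zero)
 finally show ?thesis by (simp add: c_def)
qed

lemma weighted_int_bd2:
 assumes E [measurable]: "E \<in> sets borel" "E \<subseteq> Ioo" and C: "C > 0"
 shows "(\<integral>y. (x - y) / ((x - y)^2 + e^2) * poly (p (Suc n)) y * iu E y \<partial>jacobi_measure \<alpha> \<beta>)
   = C * hilbert_reg e (\<lambda>t. bd2 C n t * (1 / W2.mw t) * indicator E t) x"
proof -
 have pt: "jacobi_weight \<alpha> \<beta> y * ((x - y) / ((x - y)^2 + e^2) * poly (p (Suc n)) y * iu E y)
  = C * ((x - y) / ((x - y)^2 + e^2) * (bd2 C n y * (1 / W2.mw y) * indicator E y))" for y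
 proof (cases "y \<in> E")
  case True
  then have y: "y \<in> Ioo" using E by auto
  define q where "q = sqrt (1 - y^2)"
  have q0: "q > 0" using y by (simp add: q_def abs_square_less_1 abs_less_iff)
  have w: "jacobi_weight \<alpha> \<beta> y * q = hw y * hw y" using weight_hw[OF y] by (simp add: q_def power2_eq_square)
  have u: "uw y = W1.mw y * hw y" using W1_mw[OF y] by simp
  have m2: "W2.mw y = W1.mw y * q" using W2_mw[OF y] by (simp add: q_def)
  have pos: "hw y > 0" "W1.mw y > 0" using hw_pos[OF y] W1.mw_pos[OF y] by auto
  have b: "C * bd2 C n y = hw y * poly (p (Suc n)) y" using y C by (simp add: bd2_def)
  have "jacobi_weight \<alpha> \<beta> y / uw y = hw y / W2.mw y"
  proof -
   have "jacobi_weight \<alpha> \<beta> y / uw y = (jacobi_weight \<alpha> \<beta> y * q) / (W1.mw y * hw y * q)" using q0 by (simp add: u)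
   also have "... = hw y / W2.mw y" unfolding w m2 using pos q0 by (simp add: field_simps)
   finally show ?thesis .
  qed
  moreover have gen: "W * (k * P * (1 / u)) = k * (P * (W / u))" for W k P u :: real by simp
  ultimately have "jacobi_weight \<alpha> \<beta> y * ((x - y) / ((x - y)^2 + e^2) * poly (p (Suc n)) y * (1 / uw y))
    = (x - y) / ((x - y)^2 + e^2) * (poly (p (Suc n)) y * (hw y / W2.mw y))"
   unfolding gen by simp
  also have "... = (x - y) / ((x - y)^2 + e^2) * ((C * bd2 C n y) * (1 / W2.mw y))" unfolding b by simp
  finally show ?thesis using True by simp
 qed simp
 have "(\<integral>y. (x - y) / ((x - y)^2 + e^2) * poly (p (Suc n)) y * iu E y \<partial>jacobi_measure \<alpha> \<beta>)
  = (\<integral>y. jacobi_weight \<alpha> \<beta> y * ((x - y) / ((x - y)^2 + e^2) * poly (p (Suc n)) y * iu E y) \<partial>lborel)"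
  by (rule integral_jacobi_measure(1)) measurable
 also have "... = C * hilbert_reg e (\<lambda>t. bd2 C n t * (1 / W2.mw t) * indicator E t) x"
  unfolding pt hilbert_reg_def by (rule integral_mult_right_zero)
 finally show ?thesis .
qed

lemma poly_kernel_integrable:
 assumes E [measurable]: "E \<in> sets borel" "E \<subseteq> Ioo" and k [measurable]: "k \<in> borel_measurable borel" and B: "\<And>y. \<bar>k y\<bar> <= B"
 shows "integrable (jacobi_measure \<alpha> \<beta>) (\<lambda>y. k y * poly q y * iu E y)"
proof -
 obtain D where D: "D >= 0" "\<forall>x\<in>{-1..1::real}. \<bar>poly q x\<bar> <= D" using poly_bounded_Icc by blast
 show ?thesis
 proof (rule bounded_mult_integrable[OF _ E])
  fix y :: real assume "y \<in> Ioo"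
  then have "\<bar>poly q y\<bar> <= D" using D by auto
  moreover have "B >= 0" using order_trans[OF abs_ge_zero B[of 0]] by simp
  ultimately show "\<bar>k y * poly q y\<bar> <= B * D" unfolding abs_mult using B[of y] by (intro mult_mono) auto
 qed measurable
qed

text \<open>Pollard's decomposition under the integral. The terms with derivatives become Hilbert
  transforms; in the third term x - y cancels the singularity, and the harmless factor (x - y)^2 /
  ((x - y)^2 + e^2) remains.\<close>

lemma reg_op_formula:
 assumes E [measurable]: "E \<in> sets borel" "E \<subseteq> Ioo" and C: "C > 0" and e: "e > 0"
 shows "(2 * real (Suc n) + 1 + \<alpha> + \<beta>) * reg_op n E e x = uw x *
   (poly (p (Suc n)) x * (2 * C * real (Suc n) * hilbert_reg e (\<lambda>t. bd1 C n t * (1 / W1.mw t) * indicator E t) x)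
   - (1 - x^2) * poly (pderiv (p (Suc n))) x * (C * hilbert_reg e (\<lambda>t. bd2 C n t * (1 / W2.mw t) * indicator E t) x)
   - real (Suc n) * poly (p (Suc n)) x * (\<integral>y. (x - y)\<^sup>2 / ((x - y)^2 + e^2) * poly (p (Suc n)) y * iu E y \<partial>jacobi_measure \<alpha> \<beta>))"
proof -
 define P where "P = poly (p (Suc n))"
 define P' where "P' = poly (pderiv (p (Suc n)))"
 define N where "N = real (Suc n)"
 define c where "c = 2 * N + 1 + \<alpha> + \<beta>"
 define k where "k y = (x - y) / ((x - y)^2 + e^2)" for y
 define k2 where "k2 y = (x - y)^2 / ((x - y)^2 + e^2)" for y
 have km [measurable]: "k \<in> borel_measurable borel" "k2 \<in> borel_measurable borel"
  unfolding k_def[abs_def] k2_def[abs_def] by measurable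
 have kb: "\<bar>k y\<bar> <= 1 / e" for y unfolding k_def by (rule hilbert_kernel_bound[OF e])
 have k2b: "\<bar>k2 y\<bar> <= 1" for y unfolding k2_def using square_ratio_le_1[OF e] by simp
 have kk: "k2 y = k y * (x - y)" for y by (simp add: k_def k2_def power2_eq_square)
 have i1: "integrable (jacobi_measure \<alpha> \<beta>) (\<lambda>y. k y * ((1 - y^2) * P' y) * iu E y)"
 proof -
  have "poly ([:1, 0, -1:] * pderiv (p (Suc n))) y = (1 - y^2) * P' y" for y
   by (simp add: P'_def power2_eq_square algebra_simps)
  then show ?thesis using poly_kernel_integrable[OF E km(1) kb, of "[:1, 0, -1:] * pderiv (p (Suc n))"] by simp
 qed
 have i2: "integrable (jacobi_measure \<alpha> \<beta>) (\<lambda>y. k y * P y * iu E y)"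
  unfolding P_def by (rule poly_kernel_integrable[OF E km(1) kb])
 have i3: "integrable (jacobi_measure \<alpha> \<beta>) (\<lambda>y. k2 y * P y * iu E y)"
  unfolding P_def by (rule poly_kernel_integrable[OF E km(2) k2b])
 have pt: "c * (k2 y * (ker n x y * iu E y)) =
   P x * (k y * ((1 - y^2) * P' y) * iu E y) - (1 - x^2) * P' x * (k y * P y * iu E y)
   - N * P x * (k2 y * P y * iu E y)" for y
 proof -
  have pol: "c * ((x - y) * ker n x y) = P x * ((1 - y^2) * P' y) - P y * ((1 - x^2) * P' x) - N * (x - y) * (P x * P y)"
   using pollard[of n x y] by (simp add: P_def P'_def N_def c_def)
  have "c * (k2 y * (ker n x y * iu E y)) = k y * (c * ((x - y) * ker n x y)) * iu E y"
   unfolding kk by (simp only: mult_ac)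
  also have "... = k y * (P x * ((1 - y^2) * P' y) - P y * ((1 - x^2) * P' x) - N * (x - y) * (P x * P y)) * iu E y"
   unfolding pol ..
  also have "... = P x * (k y * ((1 - y^2) * P' y) * iu E y) - (1 - x^2) * P' x * (k y * P y * iu E y)
   - N * P x * (k2 y * P y * iu E y)"
   unfolding kk by (simp only: left_diff_distrib right_diff_distrib mult_ac)
  finally show ?thesis .
 qed
 have gen: "(\<integral>y. X * f y - Y * g y - Z * h y \<partial>M) = X * (\<integral>y. f y \<partial>M) - Y * (\<integral>y. g y \<partial>M) - Z * (\<integral>y. h y \<partial>M)"
  if "integrable M f" "integrable M g" "integrable M h" for X Y Z :: real and f g h :: "real => real" and M
  using that by simp
 have "c * (\<integral>y. k2 y * (ker n x y * iu E y) \<partial>jacobi_measure \<alpha> \<beta>) = (\<integral>y. c * (k2 y * (ker n x y * iu E y)) \<partial>jacobi_measure \<alpha> \<beta>)"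
  by (rule integral_mult_right_zero[symmetric])
 also have "... = P x * (\<integral>y. k y * ((1 - y^2) * P' y) * iu E y \<partial>jacobi_measure \<alpha> \<beta>)
   - (1 - x^2) * P' x * (\<integral>y. k y * P y * iu E y \<partial>jacobi_measure \<alpha> \<beta>)
   - N * P x * (\<integral>y. k2 y * P y * iu E y \<partial>jacobi_measure \<alpha> \<beta>)"
  unfolding pt by (rule gen[OF i1 i2 i3])
 also have "(\<integral>y. k y * ((1 - y^2) * P' y) * iu E y \<partial>jacobi_measure \<alpha> \<beta>) = 2 * C * N * hilbert_reg e (\<lambda>t. bd1 C n t * (1 / W1.mw t) * indicator E t) x"
  unfolding k_def P'_def N_def by (rule weighted_int_bd1[OF E C])
 also have "(\<integral>y. k y * P y * iu E y \<partial>jacobi_measure \<alpha> \<beta>) = C * hilbert_reg e (\<lambda>t. bd2 C n t * (1 / W2.mw t) * indicator E t) x"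
  unfolding k_def P_def by (rule weighted_int_bd2[OF E C])
 finally have main: "c * (\<integral>y. k2 y * (ker n x y * iu E y) \<partial>jacobi_measure \<alpha> \<beta>) =
   P x * (2 * C * N * hilbert_reg e (\<lambda>t. bd1 C n t * (1 / W1.mw t) * indicator E t) x)
   - (1 - x^2) * P' x * (C * hilbert_reg e (\<lambda>t. bd2 C n t * (1 / W2.mw t) * indicator E t) x)
   - N * P x * (\<integral>y. k2 y * P y * iu E y \<partial>jacobi_measure \<alpha> \<beta>)" .
 have "c * reg_op n E e x = uw x * (c * (\<integral>y. k2 y * (ker n x y * iu E y) \<partial>jacobi_measure \<alpha> \<beta>))"
  by (simp add: reg_op_def k2_def)
 then show ?thesis unfolding main by (simp only: c_def N_def P_def P'_def k2_def)
qed

text \<open>After division by the factor of order n, the outer factors of the singular terms are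
  bounded by \<open>W1.mw\<close> and \<open>W2.mw\<close>. The nonsingular term is a function of x
  times an integral over E; the two comparisons with \<open>rho0\<close> bring it into rank-one
  form.\<close>

lemma reg_op_bound:
 "\<exists>C>0. \<exists>K\<ge>0. (\<forall>n t. \<bar>bd1 C n t\<bar> <= 1 \<and> \<bar>bd2 C n t\<bar> <= 1) \<and>
  (\<forall>n E e x. E \<in> sets borel \<and> E \<subseteq> Ioo \<and> e > 0 \<and> x \<in> Ioo -->
   \<bar>reg_op n E e x\<bar> <= C * C * (W1.mw x * \<bar>hilbert_reg e (\<lambda>t. bd1 C n t * (1 / W1.mw t) * indicator E t) x\<bar>)
    + C * C * (W2.mw x * \<bar>hilbert_reg e (\<lambda>t. bd2 C n t * (1 / W2.mw t) * indicator E t) x\<bar>)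
    + K * measure (jacobi_measure \<alpha> \<beta>) E powr (1 / r) * rho0 \<alpha> \<beta> x powr (- 1 / r))"
proof -
 obtain C where C: "C > 0" "\<And>n x. x \<in> {-1..1} ==> \<bar>poly (p n) x\<bar> * hw x <= C \<and> \<bar>poly (pderiv (p n)) x\<bar> * (sqrt (1 - x^2) * hw x) <= C * real (Suc n)"
  using pointwise_bounds[OF ab] by blast
 obtain c1 where c1: "c1 >= 0" "\<And>x. x \<in> Ioo ==> W1.mw x <= c1 * rho0 \<alpha> \<beta> x powr (- 1 / r)"
  using W1_le_rho0 by blast
 obtain c2 where c2: "c2 >= 0" "\<And>x. x \<in> Ioo ==> 1 / (hw x * uw x) <= c2 * rho0 \<alpha> \<beta> x powr (- (1 - 1 / r))"
  using inverse_hw_uw_le_rho0 by blast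
 have ab1: "\<alpha> > -1" "\<beta> > -1" using ab by auto
 obtain c3 where c3: "c3 >= 0" "\<And>E. E \<in> sets borel ==> (\<integral>\<^sup>+x. ennreal (rho0 \<alpha> \<beta> x powr (- (1 - 1 / r))) * indicator E x \<partial>jacobi_measure \<alpha> \<beta>) <= ennreal (c3 * measure (jacobi_measure \<alpha> \<beta>) E powr (1 / r))"
  using rho0_weak_and_integral[OF ab1 r] by blast
 have b1: "\<bar>bd1 C n t\<bar> <= 1" for n t
 proof (cases "t \<in> Ioo")
  case True
  then have t: "t \<in> {-1..1}" by auto
  have "\<bar>sqrt (1 - t^2) * hw t * poly (pderiv (p (Suc n))) t\<bar> = \<bar>poly (pderiv (p (Suc n))) t\<bar> * (sqrt (1 - t^2) * hw t)"
   using hw_pos[OF True] t by (simp add: abs_mult abs_square_le_1 abs_le_iff mult_ac)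
  also have "... <= C * real (Suc (Suc n))" using C(2)[OF t, of "Suc n"] by simp
  \<comment> \<open>The factor 2 in the normalisation of \<open>bd1\<close> serves to absorb n + 2
    <= 2 (n + 1).\<close>
  also have "... <= C * (2 * real (Suc n))" using C(1) by (intro mult_left_mono) auto
  finally have "\<bar>sqrt (1 - t^2) * hw t * poly (pderiv (p (Suc n))) t\<bar> <= 2 * C * real (Suc n)" by (simp add: mult_ac)
  moreover have "2 * C * real (Suc n) > 0" using C by simp
  ultimately have "\<bar>sqrt (1 - t^2) * hw t * poly (pderiv (p (Suc n))) t / (2 * C * real (Suc n))\<bar> <= 1"
   unfolding abs_divide by (simp only: abs_of_pos pos_divide_le_eq mult_1)
  then show ?thesis using True unfolding bd1_def by simp
 qed (simp add: bd1_def)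
 have b2: "\<bar>bd2 C n t\<bar> <= 1" for n t
 proof (cases "t \<in> Ioo")
  case True
  then have t: "t \<in> {-1..1}" by auto
  have "\<bar>hw t * poly (p (Suc n)) t\<bar> <= C" using C(2)[OF t, of "Suc n"] hw_pos[OF True] by (simp add: abs_mult mult_ac)
  then show ?thesis using True C(1) unfolding bd2_def by (simp add: abs_mult)
 qed (simp add: bd2_def)
 define K where "K = C * c1 * (C * c2 * c3)"
 have K: "K >= 0" using C c1 c2 c3 by (simp add: K_def)
 have main: "\<bar>reg_op n E e x\<bar> <= C * C * (W1.mw x * \<bar>hilbert_reg e (\<lambda>t. bd1 C n t * (1 / W1.mw t) * indicator E t) x\<bar>)
    + C * C * (W2.mw x * \<bar>hilbert_reg e (\<lambda>t. bd2 C n t * (1 / W2.mw t) * indicator E t) x\<bar>)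
    + K * measure (jacobi_measure \<alpha> \<beta>) E powr (1 / r) * rho0 \<alpha> \<beta> x powr (- 1 / r)"
  if E [measurable]: "E \<in> sets borel" "E \<subseteq> Ioo" and e: "e > 0" and x: "x \<in> Ioo" for n E e x
 proof -
  define N where "N = real (Suc n)"
  define P where "P = poly (p (Suc n)) x"
  define P' where "P' = poly (pderiv (p (Suc n))) x"
  define H1 where "H1 = hilbert_reg e (\<lambda>t. bd1 C n t * (1 / W1.mw t) * indicator E t) x"
  define H2 where "H2 = hilbert_reg e (\<lambda>t. bd2 C n t * (1 / W2.mw t) * indicator E t) x"
  define I where "I = (\<integral>y. (x - y)\<^sup>2 / ((x - y)^2 + e^2) * poly (p (Suc n)) y * iu E y \<partial>jacobi_measure \<alpha> \<beta>)"
  define m where "m = measure (jacobi_measure \<alpha> \<beta>) E powr (1 / r)"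
  have x': "x \<in> {-1..1}" using x by auto
  have N1: "N >= 1" by (simp add: N_def)
  define q where "q = sqrt (1 - x^2)"
  have "x^2 < 1" using x by (auto simp: abs_square_less_1)
  then have q: "q > 0" "q * q = 1 - x^2" by (auto simp: q_def)
  have pos: "hw x > 0" "W1.mw x > 0" "W2.mw x > 0" "uw x > 0" using x hw_pos W1.mw_pos W2.mw_pos uw_pos by auto
  have u: "uw x = W1.mw x * hw x" using W1_mw[OF x] by simp
  have u2: "uw x * (q * q) = W2.mw x * (q * hw x)" using W2_mw[OF x] unfolding u q_def[symmetric] by simp
  have Pb: "uw x * \<bar>P\<bar> <= C * W1.mw x"
  proof -
   have "W1.mw x * (\<bar>P\<bar> * hw x) <= W1.mw x * C" using C(2)[OF x', of "Suc n"] pos by (intro mult_left_mono) (auto simp: P_def)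
   then show ?thesis by (simp add: u mult_ac)
  qed
  have P'b: "uw x * (q * q * \<bar>P'\<bar>) <= 2 * C * N * W2.mw x"
  proof -
   have "\<bar>P'\<bar> * (q * hw x) <= C * real (Suc (Suc n))" using C(2)[OF x', of "Suc n"] by (simp add: P'_def q_def)
   also have "... <= C * (2 * N)" using C(1) by (intro mult_left_mono) (auto simp: N_def)
   finally have "W2.mw x * (\<bar>P'\<bar> * (q * hw x)) <= W2.mw x * (C * (2 * N))" using pos by (intro mult_left_mono) auto
   moreover have "uw x * (q * q * \<bar>P'\<bar>) = W2.mw x * (\<bar>P'\<bar> * (q * hw x))"
   proof -
    have "uw x * (q * q * \<bar>P'\<bar>) = (uw x * (q * q)) * \<bar>P'\<bar>" by (simp only: mult.assoc)
    then show ?thesis unfolding u2 by (simp only: mult_ac)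
   qed
   moreover have "W2.mw x * (C * (2 * N)) = 2 * C * N * W2.mw x" by (simp only: mult_ac)
   ultimately show ?thesis by (simp only:)
  qed
  have Ib: "\<bar>I\<bar> <= C * c2 * c3 * m"
  proof -
   have ii: "integrable (jacobi_measure \<alpha> \<beta>) (\<lambda>y. (x - y)\<^sup>2 / ((x - y)^2 + e^2) * poly (p (Suc n)) y * iu E y)"
    using square_ratio_le_1[OF e] by (intro poly_kernel_integrable[OF E, of _ 1]) auto
   have "ennreal \<bar>I\<bar> <= (\<integral>\<^sup>+y. norm ((x - y)^2 / ((x - y)^2 + e^2) * poly (p (Suc n)) y * iu E y) \<partial>jacobi_measure \<alpha> \<beta>)"
    unfolding I_def using integral_norm_bound_ennreal[OF ii] by simp
   also have "... <= (\<integral>\<^sup>+y. ennreal (C * c2) * (ennreal (rho0 \<alpha> \<beta> y powr (- (1 - 1 / r))) * indicator E y) \<partial>jacobi_measure \<alpha> \<beta>)"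
   proof (rule nn_integral_mono)
    fix y
    show "ennreal (norm ((x - y)^2 / ((x - y)^2 + e^2) * poly (p (Suc n)) y * iu E y)) <= ennreal (C * c2) * (ennreal (rho0 \<alpha> \<beta> y powr (- (1 - 1 / r))) * indicator E y)"
    proof (cases "y \<in> E")
     case True
     then have y: "y \<in> Ioo" "y \<in> {-1..1}" using E by auto
     have py: "hw y > 0" "uw y > 0" using hw_pos uw_pos y by auto
     have "norm ((x - y)^2 / ((x - y)^2 + e^2) * poly (p (Suc n)) y * iu E y) = ((x - y)^2 / ((x - y)^2 + e^2)) * (\<bar>poly (p (Suc n)) y\<bar> / uw y)"
      using True py by (simp add: abs_mult)
     also have "... <= 1 * (\<bar>poly (p (Suc n)) y\<bar> / uw y)"
      using square_ratio_le_1[OF e] py by (intro mult_right_mono) auto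
     also have "... = (\<bar>poly (p (Suc n)) y\<bar> * hw y) * (1 / (hw y * uw y))" using py by simp
     also have "... <= C * (c2 * rho0 \<alpha> \<beta> y powr (- (1 - 1 / r)))"
      using C(1) C(2)[OF y(2), of "Suc n"] c2(2)[OF y(1)] py by (intro mult_mono) auto
     finally have "ennreal (norm ((x - y)^2 / ((x - y)^2 + e^2) * poly (p (Suc n)) y * iu E y)) <= ennreal (C * (c2 * rho0 \<alpha> \<beta> y powr (- (1 - 1 / r))))"
      by (rule ennreal_leI)
     also have "... = ennreal (C * c2) * (ennreal (rho0 \<alpha> \<beta> y powr (- (1 - 1 / r))) * indicator E y)"
      using True C(1) c2(1) by (simp add: ennreal_mult mult_ac)
     finally show ?thesis .
    qed simp
   qed
   also have "... = ennreal (C * c2) * (\<integral>\<^sup>+y. ennreal (rho0 \<alpha> \<beta> y powr (- (1 - 1 / r))) * indicator E y \<partial>jacobi_measure \<alpha> \<beta>)"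
    by (rule nn_integral_cmult) measurable
   also have "... <= ennreal (C * c2) * ennreal (c3 * m)" unfolding m_def by (intro mult_left_mono c3(2) E) auto
   also have "... = ennreal (C * c2 * c3 * m)" using C(1) c2(1) c3(1) by (simp add: ennreal_mult m_def mult_ac)
   finally show ?thesis using C(1) c2(1) c3(1) by (subst (asm) ennreal_le_iff) (auto simp: m_def)
  qed
  have form: "(2 * N + 1 + \<alpha> + \<beta>) * reg_op n E e x = uw x * (P * (2 * C * N * H1) - q * q * P' * (C * H2) - N * P * I)"
   using reg_op_formula[OF E C(1) e, of n x] unfolding N_def P_def P'_def H1_def H2_def I_def q(2) by simp
  have "(2 * N) * \<bar>reg_op n E e x\<bar> <= (2 * N + 1 + \<alpha> + \<beta>) * \<bar>reg_op n E e x\<bar>" using ab by (intro mult_right_mono) auto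
  also have "... = \<bar>(2 * N + 1 + \<alpha> + \<beta>) * reg_op n E e x\<bar>" using ab N1 by (simp add: abs_mult)
  also have "... = uw x * \<bar>P * (2 * C * N * H1) - q * q * P' * (C * H2) - N * P * I\<bar>" unfolding form using pos by (simp add: abs_mult)
  also have "... <= uw x * (\<bar>P * (2 * C * N * H1)\<bar> + \<bar>q * q * P' * (C * H2)\<bar> + \<bar>N * P * I\<bar>)"
   using pos by (intro mult_left_mono) linarith+
  also have "... = (uw x * \<bar>P\<bar>) * (2 * C * N * \<bar>H1\<bar>) + (uw x * (q * q * \<bar>P'\<bar>)) * (C * \<bar>H2\<bar>) + N * ((uw x * \<bar>P\<bar>) * \<bar>I\<bar>)"
   using C(1) N1 q(1) by (simp add: abs_mult distrib_left mult_ac)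
  also have "... <= (C * W1.mw x) * (2 * C * N * \<bar>H1\<bar>) + (2 * C * N * W2.mw x) * (C * \<bar>H2\<bar>) + N * ((C * W1.mw x) * (C * c2 * c3 * m))"
  proof (intro add_mono)
   show "(uw x * \<bar>P\<bar>) * (2 * C * N * \<bar>H1\<bar>) <= (C * W1.mw x) * (2 * C * N * \<bar>H1\<bar>)"
    using Pb C(1) N1 by (intro mult_right_mono) auto
   show "(uw x * (q * q * \<bar>P'\<bar>)) * (C * \<bar>H2\<bar>) <= (2 * C * N * W2.mw x) * (C * \<bar>H2\<bar>)"
    using P'b C(1) by (intro mult_right_mono) auto
   have "(uw x * \<bar>P\<bar>) * \<bar>I\<bar> <= (C * W1.mw x) * (C * c2 * c3 * m)"
    using Pb Ib C(1) pos by (intro mult_mono[OF Pb Ib]) auto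
   then show "N * ((uw x * \<bar>P\<bar>) * \<bar>I\<bar>) <= N * ((C * W1.mw x) * (C * c2 * c3 * m))" using N1 by (intro mult_left_mono) auto
  qed
  also have "... <= (2 * N) * (C * C * (W1.mw x * \<bar>H1\<bar>) + C * C * (W2.mw x * \<bar>H2\<bar>) + C * W1.mw x * (C * c2 * c3 * m))"
  proof -
   have "0 <= N * ((C * W1.mw x) * (C * c2 * c3 * m))" using C(1) N1 pos c2(1) c3(1) by (simp add: m_def)
   then show ?thesis by (simp add: algebra_simps)
  qed
  finally have "\<bar>reg_op n E e x\<bar> <= C * C * (W1.mw x * \<bar>H1\<bar>) + C * C * (W2.mw x * \<bar>H2\<bar>) + C * W1.mw x * (C * c2 * c3 * m)"
   using N1 by (subst (asm) mult_le_cancel_left_pos) auto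
  moreover have "C * W1.mw x * (C * c2 * c3 * m) <= C * (c1 * rho0 \<alpha> \<beta> x powr (- 1 / r)) * (C * c2 * c3 * m)"
   using c1(2)[OF x] C(1) c2(1) c3(1) by (intro mult_right_mono mult_left_mono) (auto simp: m_def)
  ultimately show ?thesis unfolding H1_def[symmetric] H2_def[symmetric] m_def[symmetric] K_def by (simp add: mult_ac)
 qed
 show ?thesis using C(1) K b1 b2 main by (intro exI[of _ C] conjI exI[of _ K]) auto
qed

end

text \<open>Fatou's lemma for sets; it carries bounds that are uniform in e over to e -> 0 with the
  same constant.\<close>

lemma emeasure_liminf_le:
 fixes Y :: "nat => 'a set"
 assumes Y: "\<And>j. Y j \<in> sets M" and B: "\<And>j. emeasure M (Y j) <= B"
 shows "emeasure M (\<Union>m. \<Inter>j\<in>{m..}. Y j) <= B"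
proof -
 have s: "(\<Inter>j\<in>{m..}. Y j) \<in> sets M" for m by (rule sets.countable_INT') (use Y in auto)
 have "(SUP m. emeasure M (\<Inter>j\<in>{m..}. Y j)) = emeasure M (\<Union>m. \<Inter>j\<in>{m..}. Y j)"
 proof (rule SUP_emeasure_incseq)
  show "range (\<lambda>m. \<Inter>j\<in>{m..}. Y j) \<subseteq> sets M" using s by auto
  show "incseq (\<lambda>m. \<Inter>j\<in>{m..}. Y j)" by (rule incseq_SucI) auto
 qed
 moreover have "(SUP m. emeasure M (\<Inter>j\<in>{m..}. Y j)) <= B"
 proof (rule SUP_least)
  fix m
  have "emeasure M (\<Inter>j\<in>{m..}. Y j) <= emeasure M (Y m)" using Y by (intro emeasure_mono) auto
  then show "emeasure M (\<Inter>j\<in>{m..}. Y j) <= B" using B order_trans by blast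
 qed
 ultimately show ?thesis by simp
qed

lemma AE_jacobi_measure_neq: "AE y in jacobi_measure \<alpha> \<beta>. y ~= x"
proof -
 have "AE y in lborel. y ~= x" by (rule AE_lborel_singleton)
 then show ?thesis unfolding jacobi_measure_def by (subst AE_density) auto
qed

section \<open>Removing the regularisation\<close>

context jacobi_weighted
begin

lemma ker_poly: "ker n x y = poly (\<Sum>j\<le>n. smult (poly (p j) x) (p j)) y"
 by (simp add: ker_def poly_sum)

lemma ker_mult_integrable:
 assumes E: "E \<in> sets borel" "E \<subseteq> Ioo"
 shows "integrable (jacobi_measure \<alpha> \<beta>) (\<lambda>y. ker n x y * iu E y)"
proof -
 obtain D where D: "\<forall>y\<in>{-1..1::real}. \<bar>poly (\<Sum>j\<le>n. smult (poly (p j) x) (p j)) y\<bar> <= D" using poly_bounded_Icc by blast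
 show ?thesis
  by (rule bounded_mult_integrable[OF _ E, of _ D]) (use D ker_poly[of n x] in auto)
qed

lemma reg_op_tendsto:
 assumes E: "E \<in> sets borel" "E \<subseteq> Ioo"
 shows "(\<lambda>j. reg_op n E (1 / real (Suc j)) x) \<longlonglongrightarrow> uw x * (\<integral>y. ker n x y * iu E y \<partial>jacobi_measure \<alpha> \<beta>)"
 unfolding reg_op_def
proof (intro tendsto_mult_left integral_dominated_convergence)
 let ?f = "\<lambda>y. ker n x y * iu E y"
 let ?k = "\<lambda>j y. (x - y)\<^sup>2 / ((x - y)^2 + (1 / real (Suc j))^2)"
 note [measurable] = E(1)
 show "?f \<in> borel_measurable (jacobi_measure \<alpha> \<beta>)" by measurable
 show "(\<lambda>y. ?k j y * ?f y) \<in> borel_measurable (jacobi_measure \<alpha> \<beta>)" for j by measurable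
 show "integrable (jacobi_measure \<alpha> \<beta>) (\<lambda>y. norm (?f y))" by (intro integrable_norm ker_mult_integrable E)
 show "AE y in jacobi_measure \<alpha> \<beta>. norm (?k j y * ?f y) <= norm (?f y)" for j
 proof (rule AE_I2)
  fix y
  have "\<bar>?k j y\<bar> * norm (?f y) <= 1 * norm (?f y)"
   using square_ratio_le_1[of "1 / real (Suc j)" "x - y"] by (intro mult_right_mono) (auto simp: abs_le_iff simp del: of_nat_Suc intro: order_trans[of _ 0])
  then show "norm (?k j y * ?f y) <= norm (?f y)" by (simp only: abs_mult[of "?k j y"] real_norm_def mult_1)
 qed
 have "(\<lambda>j. ?k j y * ?f y) \<longlonglongrightarrow> ?f y" if y: "y ~= x" for y
 proof -
  have "(\<lambda>j. ?k j y) \<longlonglongrightarrow> (x - y)\<^sup>2 / ((x - y)^2 + 0^2)"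
   using y by (intro tendsto_divide tendsto_add tendsto_power tendsto_const LIMSEQ_inverse_real_of_nat[unfolded inverse_eq_divide]) auto
  then have "(\<lambda>j. ?k j y) \<longlonglongrightarrow> 1" using y by simp
  from tendsto_mult_right[OF this, of "?f y"] show ?thesis by simp
 qed
 then show "AE y in jacobi_measure \<alpha> \<beta>. (\<lambda>j. ?k j y * ?f y) \<longlonglongrightarrow> ?f y"
  using AE_jacobi_measure_neq[of x \<alpha> \<beta>] by (auto elim!: eventually_mono)
qed

text \<open>For each e the set where |\<open>reg_op\<close>| exceeds s lies in a union of three
  sets, one for each term of \<open>reg_op_bound\<close>, with s / 3 each. If the limit exceeds s at
  x, then so does \<open>reg_op\<close> from some index on, so x lies in the limit inferior of these
  unions. Asserting only a measurable superset Y spares the measurability of the limit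
  operator.\<close>

lemma main_weak:
 "\<exists>C\<ge>0. \<forall>n E s. E \<in> sets borel \<and> E \<subseteq> Ioo \<and> s > 0 -->
   (\<exists>Y\<in>sets borel. {x\<in>Ioo. \<bar>uw x * (\<integral>y. ker n x y * iu E y \<partial>jacobi_measure \<alpha> \<beta>)\<bar> > s} \<subseteq> Y \<and> Y \<subseteq> Ioo \<and>
    emeasure (jacobi_measure \<alpha> \<beta>) Y <= ennreal (C * (s powr (- r) * measure (jacobi_measure \<alpha> \<beta>) E)))"
proof -
 define \<mu> where "\<mu> = jacobi_measure \<alpha> \<beta>"
 have ab1: "\<alpha> > -1" "\<beta> > -1" using ab by auto
 obtain C K where C: "C > 0" and K: "K >= 0" and bd: "\<forall>n t. \<bar>bd1 C n t\<bar> <= 1 \<and> \<bar>bd2 C n t\<bar> <= 1"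
  and reg: "\<forall>n E e x. E \<in> sets borel \<and> E \<subseteq> Ioo \<and> e > 0 \<and> x \<in> Ioo -->
   \<bar>reg_op n E e x\<bar> <= C * C * (W1.mw x * \<bar>hilbert_reg e (\<lambda>t. bd1 C n t * (1 / W1.mw t) * indicator E t) x\<bar>)
    + C * C * (W2.mw x * \<bar>hilbert_reg e (\<lambda>t. bd2 C n t * (1 / W2.mw t) * indicator E t) x\<bar>)
    + K * measure \<mu> E powr (1 / r) * rho0 \<alpha> \<beta> x powr (- 1 / r)"
  using reg_op_bound[folded \<mu>_def] by (elim exE conjE) (rule that)
 obtain D1 where D1: "D1 >= 0" "\<forall>B E e s. B \<in> borel_measurable borel \<and> (\<forall>t. \<bar>B t\<bar> <= 1) \<and> E \<in> sets borel \<and> E \<subseteq> Ioo \<and> e > 0 \<and> s > 0 -->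
   emeasure \<mu> {x\<in>Ioo. W1.mw x * \<bar>hilbert_reg e (\<lambda>t. B t * (1 / W1.mw t) * indicator E t) x\<bar> > s} <= ennreal (D1 * s powr (- r) * measure \<mu> E)"
  using W1.weighted_weak[folded \<mu>_def] by (elim exE conjE) (rule that)
 obtain D2 where D2: "D2 >= 0" "\<forall>B E e s. B \<in> borel_measurable borel \<and> (\<forall>t. \<bar>B t\<bar> <= 1) \<and> E \<in> sets borel \<and> E \<subseteq> Ioo \<and> e > 0 \<and> s > 0 -->
   emeasure \<mu> {x\<in>Ioo. W2.mw x * \<bar>hilbert_reg e (\<lambda>t. B t * (1 / W2.mw t) * indicator E t) x\<bar> > s} <= ennreal (D2 * s powr (- r) * measure \<mu> E)"
  using W2.weighted_weak[folded \<mu>_def] by (elim exE conjE) (rule that)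
 obtain D3 where D3: "D3 >= 0" "\<And>K s. K >= 0 ==> s > 0 ==> emeasure \<mu> {x. K * rho0 \<alpha> \<beta> x powr (- 1 / r) > s} <= ennreal (D3 * (K powr r * s powr (- r)))"
  using rho0_weak_and_integral[OF ab1 r] unfolding \<mu>_def by blast
 define D where "D = (D1 + D2) * (3 * (C * C)) powr r + D3 * (K powr r * 3 powr r)"
 have D: "D >= 0" using D1(1) D2(1) D3(1) by (simp add: D_def)
 have main: "\<exists>Y\<in>sets borel. {x\<in>Ioo. \<bar>uw x * (\<integral>y. ker n x y * iu E y \<partial>\<mu>)\<bar> > s} \<subseteq> Y \<and> Y \<subseteq> Ioo \<and>
    emeasure \<mu> Y <= ennreal (D * (s powr (- r) * measure \<mu> E))"
  if E [measurable]: "E \<in> sets borel" "E \<subseteq> Ioo" and s: "s > 0" for n E s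
 proof -
  define m where "m = measure \<mu> E"
  have m0: "m >= 0" by (simp add: m_def)
  define s1 where "s1 = s / (3 * (C * C))"
  define s3 where "s3 = s / 3"
  have ss: "s1 > 0" "s3 > 0" using s C by (auto simp: s1_def s3_def)
  define Y1 where "Y1 e = {x\<in>Ioo. W1.mw x * \<bar>hilbert_reg e (\<lambda>t. bd1 C n t * (1 / W1.mw t) * indicator E t) x\<bar> > s1}" for e
  define Y2 where "Y2 e = {x\<in>Ioo. W2.mw x * \<bar>hilbert_reg e (\<lambda>t. bd2 C n t * (1 / W2.mw t) * indicator E t) x\<bar> > s1}" for e
  define Y3 where "Y3 = {x. K * m powr (1 / r) * rho0 \<alpha> \<beta> x powr (- 1 / r) > s3} \<inter> Ioo"
  have mm [measurable]: "W1.mw \<in> borel_measurable borel" "W2.mw \<in> borel_measurable borel"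
   unfolding W1.mw_def[abs_def] W2.mw_def[abs_def] by measurable
  have [measurable]: "hilbert_reg e (\<lambda>t. bd1 C n t * (1 / W1.mw t) * indicator E t) \<in> borel_measurable borel"
   "hilbert_reg e (\<lambda>t. bd2 C n t * (1 / W2.mw t) * indicator E t) \<in> borel_measurable borel" for e
   by measurable
  have Ym: "Y1 e \<in> sets borel" "Y2 e \<in> sets borel" "Y3 \<in> sets borel" for e
   unfolding Y1_def Y2_def Y3_def by measurable
  define Y where "Y e = Y1 e \<union> Y2 e \<union> Y3" for e
  have Yin: "Y e \<subseteq> Ioo" for e by (auto simp: Y_def Y1_def Y2_def Y3_def)
  have Yb: "emeasure \<mu> (Y e) <= ennreal (D * (s powr (- r) * m))" if e: "e > 0" for e
  proof -
   have "emeasure \<mu> (Y e) <= emeasure \<mu> (Y1 e \<union> Y2 e) + emeasure \<mu> Y3"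
    unfolding Y_def using Ym by (intro emeasure_subadditive) (auto simp: \<mu>_def)
   also have "emeasure \<mu> (Y1 e \<union> Y2 e) <= emeasure \<mu> (Y1 e) + emeasure \<mu> (Y2 e)"
    using Ym by (intro emeasure_subadditive) (auto simp: \<mu>_def)
   also have "emeasure \<mu> (Y1 e) <= ennreal (D1 * s1 powr (- r) * m)"
    unfolding Y1_def m_def using bd E e ss by (intro D1(2)[rule_format]) auto
   also have "emeasure \<mu> (Y2 e) <= ennreal (D2 * s1 powr (- r) * m)"
    unfolding Y2_def m_def using bd E e ss by (intro D2(2)[rule_format]) auto
   also have "emeasure \<mu> Y3 <= emeasure \<mu> {x. K * m powr (1 / r) * rho0 \<alpha> \<beta> x powr (- 1 / r) > s3}"
    unfolding Y3_def by (intro emeasure_mono) (auto simp: \<mu>_def)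
   also have "... <= ennreal (D3 * ((K * m powr (1 / r)) powr r * s3 powr (- r)))"
    using K ss by (intro D3(2)) auto
   finally have "emeasure \<mu> (Y e) <= ennreal (D1 * s1 powr (- r) * m) + ennreal (D2 * s1 powr (- r) * m) + ennreal (D3 * ((K * m powr (1 / r)) powr r * s3 powr (- r)))"
    by (simp add: add_mono)
   also have "... = ennreal (D1 * s1 powr (- r) * m + D2 * s1 powr (- r) * m + D3 * ((K * m powr (1 / r)) powr r * s3 powr (- r)))"
    using D1(1) D2(1) D3(1) m0 by (simp add: ennreal_plus[symmetric] del: ennreal_plus)
   also have "D1 * s1 powr (- r) * m + D2 * s1 powr (- r) * m + D3 * ((K * m powr (1 / r)) powr r * s3 powr (- r)) = D * (s powr (- r) * m)"
   proof -
    have 1: "s1 powr (- r) = s powr (- r) * (3 * (C * C)) powr r" "s3 powr (- r) = s powr (- r) * 3 powr r"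
     using s C unfolding s1_def s3_def by (simp_all add: powr_divide powr_minus field_simps)
    have 2: "(K * m powr (1 / r)) powr r = K powr r * m" using K m0 r by (simp add: powr_mult powr_powr)
    show ?thesis unfolding 1 2 D_def by (simp add: algebra_simps)
   qed
   finally show ?thesis .
  qed
  have sub: "x \<in> Y e" if "x \<in> Ioo" "e > 0" "\<bar>reg_op n E e x\<bar> > s" for x e
  proof (rule ccontr)
   assume n: "x \<notin> Y e"
   have "W1.mw x * \<bar>hilbert_reg e (\<lambda>t. bd1 C n t * (1 / W1.mw t) * indicator E t) x\<bar> <= s1"
    "W2.mw x * \<bar>hilbert_reg e (\<lambda>t. bd2 C n t * (1 / W2.mw t) * indicator E t) x\<bar> <= s1"
    and 3: "K * m powr (1 / r) * rho0 \<alpha> \<beta> x powr (- 1 / r) <= s3"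
    using n that(1) unfolding Y_def Y1_def Y2_def Y3_def by auto
   then have "C * C * (W1.mw x * \<bar>hilbert_reg e (\<lambda>t. bd1 C n t * (1 / W1.mw t) * indicator E t) x\<bar>) <= C * C * s1"
    "C * C * (W2.mw x * \<bar>hilbert_reg e (\<lambda>t. bd2 C n t * (1 / W2.mw t) * indicator E t) x\<bar>) <= C * C * s1"
    using C by (auto intro!: mult_left_mono)
   moreover have "C * C * s1 = s / 3" using C by (simp add: s1_def)
   ultimately show False using reg[rule_format, OF conjI, OF E(1) conjI, OF E(2) conjI, OF that(2,1), of n] that(3) 3 unfolding m_def s3_def by linarith
  qed
  define Z where "Z = (\<Union>k. \<Inter>j\<in>{k..}. Y (1 / real (Suc j)))"
  have Zs: "Z \<in> sets borel" unfolding Z_def Y_def by (intro sets.countable_UN image_subsetI sets.countable_INT' sets.Un Ym) auto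
  moreover have "emeasure \<mu> Z <= ennreal (D * (s powr (- r) * m))"
   unfolding Z_def by (rule emeasure_liminf_le) (use Ym Yb in \<open>auto simp: \<mu>_def Y_def\<close>)
  moreover have "Z \<subseteq> Ioo" unfolding Z_def using Yin by blast
  moreover have "{x\<in>Ioo. \<bar>uw x * (\<integral>y. ker n x y * iu E y \<partial>\<mu>)\<bar> > s} \<subseteq> Z"
  proof safe
   fix x :: real assume x: "x \<in> Ioo" and g: "s < \<bar>uw x * (\<integral>y. ker n x y * iu E y \<partial>\<mu>)\<bar>"
   have "(\<lambda>j. \<bar>reg_op n E (1 / real (Suc j)) x\<bar>) \<longlonglongrightarrow> \<bar>uw x * (\<integral>y. ker n x y * iu E y \<partial>\<mu>)\<bar>"
    unfolding \<mu>_def by (intro tendsto_rabs reg_op_tendsto E)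
   from order_tendstoD(1)[OF this g] obtain k where "\<And>j. j >= k ==> s < \<bar>reg_op n E (1 / real (Suc j)) x\<bar>"
    unfolding eventually_sequentially by blast
   then have "x \<in> Y (1 / real (Suc j))" if "j >= k" for j using that x by (intro sub) auto
   then show "x \<in> Z" unfolding Z_def by blast
  qed
  ultimately show ?thesis unfolding m_def by blast
 qed
 show ?thesis using D main unfolding \<mu>_def by (intro exI[of _ D]) auto
qed

end

section \<open>Point masses\<close>

text \<open>The sum of the constants is used, which unlike a maximum also makes sense for an empty
  set.\<close>

lemma finite_uniform_constant:
 fixes f g :: "'a => 'b => real"
 assumes A: "finite A" and g: "\<And>z t. g z t >= 0"
  and ex: "\<And>z. z \<in> A ==> \<exists>C\<ge>0. \<forall>t. P z t --> f z t <= C * g z t"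
 shows "\<exists>C\<ge>0. \<forall>z\<in>A. \<forall>t. P z t --> f z t <= C * g z t"
proof -
 from ex have "\<forall>z\<in>A. \<exists>C. C >= 0 \<and> (\<forall>t. P z t --> f z t <= C * g z t)" by auto
 from bchoice[OF this] obtain C where C: "\<And>z. z \<in> A ==> C z >= 0" "\<And>z t. z \<in> A ==> P z t ==> f z t <= C z * g z t" by blast
 have "f z t <= sum C A * g z t" if "z \<in> A" "P z t" for z t
 proof -
  have "C z <= sum C A" using that C(1) A by (intro member_le_sum) auto
  then show ?thesis using C(2)[OF that] mult_right_mono[OF _ g[of z t]] order_trans by blast
 qed
 then show ?thesis using C(1) by (intro exI[of _ "sum C A"]) (auto intro: sum_nonneg)
qed

text \<open>With c, d equal to the exponent combinations \<open>k1\<close>, \<open>k2\<close>, the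
  weight u times \<open>gwt\<close> is \<open>rho0\<close> to the power -1/r; with both signs
  reversed, \<open>gwt\<close> divided by u is \<open>rho0\<close> to the power - (1 - 1/r). So
  bounds in x and bounds in y are one family.\<close>

definition gwt :: "real => real => real => real => real => real" where
 "gwt \<alpha> \<beta> c d x = (1 - x) powr (- c - (\<alpha> + 1) / 2) * (1 + x) powr (- d - (\<beta> + 1) / 2)"

text \<open>The cap at 1 makes its negative powers at least 1 off A. Masses at the endpoints are
  left out, because \<open>gwt\<close> already accounts for them.\<close>

definition mass_dist :: "real set => real => real" where
 "mass_dist A x = Min (insert 1 ((\<lambda>a. \<bar>x - a\<bar>) ` (A \<inter> Ioo)))"

lemma gwt_nonneg: "gwt \<alpha> \<beta> c d x >= 0"
 by (simp add: gwt_def)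

lemma gwt_lower:
 assumes ab: "\<alpha> >= -1/2" "\<beta> >= -1/2" and cd: "c >= -1/4" "d >= -1/4" and x: "x \<in> Ioo"
 shows "2 powr (- c - (\<alpha> + 1) / 2) * 2 powr (- d - (\<beta> + 1) / 2) <= gwt \<alpha> \<beta> c d x"
 unfolding gwt_def using ab cd x by (intro mult_mono powr_mono2') auto

lemma mass_dist_le:
 assumes "finite A"
 shows "mass_dist A x <= 1" "z \<in> A \<inter> Ioo ==> mass_dist A x <= \<bar>x - z\<bar>"
 unfolding mass_dist_def using assms by (auto intro!: Min_le)

lemma mass_dist_pos:
 assumes "finite A" "x \<notin> A \<inter> Ioo"
 shows "mass_dist A x > 0"
 unfolding mass_dist_def using assms by (subst Min_gr_iff) auto

lemma mass_dist_powr_ge_1: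
 assumes "finite A" "x \<notin> A" "\<theta> >= 0"
 shows "1 <= mass_dist A x powr (- \<theta>)"
proof -
 have "1 powr (- \<theta>) <= mass_dist A x powr (- \<theta>)"
  using mass_dist_le(1)[OF assms(1)] mass_dist_pos[of A x] assms by (intro powr_mono2') auto
 then show ?thesis by simp
qed

section \<open>The Jacobi kernel with one variable at a mass\<close>

context jacobi_polys
begin

lemma inverse_hw_le_gwt:
 assumes cd: "c >= -1/4" "d >= -1/4" and x: "x \<in> Ioo"
 shows "1 / hw x <= 2 powr (c + 1/4) * 2 powr (d + 1/4) * gwt \<alpha> \<beta> c d x"
proof -
 have q: "- (\<alpha> / 2 + 1/4) = (c + 1/4) + (- c - (\<alpha> + 1) / 2)" "- (\<beta> / 2 + 1/4) = (d + 1/4) + (- d - (\<beta> + 1) / 2)"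
  by (simp_all add: field_simps)
 have "1 / hw x = (1 - x) powr (- (\<alpha> / 2 + 1/4)) * (1 + x) powr (- (\<beta> / 2 + 1/4))"
  unfolding hw_def powr_minus_divide by simp
 also have "... = ((1 - x) powr (c + 1/4) * (1 + x) powr (d + 1/4)) * gwt \<alpha> \<beta> c d x"
  unfolding q powr_add gwt_def by simp
 also have "... <= (2 powr (c + 1/4) * 2 powr (d + 1/4)) * gwt \<alpha> \<beta> c d x"
  using cd x by (intro mult_right_mono mult_mono powr_mono2 gwt_nonneg) auto
 finally show ?thesis .
qed

text \<open>A geometric mean, with exponents 1 - \<theta> and \<theta>, of the bounds n + 1 and 1 /
  |x - a| for the kernel times \<open>hw\<close>. The free \<theta> lets the singularity at the mass
  match the power of \<rho> wanted later.\<close>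

lemma ker_interior_gwt:
 assumes ab: "\<alpha> >= -1/2" "\<beta> >= -1/2" and cd: "c >= -1/4" "d >= -1/4" and \<theta>: "0 < \<theta>" "\<theta> < 1" and a: "a \<in> Ioo"
 shows "\<exists>C\<ge>0. \<forall>n. \<forall>x\<in>Ioo - {a}. \<bar>ker n x a\<bar> <= C * (real (Suc n) powr (1 - \<theta>) * (gwt \<alpha> \<beta> c d x * \<bar>x - a\<bar> powr (- \<theta>)))"
proof -
 obtain C where C: "C > 0" "\<And>n x. x \<in> Ioo ==> \<bar>ker n x a\<bar> * hw x <= C * real (Suc n) \<and> \<bar>x - a\<bar> * \<bar>ker n x a\<bar> * hw x <= C"
  using ker_interior_bounds[OF ab a] by blast
 define D where "D = C * (2 powr (c + 1/4) * 2 powr (d + 1/4))"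
 have "\<bar>ker n x a\<bar> <= D * (real (Suc n) powr (1 - \<theta>) * (gwt \<alpha> \<beta> c d x * \<bar>x - a\<bar> powr (- \<theta>)))" if x: "x \<in> Ioo" "x ~= a" for n x
 proof -
  define k where "k = \<bar>ker n x a\<bar> * hw x"
  define N where "N = real (Suc n)"
  have N: "N > 0" by (simp add: N_def)
  have h: "hw x > 0" by (rule hw_pos[OF x(1)])
  have xa: "\<bar>x - a\<bar> > 0" using x by simp
  have k0: "k >= 0" using h by (simp add: k_def)
  have k1: "k <= C * N" and k2: "k <= C / \<bar>x - a\<bar>" using C(2)[OF x(1), of n] xa by (auto simp: k_def N_def field_simps)
  have "k = k powr (1 - \<theta>) * k powr \<theta>" using k0 by (cases "k = 0") (auto simp: powr_add[symmetric])
  also have "... <= (C * N) powr (1 - \<theta>) * (C / \<bar>x - a\<bar>) powr \<theta>"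
   using k0 k1 k2 \<theta> by (intro mult_mono powr_mono2) auto
  also have "... = (C powr (1 - \<theta>) * C powr \<theta>) * (N powr (1 - \<theta>) * \<bar>x - a\<bar> powr (- \<theta>))"
   using C(1) N xa by (simp add: powr_mult powr_divide powr_minus_divide)
  also have "C powr (1 - \<theta>) * C powr \<theta> = C" using C(1) by (simp add: powr_add[symmetric])
  finally have "k * (1 / hw x) <= C * (N powr (1 - \<theta>) * \<bar>x - a\<bar> powr (- \<theta>)) * (2 powr (c + 1/4) * 2 powr (d + 1/4) * gwt \<alpha> \<beta> c d x)"
   using inverse_hw_le_gwt[OF cd x(1)] k0 h C(1) by (intro mult_mono) auto
  then show ?thesis using h by (simp add: k_def D_def N_def mult_ac)
 qed
 then show ?thesis using C(1) by (intro exI[of _ D]) (auto simp: D_def)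
qed

text \<open>The interval is cut at 1 - x = N^(-2) with N = n + 1. On the side away from 1 the
  estimate through \<open>hw\<close> has a surplus (1 - x)^(c - 1/4), at most N^(1/2 - 2 c). Closer
  to 1 the uniform bound N^(2 \<alpha> + 2) is compared with the lower bound of \<open>gwt\<close>
  there.\<close>

lemma ker_at_1_gwt:
 assumes ab: "\<alpha> >= -1/2" "\<beta> >= -1/2" and c: "-1/4 <= c" "c <= 1/4" and d: "-1/4 <= d"
 shows "\<exists>C\<ge>0. \<forall>n. \<forall>x\<in>Ioo. \<bar>ker n x 1\<bar> <= C * (real (Suc n) powr (\<alpha> + 1 - 2 * c) * gwt \<alpha> \<beta> c d x)"
proof -
 obtain C where C: "C > 0" "\<And>n x. x \<in> Ioo ==> \<bar>ker n x 1\<bar> * (sqrt (1 - x) * hw x) <= C * real (Suc n) powr (\<alpha> + 1/2)"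
   "\<And>n x. x \<in> {0..1} ==> \<bar>ker n x 1\<bar> <= C * real (Suc n) powr (2 * \<alpha> + 2)"
  using ker_at_1_bounds[OF ab] by blast
 define D1 where "D1 = C * 2 powr (d + 1/4)"
 define D2 where "D2 = C * 2 powr (d + (\<beta> + 1) / 2)"
 have D: "D1 >= 0" "D2 >= 0" using C(1) by (auto simp: D1_def D2_def)
 have "\<bar>ker n x 1\<bar> <= (D1 + D2) * (real (Suc n) powr (\<alpha> + 1 - 2 * c) * gwt \<alpha> \<beta> c d x)" if x: "x \<in> Ioo" for n x
 proof -
  define N where "N = real (Suc n)"
  have N: "N >= 1" by (simp add: N_def)
  have p0: "0 <= N powr (\<alpha> + 1 - 2 * c) * gwt \<alpha> \<beta> c d x" using gwt_nonneg by simp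
  have pos: "1 - x > 0" "1 + x > 0" using x by auto
  have N2: "(N powr (-2)) powr t = N powr (- 2 * t)" for t by (simp add: powr_powr)
  show ?thesis
  proof (cases "1 - x >= N powr (-2)")
   case True
   have h: "hw x > 0" by (rule hw_pos[OF x])
   have e: "- (1/2) + - (\<alpha> / 2 + 1/4) = (c - 1/4) + (- c - (\<alpha> + 1) / 2)" "- (\<beta> / 2 + 1/4) = (d + 1/4) + (- d - (\<beta> + 1) / 2)"
    by (simp_all add: field_simps)
   have "1 / (sqrt (1 - x) * hw x) = (1 - x) powr (- (1/2) + - (\<alpha> / 2 + 1/4)) * (1 + x) powr (- (\<beta> / 2 + 1/4))"
    using pos unfolding hw_def powr_add powr_minus_divide by (simp add: powr_half_sqrt)
   also have "... = ((1 - x) powr (c - 1/4) * (1 + x) powr (d + 1/4)) * gwt \<alpha> \<beta> c d x"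
    unfolding e powr_add gwt_def by simp
   also have "... <= ((N powr (-2)) powr (c - 1/4) * 2 powr (d + 1/4)) * gwt \<alpha> \<beta> c d x"
    using True c d pos x N by (intro mult_right_mono mult_mono powr_mono2 powr_mono2' gwt_nonneg) auto
   finally have i: "1 / (sqrt (1 - x) * hw x) <= (N powr (- 2 * (c - 1/4)) * 2 powr (d + 1/4)) * gwt \<alpha> \<beta> c d x" unfolding N2 .
   have "\<bar>ker n x 1\<bar> = (\<bar>ker n x 1\<bar> * (sqrt (1 - x) * hw x)) * (1 / (sqrt (1 - x) * hw x))" using h pos by simp
   also have "... <= (C * N powr (\<alpha> + 1/2)) * ((N powr (- 2 * (c - 1/4)) * 2 powr (d + 1/4)) * gwt \<alpha> \<beta> c d x)"
    using C(2)[OF x, of n] i C(1) h pos by (intro mult_mono[OF _ i]) (auto simp: N_def)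
   also have "... = D1 * ((N powr (\<alpha> + 1/2) * N powr (- 2 * (c - 1/4))) * gwt \<alpha> \<beta> c d x)" by (simp add: D1_def)
   also have "N powr (\<alpha> + 1/2) * N powr (- 2 * (c - 1/4)) = N powr (\<alpha> + 1 - 2 * c)"
    unfolding powr_add[symmetric] by (rule arg_cong[where f = "\<lambda>t. N powr t"]) (simp add: field_simps)
   also have "D1 * (N powr (\<alpha> + 1 - 2 * c) * gwt \<alpha> \<beta> c d x) <= (D1 + D2) * (N powr (\<alpha> + 1 - 2 * c) * gwt \<alpha> \<beta> c d x)"
    using D by (intro mult_right_mono p0) auto
   finally show ?thesis by (simp add: N_def)
  next
   case False
   have "N powr (-2) <= 1 powr (-2)" using N by (intro powr_mono2') auto
   then have x0: "x \<in> {0..1}" using False x by auto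
   have 1: "(N powr (-2)) powr (- c - (\<alpha> + 1) / 2) <= (1 - x) powr (- c - (\<alpha> + 1) / 2)"
    using False pos ab c by (intro powr_mono2') auto
   have 2: "2 powr (- d - (\<beta> + 1) / 2) <= (1 + x) powr (- d - (\<beta> + 1) / 2)"
    using pos x ab d by (intro powr_mono2') auto
   have "N powr (- 2 * (- c - (\<alpha> + 1) / 2)) * 2 powr (- d - (\<beta> + 1) / 2) <= gwt \<alpha> \<beta> c d x"
    unfolding gwt_def N2[symmetric] by (intro mult_mono 1 2) auto
   then have "D2 * (N powr (\<alpha> + 1 - 2 * c) * (N powr (- 2 * (- c - (\<alpha> + 1) / 2)) * 2 powr (- d - (\<beta> + 1) / 2))) <= D2 * (N powr (\<alpha> + 1 - 2 * c) * gwt \<alpha> \<beta> c d x)"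
    using D by (intro mult_left_mono) auto
   also have "D2 * (N powr (\<alpha> + 1 - 2 * c) * (N powr (- 2 * (- c - (\<alpha> + 1) / 2)) * 2 powr (- d - (\<beta> + 1) / 2)))
     = C * (N powr (\<alpha> + 1 - 2 * c) * N powr (- 2 * (- c - (\<alpha> + 1) / 2))) * (2 powr (d + (\<beta> + 1) / 2) * 2 powr (- d - (\<beta> + 1) / 2))"
    unfolding D2_def by (simp only: mult_ac)
   also have "2 powr (d + (\<beta> + 1) / 2) * 2 powr (- d - (\<beta> + 1) / 2) = (1::real)" unfolding powr_add[symmetric] by simp
   also have "N powr (\<alpha> + 1 - 2 * c) * N powr (- 2 * (- c - (\<alpha> + 1) / 2)) = N powr (2 * \<alpha> + 2)"
    unfolding powr_add[symmetric] by (rule arg_cong[where f = "\<lambda>t. N powr t"]) (simp add: field_simps)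
   finally have "C * N powr (2 * \<alpha> + 2) <= D2 * (N powr (\<alpha> + 1 - 2 * c) * gwt \<alpha> \<beta> c d x)" by simp
   also have "... <= (D1 + D2) * (N powr (\<alpha> + 1 - 2 * c) * gwt \<alpha> \<beta> c d x)" using D by (intro mult_right_mono p0) auto
   finally show ?thesis using C(3)[OF x0, of n] by (simp add: N_def)
  qed
 qed
 then show ?thesis using D by (intro exI[of _ "D1 + D2"]) auto
qed

lemma ker_at_minus_1_gwt:
 assumes ab: "\<alpha> >= -1/2" "\<beta> >= -1/2" and c: "-1/4 <= c" and d: "-1/4 <= d" "d <= 1/4"
 shows "\<exists>C\<ge>0. \<forall>n. \<forall>x\<in>Ioo. \<bar>ker n x (-1)\<bar> <= C * (real (Suc n) powr (\<beta> + 1 - 2 * d) * gwt \<alpha> \<beta> c d x)"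
proof -
 interpret R: jacobi_polys \<beta> \<alpha> "\<lambda>q. J (pcompose q [:0, -1:])" "\<lambda>n. pcompose (p n) [:0, -1:]"
  by (rule reflect)
 obtain C where C: "C >= 0" "\<And>n x. x \<in> Ioo ==> \<bar>R.ker n x 1\<bar> <= C * (real (Suc n) powr (\<beta> + 1 - 2 * d) * gwt \<beta> \<alpha> d c x)"
  using R.ker_at_1_gwt[OF ab(2,1) d c] by blast
 have "\<bar>ker n x (-1)\<bar> <= C * (real (Suc n) powr (\<beta> + 1 - 2 * d) * gwt \<alpha> \<beta> c d x)" if "x \<in> Ioo" for n x
 proof -
  have "R.ker n (- x) 1 = ker n x (-1)" unfolding R.ker_def ker_reflect by simp
  moreover have "gwt \<beta> \<alpha> d c (- x) = gwt \<alpha> \<beta> c d x" by (simp add: gwt_def mult.commute)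
  moreover have "- x \<in> Ioo" using that by auto
  ultimately show ?thesis using C(2)[of "- x" n] by simp
 qed
 then show ?thesis using C(1) by blast
qed

abbreviation (input) "gm c d \<theta> A x \<equiv> gwt \<alpha> \<beta> c d x * mass_dist A x powr (- \<theta>)"

text \<open>The exponents of n in the bounds for ker n x z against gwt, and for ker n z z' off the diagonal.\<close>

definition mexp :: "real => real => real => real => real" where
 "mexp c d \<theta> z = (if z = 1 then \<alpha> + 1 - 2 * c else if z = -1 then \<beta> + 1 - 2 * d else 1 - \<theta>)"

definition bexp :: "real => real" where
 "bexp z = (if z = 1 then \<alpha> + 1/2 else if z = -1 then \<beta> + 1/2 else 0)"

lemma ker_mass_bound:
 assumes ab: "\<alpha> >= -1/2" "\<beta> >= -1/2" and A: "finite A" "A \<subseteq> {-1..1}"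
  and c: "-1/4 <= c" "c <= 1/4" and d: "-1/4 <= d" "d <= 1/4" and \<theta>: "0 < \<theta>" "\<theta> < 1"
 shows "\<exists>C\<ge>0. \<forall>n. \<forall>x\<in>Ioo - A. \<forall>z\<in>A. \<bar>ker n x z\<bar> <= C * real (Suc n) powr mexp c d \<theta> z * gm c d \<theta> A x"
proof -
 \<comment> \<open>The pair (n, x) is packed into one variable t to fit the form of
   \<open>finite_uniform_constant\<close>.\<close>
 have "\<exists>C\<ge>0. \<forall>z\<in>A. \<forall>t. snd t \<in> Ioo - A -->
   \<bar>ker (fst t) (snd t) z\<bar> <= C * (real (Suc (fst t)) powr mexp c d \<theta> z * gm c d \<theta> A (snd t))"
 proof (rule finite_uniform_constant[OF A(1)])
  fix z assume z: "z \<in> A"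
  have fin: "\<exists>C\<ge>0. \<forall>t. snd t \<in> Ioo - A -->
    \<bar>ker (fst t) (snd t) z\<bar> <= C * (real (Suc (fst t)) powr mexp c d \<theta> z * gm c d \<theta> A (snd t))"
   if C: "C >= 0" "\<And>n x. x \<in> Ioo ==> \<bar>ker n x z\<bar> <= C * (real (Suc n) powr mexp c d \<theta> z * gwt \<alpha> \<beta> c d x)" for C
  proof (intro exI[of _ C] conjI allI impI C(1))
   fix t :: "nat \<times> real" assume t: "snd t \<in> Ioo - A"
   have "gwt \<alpha> \<beta> c d (snd t) * 1 <= gm c d \<theta> A (snd t)"
    using mass_dist_powr_ge_1[OF A(1), of "snd t" \<theta>] t \<theta> gwt_nonneg by (intro mult_left_mono) auto
   then have "C * (real (Suc (fst t)) powr mexp c d \<theta> z * gwt \<alpha> \<beta> c d (snd t)) <= C * (real (Suc (fst t)) powr mexp c d \<theta> z * gm c d \<theta> A (snd t))"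
    using C(1) by (intro mult_left_mono) auto
   then show "\<bar>ker (fst t) (snd t) z\<bar> <= C * (real (Suc (fst t)) powr mexp c d \<theta> z * gm c d \<theta> A (snd t))"
    using C(2)[of "snd t" "fst t"] t by (meson DiffD1 order_trans)
  qed
  consider "z = 1" | "z = -1" | "z \<in> Ioo" using z A(2) by force
  then show "\<exists>C\<ge>0. \<forall>t. snd t \<in> Ioo - A -->
    \<bar>ker (fst t) (snd t) z\<bar> <= C * (real (Suc (fst t)) powr mexp c d \<theta> z * gm c d \<theta> A (snd t))"
  proof cases
   case 1
   then show ?thesis using fin ker_at_1_gwt[OF ab c d(1)] unfolding mexp_def by auto
  next
   case 2
   then show ?thesis using fin ker_at_minus_1_gwt[OF ab c(1) d] unfolding mexp_def by auto
  next
   case 3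
   obtain C where C: "C >= 0" "\<And>n x. x \<in> Ioo - {z} ==> \<bar>ker n x z\<bar> <= C * (real (Suc n) powr (1 - \<theta>) * (gwt \<alpha> \<beta> c d x * \<bar>x - z\<bar> powr (- \<theta>)))"
    using ker_interior_gwt[OF ab c(1) d(1) \<theta> 3] by blast
   have m: "mexp c d \<theta> z = 1 - \<theta>" using 3 by (auto simp: mexp_def)
   show ?thesis unfolding m
   proof (intro exI[of _ C] conjI allI impI C(1))
    fix t :: "nat \<times> real" assume t: "snd t \<in> Ioo - A"
    then have tz: "snd t \<in> Ioo - {z}" using z by auto
    have "\<bar>snd t - z\<bar> powr (- \<theta>) <= mass_dist A (snd t) powr (- \<theta>)"
     using mass_dist_le(2)[OF A(1), of z "snd t"] mass_dist_pos[OF A(1), of "snd t"] 3 z t \<theta> by (intro powr_mono2') auto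
    then have "C * (real (Suc (fst t)) powr (1 - \<theta>) * (gwt \<alpha> \<beta> c d (snd t) * \<bar>snd t - z\<bar> powr (- \<theta>)))
      <= C * (real (Suc (fst t)) powr (1 - \<theta>) * gm c d \<theta> A (snd t))"
     using C(1) gwt_nonneg by (intro mult_left_mono) auto
    then show "\<bar>ker (fst t) (snd t) z\<bar> <= C * (real (Suc (fst t)) powr (1 - \<theta>) * gm c d \<theta> A (snd t))"
     using C(2)[OF tz, of "fst t"] by linarith
   qed
  qed
 qed (simp add: gwt_nonneg)
 then obtain C where C: "C >= 0" "\<And>z t. z \<in> A ==> snd t \<in> Ioo - A ==>
   \<bar>ker (fst t) (snd t) z\<bar> <= C * (real (Suc (fst t)) powr mexp c d \<theta> z * gm c d \<theta> A (snd t))" by blast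
 show ?thesis
 proof (intro exI[of _ C] conjI allI ballI C(1))
  fix n x z assume "x \<in> Ioo - A" "z \<in> A"
  then show "\<bar>ker n x z\<bar> <= C * real (Suc n) powr mexp c d \<theta> z * gm c d \<theta> A x"
   using C(2)[of z "(n, x)"] by (simp only: fst_conv snd_conv mult.assoc)
 qed
qed

text \<open>With both points fixed, an endpoint costs \<alpha> + 1/2 or \<beta> + 1/2 and an
  interior point costs nothing. On the diagonal the exponent is \<open>2 * bexp z + 1\<close>, and
  this extra power is the room in which diagonal dominance is found.\<close>

lemma ker_off_diagonal:
 assumes ab: "\<alpha> >= -1/2" "\<beta> >= -1/2" and z: "z \<in> {-1..1}" "z' \<in> {-1..1}" "z ~= z'"
 shows "\<exists>C\<ge>0. \<forall>n. \<bar>ker n z z'\<bar> <= C * real (Suc n) powr (bexp z + bexp z')"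
proof -
 have fin: "\<exists>C\<ge>0. \<forall>n. \<bar>ker n z z'\<bar> <= C * real (Suc n) powr (bexp z + bexp z')"
  if "h > 0" "C > 0" "\<And>n. \<bar>ker n z z'\<bar> * h <= C * real (Suc n) powr (bexp z + bexp z')" for C h and z z' :: real
 proof (intro exI[of _ "C / h"] conjI allI)
  show "0 <= C / h" using that by simp
  show "\<bar>ker n z z'\<bar> <= C / h * real (Suc n) powr (bexp z + bexp z')" for n
   using that(3)[of n] that(1) by (simp add: pos_le_divide_eq)
 qed
 interpret R: jacobi_polys \<beta> \<alpha> "\<lambda>q. J (pcompose q [:0, -1:])" "\<lambda>n. pcompose (p n) [:0, -1:]"
  by (rule reflect)
 have ii: "\<exists>C\<ge>0. \<forall>n. \<bar>ker n z z'\<bar> <= C * real (Suc n) powr (bexp z + bexp z')" if i: "z \<in> Ioo" "z' \<in> Ioo" "z ~= z'" for z z'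
 proof -
  obtain C where C: "C > 0" "\<And>n x. x \<in> Ioo ==> \<bar>x - z'\<bar> * \<bar>ker n x z'\<bar> * hw x <= C"
   using ker_interior_bounds[OF ab i(2)] by blast
  have e: "bexp z + bexp z' = 0" using i by (auto simp: bexp_def)
  show ?thesis by (rule fin[of "\<bar>z - z'\<bar> * hw z" C]) (use hw_pos[OF i(1)] i C e in \<open>auto simp: mult_ac\<close>)
 qed
 have i1: "\<exists>C\<ge>0. \<forall>n. \<bar>ker n z 1\<bar> <= C * real (Suc n) powr (bexp z + bexp 1)" if i: "z \<in> Ioo \<or> z = -1" for z
 proof -
  obtain C where C: "C > 0" "\<And>n x. x \<in> Ioo ==> \<bar>ker n x 1\<bar> * (sqrt (1 - x) * hw x) <= C * real (Suc n) powr (\<alpha> + 1/2)"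
    "\<And>n. \<bar>ker n (-1) 1\<bar> <= C * real (Suc n) powr (\<alpha> + \<beta> + 1)"
   using ker_at_1_bounds[OF ab] by blast
  show ?thesis
  proof (cases "z = -1")
   case True
   have "bexp z + bexp 1 = \<alpha> + \<beta> + 1" using True by (simp add: bexp_def)
   then show ?thesis using C True by (intro exI[of _ C]) auto
  next
   case False
   then have zi: "z \<in> Ioo" using i by auto
   have e: "bexp z + bexp 1 = \<alpha> + 1/2" using zi by (auto simp: bexp_def)
   show ?thesis by (rule fin[of "sqrt (1 - z) * hw z" C]) (use hw_pos[OF zi] zi C(1) C(2)[OF zi] e in auto)
  qed
 qed
 have im: "\<exists>C\<ge>0. \<forall>n. \<bar>ker n z (-1)\<bar> <= C * real (Suc n) powr (bexp z + bexp (-1))" if i: "z \<in> Ioo" for z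
 proof -
  obtain C where C: "C > 0" "\<And>n x. x \<in> Ioo ==> \<bar>R.ker n x 1\<bar> * (sqrt (1 - x) * R.hw x) <= C * real (Suc n) powr (\<beta> + 1/2)"
   using R.ker_at_1_bounds[OF ab(2,1)] by blast
  have k: "R.ker n (- z) 1 = ker n z (-1)" for n unfolding R.ker_def ker_reflect by simp
  have zi: "- z \<in> Ioo" using i by auto
  have e: "bexp z + bexp (-1) = \<beta> + 1/2" using i by (auto simp: bexp_def)
  show ?thesis by (rule fin[of "sqrt (1 + z) * R.hw (- z)" C]) (use R.hw_pos[OF zi] zi C(1) C(2)[OF zi] e k in auto)
 qed
 have sym: "\<exists>C\<ge>0. \<forall>n. \<bar>ker n z z'\<bar> <= C * real (Suc n) powr (bexp z + bexp z')"
  if "\<exists>C\<ge>0. \<forall>n. \<bar>ker n z' z\<bar> <= C * real (Suc n) powr (bexp z' + bexp z)"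
  using that by (simp only: ker_sym[of _ z z'] add.commute[of "bexp z"])
 consider "z \<in> Ioo" "z' \<in> Ioo" | "z' = 1" "z \<in> Ioo \<or> z = -1" | "z = 1" "z' \<in> Ioo \<or> z' = -1"
  | "z' = -1" "z \<in> Ioo" | "z = -1" "z' \<in> Ioo"
  using z by force
 then show ?thesis
 proof cases
  case 1 then show ?thesis using ii z(3) by blast
 next
  case 2 then show ?thesis using i1 by blast
 next
  case 3 then show ?thesis using i1 sym by blast
 next
  case 4 then show ?thesis using im by blast
 next
  case 5 then show ?thesis using im sym by blast
 qed
qed

lemma ker_off_diagonal_uniform:
 assumes ab: "\<alpha> >= -1/2" "\<beta> >= -1/2" and A: "finite A" "A \<subseteq> {-1..1}"
 shows "\<exists>C\<ge>0. \<forall>n. \<forall>z\<in>A. \<forall>z'\<in>A. z ~= z' --> \<bar>ker n z z'\<bar> <= C * real (Suc n) powr (bexp z + bexp z')"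
proof -
 have "\<exists>C\<ge>0. \<forall>zz\<in>A \<times> A. \<forall>n::nat. fst zz ~= snd zz --> \<bar>ker n (fst zz) (snd zz)\<bar> <= C * real (Suc n) powr (bexp (fst zz) + bexp (snd zz))"
 proof (rule finite_uniform_constant)
  fix zz assume zz: "zz \<in> A \<times> A"
  show "\<exists>C\<ge>0. \<forall>n::nat. fst zz ~= snd zz --> \<bar>ker n (fst zz) (snd zz)\<bar> <= C * real (Suc n) powr (bexp (fst zz) + bexp (snd zz))"
  proof (cases "fst zz = snd zz")
   case False
   have "fst zz \<in> {-1..1}" "snd zz \<in> {-1..1}" using zz A(2) by auto
   then show ?thesis using ker_off_diagonal[OF ab _ _ False] by auto
  qed auto
 qed (use A in auto)
 then show ?thesis by auto
qed

lemma ker_diag_lower: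
 assumes ab: "\<alpha> >= -1/2" "\<beta> >= -1/2" and J: "J = jacobi_int \<alpha> \<beta>" and z: "z \<in> {-1..1}"
 shows "\<exists>c>0. \<forall>n. c * real (Suc n) powr (2 * bexp z + 1) <= ker n z z"
proof -
 interpret R: jacobi_polys \<beta> \<alpha> "\<lambda>q. J (pcompose q [:0, -1:])" "\<lambda>n. pcompose (p n) [:0, -1:]"
  by (rule reflect)
 consider "z = 1" | "z = -1" | "z \<in> Ioo" using z by force
 then show ?thesis
 proof cases
  case 1
  then show ?thesis using ker_11_bounds[OF ab] by (auto simp: bexp_def algebra_simps simp del: of_nat_Suc)
 next
  case 2
  have k: "R.ker n 1 1 = ker n z z" for n unfolding R.ker_def ker_reflect 2 by simp
  have e: "2 * bexp z + 1 = 2 * \<beta> + 2" using 2 by (simp add: bexp_def)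
  show ?thesis using R.ker_11_bounds[OF ab(2,1)] unfolding k e by blast
 next
  case 3
  have p: "jacobi_polys \<alpha> \<beta> (jacobi_int \<alpha> \<beta>) p" using jacobi_polys_axioms unfolding J .
  have e: "2 * bexp z + 1 = 1" using 3 by (auto simp: bexp_def)
  have k: "(\<Sum>j\<le>n. (poly (p j) z)\<^sup>2) = ker n z z" for n by (simp add: ker_def power2_eq_square)
  show ?thesis using ker_interior_lower[OF ab 3 p] unfolding e k by simp
 qed
qed

lemma ker_diag_lower_uniform:
 assumes ab: "\<alpha> >= -1/2" "\<beta> >= -1/2" and J: "J = jacobi_int \<alpha> \<beta>" and A: "finite A" "A \<subseteq> {-1..1}"
 shows "\<exists>c>0. \<forall>n. \<forall>z\<in>A. c * real (Suc n) powr (2 * bexp z + 1) <= ker n z z"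
proof -
 have "\<exists>C\<ge>0. \<forall>z\<in>A. \<forall>n::nat. True --> real (Suc n) powr (2 * bexp z + 1) <= C * ker n z z"
 proof (rule finite_uniform_constant[OF A(1)])
  fix z assume "z \<in> A"
  then obtain c where c: "c > 0" "\<And>n. c * real (Suc n) powr (2 * bexp z + 1) <= ker n z z"
   using ker_diag_lower[OF ab J] A(2) by blast
  have "real (Suc n) powr (2 * bexp z + 1) <= 1 / c * ker n z z" for n
   using c(1) c(2)[of n] by (simp add: pos_le_divide_eq mult.commute)
  then show "\<exists>C\<ge>0. \<forall>n::nat. True --> real (Suc n) powr (2 * bexp z + 1) <= C * ker n z z"
   using c(1) by (intro exI[of _ "1 / c"]) auto
 next
  show "0 <= ker n z z" for n z unfolding ker_def by (intro sum_nonneg) auto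
 qed
 then obtain C where C: "C >= 0" "\<And>z n. z \<in> A ==> real (Suc n) powr (2 * bexp z + 1) <= C * ker n z z" by auto
 have "1 / (C + 1) * real (Suc n) powr (2 * bexp z + 1) <= ker n z z" if "z \<in> A" for n z
 proof -
  have "0 <= ker n z z" unfolding ker_def by (intro sum_nonneg) auto
  then have "real (Suc n) powr (2 * bexp z + 1) <= (C + 1) * ker n z z" using C(2)[OF that, of n] by (simp add: distrib_right)
  then show ?thesis using C(1) by (simp add: pos_divide_le_eq mult.commute)
 qed
 then show ?thesis using C(1) by (intro exI[of _ "1 / (C + 1)"]) auto
qed

end

section \<open>The gauge adapted to the masses\<close>

lemma powr_bound_on_interval:
 fixes y \<delta> g :: real
 assumes "0 < \<delta>" "\<delta> <= 1" "\<delta> <= y" "y <= 2"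
 shows "y powr g <= 2 powr \<bar>g\<bar> * \<delta> powr (- \<bar>g\<bar>)"
proof (cases "g >= 0")
 case True
 have "1 powr (- \<bar>g\<bar>) <= \<delta> powr (- \<bar>g\<bar>)" using assms by (intro powr_mono2') auto
 moreover have "y powr g <= 2 powr g" using assms True by (intro powr_mono2) auto
 ultimately have "y powr g * 1 <= 2 powr g * \<delta> powr (- \<bar>g\<bar>)" by (intro mult_mono) simp_all
 then show ?thesis using True by simp
next
 case False
 have "1 <= 2 powr \<bar>g\<bar>" by (rule ge_one_powr_ge_zero) auto
 moreover have "y powr g <= \<delta> powr g" using assms False by (intro powr_mono2') auto
 ultimately have "1 * y powr g <= 2 powr \<bar>g\<bar> * \<delta> powr g" by (intro mult_mono) auto
 then show ?thesis using False by simp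
qed

text \<open>Near a, \<open>rho0\<close> is bounded below and the weight above, so the set lies in an
  interval of length O(t). Elsewhere |x - a| is at least \<delta> and the sublevel bound for
  \<open>rho0\<close> applies.\<close>

lemma rho0_dist_sublevel:
 assumes ab: "\<alpha> > -1" "\<beta> > -1" and a: "a \<in> Ioo"
 shows "\<exists>C\<ge>0. \<forall>t>0. emeasure (jacobi_measure \<alpha> \<beta>) {x\<in>Ioo. rho0 \<alpha> \<beta> x * \<bar>x - a\<bar> < t} <= ennreal (C * t)"
proof -
 define \<mu> where "\<mu> = jacobi_measure \<alpha> \<beta>"
 define \<delta> where "\<delta> = (1 - \<bar>a\<bar>) / 2"
 have d: "0 < \<delta>" "\<delta> <= 1" using a by (auto simp: \<delta>_def)
 define W where "W = (2 powr \<bar>\<alpha>\<bar> * \<delta> powr (- \<bar>\<alpha>\<bar>)) * (2 powr \<bar>\<beta>\<bar> * \<delta> powr (- \<bar>\<beta>\<bar>))"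
 define m where "m = \<delta> powr (\<alpha> + 1) * \<delta> powr (\<beta> + 1)"
 have W: "W >= 0" and m: "m > 0" using d by (auto simp: W_def m_def)
 obtain C where C: "C >= 0" "\<And>t. t > 0 ==> emeasure \<mu> {x\<in>Ioo. rho0 \<alpha> \<beta> x < t} <= ennreal (C * t)"
  using rho0_sublevel[OF ab] unfolding \<mu>_def by blast
 have near: "x \<in> Ioo \<and> \<delta> <= 1 - x \<and> \<delta> <= 1 + x \<and> 1 - x <= 2 \<and> 1 + x <= 2" if "x \<in> {a - \<delta><..<a + \<delta>}" for x
 proof -
  have "2 * \<delta> = 1 - \<bar>a\<bar>" by (simp add: \<delta>_def)
  moreover have "a - \<delta> < x" "x < a + \<delta>" "-1 < a" "a < 1" using that a by auto
  ultimately show ?thesis using d abs_ge_self[of a] abs_ge_minus_self[of a] unfolding greaterThanLessThan_iff by linarith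
 qed
 have "emeasure \<mu> {x\<in>Ioo. rho0 \<alpha> \<beta> x * \<bar>x - a\<bar> < t} <= ennreal ((C / \<delta> + W * (2 / m)) * t)" if t: "t > 0" for t
 proof -
  define T where "T = {a - t / m..a + t / m} \<inter> {a - \<delta><..<a + \<delta>}"
  have T: "T \<in> sets borel" by (simp add: T_def)
  have sub: "{x\<in>Ioo. rho0 \<alpha> \<beta> x * \<bar>x - a\<bar> < t} \<subseteq> {x\<in>Ioo. rho0 \<alpha> \<beta> x < t / \<delta>} \<union> T"
  proof safe
   fix x assume x: "x \<in> Ioo" "rho0 \<alpha> \<beta> x * \<bar>x - a\<bar> < t" "x \<notin> T"
   have r0: "rho0 \<alpha> \<beta> x >= 0" by (rule rho0_nonneg)
   show "rho0 \<alpha> \<beta> x < t / \<delta>"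
   proof (cases "x \<in> {a - \<delta><..<a + \<delta>}")
    case False
    then have "\<delta> <= \<bar>x - a\<bar>" by auto
    then have "rho0 \<alpha> \<beta> x * \<delta> <= rho0 \<alpha> \<beta> x * \<bar>x - a\<bar>" using r0 by (intro mult_left_mono)
    then show ?thesis using x(2) d by (simp add: pos_less_divide_eq)
   next
    case True
    have "m <= rho0 \<alpha> \<beta> x" unfolding m_def rho0_def using near[OF True] d ab by (intro mult_mono powr_mono2) auto
    then have "m * \<bar>x - a\<bar> <= rho0 \<alpha> \<beta> x * \<bar>x - a\<bar>" by (intro mult_right_mono) auto
    then have "\<bar>x - a\<bar> < t / m" using x(2) m by (simp add: pos_less_divide_eq mult.commute)
    then have "x \<in> T" using True by (auto simp: T_def)
    then show ?thesis using x(3) by simp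
   qed
  qed
  have "emeasure \<mu> T = (\<integral>\<^sup>+ x. ennreal (indicator T x * jacobi_weight \<alpha> \<beta> x) \<partial>lborel)"
   unfolding \<mu>_def by (rule emeasure_jacobi_measure[OF T])
  also have "... <= (\<integral>\<^sup>+ x. ennreal W * indicator {a - t / m..a + t / m} x \<partial>lborel)"
  proof (rule nn_integral_mono)
   fix x
   show "ennreal (indicator T x * jacobi_weight \<alpha> \<beta> x) <= ennreal W * indicator {a - t / m..a + t / m} x"
   proof (cases "x \<in> T")
    case True
    have "jacobi_weight \<alpha> \<beta> x <= W"
     using near[of x] True d powr_bound_on_interval[OF d, of "1 - x" \<alpha>] powr_bound_on_interval[OF d, of "1 + x" \<beta>]
     unfolding W_def T_def jacobi_weight_def by (auto intro!: mult_mono)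
    then show ?thesis using True by (auto simp: T_def intro!: ennreal_leI)
   qed simp
  qed
  also have "... = ennreal W * emeasure lborel {a - t / m..a + t / m}" by (rule nn_integral_cmult_indicator) simp
  also have "... = ennreal (W * (2 / m) * t)" using W m t by (simp add: ennreal_mult[symmetric])
  finally have 1: "emeasure \<mu> T <= ennreal (W * (2 / m) * t)" .
  have "emeasure \<mu> {x\<in>Ioo. rho0 \<alpha> \<beta> x * \<bar>x - a\<bar> < t} <= emeasure \<mu> ({x\<in>Ioo. rho0 \<alpha> \<beta> x < t / \<delta>} \<union> T)"
   by (rule emeasure_mono[OF sub]) (use T in \<open>simp add: \<mu>_def\<close>)
  also have "... <= emeasure \<mu> {x\<in>Ioo. rho0 \<alpha> \<beta> x < t / \<delta>} + emeasure \<mu> T"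
   by (rule emeasure_subadditive) (use T in \<open>simp_all add: \<mu>_def\<close>)
  also have "... <= ennreal (C * (t / \<delta>)) + ennreal (W * (2 / m) * t)"
   using C(2)[of "t / \<delta>"] d t 1 by (intro add_mono) auto
  also have "... = ennreal (C * (t / \<delta>) + W * (2 / m) * t)" using C(1) d t W m by (intro ennreal_plus[symmetric]) auto
  also have "C * (t / \<delta>) + W * (2 / m) * t = (C / \<delta> + W * (2 / m)) * t" by (simp add: algebra_simps)
  finally show ?thesis .
 qed
 then show ?thesis unfolding \<mu>_def using C(1) d W m by (intro exI[of _ "C / \<delta> + W * (2 / m)"]) auto
qed

text \<open>The value 1 at the masses keeps them out of the sublevel sets below height 1 and makes
  every power of \<open>rhoA\<close> equal to 1 there.\<close>

definition rhoA :: "real => real => real set => real => real" where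
 "rhoA \<alpha> \<beta> A x = (if x \<in> A then 1 else rho0 \<alpha> \<beta> x * mass_dist A x)"

lemma mass_dist_nonneg: "finite A ==> mass_dist A x >= 0"
 unfolding mass_dist_def by (subst Min_ge_iff) auto

lemma rhoA_nonneg: "finite A ==> rhoA \<alpha> \<beta> A x >= 0"
 unfolding rhoA_def using rho0_nonneg mass_dist_nonneg by simp

lemma mass_dist_measurable:
 assumes "finite A"
 shows "mass_dist A \<in> borel_measurable borel"
proof -
 define f where "f i x = (case i of None => 1 | Some a => \<bar>x - a\<bar>)" for i and x :: real
 have fm: "f i \<in> borel_measurable borel" for i unfolding f_def by (cases i) auto
 have "mass_dist A x = Min ((\<lambda>i. f i x) ` (insert None (Some ` (A \<inter> Ioo))))" for x
  unfolding mass_dist_def f_def by (simp add: image_image)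
 then have "mass_dist A = (\<lambda>x. Min ((\<lambda>i. f i x) ` (insert None (Some ` (A \<inter> Ioo)))))" by auto
 moreover have "... \<in> borel_measurable borel"
  by (rule borel_measurable_Min) (use assms fm in auto)
 ultimately show ?thesis by simp
qed

lemma rhoA_measurable:
 assumes "finite A"
 shows "rhoA \<alpha> \<beta> A \<in> borel_measurable borel"
proof -
 note [measurable] = mass_dist_measurable[OF assms] borel_closed[OF finite_imp_closed[OF assms]]
 show ?thesis unfolding rhoA_def[abs_def] by measurable
qed

lemma AE_jacobi_measure_not_in_finite:
 assumes "finite A"
 shows "AE x in jacobi_measure \<alpha> \<beta>. x \<notin> A"
proof -
 have "AE x in jacobi_measure \<alpha> \<beta>. \<forall>a\<in>A. x ~= a"
  using assms AE_jacobi_measure_neq by (intro AE_finite_allI) auto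
 then show ?thesis by (auto elim!: eventually_mono)
qed

text \<open>The minimum in \<open>mass_dist\<close> is attained, so the continuous part is covered
  by finitely many sets of the two kinds already estimated. A mass is counted only when t > 1, and
  then M a <= M a t.\<close>

lemma rhoA_sublevel:
 assumes ab: "\<alpha> > -1" "\<beta> > -1" and A: "finite A" and M: "\<And>a. a \<in> A ==> M a >= 0"
 shows "\<exists>C\<ge>0. \<forall>t>0. emeasure (nu_measure \<alpha> \<beta> A M) {x\<in>space (nu_measure \<alpha> \<beta> A M). rhoA \<alpha> \<beta> A x < t} <= ennreal (C * t)"
proof -
 define \<mu> where "\<mu> = jacobi_measure \<alpha> \<beta>"
 define B where "B = A \<inter> Ioo"
 have finB: "finite B" using A by (simp add: B_def)
 obtain C0 where C0: "C0 >= 0" "\<And>t. t > 0 ==> emeasure \<mu> {x\<in>Ioo. rho0 \<alpha> \<beta> x < t} <= ennreal (C0 * t)"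
  using rho0_sublevel[OF ab] unfolding \<mu>_def by blast
 have "\<forall>a\<in>B. \<exists>C. C >= 0 \<and> (\<forall>t>0. emeasure \<mu> {x\<in>Ioo. rho0 \<alpha> \<beta> x * \<bar>x - a\<bar> < t} <= ennreal (C * t))"
  using rho0_dist_sublevel[OF ab] unfolding B_def \<mu>_def by blast
 from bchoice[OF this] obtain C where C: "\<And>a. a \<in> B ==> C a >= 0"
  "\<And>a t. a \<in> B ==> t > 0 ==> emeasure \<mu> {x\<in>Ioo. rho0 \<alpha> \<beta> x * \<bar>x - a\<bar> < t} <= ennreal (C a * t)" by blast
 define D where "D = C0 + sum C B"
 have D: "D >= 0" "sum M A >= 0" using C0 C(1) M by (auto simp: D_def intro!: add_nonneg_nonneg sum_nonneg)
 have [measurable]: "rhoA \<alpha> \<beta> A \<in> borel_measurable borel" by (rule rhoA_measurable[OF A])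
 have "emeasure (nu_measure \<alpha> \<beta> A M) {x. rhoA \<alpha> \<beta> A x < t} <= ennreal ((D + sum M A) * t)" if t: "t > 0" for t
 proof -
  define S where "S a = {x\<in>Ioo. rho0 \<alpha> \<beta> x * \<bar>x - a\<bar> < t}" for a
  define S0 where "S0 = {x\<in>Ioo. rho0 \<alpha> \<beta> x < t}"
  have Sm: "S a \<in> sets borel" "S0 \<in> sets borel" for a unfolding S_def S0_def by measurable
  have "AE x in \<mu>. x \<in> {x. rhoA \<alpha> \<beta> A x < t} --> x \<in> S0 \<union> (\<Union>a\<in>B. S a)"
   using AE_jacobi_measure_Ioo[of \<alpha> \<beta>] AE_jacobi_measure_not_in_finite[OF A, of \<alpha> \<beta>] unfolding \<mu>_def
  proof eventually_elim
   case (elim x)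
   show ?case
   proof
    assume "x \<in> {x. rhoA \<alpha> \<beta> A x < t}"
    then have l: "rho0 \<alpha> \<beta> x * mass_dist A x < t" using elim by (simp add: rhoA_def)
    have "mass_dist A x \<in> insert 1 ((\<lambda>a. \<bar>x - a\<bar>) ` B)" unfolding mass_dist_def B_def using A by (intro Min_in) auto
    then show "x \<in> S0 \<union> (\<Union>a\<in>B. S a)" using l elim(1) unfolding S0_def S_def by auto
   qed
  qed
  then have "emeasure \<mu> {x. rhoA \<alpha> \<beta> A x < t} <= emeasure \<mu> (S0 \<union> (\<Union>a\<in>B. S a))"
   by (rule emeasure_mono_AE) (use Sm finB in \<open>auto simp: \<mu>_def\<close>)
  also have "... <= emeasure \<mu> S0 + emeasure \<mu> (\<Union>a\<in>B. S a)"
   using Sm finB by (intro emeasure_subadditive) (auto simp: \<mu>_def)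
  also have "emeasure \<mu> (\<Union>a\<in>B. S a) <= (\<Sum>a\<in>B. emeasure \<mu> (S a))"
   using Sm finB by (intro emeasure_subadditive_finite) (auto simp: \<mu>_def)
  also have "... <= (\<Sum>a\<in>B. ennreal (C a * t))" unfolding S_def using C(2) t by (intro sum_mono) auto
  also have "... = ennreal (\<Sum>a\<in>B. C a * t)" using C(1) t by (intro sum_ennreal) auto
  also have "emeasure \<mu> S0 <= ennreal (C0 * t)" unfolding S0_def by (rule C0(2)[OF t])
  finally have "emeasure \<mu> {x. rhoA \<alpha> \<beta> A x < t} <= ennreal (C0 * t) + ennreal (\<Sum>a\<in>B. C a * t)" by (simp add: add_mono)
  also have "... = ennreal (C0 * t + (\<Sum>a\<in>B. C a * t))"
   using C0(1) C(1) t by (intro ennreal_plus[symmetric]) (auto intro!: sum_nonneg)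
  also have "C0 * t + (\<Sum>a\<in>B. C a * t) = D * t" by (simp add: D_def distrib_right sum_distrib_right)
  finally have 1: "emeasure \<mu> {x. rhoA \<alpha> \<beta> A x < t} <= ennreal (D * t)" .
  have "(\<Sum>a\<in>A. ennreal (M a) * indicator {x. rhoA \<alpha> \<beta> A x < t} a) <= (\<Sum>a\<in>A. ennreal (M a * t))"
  proof (rule sum_mono)
   fix a assume a: "a \<in> A"
   show "ennreal (M a) * indicator {x. rhoA \<alpha> \<beta> A x < t} a <= ennreal (M a * t)"
   proof (cases "rhoA \<alpha> \<beta> A a < t")
    case True
    then have "1 <= t" using a by (simp add: rhoA_def)
    then have "M a * 1 <= M a * t" using M[OF a] by (intro mult_left_mono) auto
    then show ?thesis using True by (auto intro!: ennreal_leI)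
   qed simp
  qed
  also have "... = ennreal (\<Sum>a\<in>A. M a * t)" using M t by (intro sum_ennreal) auto
  also have "(\<Sum>a\<in>A. M a * t) = sum M A * t" by (simp add: sum_distrib_right)
  finally have 2: "(\<Sum>a\<in>A. ennreal (M a) * indicator {x. rhoA \<alpha> \<beta> A x < t} a) <= ennreal (sum M A * t)" .
  have "emeasure (nu_measure \<alpha> \<beta> A M) {x. rhoA \<alpha> \<beta> A x < t} = emeasure \<mu> {x. rhoA \<alpha> \<beta> A x < t} + (\<Sum>a\<in>A. ennreal (M a) * indicator {x. rhoA \<alpha> \<beta> A x < t} a)"
   unfolding \<mu>_def by (rule emeasure_nu[OF A]) measurable
  also have "... <= ennreal (D * t) + ennreal (sum M A * t)" by (intro add_mono 1 2)
  also have "... = ennreal (D * t + sum M A * t)" using D t by (intro ennreal_plus[symmetric]) auto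
  finally show ?thesis by (simp add: distrib_right)
 qed
 then show ?thesis using D space_nu[OF A] by (intro exI[of _ "D + sum M A"]) auto
qed

text \<open>Stated for any linear functional, because it serves both the Jacobi measure and the
  measure with masses; the latter is not interpreted in the Jacobi locales.\<close>

lemma orthonormal_reproducing:
 fixes J :: "real poly => real"
 assumes add: "\<And>f g. J (f + g) = J f + J g" and smult: "\<And>c f. J (smult c f) = c * J f"
  and deg: "\<And>n. degree (Q n) = n" and orth: "\<And>m n. J (Q m * Q n) = (if m = n then 1 else 0)"
  and q: "\<And>i. i > n ==> coeff q i = 0"
 shows "J ((\<Sum>j\<le>n. smult (poly (Q j) x) (Q j)) * q) = poly q x"
proof -
 have J0: "J 0 = 0" using smult[of 0 0] by simp
 have J_sum: "J (\<Sum>i\<in>I. f i) = (\<Sum>i\<in>I. J (f i))" for I :: "nat set" and f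
  by (induction I rule: infinite_finite_induct) (auto simp: add J0)
 have "Q k ~= 0" for k using orth[of k k] J0 by auto
 then have "coeff (Q k) k ~= 0" for k using deg[of k] by (metis leading_coeff_0_iff)
 then have "\<exists>c. q = (\<Sum>k<Suc n. smult (c k) (Q k))" by (intro poly_span) (use deg q in auto)
 then obtain c where c: "q = (\<Sum>k<Suc n. smult (c k) (Q k))" by blast
 have cj: "J (Q j * q) = c j" if "j <= n" for j
 proof -
  have "J (Q j * q) = (\<Sum>k<Suc n. c k * J (Q j * Q k))"
   unfolding c sum_distrib_left J_sum by (intro sum.cong) (auto simp: smult)
  also have "... = (\<Sum>k<Suc n. if k = j then c j else 0)" by (intro sum.cong) (auto simp: orth)
  finally show ?thesis using that by simp
 qed
 have "J ((\<Sum>j\<le>n. smult (poly (Q j) x) (Q j)) * q) = (\<Sum>j\<le>n. poly (Q j) x * J (Q j * q))"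
  unfolding sum_distrib_right J_sum by (intro sum.cong) (auto simp: smult)
 also have "... = (\<Sum>j\<le>n. c j * poly (Q j) x)" by (intro sum.cong) (auto simp: cj)
 also have "... = poly q x" unfolding c by (simp add: poly_sum lessThan_Suc_atMost)
 finally show ?thesis .
qed

section \<open>The kernel of the measure with masses\<close>

locale jacobi_mass = jacobi_weighted \<alpha> \<beta> p a b r for \<alpha> \<beta> p a b r +
 fixes A :: "real set" and M :: "real => real" and P :: "nat => real poly"
 assumes finA: "finite A" and Asub: "A \<subseteq> {-1..1}" and Mpos: "\<And>z. z \<in> A ==> M z > 0"
  and orthP: "orthonormal_polys (nu_measure \<alpha> \<beta> A M) P"
begin

abbreviation "\<mu> \<equiv> jacobi_measure \<alpha> \<beta>"
abbreviation "\<nu> \<equiv> nu_measure \<alpha> \<beta> A M"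
abbreviation "L \<equiv> kernel_L P"

lemma ab1: "\<alpha> > -1" "\<beta> > -1" using ab by auto

lemma M_nonneg: "\<forall>z\<in>A. M z >= 0" using Mpos by (auto intro: less_imp_le)

definition Lpoly :: "nat => real => real poly" where
 "Lpoly n x = (\<Sum>j\<le>n. smult (poly (P j) x) (P j))"

definition Kpoly :: "nat => real => real poly" where
 "Kpoly n x = (\<Sum>j\<le>n. smult (poly (p j) x) (p j))"

lemma poly_Lpoly: "poly (Lpoly n x) y = L n x y"
 by (simp add: Lpoly_def kernel_L_def poly_sum)

lemma poly_Kpoly: "poly (Kpoly n x) y = ker n x y"
 by (simp add: Kpoly_def ker_def poly_sum)

lemma L_sym: "L n x y = L n y x"
 by (simp add: kernel_L_def mult.commute)

lemma degree_P: "degree (P n) = n"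
 using orthP by (simp add: orthonormal_polys_def)

lemma coeff_Lpoly: "i > n ==> coeff (Lpoly n x) i = 0"
 unfolding Lpoly_def coeff_sum by (intro sum.neutral) (auto intro!: coeff_eq_0 simp: degree_P)

lemma coeff_Kpoly: "i > n ==> coeff (Kpoly n x) i = 0"
 unfolding Kpoly_def coeff_sum by (intro sum.neutral) (auto intro!: coeff_eq_0 simp: degree_p)

lemma integrable_nu_poly: "integrable \<nu> (poly q)"
 using integrable_nu_iff[OF finA _ M_nonneg, of "poly q"] integrable_jacobi_poly[OF ab1] by simp

lemma integral_nu_poly: "(\<integral>y. poly q y \<partial>\<nu>) = jacobi_int \<alpha> \<beta> q + (\<Sum>z\<in>A. M z * poly q z)"
 using integral_nu[OF finA _ M_nonneg, of "poly q"] integrable_jacobi_poly[OF ab1] by simp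

lemma L_reproducing:
 assumes "\<And>i. i > n ==> coeff q i = 0"
 shows "jacobi_int \<alpha> \<beta> (Lpoly n x * q) + (\<Sum>z\<in>A. M z * (L n x z * poly q z)) = poly q x"
proof -
 have "(\<integral>y. poly (Lpoly n x * q) y \<partial>\<nu>) = poly q x"
  unfolding Lpoly_def
 proof (rule orthonormal_reproducing[where J = "\<lambda>f. \<integral>y. poly f y \<partial>\<nu>"])
  show "(\<integral>y. poly (f + g) y \<partial>\<nu>) = (\<integral>y. poly f y \<partial>\<nu>) + (\<integral>y. poly g y \<partial>\<nu>)" for f g
   using integrable_nu_poly by simp
  show "(\<integral>y. poly (P m * P k) y \<partial>\<nu>) = (if m = k then 1 else 0)" for m k
   using orthP by (simp add: orthonormal_polys_def)
 qed (use degree_P assms in auto)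
 moreover have "(\<Sum>z\<in>A. M z * poly (Lpoly n x * q) z) = (\<Sum>z\<in>A. M z * (L n x z * poly q z))" by (simp add: poly_Lpoly)
 ultimately show ?thesis unfolding integral_nu_poly by (simp only:)
qed

lemma K_reproducing:
 assumes "\<And>i. i > n ==> coeff q i = 0"
 shows "jacobi_int \<alpha> \<beta> (Kpoly n x * q) = poly q x"
 unfolding Kpoly_def by (rule orthonormal_reproducing[OF J_add J_smult degree_p orth]) (use assms in auto)

text \<open>Both kernels have degree at most n in each variable. Integrated against
  \<open>\<nu>\<close>, the product of L(x, .) and K(., z) is K(x, z) because L reproduces; against
  the Jacobi measure it is L(x, z) because K reproduces. The two integrals differ by the
  masses.\<close>

lemma mass_system: "ker n x z = L n x z + (\<Sum>i\<in>A. M i * L n x i * ker n i z)"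
proof -
 have "jacobi_int \<alpha> \<beta> (Lpoly n x * Kpoly n z) + (\<Sum>i\<in>A. M i * (L n x i * poly (Kpoly n z) i)) = poly (Kpoly n z) x"
  by (rule L_reproducing[OF coeff_Kpoly])
 moreover have "jacobi_int \<alpha> \<beta> (Kpoly n z * Lpoly n x) = poly (Lpoly n x) z"
  by (rule K_reproducing[OF coeff_Lpoly])
 ultimately show ?thesis
  by (simp only: poly_Kpoly poly_Lpoly mult.commute[of "Kpoly n z"] ker_sym[of n z] mult.assoc)
qed

text \<open>The reproducing property for L(x, .) itself gives M z L(x, z)^2 <= L(x, x). Taking z = x
  bounds the diagonal by 1 / M x, and then every entry is bounded.\<close>

lemma L_mass_bound: "\<exists>D\<ge>0. \<forall>n. \<forall>x\<in>A. \<forall>z\<in>A. \<bar>L n x z\<bar> <= D"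
proof -
 define D where "D = 1 + (\<Sum>t\<in>A \<times> A. 1 / (M (fst t) * M (snd t)))"
 have t0: "0 <= 1 / (M (fst t) * M (snd t))" if "t \<in> A \<times> A" for t using that Mpos by (auto intro!: less_imp_le)
 have sq: "M z * (L n x z)^2 <= L n x x" if "z \<in> A" for n x z
 proof -
  have "jacobi_int \<alpha> \<beta> (Lpoly n x * Lpoly n x) + (\<Sum>i\<in>A. M i * (L n x i * L n x i)) = L n x x"
   using L_reproducing[of n "Lpoly n x" x, OF coeff_Lpoly] by (simp only: poly_Lpoly)
  moreover have "0 <= jacobi_int \<alpha> \<beta> (Lpoly n x * Lpoly n x)" by (intro Bochner_Integration.integral_nonneg) simp
  moreover have "M z * (L n x z * L n x z) <= (\<Sum>i\<in>A. M i * (L n x i * L n x i))"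
   by (rule member_le_sum[of z A "\<lambda>i. M i * (L n x i * L n x i)"]) (use finA that M_nonneg in auto)
  ultimately show ?thesis unfolding power2_eq_square by linarith
 qed
 have "\<bar>L n x z\<bar> <= D" if xz: "x \<in> A" "z \<in> A" for n x z
 proof -
  have Mp: "M x > 0" "M z > 0" using Mpos xz by auto
  have l0: "0 <= L n x x" unfolding kernel_L_def by (intro sum_nonneg) auto
  have "L n x x <= 1 / M x"
  proof (cases "L n x x = 0")
   case False
   have "(M x * L n x x) * L n x x <= 1 * L n x x" using sq[OF xz(1), of n x] by (simp add: power2_eq_square)
   then have "M x * L n x x <= 1" using False l0 by (subst (asm) mult_le_cancel_right) auto
   then show ?thesis using Mp by (simp add: field_simps)
  qed (use Mp in simp)
  then have "M z * (L n x z)^2 <= 1 / M x" using sq[OF xz(2), of n x] by linarith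
  then have "(L n x z)^2 <= 1 / (M x * M z)" using Mp by (simp add: field_simps)
  moreover have "1 / (M (fst (x, z)) * M (snd (x, z))) <= (\<Sum>t\<in>A \<times> A. 1 / (M (fst t) * M (snd t)))"
   by (rule member_le_sum) (use xz finA t0 in auto)
  moreover have "\<bar>L n x z\<bar> <= 1 + (L n x z)^2"
  proof -
   have "0 <= (\<bar>L n x z\<bar> - 1)^2" by simp
   then have "2 * \<bar>L n x z\<bar> <= 1 + (L n x z)^2" by (simp add: power2_eq_square algebra_simps)
   then show ?thesis using abs_ge_zero[of "L n x z"] by linarith
  qed
  ultimately show ?thesis by (simp add: D_def)
 qed
 moreover have "D >= 0" unfolding D_def using t0 by (intro add_nonneg_nonneg sum_nonneg) auto
 ultimately show ?thesis by blast
qed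

lemma mexp_sum: "z \<in> {-1..1} ==> mexp c d \<theta> z + mexp (- c) (- d) (1 - \<theta>) z = 2 * bexp z + 1"
 by (simp add: mexp_def bexp_def)

lemma mexp_ge_bexp:
 assumes "c <= 1/4" "d <= 1/4" "\<theta> < 1"
 shows "bexp z <= mexp c d \<theta> z"
 using assms by (simp add: mexp_def bexp_def)

lemma bexp_nonneg: "0 <= bexp z"
 using ab by (simp add: bexp_def)

text \<open>An instance of \<open>mass_system_bound\<close>. The decay exponent is the growth
  exponent for the parameters (-c, -d, 1 - \<theta>), because by \<open>mexp_sum\<close> the two add
  up exactly to the exponent of the diagonal entries; \<open>gap\<close> is the off-diagonal
  gain.\<close>

lemma L_gwt_bound:
 assumes c: "-1/4 <= c" "c <= 1/4" and d: "-1/4 <= d" "d <= 1/4" and \<theta>: "0 < \<theta>" "\<theta> < 1" and \<delta>: "\<delta> > 0"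
  and gap: "\<And>z z'. z \<in> A ==> z' \<in> A ==> bexp z + bexp z' <= mexp c d \<theta> z' + mexp (- c) (- d) (1 - \<theta>) z - \<delta>"
 shows "\<exists>D\<ge>0. \<forall>n. \<forall>x\<in>Ioo - A. \<forall>z\<in>A. \<bar>L n x z\<bar> * real (Suc n) powr mexp (- c) (- d) (1 - \<theta>) z <= D * gm c d \<theta> A x"
proof -
 obtain C1 where C1: "C1 >= 0" "\<And>n x z. x \<in> Ioo - A ==> z \<in> A ==> \<bar>ker n x z\<bar> <= C1 * real (Suc n) powr mexp c d \<theta> z * gm c d \<theta> A x"
  using ker_mass_bound[OF ab finA Asub c d \<theta>] by blast
 obtain C2 where C2: "C2 >= 0" "\<And>n z z'. z \<in> A ==> z' \<in> A ==> z ~= z' ==> \<bar>ker n z z'\<bar> <= C2 * real (Suc n) powr (bexp z + bexp z')"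
  using ker_off_diagonal_uniform[OF ab finA Asub] by blast
 obtain e where e: "e > 0" "\<And>n z. z \<in> A ==> e * real (Suc n) powr (2 * bexp z + 1) <= ker n z z"
  using ker_diag_lower_uniform[OF ab refl finA Asub] by blast
 define g where "g = 2 powr (- c - (\<alpha> + 1) / 2) * 2 powr (- d - (\<beta> + 1) / 2)"
 have g: "g > 0" by (simp add: g_def)
 have G: "g <= gm c d \<theta> A x" if x: "x \<in> Ioo - A" for x
 proof -
  have "g * 1 <= gm c d \<theta> A x"
   using gwt_lower[OF ab c(1) d(1), of x] mass_dist_powr_ge_1[OF finA, of x \<theta>] x \<theta> gwt_nonneg unfolding g_def[symmetric]
   by (intro mult_mono) auto
  then show ?thesis by simp
 qed
 show ?thesis
 proof (rule mass_system_bound[where K = ker and M = M and c = e and C = "C1 + C2" and \<delta> = \<delta> and ex = "mexp c d \<theta>"])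
  show "0 <= gm c d \<theta> A x" for x using gwt_nonneg by simp
  show "e * real (Suc n) powr (mexp c d \<theta> z + mexp (- c) (- d) (1 - \<theta>) z) <= ker n z z" if "z \<in> A" for n z
   using e(2)[OF that, of n] mexp_sum[of z c d \<theta>] that Asub by auto
  show "\<bar>ker n z z'\<bar> <= (C1 + C2) * real (Suc n) powr (mexp c d \<theta> z' + mexp (- c) (- d) (1 - \<theta>) z - \<delta>)"
   if "z \<in> A" "z' \<in> A" "z ~= z'" for n z z'
  proof -
   have "C2 * real (Suc n) powr (bexp z + bexp z') <= (C1 + C2) * real (Suc n) powr (mexp c d \<theta> z' + mexp (- c) (- d) (1 - \<theta>) z - \<delta>)"
    using gap[OF that(1,2)] C1(1) C2(1) by (intro mult_mono powr_mono) auto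
   then show ?thesis using C2(2)[OF that, of n] by linarith
  qed
  show "\<bar>ker n x z\<bar> <= (C1 + C2) * real (Suc n) powr mexp c d \<theta> z * gm c d \<theta> A x"
   if "x \<in> Ioo - A" "z \<in> A" for n x z
  proof -
   have "C1 * real (Suc n) powr mexp c d \<theta> z * gm c d \<theta> A x <= (C1 + C2) * real (Suc n) powr mexp c d \<theta> z * gm c d \<theta> A x"
    using C2(1) gwt_nonneg by (intro mult_right_mono) auto
   then show ?thesis using C1(2)[OF that, of n] by linarith
  qed
  \<comment> \<open>For fixed n the kernel is a polynomial, bounded on [-1, 1], and the majorant is
    at least \<open>g\<close> > 0.\<close>
  show "\<exists>B\<ge>0. \<forall>x\<in>Ioo - A. \<forall>z\<in>A. \<bar>L n x z\<bar> <= B * gm c d \<theta> A x" for n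
  proof -
   have "\<exists>C\<ge>0. \<forall>z\<in>A. \<forall>x. x \<in> {-1..1} --> \<bar>L n x z\<bar> <= C * 1"
   proof (rule finite_uniform_constant[OF finA])
    fix z
    obtain B where B: "B >= 0" "\<forall>x\<in>{-1..1}. \<bar>poly (Lpoly n z) x\<bar> <= B" using poly_bounded_Icc by blast
    then show "\<exists>C\<ge>0. \<forall>x. x \<in> {-1..1} --> \<bar>L n x z\<bar> <= C * 1"
     by (intro exI[of _ B]) (auto simp: poly_Lpoly L_sym[of n _ z])
   qed simp
   then obtain B where B: "B >= 0" "\<And>x z. z \<in> A ==> x \<in> {-1..1} ==> \<bar>L n x z\<bar> <= B" by auto
   have "\<bar>L n x z\<bar> <= B / g * gm c d \<theta> A x" if "x \<in> Ioo - A" "z \<in> A" for x z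
   proof -
    have "\<bar>L n x z\<bar> <= B / g * g" using B(2)[OF that(2), of x] that(1) g by auto
    also have "... <= B / g * gm c d \<theta> A x" using G[OF that(1)] B(1) g by (intro mult_left_mono) auto
    finally show ?thesis .
   qed
   then show ?thesis using B(1) g by (intro exI[of _ "B / g"]) auto
  qed
  show "ker n x z = L n x z + (\<Sum>i\<in>A. M i * L n x i * ker n i z)" for n x z by (rule mass_system)
 qed (use finA Mpos e C1(1) C2(1) \<delta> in auto)
qed

definition k1 :: real where "k1 = a + (\<alpha> + 1) * (1 / r - 1/2)"
definition k2 :: real where "k2 = b + (\<beta> + 1) * (1 / r - 1/2)"

lemma k_bounds: "-1/4 <= k1" "k1 < 1/4" "-1/4 <= k2" "k2 < 1/4"
 using ka kb by (auto simp: k1_def k2_def)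

definition G1 :: "real => real" where "G1 x = gwt \<alpha> \<beta> k1 k2 x * mass_dist A x powr (- (1 / r))"
definition G2 :: "real => real" where "G2 x = gwt \<alpha> \<beta> (- k1) (- k2) x * mass_dist A x powr (- (1 - 1 / r))"
text \<open>One exponent in two roles: L(x, z) gains n^(-\<open>ey z\<close>) against
  \<open>G1\<close>, and the Jacobi kernel at z loses n^(\<open>ey z\<close>) against
  \<open>G2\<close>. Products of the two are therefore bounded in n.\<close>

definition ey :: "real => real" where "ey = mexp (- k1) (- k2) (1 - 1 / r)"

lemma ey_nonneg: "0 <= ey z"
 using mexp_ge_bexp[of "- k1" "- k2" "1 - 1 / r" z] k_bounds r bexp_nonneg[of z] unfolding ey_def by auto

lemma r_inverse: "0 < 1 / r" "1 / r < 1" "0 < 1 - 1 / r" "1 - 1 / r < 1"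
 using r by auto

text \<open>The system is solved for (k1, k2, 1/r) and for the dual parameters (-k1, -k2, 1 - 1/r).
  A positive gain \<delta> exists since k1, k2 < 1/4. For the dual exponents only the inequality
  with \<open>bexp\<close>, without gain, is at hand, as equality occurs for k1 or k2 equal to -1/4;
  a gain in one of the two summands of the gap condition suffices.\<close>

lemma mass_kernel_bounds:
 "\<exists>D\<ge>0. (\<forall>n. \<forall>x\<in>Ioo - A. \<forall>z\<in>A. \<bar>L n x z\<bar> * real (Suc n) powr ey z <= D * G1 x \<and> \<bar>L n x z\<bar> <= D * G2 x
   \<and> \<bar>ker n x z\<bar> <= D * real (Suc n) powr ey z * G2 x)"
proof -
 define \<delta> where "\<delta> = min (1/2 - 2 * k1) (min (1/2 - 2 * k2) (1 - 1 / r))"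
 have \<delta>: "\<delta> > 0" "\<delta> <= 1/2 - 2 * k1" "\<delta> <= 1/2 - 2 * k2" "\<delta> <= 1 - 1 / r" using k_bounds r_inverse by (auto simp: \<delta>_def)
 have gx: "bexp z <= mexp k1 k2 (1 / r) z - \<delta>" for z using \<delta> unfolding bexp_def mexp_def by auto
 have gy: "bexp z <= mexp (- k1) (- k2) (1 - 1 / r) z" for z
  using k_bounds r_inverse by (intro mexp_ge_bexp) auto
 have kb: "-1/4 <= - k1" "- k1 <= 1/4" "-1/4 <= - k2" "- k2 <= 1/4" "k1 <= 1/4" "k2 <= 1/4" using k_bounds by auto
 have rr: "1 - (1 - 1 / r) = 1 / r" by simp
 have gap1: "bexp z + bexp z' <= mexp k1 k2 (1 / r) z' + mexp (- k1) (- k2) (1 - 1 / r) z - \<delta>" for z z'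
  using gx[of z'] gy[of z] by linarith
 have gap2: "bexp z + bexp z' <= mexp (- k1) (- k2) (1 - 1 / r) z' + mexp (- (- k1)) (- (- k2)) (1 - (1 - 1 / r)) z - \<delta>" for z z'
  using gx[of z] gy[of z'] unfolding minus_minus rr by linarith
 obtain D1 where D1: "D1 >= 0" "\<And>n x z. x \<in> Ioo - A ==> z \<in> A ==> \<bar>L n x z\<bar> * real (Suc n) powr ey z <= D1 * G1 x"
  using L_gwt_bound[OF k_bounds(1) kb(5) k_bounds(3) kb(6) r_inverse(1,2) \<delta>(1) gap1] unfolding ey_def G1_def by blast
 obtain D2 where D2: "D2 >= 0" "\<And>n x z. x \<in> Ioo - A ==> z \<in> A ==> \<bar>L n x z\<bar> * real (Suc n) powr mexp k1 k2 (1 / r) z <= D2 * G2 x"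
  using L_gwt_bound[OF kb(1-4) r_inverse(3,4) \<delta>(1) gap2] unfolding G2_def minus_minus rr by blast
 obtain D3 where D3: "D3 >= 0" "\<And>n x z. x \<in> Ioo - A ==> z \<in> A ==> \<bar>ker n x z\<bar> <= D3 * real (Suc n) powr ey z * G2 x"
  using ker_mass_bound[OF ab finA Asub kb(1-4) r_inverse(3,4)] unfolding ey_def G2_def by blast
 have G0: "G1 x >= 0" "G2 x >= 0" for x using gwt_nonneg by (auto simp: G1_def G2_def)
 have "\<bar>L n x z\<bar> * real (Suc n) powr ey z <= (D1 + D2 + D3) * G1 x \<and> \<bar>L n x z\<bar> <= (D1 + D2 + D3) * G2 x
   \<and> \<bar>ker n x z\<bar> <= (D1 + D2 + D3) * real (Suc n) powr ey z * G2 x" if "x \<in> Ioo - A" "z \<in> A" for n x z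
 proof (intro conjI)
  have "D1 * G1 x <= (D1 + D2 + D3) * G1 x" using D1 D2 D3 G0 by (intro mult_right_mono) auto
  then show "\<bar>L n x z\<bar> * real (Suc n) powr ey z <= (D1 + D2 + D3) * G1 x" using D1(2)[OF that, of n] by linarith
  have "0 <= mexp k1 k2 (1 / r) z" using gx[of z] bexp_nonneg[of z] \<delta>(1) by linarith
  then have "\<bar>L n x z\<bar> * 1 <= \<bar>L n x z\<bar> * real (Suc n) powr mexp k1 k2 (1 / r) z"
   by (intro mult_left_mono ge_one_powr_ge_zero) auto
  moreover have "D2 * G2 x <= (D1 + D2 + D3) * G2 x" using D1 D2 D3 G0 by (intro mult_right_mono) auto
  ultimately show "\<bar>L n x z\<bar> <= (D1 + D2 + D3) * G2 x" using D2(2)[OF that, of n] by linarith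
  have "D3 * real (Suc n) powr ey z * G2 x <= (D1 + D2 + D3) * real (Suc n) powr ey z * G2 x" using D1 D2 D3 G0 by (intro mult_right_mono) auto
  then show "\<bar>ker n x z\<bar> <= (D1 + D2 + D3) * real (Suc n) powr ey z * G2 x" using D3(2)[OF that, of n] by linarith
 qed
 then show ?thesis using D1(1) D2(1) D3(1) by (intro exI[of _ "D1 + D2 + D3"]) auto
qed

lemma G1_rhoA:
 assumes x: "x \<in> Ioo - A"
 shows "uw x * G1 x = rhoA \<alpha> \<beta> A x powr (- 1 / r)"
proof -
 have xi: "x \<in> Ioo" using x by simp
 have q: "(1 - x) powr a * (1 - x) powr (- k1 - (\<alpha> + 1) / 2) = (1 - x) powr (- ((\<alpha> + 1) * (1 / r)))"
  "(1 + x) powr b * (1 + x) powr (- k2 - (\<beta> + 1) / 2) = (1 + x) powr (- ((\<beta> + 1) * (1 / r)))"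
  unfolding powr_add[symmetric] k1_def k2_def kappa_eq by simp_all
 have "uw x * gwt \<alpha> \<beta> k1 k2 x = rho0 \<alpha> \<beta> x powr (- (1 / r))"
  unfolding powr_rho0[OF xi] uw_def gwt_def q[symmetric] by (simp only: mult_ac)
 then show ?thesis using x rho0_nonneg mass_dist_nonneg[OF finA]
  by (simp add: G1_def rhoA_def powr_mult mult.assoc[symmetric])
qed

lemma G2_rhoA:
 assumes x: "x \<in> Ioo - A"
 shows "G2 x / uw x = rhoA \<alpha> \<beta> A x powr (- (1 - 1 / r))"
proof -
 have xi: "x \<in> Ioo" using x by simp
 have q: "(1 - x) powr (- (- k1) - (\<alpha> + 1) / 2) = (1 - x) powr a * (1 - x) powr (- ((\<alpha> + 1) * (1 - 1 / r)))"
  "(1 + x) powr (- (- k2) - (\<beta> + 1) / 2) = (1 + x) powr b * (1 + x) powr (- ((\<beta> + 1) * (1 - 1 / r)))"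
  unfolding powr_add[symmetric] k1_def k2_def kappa_eq right_diff_distrib by (simp_all add: algebra_simps)
 have "gwt \<alpha> \<beta> (- k1) (- k2) x = uw x * rho0 \<alpha> \<beta> x powr (- (1 - 1 / r))"
  unfolding powr_rho0[OF xi] uw_def gwt_def q by (simp only: mult_ac)
 then show ?thesis using x rho0_nonneg mass_dist_nonneg[OF finA] uw_pos[OF xi]
  by (simp add: G2_def rhoA_def powr_mult)
qed

end

text \<open>For m > 0 the rearrangement at t is at most that s for which the bound on the
  distribution function equals t.\<close>

lemma weak_Lp_norm_le:
 assumes r: "r > 1" and C: "C > 0" "m >= 0"
  and bd: "\<And>s. s > 0 ==> emeasure N {x\<in>space N. \<bar>F x\<bar> > s} <= ennreal (C * (s powr (- r) * m))"
 shows "weak_Lp_norm N r F <= ereal (C powr (1 / r)) * ereal (m powr (1 / r))"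
 unfolding weak_Lp_norm_def
proof (rule SUP_least)
 fix t :: real assume "t \<in> {0<..}"
 then have t: "t > 0" by simp
 have re: "rearrangement N F t <= ereal s" if "s > 0" "C * (s powr (- r) * m) <= t" for s
 proof -
  have "emeasure N {x\<in>space N. \<bar>F x\<bar> > s} <= ennreal t" using bd[OF that(1)] that(2) by (meson ennreal_leI order_trans)
  then show ?thesis unfolding rearrangement_def using that(1) by (intro Inf_lower) auto
 qed
 show "ereal (t powr (1 / r)) * rearrangement N F t <= ereal (C powr (1 / r)) * ereal (m powr (1 / r))"
 proof (cases "m = 0")
  case True
  \<comment> \<open>For m = 0 every s > 0 is admissible in the infimum that defines the
    rearrangement.\<close>
  have "rearrangement N F t <= 0"
  proof (rule ereal_le_epsilon2)
   fix e :: real assume "0 < e"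
   then show "rearrangement N F t <= 0 + ereal e" using re[of e] True t by simp
  qed
  then have "ereal (t powr (1 / r)) * rearrangement N F t <= ereal (t powr (1 / r)) * 0" by (intro ereal_mult_left_mono) auto
  then show ?thesis using True r by (simp add: zero_ereal_def[symmetric])
 next
  case False
  then have m: "m > 0" using C by simp
  define s where "s = (C * m / t) powr (1 / r)"
  have s: "s > 0" using C m t by (simp add: s_def)
  have "s powr (- r) = t / (C * m)" unfolding s_def using C m t r by (simp add: powr_powr powr_minus_divide)
  then have "rearrangement N F t <= ereal s" using C m t s by (intro re) auto
  then have "ereal (t powr (1 / r)) * rearrangement N F t <= ereal (t powr (1 / r)) * ereal s" by (intro ereal_mult_left_mono) auto
  also have "... = ereal (C powr (1 / r) * m powr (1 / r))" using C m t by (simp add: s_def powr_divide powr_mult)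
  finally show ?thesis by simp
 qed
qed

lemma Lp_norm_indicator:
 assumes "r > 0" "E \<in> sets N"
 shows "Lp_norm N r (indicator E) = measure N E powr (1 / r)"
proof -
 have "(\<lambda>x. \<bar>indicator E x :: real\<bar> powr r) = indicator E" by (auto simp: indicator_def)
 moreover have "E \<inter> space N = E" using sets.sets_into_space[OF assms(2)] by auto
 ultimately show ?thesis unfolding Lp_norm_def by simp
qed

section \<open>The partial sum operator for the measure with masses\<close>

locale jacobi_mass_weight = jacobi_mass +
 fixes u :: "real => real"
 assumes u_eq: "\<And>x. x \<in> Ioo ==> u x = uw x" and u_pos: "x \<in> {-1..1} ==> u x > 0"
begin

abbreviation (input) "uS n E x \<equiv> u x * partial_sum_S \<nu> P n (\<lambda>y. indicator E y / u y) x"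

lemma nu_finite: "finite_measure \<nu>"
proof
 have "emeasure \<nu> UNIV = emeasure \<mu> UNIV + (\<Sum>z\<in>A. ennreal (M z) * indicator UNIV z)"
  by (rule emeasure_nu[OF finA]) simp
 also have "... ~= \<infinity>"
 proof -
  have "(\<Sum>z\<in>A. ennreal (M z) * indicator UNIV z) = ennreal (sum M A)" using M_nonneg by (simp add: sum_ennreal)
  then show ?thesis using finite_measure.emeasure_finite[OF jacobi_measure_finite[OF ab1], of UNIV] by simp
 qed
 finally show "emeasure \<nu> (space \<nu>) ~= \<infinity>" unfolding space_nu[OF finA] .
qed

text \<open>By the second part, a set containing a mass has measure bounded below; so a bounded
  contribution of that mass is a multiple of \<open>measure \<nu> E powr (1 / r)\<close>.\<close>

lemma mu_le_nu:
 assumes "E \<in> sets borel"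
 shows "measure \<mu> (E \<inter> Ioo) <= measure \<nu> E" "\<And>z. z \<in> A \<inter> E ==> M z <= measure \<nu> E"
proof -
 interpret N: finite_measure \<nu> by (rule nu_finite)
 interpret U: finite_measure \<mu> by (rule jacobi_measure_finite[OF ab1])
 note e = emeasure_nu[OF finA assms, of \<alpha> \<beta> M]
 have "emeasure \<mu> (E \<inter> Ioo) <= emeasure \<mu> E" using assms by (intro emeasure_mono) auto
 also have "... <= emeasure \<nu> E" unfolding e by simp
 finally show "measure \<mu> (E \<inter> Ioo) <= measure \<nu> E" by (simp add: U.emeasure_eq_measure N.emeasure_eq_measure)
 fix z assume z: "z \<in> A \<inter> E"
 have "ennreal (M z) * indicator E z <= (\<Sum>z\<in>A. ennreal (M z) * indicator E z)"
  using z finA by (intro member_le_sum) auto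
 also have "... <= emeasure \<nu> E" unfolding e by simp
 finally show "M z <= measure \<nu> E" using z by (simp add: N.emeasure_eq_measure)
qed

lemma rhoA_weak_and_integral:
 "\<exists>C\<ge>0. (\<forall>K s. K >= 0 \<and> s > 0 --> emeasure \<nu> {x. K * rhoA \<alpha> \<beta> A x powr (- 1 / r) > s} <= ennreal (C * (K powr r * s powr (- r)))) \<and>
   (\<forall>E\<in>sets borel. (\<integral>\<^sup>+x. ennreal (rhoA \<alpha> \<beta> A x powr (- (1 - 1 / r))) * indicator E x \<partial>\<nu>) <= ennreal (C * measure \<nu> E powr (1 / r)))"
proof -
 obtain C where C: "C >= 0" "\<And>t. t > 0 ==> emeasure \<nu> {x\<in>space \<nu>. rhoA \<alpha> \<beta> A x < t} <= ennreal (C * t)"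
  using rhoA_sublevel[OF ab1 finA, of M] M_nonneg by blast
 have m: "rhoA \<alpha> \<beta> A \<in> borel_measurable \<nu>"
  using rhoA_measurable[OF finA] by (simp add: measurable_cong_sets[OF sets_nu[OF finA] refl])
 from sublevel_weak_and_integral[OF nu_finite m rhoA_nonneg[OF finA] C r] show ?thesis
  by (simp add: space_nu[OF finA] sets_nu[OF finA])
qed

lemma poly_weighted_integrable:
 assumes E: "E \<in> sets borel" "E \<subseteq> Ioo"
 shows "integrable \<mu> (\<lambda>y. poly q y * iu E y)"
 using poly_kernel_integrable[OF E, of "\<lambda>_. 1" 1 q] by simp

text \<open>By \<open>G2_rhoA\<close>, dividing \<open>G2\<close> by the weight yields exactly the
  power of \<open>rhoA\<close> in the sublevel integral estimate; the constant does not depend on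
  the polynomial, hence not on n.\<close>

lemma poly_G2_integral:
 "\<exists>c\<ge>0. \<forall>q B E. E \<in> sets borel \<and> B >= 0 \<and> (\<forall>y\<in>Ioo - A. \<bar>poly q y\<bar> <= B * G2 y) -->
   \<bar>\<integral>y. poly q y * iu (E \<inter> Ioo) y \<partial>\<mu>\<bar> <= B * (c * measure \<nu> E powr (1 / r))"
proof -
 obtain C where C: "C >= 0" "\<And>E. E \<in> sets borel ==> (\<integral>\<^sup>+x. ennreal (rhoA \<alpha> \<beta> A x powr (- (1 - 1 / r))) * indicator E x \<partial>\<nu>) <= ennreal (C * measure \<nu> E powr (1 / r))"
  using rhoA_weak_and_integral by blast
 note [measurable] = rhoA_measurable[OF finA]
 have "\<bar>\<integral>y. poly q y * iu (E \<inter> Ioo) y \<partial>\<mu>\<bar> <= B * (C * measure \<nu> E powr (1 / r))"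
  if E [measurable]: "E \<in> sets borel" and B: "B >= 0" and q: "\<And>y. y \<in> Ioo - A ==> \<bar>poly q y\<bar> <= B * G2 y" for q B E
 proof -
  let ?h = "\<lambda>y. ennreal (rhoA \<alpha> \<beta> A y powr (- (1 - 1 / r))) * indicator E y"
  have ii: "integrable \<mu> (\<lambda>y. poly q y * iu (E \<inter> Ioo) y)" by (rule poly_weighted_integrable) auto
  have "ennreal \<bar>\<integral>y. poly q y * iu (E \<inter> Ioo) y \<partial>\<mu>\<bar> <= (\<integral>\<^sup>+y. norm (poly q y * iu (E \<inter> Ioo) y) \<partial>\<mu>)"
   using integral_norm_bound_ennreal[OF ii] by simp
  also have "... <= (\<integral>\<^sup>+y. ennreal B * ?h y \<partial>\<mu>)"
  proof (rule nn_integral_mono_AE)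
   show "AE y in \<mu>. ennreal (norm (poly q y * iu (E \<inter> Ioo) y)) <= ennreal B * ?h y"
    using AE_jacobi_measure_not_in_finite[OF finA, of \<alpha> \<beta>]
   proof eventually_elim
    case (elim y)
    show ?case
    proof (cases "y \<in> E \<inter> Ioo")
     case True
     then have y: "y \<in> Ioo - A" using elim by auto
     then have up: "uw y > 0" using uw_pos by simp
     have "norm (poly q y * iu (E \<inter> Ioo) y) = \<bar>poly q y\<bar> / uw y" using True up by simp
     also have "... <= B * G2 y / uw y" using q[OF y] up by (intro divide_right_mono) auto
     also have "... = B * rhoA \<alpha> \<beta> A y powr (- (1 - 1 / r))" unfolding G2_rhoA[OF y, symmetric] by simp
     finally have "ennreal (norm (poly q y * iu (E \<inter> Ioo) y)) <= ennreal (B * rhoA \<alpha> \<beta> A y powr (- (1 - 1 / r)))"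
      by (rule ennreal_leI)
     also have "... = ennreal B * ?h y" using True B by (simp add: ennreal_mult)
     finally show ?thesis .
    qed simp
   qed
  qed
  also have "... = ennreal B * (\<integral>\<^sup>+y. ?h y \<partial>\<mu>)" by (rule nn_integral_cmult) measurable
  also have "(\<integral>\<^sup>+y. ?h y \<partial>\<mu>) <= (\<integral>\<^sup>+y. ?h y \<partial>\<nu>)"
  proof -
   have "?h \<in> borel_measurable borel" by measurable
   from nn_integral_nu[OF finA this, of \<alpha> \<beta> M] show ?thesis by simp
  qed
  also have "... <= ennreal (C * measure \<nu> E powr (1 / r))" by (rule C(2)[OF E])
  finally have "ennreal \<bar>\<integral>y. poly q y * iu (E \<inter> Ioo) y \<partial>\<mu>\<bar> <= ennreal B * ennreal (C * measure \<nu> E powr (1 / r))"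
   by (simp add: mult_left_mono)
  also have "... = ennreal (B * (C * measure \<nu> E powr (1 / r)))" using B C(1) by (intro ennreal_mult[symmetric]) auto
  finally show ?thesis using B C(1) by (subst (asm) ennreal_le_iff) auto
 qed
 then show ?thesis using C(1) by (intro exI[of _ C]) auto
qed

lemma partial_sum_formula:
 assumes E: "E \<in> sets borel" "E \<subseteq> {-1..1}"
 shows "partial_sum_S \<nu> P n (\<lambda>y. indicator E y / u y) x =
  (\<integral>y. L n x y * iu (E \<inter> Ioo) y \<partial>\<mu>) + (\<Sum>z\<in>A. M z * (L n x z * (indicator E z / u z)))"
proof -
 let ?g = "\<lambda>y. L n x y * (indicator E y / u y)"
 let ?h = "\<lambda>y. L n x y * iu (E \<inter> Ioo) y"
 \<comment> \<open>No measurability of u is assumed. Since E lies in [-1, 1] and u is a power weight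
   inside, the integrand agrees with a measurable function except at the two endpoints.\<close>
 have geq: "?g y = (if y = 1 then ?g 1 else if y = -1 then ?g (-1) else ?h y)" for y
 proof (cases "y = 1 \<or> y = -1")
  case False
  then have "y \<in> E \<longleftrightarrow> y \<in> E \<inter> Ioo" using E(2) by force
  then have "indicator E y = (indicator (E \<inter> Ioo) y :: real)" by (simp only: indicator_def)
  moreover have "indicator E y / u y = (iu E y :: real)" if "y \<in> Ioo" using u_eq[OF that] by simp
  ultimately show ?thesis using False by (cases "y \<in> E \<inter> Ioo") auto
 qed auto
 have m0: "?h \<in> borel_measurable borel" unfolding poly_Lpoly[symmetric] using E(1) by measurable
 have m: "?g \<in> borel_measurable borel"
  by (subst geq, intro measurable_If m0) auto
 have ae: "AE y in \<mu>. ?g y = ?h y"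
  using AE_jacobi_measure_Ioo[of \<alpha> \<beta>] by eventually_elim (subst geq, auto)
 have i0: "integrable \<mu> ?h" using poly_weighted_integrable[of "E \<inter> Ioo" "Lpoly n x"] E(1) by (simp add: poly_Lpoly)
 have i: "integrable \<mu> ?g"
  using i0 ae m m0 by (subst integrable_cong_AE[of _ _ ?h]) auto
 have "partial_sum_S \<nu> P n (\<lambda>y. indicator E y / u y) x = (\<integral>y. ?g y \<partial>\<mu>) + (\<Sum>z\<in>A. M z * ?g z)"
  unfolding partial_sum_S_def by (rule integral_nu[OF finA m M_nonneg i])
 also have "(\<integral>y. ?g y \<partial>\<mu>) = (\<integral>y. ?h y \<partial>\<mu>)" using ae m m0 by (intro integral_cong_AE) auto
 finally show ?thesis .
qed

text \<open>Off the masses, L(x, .) is replaced by the Jacobi kernel minus the sum over the masses.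
  In that sum the growth n^(\<open>ey i\<close>) of the integral is compensated by the decay of L(x,
  i), which leaves a multiple of \<open>rhoA\<close> to the power -1/r. At the masses L is bounded
  and \<open>rhoA\<close> equals 1.\<close>

lemma pointwise_estimate:
 "\<exists>K\<ge>0. \<forall>n E. E \<in> sets borel \<and> E \<subseteq> {-1..1} -->
   (\<forall>x\<in>Ioo - A. \<bar>uS n E x\<bar> \<le>
    \<bar>uw x * (\<integral>y. ker n x y * iu (E \<inter> Ioo) y \<partial>\<mu>)\<bar> + K * measure \<nu> E powr (1 / r) * rhoA \<alpha> \<beta> A x powr (- 1 / r)) \<and>
   (\<forall>x\<in>A. \<bar>uS n E x\<bar> <= K * measure \<nu> E powr (1 / r) * rhoA \<alpha> \<beta> A x powr (- 1 / r))"
proof -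
 obtain D where D: "D >= 0" "\<And>n x z. x \<in> Ioo - A ==> z \<in> A ==> \<bar>L n x z\<bar> * real (Suc n) powr ey z <= D * G1 x \<and> \<bar>L n x z\<bar> <= D * G2 x
   \<and> \<bar>ker n x z\<bar> <= D * real (Suc n) powr ey z * G2 x"
  using mass_kernel_bounds by blast
 obtain c where c0: "c >= 0" and c1: "\<forall>q B E. E \<in> sets borel \<and> B >= 0 \<and> (\<forall>y\<in>Ioo - A. \<bar>poly q y\<bar> <= B * G2 y) -->
   \<bar>\<integral>y. poly q y * iu (E \<inter> Ioo) y \<partial>\<mu>\<bar> <= B * (c * measure \<nu> E powr (1 / r))"
  using poly_G2_integral by (elim exE conjE) (rule that)
 have c: "c >= 0" "E \<in> sets borel ==> B >= 0 ==> (\<And>y. y \<in> Ioo - A ==> \<bar>poly q y\<bar> <= B * G2 y) ==>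
   \<bar>\<integral>y. poly q y * iu (E \<inter> Ioo) y \<partial>\<mu>\<bar> <= B * (c * measure \<nu> E powr (1 / r))" for q B E
  using c0 c1[rule_format, of E B q] by simp_all
 obtain L0 where L0: "L0 >= 0" "\<And>n x z. x \<in> A ==> z \<in> A ==> \<bar>L n x z\<bar> <= L0"
  using L_mass_bound by blast
 \<comment> \<open>Chosen so that M z / u z is at most \<open>Q z\<close> times
   \<open>measure \<nu> E powr (1 / r)\<close> whenever E contains the mass z.\<close>
 define Q where "Q z = M z / (u z * M z powr (1 / r))" for z
 have up: "u z > 0" if "z \<in> A" for z using that Asub u_pos by blast
 have Q0: "Q z >= 0" if "z \<in> A" for z using Mpos[OF that] up[OF that] by (simp add: Q_def)
 define K1 where "K1 = (\<Sum>z\<in>A. M z * D * (D * c)) + (\<Sum>z\<in>A. D * Q z)"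
 define K2 where "K2 = (\<Sum>x\<in>A. u x * (D * c + (\<Sum>z\<in>A. L0 * Q z)))"
 have K1: "K1 >= 0" unfolding K1_def using D(1) c(1) Q0 M_nonneg by (intro add_nonneg_nonneg sum_nonneg mult_nonneg_nonneg) auto
 have inner: "0 <= D * c + (\<Sum>z\<in>A. L0 * Q z)" using D(1) c(1) Q0 L0(1) by (intro add_nonneg_nonneg sum_nonneg mult_nonneg_nonneg) auto
 have K2: "K2 >= 0" unfolding K2_def using inner up by (intro sum_nonneg mult_nonneg_nonneg) (auto intro: less_imp_le)
 have main: "(\<forall>x\<in>Ioo - A. \<bar>uS n E x\<bar> \<le>
    \<bar>uw x * (\<integral>y. ker n x y * iu (E \<inter> Ioo) y \<partial>\<mu>)\<bar> + (K1 + K2) * measure \<nu> E powr (1 / r) * rhoA \<alpha> \<beta> A x powr (- 1 / r)) \<and>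
   (\<forall>x\<in>A. \<bar>uS n E x\<bar> <= (K1 + K2) * measure \<nu> E powr (1 / r) * rhoA \<alpha> \<beta> A x powr (- 1 / r))"
  if E: "E \<in> sets borel" "E \<subseteq> {-1..1}" for n E
 proof -
  define m where "m = measure \<nu> E powr (1 / r)"
  have m0: "m >= 0" by (simp add: m_def)
  define I where "I k = (\<integral>y. k y * iu (E \<inter> Ioo) y \<partial>\<mu>)" for k
  have mass: "M z * (indicator E z / u z) <= Q z * m" if z: "z \<in> A" for z
  proof (cases "z \<in> E")
   case True
   have "M z powr (1 / r) <= m" unfolding m_def using mu_le_nu(2)[OF E(1), of z] True z M_nonneg r by (intro powr_mono2) auto
   then have "M z / u z * 1 <= M z / u z * (m / M z powr (1 / r))" using Mpos[OF z] up[OF z] by (intro mult_left_mono) auto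
   then show ?thesis using True by (simp add: Q_def)
  qed (use Q0[OF z] m0 in simp)
  have mass0: "0 <= M z * (indicator E z / u z)" if z: "z \<in> A" for z using Mpos[OF z] up[OF z] by (simp add: indicator_def)
  have N1: "1 <= real (Suc n) powr ey z" for z using ey_nonneg by (intro ge_one_powr_ge_zero) auto
  have IK: "\<bar>I (ker n z)\<bar> <= D * real (Suc n) powr ey z * (c * m)" if z: "z \<in> A" for z
  proof -
   have "\<bar>\<integral>y. poly (Kpoly n z) y * iu (E \<inter> Ioo) y \<partial>\<mu>\<bar> <= D * real (Suc n) powr ey z * (c * measure \<nu> E powr (1 / r))"
    by (rule c(2)[OF E(1)]) (use D z ker_sym in \<open>auto simp: poly_Kpoly ker_sym[of n z]\<close>)
   then show ?thesis by (simp add: I_def m_def poly_Kpoly)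
  qed
  have IL: "\<bar>I (L n x)\<bar> <= D * (c * m)" if x: "x \<in> A" for x
  proof -
   have "\<bar>\<integral>y. poly (Lpoly n x) y * iu (E \<inter> Ioo) y \<partial>\<mu>\<bar> <= D * (c * measure \<nu> E powr (1 / r))"
    by (rule c(2)[OF E(1)]) (use D x in \<open>auto simp: poly_Lpoly L_sym[of n x]\<close>)
   then show ?thesis by (simp add: I_def m_def poly_Lpoly)
  qed
  have 1: "\<bar>uS n E x\<bar> <= \<bar>uw x * I (ker n x)\<bar> + (K1 + K2) * m * rhoA \<alpha> \<beta> A x powr (- 1 / r)"
   if x: "x \<in> Ioo - A" for x
  proof -
   define \<rho> where "\<rho> = rhoA \<alpha> \<beta> A x powr (- 1 / r)"
   have \<rho>0: "\<rho> >= 0" by (simp add: \<rho>_def)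
   have ux: "uw x > 0" "u x = uw x" using x uw_pos u_eq by auto
   have Lb: "uw x * \<bar>L n x z\<bar> * real (Suc n) powr ey z <= D * \<rho>" if z: "z \<in> A" for z
   proof -
    have "uw x * (\<bar>L n x z\<bar> * real (Suc n) powr ey z) <= uw x * (D * G1 x)" using D(2)[OF x z, of n] ux by (intro mult_left_mono) auto
    also have "... = D * \<rho>" unfolding \<rho>_def G1_rhoA[OF x, symmetric] by simp
    finally show ?thesis by (simp only: mult.assoc)
   qed
   have dec: "I (L n x) = I (ker n x) - (\<Sum>i\<in>A. M i * L n x i * I (ker n i))"
   proof -
    have ik: "integrable \<mu> (\<lambda>y. ker n i y * iu (E \<inter> Ioo) y)" for i
     using E(1) by (intro ker_mult_integrable) auto
    have pt: "L n x y * iu (E \<inter> Ioo) y = ker n x y * iu (E \<inter> Ioo) y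
      - (\<Sum>i\<in>A. M i * L n x i * (ker n i y * iu (E \<inter> Ioo) y))" for y
    proof -
     have "L n x y = ker n x y - (\<Sum>i\<in>A. M i * L n x i * ker n i y)" using mass_system[of n x y] by simp
     then show ?thesis by (simp only: left_diff_distrib sum_distrib_right mult.assoc)
    qed
    have gen: "(\<integral>y. f y - (\<Sum>i\<in>A. k i * g i y) \<partial>\<mu>) = (\<integral>y. f y \<partial>\<mu>) - (\<Sum>i\<in>A. k i * (\<integral>y. g i y \<partial>\<mu>))"
     if "integrable \<mu> f" "\<And>i. integrable \<mu> (g i)" for f g and k :: "real => real"
     using that by simp
    show ?thesis unfolding I_def pt by (rule gen[OF ik ik])
   qed
   have 2: "\<bar>uw x * (\<Sum>i\<in>A. M i * L n x i * I (ker n i))\<bar> <= (\<Sum>z\<in>A. M z * D * (D * c)) * m * \<rho>"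
   proof -
    have "\<bar>uw x * (\<Sum>i\<in>A. M i * L n x i * I (ker n i))\<bar> = \<bar>\<Sum>i\<in>A. uw x * (M i * L n x i * I (ker n i))\<bar>" by (simp only: sum_distrib_left)
    also have "... <= (\<Sum>i\<in>A. \<bar>uw x * (M i * L n x i * I (ker n i))\<bar>)" by (rule sum_abs)
    also have "... <= (\<Sum>i\<in>A. M i * D * (D * c) * m * \<rho>)"
    proof (rule sum_mono)
     fix i assume i: "i \<in> A"
     have "\<bar>uw x * (M i * L n x i * I (ker n i))\<bar> = M i * (uw x * \<bar>L n x i\<bar>) * \<bar>I (ker n i)\<bar>" using ux Mpos[OF i] by (simp add: abs_mult)
     also have "... <= M i * (uw x * \<bar>L n x i\<bar>) * (D * real (Suc n) powr ey i * (c * m))"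
      using IK[OF i] ux Mpos[OF i] by (intro mult_left_mono) auto
     also have "... = M i * (uw x * \<bar>L n x i\<bar> * real (Suc n) powr ey i) * (D * c * m)" by (simp only: mult_ac)
     also have "... <= M i * (D * \<rho>) * (D * c * m)" using Lb[OF i] Mpos[OF i] D(1) c(1) m0 by (intro mult_right_mono mult_left_mono) auto
     finally show "\<bar>uw x * (M i * L n x i * I (ker n i))\<bar> <= M i * D * (D * c) * m * \<rho>" by (simp only: mult_ac)
    qed
    finally show ?thesis by (simp only: sum_distrib_right)
   qed
   have 3: "\<bar>uw x * (\<Sum>z\<in>A. M z * (L n x z * (indicator E z / u z)))\<bar> <= (\<Sum>z\<in>A. D * Q z) * m * \<rho>"
   proof -
    have "\<bar>uw x * (\<Sum>z\<in>A. M z * (L n x z * (indicator E z / u z)))\<bar> = \<bar>\<Sum>z\<in>A. uw x * (M z * (L n x z * (indicator E z / u z)))\<bar>" by (simp only: sum_distrib_left)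
    also have "... <= (\<Sum>z\<in>A. \<bar>uw x * (M z * (L n x z * (indicator E z / u z)))\<bar>)" by (rule sum_abs)
    also have "... <= (\<Sum>z\<in>A. D * Q z * m * \<rho>)"
    proof (rule sum_mono)
     fix z assume z: "z \<in> A"
     have "\<bar>uw x * (M z * (L n x z * (indicator E z / u z)))\<bar> = \<bar>(uw x * L n x z) * (M z * (indicator E z / u z))\<bar>" by (simp only: mult_ac)
     also have "... = (uw x * \<bar>L n x z\<bar> * 1) * (M z * (indicator E z / u z))"
      using Mpos[OF z] up[OF z] ux by (simp add: abs_mult)
     also have "... <= (uw x * \<bar>L n x z\<bar> * real (Suc n) powr ey z) * (M z * (indicator E z / u z))"
      using N1[of z] ux mass0[OF z] by (intro mult_right_mono mult_left_mono) auto
     also have "... <= (D * \<rho>) * (Q z * m)" using Lb[OF z] mass[OF z] mass0[OF z] D(1) \<rho>0 by (intro mult_mono[OF Lb[OF z] mass[OF z]]) auto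
     finally show "\<bar>uw x * (M z * (L n x z * (indicator E z / u z)))\<bar> <= D * Q z * m * \<rho>" by (simp only: mult_ac)
    qed
    finally show ?thesis by (simp only: sum_distrib_right)
   qed
   have "uS n E x = uw x * I (ker n x) - uw x * (\<Sum>i\<in>A. M i * L n x i * I (ker n i))
     + uw x * (\<Sum>z\<in>A. M z * (L n x z * (indicator E z / u z)))"
    unfolding partial_sum_formula[OF E] I_def[symmetric] dec ux(2) by (simp only: distrib_left right_diff_distrib)
   moreover have "(\<Sum>z\<in>A. M z * D * (D * c)) * m * \<rho> + (\<Sum>z\<in>A. D * Q z) * m * \<rho> = K1 * m * \<rho>" by (simp only: K1_def distrib_right)
   moreover have "K1 * m * \<rho> <= (K1 + K2) * m * \<rho>" using K2 m0 \<rho>0 by (intro mult_right_mono) auto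
   ultimately show ?thesis using 2 3 unfolding \<rho>_def[symmetric] by linarith
  qed
  have 2: "\<bar>uS n E x\<bar> <= (K1 + K2) * m * rhoA \<alpha> \<beta> A x powr (- 1 / r)" if x: "x \<in> A" for x
  proof -
   have "\<bar>\<Sum>z\<in>A. M z * (L n x z * (indicator E z / u z))\<bar> <= (\<Sum>z\<in>A. \<bar>M z * (L n x z * (indicator E z / u z))\<bar>)" by (rule sum_abs)
   also have "... <= (\<Sum>z\<in>A. L0 * Q z * m)"
   proof (rule sum_mono)
    fix z assume z: "z \<in> A"
    have "\<bar>M z * (L n x z * (indicator E z / u z))\<bar> = \<bar>L n x z\<bar> * (M z * (indicator E z / u z))"
     using Mpos[OF z] up[OF z] by (simp add: abs_mult)
    also have "... <= L0 * (Q z * m)" by (rule mult_mono[OF L0(2)[OF x z] mass[OF z] L0(1) mass0[OF z]])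
    finally show "\<bar>M z * (L n x z * (indicator E z / u z))\<bar> <= L0 * Q z * m" by (simp only: mult.assoc)
   qed
   finally have 3: "\<bar>\<Sum>z\<in>A. M z * (L n x z * (indicator E z / u z))\<bar> <= (\<Sum>z\<in>A. L0 * Q z) * m" by (simp only: sum_distrib_right)
   have "\<bar>uS n E x\<bar> = u x * \<bar>I (L n x) + (\<Sum>z\<in>A. M z * (L n x z * (indicator E z / u z)))\<bar>"
    unfolding partial_sum_formula[OF E] I_def[symmetric] abs_mult using up[OF x] by simp
   also have "... <= u x * (D * (c * m) + (\<Sum>z\<in>A. L0 * Q z) * m)" using IL[OF x] 3 up[OF x] by (intro mult_left_mono) linarith+
   also have "... = (u x * (D * c + (\<Sum>z\<in>A. L0 * Q z))) * m" by (simp add: algebra_simps)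
   also have "... <= K2 * m"
   proof (rule mult_right_mono[OF _ m0])
    show "u x * (D * c + (\<Sum>z\<in>A. L0 * Q z)) <= K2" unfolding K2_def
     using x finA up inner by (intro member_le_sum[of x A "\<lambda>x. u x * (D * c + (\<Sum>z\<in>A. L0 * Q z))"]) (auto intro!: mult_nonneg_nonneg[OF less_imp_le[OF up] inner])
   qed
   also have "... <= (K1 + K2) * m" using K1 m0 by (intro mult_right_mono) auto
   finally show ?thesis using x by (simp add: rhoA_def)
  qed
  show ?thesis using 1 2 unfolding I_def m_def by blast
 qed
 have "\<forall>n E. E \<in> sets borel \<and> E \<subseteq> {-1..1} -->
   (\<forall>x\<in>Ioo - A. \<bar>uS n E x\<bar> \<le>
    \<bar>uw x * (\<integral>y. ker n x y * iu (E \<inter> Ioo) y \<partial>\<mu>)\<bar> + (K1 + K2) * measure \<nu> E powr (1 / r) * rhoA \<alpha> \<beta> A x powr (- 1 / r)) \<and>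
   (\<forall>x\<in>A. \<bar>uS n E x\<bar> <= (K1 + K2) * measure \<nu> E powr (1 / r) * rhoA \<alpha> \<beta> A x powr (- 1 / r))"
  by (intro allI impI, elim conjE, rule main)
 then show ?thesis using K1 K2 by (intro exI[of _ "K1 + K2"] conjI) auto
qed

text \<open>Each summand of the pointwise estimate receives s / 2. Removing A from Y makes the two
  measures of Y agree, and Z, the points neither inside the interval nor masses, is a null
  set.\<close>

lemma weak_estimate:
 "\<exists>C>0. \<forall>n E s. E \<in> sets borel \<and> E \<subseteq> {-1..1} \<and> s > 0 -->
   emeasure \<nu> {x\<in>space \<nu>. \<bar>uS n E x\<bar> > s} <= ennreal (C * (s powr (- r) * measure \<nu> E))"
proof -
 obtain K where K: "K >= 0" and pe: "\<forall>n E. E \<in> sets borel \<and> E \<subseteq> {-1..1} -->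
   (\<forall>x\<in>Ioo - A. \<bar>uS n E x\<bar> \<le>
    \<bar>uw x * (\<integral>y. ker n x y * iu (E \<inter> Ioo) y \<partial>\<mu>)\<bar> + K * measure \<nu> E powr (1 / r) * rhoA \<alpha> \<beta> A x powr (- 1 / r)) \<and>
   (\<forall>x\<in>A. \<bar>uS n E x\<bar> <= K * measure \<nu> E powr (1 / r) * rhoA \<alpha> \<beta> A x powr (- 1 / r))"
  using pointwise_estimate by (elim exE conjE) (rule that)
 obtain C1 where C1: "C1 >= 0" and mw: "\<forall>n E s. E \<in> sets borel \<and> E \<subseteq> Ioo \<and> s > 0 -->
   (\<exists>Y\<in>sets borel. {x\<in>Ioo. \<bar>uw x * (\<integral>y. ker n x y * iu E y \<partial>\<mu>)\<bar> > s} \<subseteq> Y \<and> Y \<subseteq> Ioo \<and>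
    emeasure \<mu> Y <= ennreal (C1 * (s powr (- r) * measure \<mu> E)))"
  using main_weak by (elim exE conjE) (rule that)
 obtain C2 where C2: "C2 >= 0" "\<And>K s. K >= 0 ==> s > 0 ==> emeasure \<nu> {x. K * rhoA \<alpha> \<beta> A x powr (- 1 / r) > s} <= ennreal (C2 * (K powr r * s powr (- r)))"
  using rhoA_weak_and_integral by blast
 define C where "C = (C1 + C2 * K powr r) * 2 powr r + 1"
 have C: "C > 0" unfolding C_def using C1 C2(1) by (intro add_nonneg_pos mult_nonneg_nonneg add_nonneg_nonneg) auto
 have "emeasure \<nu> {x\<in>space \<nu>. \<bar>uS n E x\<bar> > s} <= ennreal (C * (s powr (- r) * measure \<nu> E))"
  if E: "E \<in> sets borel" "E \<subseteq> {-1..1}" and s: "s > 0" for n E s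
 proof -
  define m where "m = measure \<nu> E"
  have m0: "m >= 0" by (simp add: m_def)
  have E0: "E \<inter> Ioo \<in> sets borel" "E \<inter> Ioo \<subseteq> Ioo" using E by auto
  obtain Y where Y: "Y \<in> sets borel" and YI: "Y \<subseteq> Ioo"
   "{x\<in>Ioo. \<bar>uw x * (\<integral>y. ker n x y * iu (E \<inter> Ioo) y \<partial>\<mu>)\<bar> > s / 2} \<subseteq> Y"
   and Yb: "emeasure \<mu> Y <= ennreal (C1 * ((s / 2) powr (- r) * measure \<mu> (E \<inter> Ioo)))"
   using mw[rule_format, of "E \<inter> Ioo" "s / 2" n] E0 s by auto
  define R where "R = {x. K * m powr (1 / r) * rhoA \<alpha> \<beta> A x powr (- 1 / r) > s / 2}"
  define Z where "Z = - (Ioo \<union> A)"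
  have Am: "A \<in> sets borel" using finA by (intro borel_closed finite_imp_closed)
  have Rm: "R \<in> sets borel" unfolding R_def using rhoA_measurable[OF finA] by measurable
  have Zm: "Z \<in> sets borel" unfolding Z_def using Am by (intro borel_comp sets.Un) auto
  have sub: "{x\<in>space \<nu>. \<bar>uS n E x\<bar> > s} \<subseteq> (Y - A) \<union> R \<union> Z"
  proof
   fix x assume "x \<in> {x\<in>space \<nu>. \<bar>uS n E x\<bar> > s}"
   then have big: "\<bar>uS n E x\<bar> > s" by simp
   note pe' = pe[rule_format, OF conjI[OF E], of n, folded m_def]
   show "x \<in> (Y - A) \<union> R \<union> Z"
   proof (rule ccontr)
    assume no: "x \<notin> (Y - A) \<union> R \<union> Z"
    then have xr: "K * m powr (1 / r) * rhoA \<alpha> \<beta> A x powr (- 1 / r) <= s / 2" by (auto simp: R_def)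
    show False
    proof (cases "x \<in> A")
     case True
     then show False using conjunct2[OF pe'] xr big s by force
    next
     case False
     then have xi: "x \<in> Ioo - A" using no by (auto simp: Z_def)
     then have "x \<notin> Y" using no by auto
     then have "\<bar>uw x * (\<integral>y. ker n x y * iu (E \<inter> Ioo) y \<partial>\<mu>)\<bar> <= s / 2" using YI(2) xi by force
     then show False using bspec[OF conjunct1[OF pe'] xi] xr big by linarith
    qed
   qed
  qed
  have "emeasure \<nu> (Y - A) = emeasure \<mu> (Y - A)"
   using Y Am by (subst emeasure_nu[OF finA]) (auto intro!: sum.neutral)
  also have "... <= emeasure \<mu> Y" using Y by (intro emeasure_mono) auto
  also have "... <= ennreal (C1 * ((s / 2) powr (- r) * m))"
   using Yb mu_le_nu(1)[OF E(1)] C1 unfolding m_def by (meson ennreal_leI mult_left_mono order_trans powr_ge_zero)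
  finally have b1: "emeasure \<nu> (Y - A) <= ennreal (C1 * ((s / 2) powr (- r) * m))" .
  have b2: "emeasure \<nu> R <= ennreal (C2 * ((K * m powr (1 / r)) powr r * (s / 2) powr (- r)))"
   unfolding R_def using K s by (intro C2(2)) auto
  have b3: "emeasure \<nu> Z = 0"
  proof -
   have "emeasure \<mu> Z = emeasure \<mu> (Z \<inter> Ioo)" by (rule emeasure_jacobi_Ioo[OF Zm])
   also have "Z \<inter> Ioo = {}" by (auto simp: Z_def)
   finally have "emeasure \<mu> Z = 0" by simp
   then show ?thesis by (subst emeasure_nu[OF finA Zm]) (auto simp: Z_def intro!: sum.neutral)
  qed
  have "emeasure \<nu> {x\<in>space \<nu>. \<bar>uS n E x\<bar> > s} <= emeasure \<nu> ((Y - A) \<union> R \<union> Z)"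
   using sub Y Am Rm Zm by (intro emeasure_mono) (auto simp: sets_nu[OF finA])
  also have "... <= emeasure \<nu> ((Y - A) \<union> R) + emeasure \<nu> Z"
   using Y Am Rm Zm by (intro emeasure_subadditive) (auto simp: sets_nu[OF finA])
  also have "emeasure \<nu> ((Y - A) \<union> R) <= emeasure \<nu> (Y - A) + emeasure \<nu> R"
   using Y Am Rm Zm by (intro emeasure_subadditive) (auto simp: sets_nu[OF finA])
  finally have "emeasure \<nu> {x\<in>space \<nu>. \<bar>uS n E x\<bar> > s}
    <= ennreal (C1 * ((s / 2) powr (- r) * m)) + ennreal (C2 * ((K * m powr (1 / r)) powr r * (s / 2) powr (- r)))"
   using add_mono[OF b1 b2] unfolding b3 by (auto intro: order_trans)
  also have "... = ennreal (C1 * ((s / 2) powr (- r) * m) + C2 * ((K * m powr (1 / r)) powr r * (s / 2) powr (- r)))"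
   using C1 C2(1) m0 by (intro ennreal_plus[symmetric]) auto
  also have "... <= ennreal (C * (s powr (- r) * m))"
  proof (rule ennreal_leI)
   have 1: "(s / 2) powr (- r) = s powr (- r) * 2 powr r" using s by (simp add: powr_divide powr_minus field_simps)
   have 2: "(K * m powr (1 / r)) powr r = K powr r * m" using K m0 r by (simp add: powr_mult powr_powr)
   have "C1 * ((s / 2) powr (- r) * m) + C2 * ((K * m powr (1 / r)) powr r * (s / 2) powr (- r)) = ((C1 + C2 * K powr r) * 2 powr r) * (s powr (- r) * m)"
    unfolding 1 2 by (simp add: algebra_simps)
   also have "... <= C * (s powr (- r) * m)" using m0 by (intro mult_right_mono) (auto simp: C_def)
   finally show "C1 * ((s / 2) powr (- r) * m) + C2 * ((K * m powr (1 / r)) powr r * (s / 2) powr (- r)) <= C * (s powr (- r) * m)" .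
  qed
  finally show ?thesis unfolding m_def .
 qed
 then show ?thesis using C by (intro exI[of _ C]) auto
qed

lemma restricted_weak_type:
 "\<exists>C>0. \<forall>n E. E \<in> sets borel \<and> E \<subseteq> {-1..1} -->
   weak_Lp_norm \<nu> r (\<lambda>x. uS n E x) <= ereal C * ereal (Lp_norm \<nu> r (indicator E))"
proof -
 obtain C where C: "C > 0" and C': "\<forall>n E s. E \<in> sets borel \<and> E \<subseteq> {-1..1} \<and> s > 0 -->
   emeasure \<nu> {x\<in>space \<nu>. \<bar>uS n E x\<bar> > s} <= ennreal (C * (s powr (- r) * measure \<nu> E))"
  using weak_estimate by (elim exE conjE) (rule that)
 have "weak_Lp_norm \<nu> r (\<lambda>x. uS n E x) <= ereal (C powr (1 / r)) * ereal (Lp_norm \<nu> r (indicator E))"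
  if E: "E \<in> sets borel" "E \<subseteq> {-1..1}" for n E
 proof -
  have "Lp_norm \<nu> r (indicator E) = measure \<nu> E powr (1 / r)"
   using r E(1) by (intro Lp_norm_indicator) (auto simp: sets_nu[OF finA])
  moreover have "weak_Lp_norm \<nu> r (\<lambda>x. uS n E x) <= ereal (C powr (1 / r)) * ereal (measure \<nu> E powr (1 / r))"
   by (rule weak_Lp_norm_le[OF r C measure_nonneg C'[rule_format]]) (simp add: E)
  ultimately show ?thesis by (simp only:)
 qed
 then show ?thesis using C by (intro exI[of _ "C powr (1 / r)"]) auto
qed

end

theorem theorem16:
  fixes \<alpha> \<beta> a b p :: real and A :: "real set" and M :: "real \<Rightarrow> real"
    and P :: "nat \<Rightarrow> real poly" and u :: "real \<Rightarrow> real"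
  assumes "\<alpha> \<ge> -1/2" and "\<beta> \<ge> -1/2" and "1 < p"
    and "finite A" and "A \<subseteq> {-1..1}" and "\<forall>x\<in>A. M x > 0"
    and "orthonormal_polys (nu_measure \<alpha> \<beta> A M) P"
    and "\<forall>x\<in>{-1<..<1}. u x = (1 - x) powr a * (1 + x) powr b"
    and "u (-1) > 0" and "u 1 > 0"
    and "-1/4 \<le> a + (\<alpha> + 1) * (1/p - 1/2)" and "a + (\<alpha> + 1) * (1/p - 1/2) < 1/4"
    and "-1/4 \<le> b + (\<beta> + 1) * (1/p - 1/2)" and "b + (\<beta> + 1) * (1/p - 1/2) < 1/4"
  shows "\<exists>C>0. \<forall>n E. E \<in> sets borel \<and> E \<subseteq> {-1..1} \<longrightarrow>
           weak_Lp_norm (nu_measure \<alpha> \<beta> A M) p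
             (\<lambda>x. u x * partial_sum_S (nu_measure \<alpha> \<beta> A M) P n (\<lambda>y. indicator E y / u y) x)
           \<le> ereal C * ereal (Lp_norm (nu_measure \<alpha> \<beta> A M) p (indicator E))"
proof -
 have "\<alpha> > -1" "\<beta> > -1" using assms(1,2) by auto
 then interpret F: jacobi_functional \<alpha> \<beta> "jacobi_int \<alpha> \<beta>" by (rule jacobi_functional_measure)
 \<comment> \<open>The Jacobi polynomials are fixed only up to sign here, which their kernel does
   not see.\<close>
 obtain q where q: "\<And>n. degree (q n) = n \<and> (\<forall>m. jacobi_int \<alpha> \<beta> (q m * q n) = (if m = n then 1 else 0))"
  using F.orthonormal_exists by blast
 interpret jacobi_polys \<alpha> \<beta> "jacobi_int \<alpha> \<beta>" q by unfold_locales (use q in auto)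
 interpret W: jacobi_weighted \<alpha> \<beta> q a b p by unfold_locales (use assms in auto)
 have "u x > 0" if x: "x \<in> {-1..1}" for x
 proof -
  consider "x = 1" | "x = -1" | "x \<in> Ioo" using x by force
  then show ?thesis using assms(8-10) by cases auto
 qed
 then interpret jacobi_mass_weight \<alpha> \<beta> q a b p A M P u
  by unfold_locales (use assms in \<open>auto simp: W.uw_def\<close>)
 show ?thesis by (rule restricted_weak_type)
qed

end
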